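(* Let $k\ge2$. Then the map $$\overline{\operatorname{Tr}}_k:\operatorname{Im}(\tau'_k)\cap D_k(H)\longrightarrow C_{k+1}(H)/\overline{C_{k+1}(H)},\qquad d\longmapsto\psi_{k+1}(\mu_k(f)),$$ where $f$ is any element of $A_k$ such that $\tau'_k(f)=d$, is well-defined. Moreover, it is an $\operatorname{Sp}(H)$-equivariant homomorphism that vanishes on the image of $\tau_k$.
   Context: Let $g\ge1$ and let $\pi=\pi_1(\Sigma_{g,1})$ be the free group on $\alpha_1,\beta_1,\dots,\alpha_g,\beta_g$, with lower central series $(\Gamma_k\pi)_{k\ge 1}$; $H=\pi/\Gamma_2\pi$, $\{x\}$ is the class of $x\in\pi$, and $a_i,b_i$ are the classes of $\alpha_i,\beta_i$, a symplectic basis for the intersection form. The boundary element $\zeta\in\pi$ satisfies $\zeta^{-1}=\prod_{i=1}^g[\beta_i^{-1},\alpha_i]$, $[x,y]=xyx^{-1}y^{-1}$. $\mathcal L(H)$ is the free Lie ring on $H$, with $\mathcal L_k(H)\cong\Gamma_k\pi/\Gamma_{k+1}\pi$, and $\omega=\sum_i[a_i,b_i]\in\mathcal L_2(H)$ is the class of $\zeta^{-1}$. The mapping class group is $\mathcal M=\{f\in\operatorname{Aut}(\pi):f(\zeta)=\zeta\}$; $A_k$ is the kernel of $\operatorname{Aut}(\pi)\to\operatorname{Aut}(\pi/\Gamma_{k+1}\pi)$; $J_k=\mathcal M\cap A_k$. $\operatorname{Der}_k(H)=H^*\otimes\mathcal L_{k+1}(H)$ is the group of degree $k$ derivations of $\mathcal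 L(H)$; $D_k(H)=\{d\in\operatorname{Der}_k(H):d(\omega)=0\}$. $\tau'_k:A_k\to\operatorname{Der}_k(H)$, $\tau'_k(f)(\{x\})=[f(x)x^{-1}]\in\mathcal L_{k+1}(H)$; $\tau_k:J_k\to D_k(H)$ is its restriction. $C(H)=T(H)/[T(H),T(H)]$, the tensor algebra modulo the span of all $xy-yx$. The Satoh trace $\operatorname{Tr}_k:\operatorname{Der}_k(H)\to C_k(H)$ is induced by $h^*\otimes x_1\cdots x_{k+1}\mapsto h^*(x_1)x_2\cdots x_{k+1}$ via $\mathcal L(H)\subset T(H)$. $\overline{C_k(H)}=\operatorname{Tr}_k(D_k(H))$. $\mathcal G_k=\{f\in A_k: f(\zeta)\zeta^{-1}\in\Gamma_{k+3}\pi\}=(\tau'_k)^{-1}(D_k(H))$, and $\mu_k:\mathcal G_k\to\mathcal L_{k+3}(H)$ sends $f$ to the class of $f(\zeta)\zeta^{-1}$ in $\Gamma_{k+3}\pi/\Gamma_{k+4}\pi$. The evaluation $\operatorname{Der}_k(H)\to\mathcal L_{k+2}(H)$, $d\mapsto d(\omega)$, is surjective with kernel $D_k(H)$, and $\psi_k:\mathcal L_{k+2}(H)\to C_k(H)/\overline{C_k(H)}$ is the homomorphism sending $l$ to the class of $\operatorname{Tr}_k(d)$ for any $d\in \operatorname{Der}_k(H)$ with $d(\omega)=l$. $\operatorname{Sp}(H)$ acts on derivations by $f_*\cdot d=f_*\circ d\circ f_*^{-1}$ and naturally on $C_k(H)$, preserving $\overline{C_k(H)}$. *)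

theory Defs
  imports
    "HOL-Algebra.Generated_Groups"
    "HOL-Algebra.Bij"
    "HOL-Library.Poly_Mapping"
begin

section \<open>Free groups and lower central series\<close>

text \<open>A letter \<open>(x, True)\<close> stands for the generator \<open>x\<close> and \<open>(x, False)\<close> for its inverse.
  The elements of a free group are the reduced words; \<open>push\<close> multiplies a reduced word by a
  letter on the left.\<close>

type_synonym 'a fword = "('a \<times> bool) list"

fun reduced :: "'a fword \<Rightarrow> bool" where
  "reduced [] = True"
| "reduced [l] = True"
| "reduced (l # m # w) = (m \<noteq> (fst l, \<not> snd l) \<and> reduced (m # w))"

fun push :: "'a \<times> bool \<Rightarrow> 'a fword \<Rightarrow> 'a fword" where
  "push l [] = [l]"
| "push l (m # w) = (if m = (fst l, \<not> snd l) then w else l # m # w)"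

definition free_group :: "'a set \<Rightarrow> 'a fword monoid" where
  "free_group X =
     \<lparr>carrier = {w. reduced w \<and> fst ` set w \<subseteq> X}, mult = (\<lambda>u v. foldr push u v), one = []\<rparr>"

definition commutator :: "('a, 'b) monoid_scheme \<Rightarrow> 'a \<Rightarrow> 'a \<Rightarrow> 'a" where
  "commutator G x y = x \<otimes>\<^bsub>G\<^esub> y \<otimes>\<^bsub>G\<^esub> inv\<^bsub>G\<^esub> x \<otimes>\<^bsub>G\<^esub> inv\<^bsub>G\<^esub> y"

text \<open>The series is indexed from 1, and the value at 0 is a dummy.\<close>

fun lower_central :: "('a, 'b) monoid_scheme \<Rightarrow> nat \<Rightarrow> 'a set" where
  "lower_central G 0 = carrier G"
| "lower_central G (Suc 0) = carrier G"
| "lower_central G (Suc (Suc n)) =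
     generate G {commutator G x y | x y. x \<in> lower_central G (Suc n) \<and> y \<in> carrier G}"


section \<open>Free Lie rings\<close>

text \<open>The free Lie ring on a set of generators: formal bracket expressions modulo the
  congruence generated by the axioms of a Lie ring.\<close>

datatype 'a lie_term =
    LGen 'a
  | LZero
  | LNeg "'a lie_term"
  | LAdd "'a lie_term" "'a lie_term"
  | LBr "'a lie_term" "'a lie_term"

inductive lie_eq :: "'a lie_term \<Rightarrow> 'a lie_term \<Rightarrow> bool" where
  refl: "lie_eq s s"
| sym: "lie_eq s t \<Longrightarrow> lie_eq t s"
| trans: "lie_eq s t \<Longrightarrow> lie_eq t u \<Longrightarrow> lie_eq s u"
| neg_cong: "lie_eq s t \<Longrightarrow> lie_eq (LNeg s) (LNeg t)"
| add_cong: "lie_eq s t \<Longrightarrow> lie_eq s' t' \<Longrightarrow> lie_eq (LAdd s s') (LAdd t t')"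
| br_cong: "lie_eq s t \<Longrightarrow> lie_eq s' t' \<Longrightarrow> lie_eq (LBr s s') (LBr t t')"
| add_assoc: "lie_eq (LAdd (LAdd s t) u) (LAdd s (LAdd t u))"
| add_comm: "lie_eq (LAdd s t) (LAdd t s)"
| add_zero: "lie_eq (LAdd LZero s) s"
| add_neg: "lie_eq (LAdd (LNeg s) s) LZero"
| br_add_left: "lie_eq (LBr (LAdd s t) u) (LAdd (LBr s u) (LBr t u))"
| br_add_right: "lie_eq (LBr u (LAdd s t)) (LAdd (LBr u s) (LBr u t))"
| br_self: "lie_eq (LBr s s) LZero"
| jacobi: "lie_eq (LAdd (LBr s (LBr t u)) (LAdd (LBr t (LBr u s)) (LBr u (LBr s t)))) LZero"

quotient_type 'a free_lie = "'a lie_term" / lie_eq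
  by (rule equivpI)
     (auto intro!: reflpI sympI transpI intro: lie_eq.refl lie_eq.sym lie_eq.trans)

instantiation free_lie :: (type) ab_group_add
begin

lift_definition zero_free_lie :: "'a free_lie" is LZero .

lift_definition uminus_free_lie :: "'a free_lie \<Rightarrow> 'a free_lie" is LNeg
  by (rule lie_eq.neg_cong)

lift_definition plus_free_lie :: "'a free_lie \<Rightarrow> 'a free_lie \<Rightarrow> 'a free_lie" is LAdd
  by (rule lie_eq.add_cong)

definition minus_free_lie :: "'a free_lie \<Rightarrow> 'a free_lie \<Rightarrow> 'a free_lie" where
  "minus_free_lie x y = x + - y"

instance
proof
  fix a b c :: "'a free_lie"
  show "a + b + c = a + (b + c)" by transfer (rule lie_eq.add_assoc)
  show "a + b = b + a" by transfer (rule lie_eq.add_comm)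
  show "0 + a = a" by transfer (rule lie_eq.add_zero)
  show "- a + a = 0" by transfer (rule lie_eq.add_neg)
  show "a - b = a + - b" by (rule minus_free_lie_def)
qed

end

lift_definition lie_gen :: "'a \<Rightarrow> 'a free_lie" is LGen .

lift_definition lie_br :: "'a free_lie \<Rightarrow> 'a free_lie \<Rightarrow> 'a free_lie" is LBr
  by (rule lie_eq.br_cong)

lemma lie_br_add_left: "lie_br (x + y) z = lie_br x z + lie_br y z"
  by transfer (rule lie_eq.br_add_left)

lemma lie_br_add_right: "lie_br z (x + y) = lie_br z x + lie_br z y"
  by transfer (rule lie_eq.br_add_right)

lemma lie_br_self: "lie_br x x = 0"
  by transfer (rule lie_eq.br_self)

lemma lie_br_jacobi: "lie_br x (lie_br y z) + (lie_br y (lie_br z x) + lie_br z (lie_br x y)) = 0"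
  by transfer (rule lie_eq.jacobi)

text \<open>The Lie subring generated by a set \<open>X\<close> of generators is the free Lie ring on \<open>X\<close>.\<close>

inductive lie_homogeneous :: "'a set \<Rightarrow> nat \<Rightarrow> 'a free_lie \<Rightarrow> bool" for X where
  gen: "x \<in> X \<Longrightarrow> lie_homogeneous X 1 (lie_gen x)"
| br: "lie_homogeneous X m u \<Longrightarrow> lie_homogeneous X n v \<Longrightarrow> lie_homogeneous X (m + n) (lie_br u v)"
| zero: "lie_homogeneous X k 0"
| diff: "lie_homogeneous X k u \<Longrightarrow> lie_homogeneous X k v \<Longrightarrow> lie_homogeneous X k (u - v)"

definition lie_part :: "'a set \<Rightarrow> nat \<Rightarrow> 'a free_lie set" where
  "lie_part X k = {l. lie_homogeneous X k l}"

inductive_set lie_ring_on :: "'a set \<Rightarrow> 'a free_lie set" for X where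
  gen: "x \<in> X \<Longrightarrow> lie_gen x \<in> lie_ring_on X"
| br: "u \<in> lie_ring_on X \<Longrightarrow> v \<in> lie_ring_on X \<Longrightarrow> lie_br u v \<in> lie_ring_on X"
| zero: "0 \<in> lie_ring_on X"
| diff: "u \<in> lie_ring_on X \<Longrightarrow> v \<in> lie_ring_on X \<Longrightarrow> u - v \<in> lie_ring_on X"

primrec lie_term_subst :: "('a \<Rightarrow> 'b free_lie) \<Rightarrow> 'a lie_term \<Rightarrow> 'b free_lie" where
  "lie_term_subst \<sigma> (LGen x) = \<sigma> x"
| "lie_term_subst \<sigma> LZero = 0"
| "lie_term_subst \<sigma> (LNeg s) = - lie_term_subst \<sigma> s"
| "lie_term_subst \<sigma> (LAdd s t) = lie_term_subst \<sigma> s + lie_term_subst \<sigma> t"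
| "lie_term_subst \<sigma> (LBr s t) = lie_br (lie_term_subst \<sigma> s) (lie_term_subst \<sigma> t)"

lemma lie_term_subst_cong: "lie_eq s t \<Longrightarrow> lie_term_subst \<sigma> s = lie_term_subst \<sigma> t"
  by (induction rule: lie_eq.induct)
     (simp_all add: lie_br_add_left lie_br_add_right lie_br_self lie_br_jacobi add.assoc add.commute)

lift_definition lie_subst :: "('a \<Rightarrow> 'b free_lie) \<Rightarrow> 'a free_lie \<Rightarrow> 'b free_lie"
  is lie_term_subst
  by (rule lie_term_subst_cong)


section \<open>Tensor algebra of a free abelian group\<close>

text \<open>With concatenation as addition on words, \<open>'a list \<Rightarrow>\<^sub>0 int\<close> is the ring of noncommutative
  polynomials, that is, the tensor algebra of the free abelian group with basis \<open>'a\<close>.\<close>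

instantiation list :: (type) monoid_add
begin

definition zero_list :: "'a list" where "zero_list = []"

definition plus_list :: "'a list \<Rightarrow> 'a list \<Rightarrow> 'a list" where "plus_list = (@)"

instance
  by standard (simp_all add: zero_list_def plus_list_def)

end

type_synonym 'a tensor = "'a list \<Rightarrow>\<^sub>0 int"

definition tensor_on :: "'a set \<Rightarrow> 'a tensor set" where
  "tensor_on X = {p. \<forall>w \<in> Poly_Mapping.keys p. set w \<subseteq> X}"

definition tensor_part :: "'a set \<Rightarrow> nat \<Rightarrow> 'a tensor set" where
  "tensor_part X k = {p \<in> tensor_on X. \<forall>w \<in> Poly_Mapping.keys p. length w = k}"

definition tensor_subst :: "('a \<Rightarrow> 'b tensor) \<Rightarrow> 'a tensor \<Rightarrow> 'b tensor" where
  "tensor_subst \<sigma> p = (\<Sum>w \<in> Poly_Mapping.keys p. of_int (Poly_Mapping.lookup p w) * prod_list (map \<sigma> w))"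

primrec lie_term_tensor :: "'a lie_term \<Rightarrow> 'a tensor" where
  "lie_term_tensor (LGen x) = Poly_Mapping.single [x] 1"
| "lie_term_tensor LZero = 0"
| "lie_term_tensor (LNeg s) = - lie_term_tensor s"
| "lie_term_tensor (LAdd s t) = lie_term_tensor s + lie_term_tensor t"
| "lie_term_tensor (LBr s t) =
     lie_term_tensor s * lie_term_tensor t - lie_term_tensor t * lie_term_tensor s"

lemma lie_term_tensor_cong: "lie_eq s t \<Longrightarrow> lie_term_tensor s = lie_term_tensor t"
  by (induction rule: lie_eq.induct) (simp_all add: algebra_simps)

text \<open>The inclusion of the free Lie ring into the tensor algebra.\<close>

lift_definition lie_tensor :: "'a free_lie \<Rightarrow> 'a tensor" is lie_term_tensor
  by (rule lie_term_tensor_cong)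


section \<open>The surface group, its homology and its automorphisms\<close>

text \<open>\<open>Alpha i\<close> and \<open>Beta i\<close> name the free generators of the surface group and also the
  corresponding elements \<open>a\<^sub>i\<close> and \<open>b\<^sub>i\<close> of the symplectic basis of \<open>H\<close>.\<close>

datatype gen = Alpha nat | Beta nat

definition gens :: "nat \<Rightarrow> gen set" where
  "gens g = Alpha ` {1..g} \<union> Beta ` {1..g}"

definition surface_group :: "nat \<Rightarrow> gen fword monoid" where
  "surface_group g = free_group (gens g)"

abbreviation Gam :: "nat \<Rightarrow> nat \<Rightarrow> gen fword set" where
  "Gam g k \<equiv> lower_central (surface_group g) k"

definition pi_gen :: "gen \<Rightarrow> gen fword" where
  "pi_gen e = [(e, True)]"

definition zeta :: "nat \<Rightarrow> gen fword" where
  "zeta g = inv\<^bsub>surface_group g\<^esub>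
     (foldr (\<lambda>i w. commutator (surface_group g)
                      (inv\<^bsub>surface_group g\<^esub> pi_gen (Beta i)) (pi_gen (Alpha i))
                    \<otimes>\<^bsub>surface_group g\<^esub> w)
        [1..<Suc g] \<one>\<^bsub>surface_group g\<^esub>)"

definition homology :: "nat \<Rightarrow> gen fword set monoid" where
  "homology g = surface_group g Mod Gam g 2"

definition hclass :: "nat \<Rightarrow> gen fword \<Rightarrow> gen fword set" where
  "hclass g x = Gam g 2 #>\<^bsub>surface_group g\<^esub> x"

definition exponent_sum :: "gen \<Rightarrow> gen fword \<Rightarrow> int" where
  "exponent_sum e w =
     (\<Sum>l \<leftarrow> w. if fst l = e then (if snd l then 1 else - 1) else 0)"

text \<open>The dual basis of \<open>H\<^sup>*\<close>: the exponent sum is constant on cosets of \<open>\<Gamma>\<^sub>2\<close>.\<close>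

definition dual_basis :: "gen \<Rightarrow> gen fword set \<Rightarrow> int" where
  "dual_basis e h = the_elem (exponent_sum e ` h)"

definition intersection_form :: "nat \<Rightarrow> gen fword set \<Rightarrow> gen fword set \<Rightarrow> int" where
  "intersection_form g h h' =
     (\<Sum>i = 1..g. dual_basis (Alpha i) h * dual_basis (Beta i) h'
                - dual_basis (Beta i) h * dual_basis (Alpha i) h')"

definition Sp :: "nat \<Rightarrow> (gen fword set \<Rightarrow> gen fword set) set" where
  "Sp g = {\<phi> \<in> auto (homology g). \<forall>h \<in> carrier (homology g). \<forall>h' \<in> carrier (homology g).
             intersection_form g (\<phi> h) (\<phi> h') = intersection_form g h h'}"

definition mapping_class_group :: "nat \<Rightarrow> (gen fword \<Rightarrow> gen fword) set" where
  "mapping_class_group g = {f \<in> auto (surface_group g). f (zeta g) = zeta g}"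

definition induced_auto ::
    "nat \<Rightarrow> nat \<Rightarrow> (gen fword \<Rightarrow> gen fword) \<Rightarrow> gen fword set \<Rightarrow> gen fword set" where
  "induced_auto g k f = (\<lambda>c \<in> carrier (surface_group g Mod Gam g k). f ` c)"

definition Johnson_A :: "nat \<Rightarrow> nat \<Rightarrow> (gen fword \<Rightarrow> gen fword) set" where
  "Johnson_A g k = kernel (AutoGroup (surface_group g))
     (AutoGroup (surface_group g Mod Gam g (k + 1))) (induced_auto g (k + 1))"

definition Johnson_J :: "nat \<Rightarrow> nat \<Rightarrow> (gen fword \<Rightarrow> gen fword) set" where
  "Johnson_J g k = mapping_class_group g \<inter> Johnson_A g k"


section \<open>Lie algebra of the lower central series\<close>

abbreviation Lie :: "nat \<Rightarrow> gen free_lie set" where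
  "Lie g \<equiv> lie_ring_on (gens g)"

abbreviation Lie_part :: "nat \<Rightarrow> nat \<Rightarrow> gen free_lie set" where
  "Lie_part g k \<equiv> lie_part (gens g) k"

text \<open>The canonical isomorphism between the component of degree \<open>k\<close> of the free Lie ring and
  \<open>\<Gamma>\<^sub>k / \<Gamma>\<^sub>k\<^sub>+\<^sub>1\<close> is the identity of \<open>H\<close> in degree 1 and turns brackets into group commutators.
  \<open>lie_rep g k l x\<close> says that it matches \<open>l\<close> with the class of \<open>x \<in> \<Gamma>\<^sub>k\<close>.\<close>

inductive lie_rep :: "nat \<Rightarrow> nat \<Rightarrow> gen free_lie \<Rightarrow> gen fword \<Rightarrow> bool" for g where
  gen: "e \<in> gens g \<Longrightarrow> lie_rep g 1 (lie_gen e) (pi_gen e)"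
| br: "lie_rep g m u x \<Longrightarrow> lie_rep g n v y \<Longrightarrow>
       lie_rep g (m + n) (lie_br u v) (commutator (surface_group g) x y)"
| add: "lie_rep g k u x \<Longrightarrow> lie_rep g k v y \<Longrightarrow> lie_rep g k (u + v) (x \<otimes>\<^bsub>surface_group g\<^esub> y)"
| neg: "lie_rep g k u x \<Longrightarrow> lie_rep g k (- u) (inv\<^bsub>surface_group g\<^esub> x)"
| zero: "k \<ge> 1 \<Longrightarrow> x \<in> Gam g (k + 1) \<Longrightarrow> lie_rep g k 0 x"

definition lie_class :: "nat \<Rightarrow> nat \<Rightarrow> gen fword \<Rightarrow> gen free_lie" where
  "lie_class g k x = (THE l. lie_rep g k l x)"

text \<open>\<open>word_lie\<close> is constant on cosets of \<open>\<Gamma>\<^sub>2\<close> and identifies \<open>H\<close> with the degree 1 part of the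
  free Lie ring.\<close>

definition word_lie :: "gen fword \<Rightarrow> gen free_lie" where
  "word_lie w = (\<Sum>l \<leftarrow> w. if snd l then lie_gen (fst l) else - lie_gen (fst l))"

definition homology_lie :: "gen fword set \<Rightarrow> gen free_lie" where
  "homology_lie h = the_elem (word_lie ` h)"

definition omega :: "nat \<Rightarrow> gen free_lie" where
  "omega g = (\<Sum>i = 1..g. lie_br (lie_gen (Alpha i)) (lie_gen (Beta i)))"


section \<open>Derivations and Johnson homomorphisms\<close>

definition Der :: "nat \<Rightarrow> nat \<Rightarrow> (gen free_lie \<Rightarrow> gen free_lie) set" where
  "Der g k = {d \<in> extensional (Lie g).
     (\<forall>u \<in> Lie g. \<forall>v \<in> Lie g. d (u + v) = d u + d v) \<and>
     (\<forall>u \<in> Lie g. \<forall>v \<in> Lie g. d (lie_br u v) = lie_br (d u) v + lie_br u (d v)) \<and>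
     (\<forall>m. \<forall>u \<in> Lie_part g m. d u \<in> Lie_part g (m + k))}"

definition Der_group :: "nat \<Rightarrow> nat \<Rightarrow> (gen free_lie \<Rightarrow> gen free_lie) monoid" where
  "Der_group g k =
     \<lparr>carrier = Der g k, mult = (\<lambda>d d'. \<lambda>l \<in> Lie g. d l + d' l), one = (\<lambda>l \<in> Lie g. 0)\<rparr>"

definition Der_symp :: "nat \<Rightarrow> nat \<Rightarrow> (gen free_lie \<Rightarrow> gen free_lie) set" where
  "Der_symp g k = {d \<in> Der g k. d (omega g) = 0}"

definition tau' :: "nat \<Rightarrow> nat \<Rightarrow> (gen fword \<Rightarrow> gen fword) \<Rightarrow> gen free_lie \<Rightarrow> gen free_lie" where
  "tau' g k f = (THE d. d \<in> Der g k \<and> (\<forall>x \<in> carrier (surface_group g).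
      d (homology_lie (hclass g x)) =
      lie_class g (k + 1) (f x \<otimes>\<^bsub>surface_group g\<^esub> inv\<^bsub>surface_group g\<^esub> x)))"

definition Johnson_G :: "nat \<Rightarrow> nat \<Rightarrow> (gen fword \<Rightarrow> gen fword) set" where
  "Johnson_G g k = {f \<in> Johnson_A g k.
     f (zeta g) \<otimes>\<^bsub>surface_group g\<^esub> inv\<^bsub>surface_group g\<^esub> zeta g \<in> Gam g (k + 3)}"

definition mu :: "nat \<Rightarrow> nat \<Rightarrow> (gen fword \<Rightarrow> gen fword) \<Rightarrow> gen free_lie" where
  "mu g k f = lie_class g (k + 3)
     (f (zeta g) \<otimes>\<^bsub>surface_group g\<^esub> inv\<^bsub>surface_group g\<^esub> zeta g)"


section \<open>Cyclic tensors and the Satoh trace\<close>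

abbreviation Tens :: "nat \<Rightarrow> gen tensor set" where
  "Tens g \<equiv> tensor_on (gens g)"

definition Tens_group :: "nat \<Rightarrow> gen tensor monoid" where
  "Tens_group g = \<lparr>carrier = Tens g, mult = (+), one = 0\<rparr>"

definition Tens_comm :: "nat \<Rightarrow> gen tensor set" where
  "Tens_comm g = generate (Tens_group g) {x * y - y * x | x y. x \<in> Tens g \<and> y \<in> Tens g}"

definition cyc_class :: "nat \<Rightarrow> gen tensor \<Rightarrow> gen tensor set" where
  "cyc_class g p = Tens_comm g #>\<^bsub>Tens_group g\<^esub> p"

text \<open>\<open>C\<^sub>k(H)\<close>, as the subgroup of degree \<open>k\<close> elements of \<open>C(H)\<close>.\<close>

definition Cyc :: "nat \<Rightarrow> nat \<Rightarrow> gen tensor set monoid" where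
  "Cyc g k = (Tens_group g Mod Tens_comm g)
     \<lparr>carrier := cyc_class g ` tensor_part (gens g) k\<rparr>"

definition contract :: "nat \<Rightarrow> (gen fword set \<Rightarrow> int) \<Rightarrow> gen tensor \<Rightarrow> gen tensor" where
  "contract g \<eta> p = (\<Sum>w \<in> Poly_Mapping.keys p. case w of [] \<Rightarrow> 0
      | x # w' \<Rightarrow> Poly_Mapping.single w' (Poly_Mapping.lookup p w * \<eta> (hclass g (pi_gen x))))"

text \<open>As an element of \<open>H\<^sup>* \<otimes> \<L>\<^sub>k\<^sub>+\<^sub>1(H)\<close>, a derivation \<open>d\<close> is the sum of the tensors
  \<open>e\<^sup>* \<otimes> d(e)\<close> over the elements \<open>e\<close> of the basis of \<open>H\<close>.\<close>

definition satoh_trace :: "nat \<Rightarrow> (gen free_lie \<Rightarrow> gen free_lie) \<Rightarrow> gen tensor set" where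
  "satoh_trace g d =
     cyc_class g (\<Sum>e \<in> gens g. contract g (dual_basis e) (lie_tensor (d (lie_gen e))))"

definition Cyc_bar :: "nat \<Rightarrow> nat \<Rightarrow> gen tensor set set" where
  "Cyc_bar g k = satoh_trace g ` Der_symp g k"

definition psi :: "nat \<Rightarrow> nat \<Rightarrow> gen free_lie \<Rightarrow> gen tensor set set" where
  "psi g k l = (THE c. \<exists>d \<in> Der g k. d (omega g) = l \<and>
      c = Cyc_bar g k #>\<^bsub>Cyc g k\<^esub> satoh_trace g d)"


section \<open>Actions of the symplectic group\<close>

definition Lie_act ::
    "nat \<Rightarrow> (gen fword set \<Rightarrow> gen fword set) \<Rightarrow> gen free_lie \<Rightarrow> gen free_lie" where
  "Lie_act g \<phi> = lie_subst (\<lambda>e. homology_lie (\<phi> (hclass g (pi_gen e))))"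

definition Tens_act ::
    "nat \<Rightarrow> (gen fword set \<Rightarrow> gen fword set) \<Rightarrow> gen tensor \<Rightarrow> gen tensor" where
  "Tens_act g \<phi> = tensor_subst (\<lambda>e. lie_tensor (homology_lie (\<phi> (hclass g (pi_gen e)))))"

definition Der_act ::
    "nat \<Rightarrow> (gen fword set \<Rightarrow> gen fword set) \<Rightarrow> (gen free_lie \<Rightarrow> gen free_lie)
      \<Rightarrow> gen free_lie \<Rightarrow> gen free_lie" where
  "Der_act g \<phi> d = (\<lambda>l \<in> Lie g. Lie_act g \<phi> (d (Lie_act g (inv\<^bsub>AutoGroup (homology g)\<^esub> \<phi>) l)))"

text \<open>Elements of \<open>C\<^sub>k(H)\<close> are cosets in the tensor algebra, and elements of its quotient by
  \<open>Cyc_bar\<close> are cosets of such cosets; automorphisms act by taking images.\<close>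

definition Cyc_act ::
    "nat \<Rightarrow> (gen fword set \<Rightarrow> gen fword set) \<Rightarrow> gen tensor set \<Rightarrow> gen tensor set" where
  "Cyc_act g \<phi> c = Tens_act g \<phi> ` c"

definition Cyc_quot_act ::
    "nat \<Rightarrow> (gen fword set \<Rightarrow> gen fword set) \<Rightarrow> gen tensor set set \<Rightarrow> gen tensor set set" where
  "Cyc_quot_act g \<phi> q = Cyc_act g \<phi> ` q"


section \<open>The induced trace\<close>

definition Tr_bar_dom :: "nat \<Rightarrow> nat \<Rightarrow> (gen free_lie \<Rightarrow> gen free_lie) set" where
  "Tr_bar_dom g k = tau' g k ` Johnson_A g k \<inter> Der_symp g k"

definition Tr_bar :: "nat \<Rightarrow> nat \<Rightarrow> (gen free_lie \<Rightarrow> gen free_lie) \<Rightarrow> gen tensor set set" where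
  "Tr_bar g k = (\<lambda>d \<in> Tr_bar_dom g k.
     psi g (k + 1) (mu g k (SOME f. f \<in> Johnson_A g k \<and> tau' g k f = d)))"

end

(*
  Let M be the Magnus embedding of pi into the noncommutative power series Z<<H>>. Lyndon bases
  show that x lies in Gamma_k exactly if M(x) - 1 has order at least k, and that its leading term
  is then the image of the class of x in L_k(H). Hence tau'_k(f) and mu_k(f) are leading terms of
  M(f(x)) - M(x).

  Two lifts of d to A_k differ by some h in A_{k+1}, and mu changes by -tau'_{k+1}(h)(omega). So
  the trace is well defined because the Satoh trace vanishes on the image of tau'_m for m >= 2.
  To see this, let P be the Jacobian matrix of the automorphism, whose entries, like those of its
  inverse, lie in the integral group ring, and let s = tr(P^-1 E(P)), where E multiplies each word
  by its length. Up to the factor m, the leading term of s is the trace. A Dwork congruence says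
  that the cyclic coefficients of s at v and v^p agree modulo p. Since s is in the group ring, its
  cyclic coefficients at v^p vanish for all large primes p, unless v is a power of a letter X; that
  case uses (1 + X)^p = 1 + X^p modulo p and the vanishing of s in degree 1. So all cyclic
  coefficients of s vanish.

  For equivariance, an element of Sp(H) is lifted to an arbitrary automorphism F of pi, which need
  not fix zeta. Then F^-1(zeta) = c zeta with c in Gamma_3, so for d = tau'_k(f) one finds
  mu(F f F^-1) = F(mu(f) + d(c)). Writing c = e(omega) with e a derivation of degree 1 gives
  d(c) = [d, e](omega), and Tr [d, e] = d Tr(e) - e Tr(d) vanishes in C(H): Tr(d) does, and d sends
  the degree 1 element Tr(e) to a sum of commutators.
*)
theory Submission
  imports Defs "HOL-Library.List_Lexorder" "HOL-Computational_Algebra.Formal_Power_Series"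
    "HOL-Computational_Algebra.Primes"
begin

section \<open>Free groups\<close>

text \<open>The natural invariant would be the logarithm of a determinant of P, which needs
  commutativity and denominators. The series s stands for its logarithmic derivative: it is integral
  and additive modulo commutators for products of matrices. The factor m is harmless because
  necklaces form a basis of C(H), so that this group is torsion-free. Dwork's congruence holds for
  every integral matrix congruent to the identity over finitely many letters, and it only compares
  coefficients. Vanishing comes from the group ring, whose elements contain only words with
  boundedly many changes of letter. Degree m = 1 is a true exception, as conjugation by y has trace
  (1 - 2g) y. Well-definedness takes m = k + 1, equivariance also m = k. Lyndon words are used
  because the least word of a bracketing has coefficient 1: the triangular argument works over the
  integers, and one rewriting serves the free Lie ring and the group commutators at once. Lifting
  Sp(H) to arbitrary automorphisms needs only Nielsen moves; the price is the defect c.\<close>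

lemma reduced_tl: "reduced (l # w) \<Longrightarrow> reduced w"
  by (cases w) auto

lemma reduced_push: "reduced w \<Longrightarrow> reduced (push l w)"
  by (cases w) (auto dest: reduced_tl)

lemma push_push_inverse: "reduced w \<Longrightarrow> push l (push (fst l, \<not> snd l) w) = w"
  by (cases w; cases "tl w") (auto split: if_splits)

lemma reduced_foldr_push: "reduced w \<Longrightarrow> reduced (foldr push u w)"
  by (induction u) (auto intro: reduced_push)

text \<open>Van der Waerden's device: words act on reduced words through \<open>push\<close>, where
  a letter and its inverse act as mutually inverse maps. Hence a cancellation inside the acting word
  does not change its action, and associativity follows without comparing normal forms.\<close>

lemma foldr_push_push: "reduced w \<Longrightarrow> foldr push (push l v) w = push l (foldr push v w)"
proof (cases v)
  case (Cons m v')
  assume "reduced w"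
  then show ?thesis
    using Cons push_push_inverse[OF reduced_foldr_push, of w l v'] by auto
qed simp

lemma foldr_push_assoc:
  "reduced w \<Longrightarrow> foldr push (foldr push u v) w = foldr push u (foldr push v w)"
  by (induction u) (auto simp: foldr_push_push)

lemma push_reduced: "reduced (l # w) \<Longrightarrow> push l w = l # w"
  by (cases w) auto

lemma foldr_push_Nil: "reduced u \<Longrightarrow> foldr push u [] = u"
proof (induction u)
  case (Cons l u)
  then show ?case using reduced_tl[of l u] by (simp add: push_reduced)
qed simp

lemma set_push: "fst ` set (push l w) \<subseteq> insert (fst l) (fst ` set w)"
  by (cases w) auto

lemma set_foldr_push: "fst ` set (foldr push u w) \<subseteq> fst ` set u \<union> fst ` set w"
proof (induction u)
  case (Cons l u)
  then show ?case using set_push[of l "foldr push u w"] by simp blast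
qed simp

lemma carrier_free_group: "w \<in> carrier (free_group X) \<longleftrightarrow> reduced w \<and> fst ` set w \<subseteq> X"
  by (simp add: free_group_def)

lemma mult_free_group: "u \<otimes>\<^bsub>free_group X\<^esub> v = foldr push u v"
  by (simp add: free_group_def)

lemma one_free_group: "\<one>\<^bsub>free_group X\<^esub> = []"
  by (simp add: free_group_def)

lemma foldr_push_inverse:
  "reduced w \<Longrightarrow> foldr push (map (\<lambda>l. (fst l, \<not> snd l)) (rev u)) (foldr push u w) = w"
proof (induction u)
  case (Cons l u)
  then show ?case
    using push_push_inverse[OF reduced_foldr_push[of w u], of "(fst l, \<not> snd l)"] by simp
qed simp

lemma group_free_group: "group (free_group X)"
proof (rule groupI)
  fix u v w assume u: "u \<in> carrier (free_group X)" and v: "v \<in> carrier (free_group X)"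
    and w: "w \<in> carrier (free_group X)"
  show "u \<otimes>\<^bsub>free_group X\<^esub> v \<in> carrier (free_group X)"
    using u v set_foldr_push[of u v]
    by (simp add: carrier_free_group mult_free_group reduced_foldr_push) blast
  show "u \<otimes>\<^bsub>free_group X\<^esub> v \<otimes>\<^bsub>free_group X\<^esub> w = u \<otimes>\<^bsub>free_group X\<^esub> (v \<otimes>\<^bsub>free_group X\<^esub> w)"
    using w by (simp add: carrier_free_group mult_free_group foldr_push_assoc)
next
  fix u assume u: "u \<in> carrier (free_group X)"
  define r where "r = map (\<lambda>l. (fst l, \<not> snd l)) (rev u)"
  have "foldr push r [] \<in> carrier (free_group X)"
    using u set_foldr_push[of r "[]"]
    by (auto simp: carrier_free_group reduced_foldr_push r_def image_image)
  moreover have "foldr push (foldr push r []) u = []"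
  proof -
    have "foldr push (foldr push r []) u = foldr push r (foldr push u [])"
      using u by (simp add: foldr_push_assoc carrier_free_group foldr_push_Nil)
    also have "\<dots> = []" unfolding r_def by (rule foldr_push_inverse) simp
    finally show ?thesis .
  qed
  ultimately show "\<exists>y\<in>carrier (free_group X). y \<otimes>\<^bsub>free_group X\<^esub> u = \<one>\<^bsub>free_group X\<^esub>"
    by (auto simp: mult_free_group one_free_group)
qed (auto simp: carrier_free_group mult_free_group one_free_group)

lemma letter_in_free_group: "x \<in> X \<Longrightarrow> [(x, b)] \<in> carrier (free_group X)"
  by (simp add: carrier_free_group)

lemma inv_letter_free_group: "x \<in> X \<Longrightarrow> inv\<^bsub>free_group X\<^esub> [(x, b)] = [(x, \<not> b)]"
  by (rule group.inv_equality[OF group_free_group])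
    (auto simp: mult_free_group one_free_group letter_in_free_group)

lemma free_group_induct [consumes 1, case_names Nil Cons]:
  assumes "w \<in> carrier (free_group X)" and "P []"
    and "\<And>x b w. x \<in> X \<Longrightarrow> w \<in> carrier (free_group X) \<Longrightarrow> P w \<Longrightarrow> P ([(x, b)] \<otimes>\<^bsub>free_group X\<^esub> w)"
  shows "P w"
  using assms(1)
proof (induction w)
  case (Cons l w)
  then have w: "w \<in> carrier (free_group X)" and "fst l \<in> X"
    by (auto simp: carrier_free_group dest: reduced_tl)
  then have "P ([(fst l, snd l)] \<otimes>\<^bsub>free_group X\<^esub> w)"
    using Cons by (intro assms(3)) auto
  then show ?case
    using Cons(2) by (simp add: mult_free_group carrier_free_group push_reduced)
qed (use assms in simp)

section \<open>Homomorphisms out of a free group\<close>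

definition word_eval :: "('b, 'c) monoid_scheme \<Rightarrow> ('a \<Rightarrow> 'b) \<Rightarrow> 'a fword \<Rightarrow> 'b" where
  "word_eval G u w =
     foldr (\<lambda>l a. (if snd l then u (fst l) else inv\<^bsub>G\<^esub> u (fst l)) \<otimes>\<^bsub>G\<^esub> a) w \<one>\<^bsub>G\<^esub>"

context group
begin

lemma mult_inv_cancel [simp]:
  "x \<in> carrier G \<Longrightarrow> y \<in> carrier G \<Longrightarrow> x \<otimes> (inv x \<otimes> y) = y"
  "x \<in> carrier G \<Longrightarrow> y \<in> carrier G \<Longrightarrow> inv x \<otimes> (x \<otimes> y) = y"
  by (simp_all add: m_assoc[symmetric])

lemma word_eval_closed:
  "u \<in> X \<rightarrow> carrier G \<Longrightarrow> fst ` set w \<subseteq> X \<Longrightarrow> word_eval G u w \<in> carrier G"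
  by (induction w) (auto simp: word_eval_def)

lemma word_eval_push:
  assumes u: "u \<in> X \<rightarrow> carrier G" and w: "fst ` set w \<subseteq> X" "fst l \<in> X"
  shows "word_eval G u (push l w) = (if snd l then u (fst l) else inv (u (fst l))) \<otimes> word_eval G u w"
proof (cases w)
  case (Cons m w')
  have "word_eval G u w' \<in> carrier G" "u (fst l) \<in> carrier G" "u (fst m) \<in> carrier G"
    using word_eval_closed[OF u, of w'] u w Cons by auto
  then show ?thesis
    using Cons by (auto simp: word_eval_def)
qed (simp add: word_eval_def)

lemma word_eval_hom:
  assumes u: "u \<in> X \<rightarrow> carrier G"
  shows "word_eval G u \<in> hom (free_group X) G"
proof -
  have "word_eval G u (foldr push v w) = word_eval G u v \<otimes> word_eval G u w"
    if "fst ` set v \<subseteq> X" and w: "fst ` set w \<subseteq> X" for v w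
    using that(1)
  proof (induction v)
    case Nil
    then show ?case using word_eval_closed[OF u w] by (simp add: word_eval_def)
  next
    case (Cons l v)
    have a: "fst ` set (foldr push v w) \<subseteq> X" "fst l \<in> X" "fst ` set v \<subseteq> X"
      using set_foldr_push[of v w] Cons(2) w by simp_all blast
    have b: "word_eval G u v \<in> carrier G" "word_eval G u w \<in> carrier G" "u (fst l) \<in> carrier G"
      using word_eval_closed[OF u] a w u by auto
    have "word_eval G u (l # v) = (if snd l then u (fst l) else inv (u (fst l))) \<otimes> word_eval G u v"
      by (simp add: word_eval_def)
    with a b Cons.IH[OF a(3)] show ?case by (auto simp: word_eval_push[OF u] m_assoc)
  qed
  then show ?thesis
    using word_eval_closed[OF u] by (auto simp: hom_def carrier_free_group mult_free_group)
qed

lemma word_eval_letter: "u x \<in> carrier G \<Longrightarrow> word_eval G u [(x, True)] = u x"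
  by (simp add: word_eval_def)

end

lemma free_group_hom_eqI:
  assumes H: "group H" and f: "f \<in> hom (free_group X) H" and h: "h \<in> hom (free_group X) H"
    and eq: "\<And>x. x \<in> X \<Longrightarrow> f [(x, True)] = h [(x, True)]" and w: "w \<in> carrier (free_group X)"
  shows "f w = h w"
proof -
  interpret f: group_hom "free_group X" H f
    using H f by (simp add: group_hom_def group_hom_axioms_def group_free_group)
  interpret h: group_hom "free_group X" H h
    using H h by (simp add: group_hom_def group_hom_axioms_def group_free_group)
  have let_eq: "f [(x, b)] = h [(x, b)]" if "x \<in> X" for x b
  proof (cases b)
    case False
    have "[(x, b)] = inv\<^bsub>free_group X\<^esub> [(x, True)]"
      using that False by (simp add: inv_letter_free_group)
    then show ?thesis
      using that eq by (simp add: letter_in_free_group)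
  qed (use that eq in simp)
  show ?thesis
    using w
  proof (induction rule: free_group_induct)
    case Nil
    then show ?case using f.hom_one h.hom_one by (simp add: one_free_group)
  next
    case (Cons x b w)
    then show ?case by (simp add: letter_in_free_group let_eq)
  qed
qed

section \<open>The lower central series\<close>

context group
begin

lemma commutator_closed [simp]:
  "x \<in> carrier G \<Longrightarrow> y \<in> carrier G \<Longrightarrow> commutator G x y \<in> carrier G"
  by (simp add: commutator_def)

lemma lower_central_normal: "lower_central G n \<lhd> G"
proof -
  have "lower_central G n \<lhd> G \<and> lower_central G (Suc n) \<lhd> G"
  proof (induction n)
    case 0
    then show ?case by (simp add: normal_self)
  next
    case (Suc n)
    interpret N: normal "lower_central G (Suc n)" G using Suc by simp
    have "generate G {commutator G x y |x y. x \<in> lower_central G (Suc n) \<and> y \<in> carrier G} \<lhd> G"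
    proof (rule normal_generateI)
      fix h z
      assume "h \<in> {commutator G x y |x y. x \<in> lower_central G (Suc n) \<and> y \<in> carrier G}"
        and z: "z \<in> carrier G"
      then obtain x y where xy: "h = commutator G x y" "x \<in> lower_central G (Suc n)" "y \<in> carrier G"
        by auto
      have "x \<in> carrier G" using xy N.mem_carrier by blast
      then have "z \<otimes> h \<otimes> inv z = commutator G (z \<otimes> x \<otimes> inv z) (z \<otimes> y \<otimes> inv z)"
        using xy z by (simp add: commutator_def m_assoc inv_mult_group)
      moreover have "z \<otimes> x \<otimes> inv z \<in> lower_central G (Suc n)"
        using N.inv_op_closed2 z xy by simp
      ultimately show "z \<otimes> h \<otimes> inv z \<in>
        {commutator G x y |x y. x \<in> lower_central G (Suc n) \<and> y \<in> carrier G}"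
        using z xy by auto
    qed (use N.subset in auto)
    with Suc show ?case by simp
  qed
  then show ?thesis by simp
qed

lemma lower_central_subgroup: "subgroup (lower_central G n) G"
  using lower_central_normal by (rule normal_imp_subgroup)

lemma lower_central_carrier: "x \<in> lower_central G n \<Longrightarrow> x \<in> carrier G"
  by (rule subgroup.mem_carrier[OF lower_central_subgroup])

lemma lower_central_closed [simp]:
  "\<one> \<in> lower_central G n"
  "x \<in> lower_central G n \<Longrightarrow> inv x \<in> lower_central G n"
  "x \<in> lower_central G n \<Longrightarrow> y \<in> lower_central G n \<Longrightarrow> x \<otimes> y \<in> lower_central G n"
  using lower_central_subgroup[of n]
  by (simp_all add: subgroup.one_closed subgroup.m_inv_closed subgroup.m_closed)

lemma commutator_in_normal:
  assumes N: "N \<lhd> G" and y: "y \<in> carrier G" and x: "x \<in> N"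
  shows "commutator G x y \<in> N" "commutator G y x \<in> N"
proof -
  interpret N: normal N G by (rule N)
  have *: "y \<otimes> inv x \<otimes> inv y \<in> N" "y \<otimes> x \<otimes> inv y \<in> N"
    using x y N.inv_op_closed2 by auto
  have "x \<otimes> (y \<otimes> inv x \<otimes> inv y) \<in> N" "y \<otimes> x \<otimes> inv y \<otimes> inv x \<in> N"
    using N.m_closed[OF x *(1)] N.m_closed[OF *(2) N.m_inv_closed[OF x]] by auto
  then show "commutator G x y \<in> N" "commutator G y x \<in> N"
    using x y N.mem_carrier by (auto simp: commutator_def m_assoc)
qed

lemma lower_central_Suc_subset: "lower_central G (Suc n) \<subseteq> lower_central G n"
proof (cases n)
  case (Suc m)
  have "generate G {commutator G x y |x y. x \<in> lower_central G (Suc m) \<and> y \<in> carrier G}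
      \<subseteq> lower_central G (Suc m)"
    by (rule generate_subgroup_incl)
      (auto intro!: commutator_in_normal(1) lower_central_normal lower_central_subgroup
        intro: lower_central_carrier)
  then show ?thesis using Suc by simp
qed simp

lemma lower_central_antimono: "m \<le> n \<Longrightarrow> lower_central G n \<subseteq> lower_central G m"
  by (rule lift_Suc_antimono_le[of "lower_central G"]) (rule lower_central_Suc_subset)

lemma commutator_lower_central_carrier:
  "x \<in> lower_central G n \<Longrightarrow> y \<in> carrier G \<Longrightarrow> commutator G x y \<in> lower_central G (Suc n)"
  by (cases n) (auto simp: lower_central.simps(3) intro!: generate.incl)

lemma inv_commutator:
  "x \<in> carrier G \<Longrightarrow> y \<in> carrier G \<Longrightarrow> inv commutator G x y = commutator G y x"
  by (simp add: commutator_def m_assoc inv_mult_group)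

lemma hall_witt:
  assumes "x \<in> carrier G" "y \<in> carrier G" "z \<in> carrier G"
  shows "commutator G (commutator G x y) (y \<otimes> z \<otimes> inv y) \<otimes>
    commutator G (commutator G y z) (z \<otimes> x \<otimes> inv z) \<otimes>
    commutator G (commutator G z x) (x \<otimes> y \<otimes> inv x) = \<one>"
  using assms by (simp add: commutator_def m_assoc inv_mult_group)

lemma commutator_mult_right:
  assumes "x \<in> carrier G" "y \<in> carrier G" "z \<in> carrier G"
  shows "commutator G x (y \<otimes> z) = commutator G x y \<otimes> (y \<otimes> commutator G x z \<otimes> inv y)"
  using assms by (simp add: commutator_def m_assoc inv_mult_group)

lemma commutator_mult_left:
  assumes "x \<in> carrier G" "y \<in> carrier G" "z \<in> carrier G"
  shows "commutator G (x \<otimes> y) z = (x \<otimes> commutator G y z \<otimes> inv x) \<otimes> commutator G x z"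
  using assms by (simp add: commutator_def m_assoc inv_mult_group)

text \<open>The three subgroups argument, by induction on \<open>b\<close> with \<open>a\<close>
  arbitrary. A generator [y, z] of the next term is commuted with x through the Hall-Witt identity.
  Its other two factors lie in the required term: one commutes an element of degree a + b with a
  group element, the other falls under the induction hypothesis at \<open>Suc a\<close>.\<close>

lemma commutator_lower_central:
  assumes "1 \<le> a" "1 \<le> b" "x \<in> lower_central G a" "y \<in> lower_central G b"
  shows "commutator G x y \<in> lower_central G (a + b)"
  using assms(2,1,3,4)
proof (induction b arbitrary: a x y rule: nat_induct_at_least)
  case base
  then show ?case using commutator_lower_central_carrier by simp
next
  case (Suc b)
  let ?N = "lower_central G (a + Suc b)"
  interpret N: normal ?N G by (rule lower_central_normal)
  interpret A: normal "lower_central G a" G by (rule lower_central_normal)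
  interpret B: normal "lower_central G b" G by (rule lower_central_normal)
  have gens: "commutator G (commutator G y z) x \<in> ?N"
    if y: "y \<in> lower_central G b" and z: "z \<in> carrier G" and x: "x \<in> lower_central G a" for x y z
  proof -
    \<comment> \<open>The Hall-Witt identity contains [[y, z], z x' z^-1]; conjugating beforehand
      makes its last entry equal to x.\<close>
    define x' where "x' = inv z \<otimes> x \<otimes> z"
    have c: "x \<in> carrier G" "y \<in> carrier G" "x' \<in> carrier G"
      using x y z by (auto simp: x'_def lower_central_carrier)
    have x': "x' \<in> lower_central G a" unfolding x'_def using A.inv_op_closed1 z x by simp
    have "commutator G x' y \<in> lower_central G (a + b)" using Suc x' y by blast
    then have 1: "commutator G (commutator G x' y) (y \<otimes> z \<otimes> inv y) \<in> ?N"
      using commutator_lower_central_carrier[of _ "a + b"] c z by simp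
    have "commutator G x' z \<in> lower_central G (Suc a)"
      using x' z by (rule commutator_lower_central_carrier)
    then have "inv commutator G x' z \<in> lower_central G (Suc a)" by simp
    then have "commutator G z x' \<in> lower_central G (Suc a)"
      using c z by (simp add: inv_commutator)
    moreover have "x' \<otimes> y \<otimes> inv x' \<in> lower_central G b" using B.inv_op_closed2 c y by simp
    ultimately have 2: "commutator G (commutator G z x') (x' \<otimes> y \<otimes> inv x') \<in> ?N"
      using Suc.IH[of "Suc a"] by simp
    have x'x: "z \<otimes> x' \<otimes> inv z = x" using c z by (simp add: x'_def m_assoc)
    let ?A = "commutator G (commutator G x' y) (y \<otimes> z \<otimes> inv y)"
    let ?B = "commutator G (commutator G y z) x"
    let ?C = "commutator G (commutator G z x') (x' \<otimes> y \<otimes> inv x')"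
    have car: "?A \<in> carrier G" "?B \<in> carrier G" "?C \<in> carrier G" using c z by auto
    have "?A \<otimes> ?B \<otimes> ?C = \<one>" using hall_witt[of x' y z] c z x'x by simp
    then have "inv ?A \<otimes> (?A \<otimes> ?B \<otimes> ?C) \<otimes> inv ?C = inv ?A \<otimes> inv ?C" using car by simp
    then have "?B = inv ?A \<otimes> inv ?C" using car by (simp add: m_assoc)
    then show ?thesis using 1 2 by simp
  qed
  \<comment> \<open>The elements whose commutators with Gamma_a fall into the normal subgroup form a
    subgroup, so generators suffice.\<close>
  let ?H = "{c \<in> carrier G. \<forall>x\<in>lower_central G a. commutator G c x \<in> ?N}"
  have "subgroup ?H G"
  proof (rule subgroupI)
    show "?H \<noteq> {}"
      by (auto simp: commutator_def lower_central_carrier intro!: exI[of _ \<one>])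
  next
    fix c assume c: "c \<in> ?H"
    have "commutator G (inv c) x \<in> ?N" if x: "x \<in> lower_central G a" for x
    proof -
      have xc: "x \<in> carrier G" using x by (rule lower_central_carrier)
      have "inv c \<otimes> inv commutator G c x \<otimes> c \<in> ?N"
        using c x by (intro N.inv_op_closed1 N.m_inv_closed) auto
      moreover have "commutator G (inv c) x = inv c \<otimes> inv commutator G c x \<otimes> c"
        using c xc by (simp add: commutator_def m_assoc inv_mult_group)
      ultimately show ?thesis by simp
    qed
    then show "inv c \<in> ?H" using c by auto
  next
    fix c d assume c: "c \<in> ?H" and d: "d \<in> ?H"
    have "commutator G (c \<otimes> d) x \<in> ?N" if x: "x \<in> lower_central G a" for x
    proof -
      have "c \<otimes> commutator G d x \<otimes> inv c \<in> ?N"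
        using c d x by (intro N.inv_op_closed2) auto
      then show ?thesis
        using c d x lower_central_carrier[OF x] by (simp add: commutator_mult_left)
    qed
    then show "c \<otimes> d \<in> ?H" using c d by auto
  qed auto
  moreover have "{commutator G x y |x y. x \<in> lower_central G b \<and> y \<in> carrier G} \<subseteq> ?H"
    using gens lower_central_carrier by auto
  ultimately have "generate G {commutator G x y |x y. x \<in> lower_central G b \<and> y \<in> carrier G} \<subseteq> ?H"
    by (intro generate_subgroup_incl)
  moreover have "lower_central G (Suc b)
      = generate G {commutator G x y |x y. x \<in> lower_central G b \<and> y \<in> carrier G}"
    using Suc by (cases b) auto
  ultimately have "commutator G y x \<in> ?N" using Suc by auto
  then have "inv commutator G y x \<in> ?N" by simp
  then show ?case using Suc.prems lower_central_carrier by (simp add: inv_commutator)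
qed

end

lemma (in group_hom) hom_commutator:
  "x \<in> carrier G \<Longrightarrow> y \<in> carrier G \<Longrightarrow> h (commutator G x y) = commutator H (h x) (h y)"
  by (simp add: commutator_def)

lemma (in group_hom) hom_lower_central:
  "x \<in> lower_central G n \<Longrightarrow> h x \<in> lower_central H n"
proof (induction n arbitrary: x rule: induct_nat_012)
  case (ge2 n)
  let ?S = "{commutator G x y |x y. x \<in> lower_central G (Suc n) \<and> y \<in> carrier G}"
  from ge2.prems have "x \<in> generate G ?S" by simp
  then show ?case
  proof (induction rule: generate.induct)
    case one
    then show ?case using H.lower_central_closed(1)[of "Suc (Suc n)"] by simp
  next
    case (incl c)
    then show ?case
      using ge2.IH(2) H.commutator_lower_central_carrier[of _ "Suc n"]
      by (auto simp: G.lower_central_carrier hom_commutator)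
  next
    case (inv c)
    then have "h c \<in> lower_central H (Suc (Suc n))" "c \<in> carrier G"
      using ge2.IH(2) H.commutator_lower_central_carrier[of _ "Suc n"]
      by (auto simp: G.lower_central_carrier hom_commutator)
    then show ?case using H.lower_central_closed(2)[of "h c" "Suc (Suc n)"] by simp
  next
    case (eng c d)
    have "?S \<subseteq> carrier G" using G.lower_central_carrier by auto
    with eng have "c \<in> carrier G" "d \<in> carrier G" using G.generate_in_carrier by auto
    then show ?case
      using eng H.lower_central_closed(3)[of "h c" "Suc (Suc n)" "h d"] by simp
  qed
qed auto

section \<open>Commutator calculus in the graded quotients\<close>

context group
begin

text \<open>The next lemmas compute in the quotient by \<open>lower_central G (Suc n)\<close>, in which
  \<open>lower_central G n\<close> is central.\<close>

lemma quotient_group_hom: "N \<lhd> G \<Longrightarrow> group_hom G (G Mod N) (\<lambda>x. N #> x)"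
  by (simp add: group_hom_def group_hom_axioms_def normal.factorgroup_is_group
      normal.r_coset_hom_Mod)

lemma rcos_eq_iff:
  assumes "N \<lhd> G" "x \<in> carrier G" "y \<in> carrier G"
  shows "N #> x = N #> y \<longleftrightarrow> x \<otimes> inv y \<in> N"
proof -
  interpret N: normal N G by (rule assms)
  show ?thesis
    using assms N.rcos_module[of y x] N.subgroup_axioms
    by (metis group_axioms rcos_self repr_independence)
qed

lemma rcos_conj_commute:
  assumes N: "N \<lhd> G" and "x \<in> carrier G" "c \<in> carrier G" and "commutator G x c \<in> N"
  shows "N #> (x \<otimes> c \<otimes> inv x) = N #> c"
  using assms by (simp add: rcos_eq_iff commutator_def)

lemma rcos_commutator_mult_left:
  assumes "1 \<le> a" "1 \<le> b" "x \<in> lower_central G a" "x' \<in> lower_central G a" "y \<in> lower_central G b"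
  shows "lower_central G (Suc (a + b)) #> commutator G (x \<otimes> x') y =
    lower_central G (Suc (a + b)) #> (commutator G x y \<otimes> commutator G x' y)"
proof -
  let ?N = "lower_central G (Suc (a + b))"
  have N: "?N \<lhd> G" by (rule lower_central_normal)
  interpret q: group_hom G "G Mod ?N" "\<lambda>x. ?N #> x" using N by (rule quotient_group_hom)
  have c: "x \<in> carrier G" "x' \<in> carrier G" "y \<in> carrier G"
    using assms lower_central_carrier by auto
  have A: "commutator G x' y \<in> lower_central G (a + b)" "commutator G x y \<in> lower_central G (a + b)"
    using assms by (auto intro: commutator_lower_central)
  have *: "commutator G z w \<in> ?N" if "w \<in> lower_central G (a + b)" "z \<in> carrier G" for z w
  proof -
    have "inv commutator G w z \<in> ?N"
      using that commutator_lower_central_carrier[of w "a+b" z] by simp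
    then show ?thesis using that lower_central_carrier by (simp add: inv_commutator)
  qed
  have 1: "?N #> (x \<otimes> commutator G x' y \<otimes> inv x) = ?N #> commutator G x' y"
    using N c A * by (intro rcos_conj_commute) auto
  have "?N #> commutator G (x \<otimes> x') y = ?N #> (commutator G x' y \<otimes> commutator G x y)"
    using c 1 by (simp add: commutator_mult_left q.hom_mult del: q.hom_mult[symmetric])
  also have "\<dots> = ?N #> (commutator G x y \<otimes> commutator G x' y)"
  proof (subst rcos_eq_iff[OF N])
    have "u \<otimes> v \<otimes> inv (v \<otimes> u) = commutator G u v" if "u \<in> carrier G" "v \<in> carrier G" for u v
      using that by (simp add: commutator_def m_assoc inv_mult_group)
    then show "commutator G x' y \<otimes> commutator G x y \<otimes>
        inv (commutator G x y \<otimes> commutator G x' y) \<in> ?N"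
      using *[OF A(2), of "commutator G x' y"] c by simp
  qed (use c in auto)
  finally show ?thesis .
qed

lemma rcos_commutator_inv_left:
  assumes "1 \<le> a" "1 \<le> b" "x \<in> lower_central G a" "y \<in> lower_central G b"
  shows "lower_central G (Suc (a + b)) #> commutator G (inv x) y =
    lower_central G (Suc (a + b)) #> inv commutator G x y"
proof -
  let ?N = "lower_central G (Suc (a + b))"
  have N: "?N \<lhd> G" by (rule lower_central_normal)
  interpret q: group_hom G "G Mod ?N" "\<lambda>x. ?N #> x" using N by (rule quotient_group_hom)
  have c: "x \<in> carrier G" "y \<in> carrier G" using assms lower_central_carrier by auto
  have ix: "inv x \<in> lower_central G a" using assms by simp
  have "commutator G \<one> y = \<one>" using c by (simp add: commutator_def)
  then have "?N #> (commutator G (inv x) y \<otimes> commutator G x y) = ?N #> \<one>"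
    using rcos_commutator_mult_left[OF assms(1,2) ix assms(3,4)] c by simp
  then have "commutator G (inv x) y \<otimes> commutator G x y \<otimes> inv \<one> \<in> ?N"
    using c by (subst (asm) rcos_eq_iff[OF N]) auto
  then show ?thesis
    using c by (subst rcos_eq_iff[OF N]) auto
qed

text \<open>Conjugation multiplies z by [y, z], which lies deeper in the series, so the extra
  commutator with x is trivial in the quotient.\<close>

lemma rcos_commutator_conj_right:
  assumes "1 \<le> a" "1 \<le> b" "1 \<le> c" "x \<in> lower_central G a" "y \<in> lower_central G b" "z \<in> lower_central G c"
  shows "lower_central G (Suc (a + c)) #> commutator G x (y \<otimes> z \<otimes> inv y) =
    lower_central G (Suc (a + c)) #> commutator G x z"
proof -
  let ?N = "lower_central G (Suc (a + c))"
  have N: "?N \<lhd> G" by (rule lower_central_normal)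
  interpret q: group_hom G "G Mod ?N" "\<lambda>x. ?N #> x" using N by (rule quotient_group_hom)
  have car: "x \<in> carrier G" "y \<in> carrier G" "z \<in> carrier G" using assms lower_central_carrier by auto
  have yz: "commutator G y z \<in> lower_central G (b + c)"
    using assms by (intro commutator_lower_central) auto
  have "commutator G x (commutator G y z) \<in> lower_central G (a + (b + c))"
    using assms yz by (intro commutator_lower_central) auto
  then have 1: "commutator G x (commutator G y z) \<in> ?N"
    using lower_central_antimono[of "Suc (a + c)" "a + (b + c)"] assms by auto
  have w: "commutator G x z \<in> lower_central G (a + c)" using assms by (intro commutator_lower_central)
  have "inv commutator G (commutator G x z) (commutator G y z) \<in> ?N"
    using w commutator_lower_central_carrier[of _ "a + c"] car by simp
  then have 2: "commutator G (commutator G y z) (commutator G x z) \<in> ?N"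
    using car by (simp add: inv_commutator)
  have "y \<otimes> z \<otimes> inv y = commutator G y z \<otimes> z" using car by (simp add: commutator_def m_assoc)
  then have "commutator G x (y \<otimes> z \<otimes> inv y) = commutator G x (commutator G y z) \<otimes>
      (commutator G y z \<otimes> commutator G x z \<otimes> inv commutator G y z)"
    using car by (simp add: commutator_mult_right)
  moreover have "?N #> (commutator G y z \<otimes> commutator G x z \<otimes> inv commutator G y z) = ?N #> commutator G x z"
    using N car 2 by (intro rcos_conj_commute) auto
  moreover have "?N #> commutator G x (commutator G y z) = ?N #> \<one>"
    using 1 car by (subst rcos_eq_iff[OF N]) auto
  ultimately show ?thesis using car by (metis commutator_closed inv_closed l_one m_closed one_closed q.hom_mult)
qed

text \<open>The Hall-Witt identity in the quotient, where the conjugations disappear. It is arranged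
  as a Leibniz rule for commutation with z, the shape in which brackets of Lyndon words are
  rewritten.\<close>

lemma rcos_commutator_jacobi:
  assumes "1 \<le> a" "1 \<le> b" "1 \<le> c" and x: "x \<in> lower_central G a" and y: "y \<in> lower_central G b"
    and z: "z \<in> lower_central G c" and n: "n = a + b + c"
  shows "lower_central G (Suc n) #> commutator G (commutator G x y) z =
    lower_central G (Suc n) #>
      (commutator G (commutator G x z) y \<otimes> commutator G x (commutator G y z))"
proof -
  let ?N = "lower_central G (Suc n)"
  have N: "?N \<lhd> G" by (rule lower_central_normal)
  interpret q: group_hom G "G Mod ?N" "\<lambda>x. ?N #> x" using N by (rule quotient_group_hom)
  let ?q = "\<lambda>x. ?N #> x"
  have car: "x \<in> carrier G" "y \<in> carrier G" "z \<in> carrier G" using x y z lower_central_carrier by auto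
  have xy: "commutator G x y \<in> lower_central G (a + b)" and yz: "commutator G y z \<in> lower_central G (b + c)"
    and zx: "commutator G z x \<in> lower_central G (a + c)" and xz: "commutator G x z \<in> lower_central G (a + c)"
    using assms commutator_lower_central[of c a z x] by (auto intro: commutator_lower_central simp: add.commute)
  have 1: "?q (commutator G (commutator G x y) (y \<otimes> z \<otimes> inv y)) = ?q (commutator G (commutator G x y) z)"
    using rcos_commutator_conj_right[OF _ assms(2,3) xy y z] assms(1) n by simp
  have 2: "?q (commutator G (commutator G y z) (z \<otimes> x \<otimes> inv z)) = ?q (commutator G (commutator G y z) x)"
    using rcos_commutator_conj_right[OF _ assms(3,1) yz z x] assms(2) n by (simp add: ac_simps)
  have 3: "?q (commutator G (commutator G z x) (x \<otimes> y \<otimes> inv x)) = ?q (commutator G (commutator G z x) y)"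
    using rcos_commutator_conj_right[OF _ assms(1,2) zx x y] assms(1) n by (simp add: ac_simps)
  have 4: "?q (commutator G (commutator G z x) y) = ?q (inv commutator G (commutator G x z) y)"
    using rcos_commutator_inv_left[OF _ assms(2) xz y] assms(1) n car by (simp add: ac_simps inv_commutator)
  have 5: "commutator G (commutator G y z) x = inv commutator G x (commutator G y z)"
    using car by (simp add: inv_commutator)
  let ?A = "commutator G (commutator G x y) z" and ?B = "commutator G x (commutator G y z)"
    and ?C = "commutator G (commutator G x z) y"
  have cc: "?A \<in> carrier G" "?B \<in> carrier G" "?C \<in> carrier G" using car by auto
  have "?q (?A \<otimes> inv ?B \<otimes> inv ?C) = ?q \<one>"
    using hall_witt[of x y z] 1 2 3 4 5 car by (metis commutator_closed inv_closed m_closed q.hom_mult)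
  then have "?A \<otimes> inv ?B \<otimes> inv ?C \<otimes> inv \<one> \<in> ?N"
    using cc by (subst (asm) rcos_eq_iff[OF N]) auto
  then have "?A \<otimes> inv (?C \<otimes> ?B) \<in> ?N" using cc by (simp add: inv_mult_group m_assoc)
  then show ?thesis using cc by (subst rcos_eq_iff[OF N]) auto
qed

end

section \<open>Noncommutative power series and the Magnus expansion\<close>

typedef 'a ncps = "UNIV :: ('a list \<Rightarrow> int) set" morphisms nc Abs_ncps ..

setup_lifting type_definition_ncps

text \<open>The Cauchy product over all splittings of a word, by recursion on the first letter: this
  letter belongs to the right factor if the left one is empty, and is otherwise absorbed by a left
  derivative of \<open>f\<close>.\<close>

fun conv :: "('a list \<Rightarrow> int) \<Rightarrow> ('a list \<Rightarrow> int) \<Rightarrow> 'a list \<Rightarrow> int" where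
  "conv f g [] = f [] * g []"
| "conv f g (x # w) = f [] * g (x # w) + conv (\<lambda>u. f (x # u)) g w"

lemma conv_add_left: "conv (\<lambda>w. f w + f' w) g w = conv f g w + conv f' g w"
  by (induction w arbitrary: f f') (simp_all add: algebra_simps)

lemma conv_add_right: "conv f (\<lambda>w. g w + g' w) w = conv f g w + conv f g' w"
  by (induction w arbitrary: f) (simp_all add: algebra_simps)

lemma conv_scale_left: "conv (\<lambda>w. c * f w) g w = c * conv f g w"
  by (induction w arbitrary: f) (simp_all add: algebra_simps)

lemma conv_zero_left: "conv (\<lambda>w. 0) g w = 0"
  by (induction w) simp_all

lemma conv_assoc: "conv (conv f g) h w = conv f (conv g h) w"
proof (induction w arbitrary: f)
  case (Cons x w)
  have "conv (\<lambda>u. conv f g (x # u)) h w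
      = conv (\<lambda>u. f [] * g (x # u)) h w + conv (conv (\<lambda>u. f (x # u)) g) h w"
    using conv_add_left[of "\<lambda>u. f [] * g (x # u)" "conv (\<lambda>u. f (x # u)) g"] by simp
  then show ?case
    by (simp add: conv_scale_left Cons algebra_simps)
qed simp

lemma conv_one_left: "conv (\<lambda>w. if w = [] then 1 else 0) g w = g w"
  by (cases w) (simp_all add: conv_zero_left)

lemma conv_one_right: "conv f (\<lambda>w. if w = [] then 1 else 0) w = f w"
  by (induction w arbitrary: f) simp_all

instantiation ncps :: (type) ring_1
begin

lift_definition zero_ncps :: "'a ncps" is "\<lambda>w. 0" .
lift_definition one_ncps :: "'a ncps" is "\<lambda>w. if w = [] then 1 else 0" .
lift_definition plus_ncps :: "'a ncps \<Rightarrow> 'a ncps \<Rightarrow> 'a ncps" is "\<lambda>f g w. f w + g w" .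
lift_definition minus_ncps :: "'a ncps \<Rightarrow> 'a ncps \<Rightarrow> 'a ncps" is "\<lambda>f g w. f w - g w" .
lift_definition uminus_ncps :: "'a ncps \<Rightarrow> 'a ncps" is "\<lambda>f w. - f w" .
lift_definition times_ncps :: "'a ncps \<Rightarrow> 'a ncps \<Rightarrow> 'a ncps" is conv .

instance
proof
  fix a b c :: "'a ncps"
  show "a * b * c = a * (b * c)" by transfer (simp add: fun_eq_iff conv_assoc)
  show "1 * a = a" by transfer (simp add: fun_eq_iff conv_one_left)
  show "a * 1 = a" by transfer (simp add: fun_eq_iff conv_one_right)
  show "(a + b) * c = a * c + b * c" by transfer (simp add: fun_eq_iff conv_add_left)
  show "a * (b + c) = a * b + a * c" by transfer (simp add: fun_eq_iff conv_add_right)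
  show "(0 :: 'a ncps) \<noteq> 1" by transfer (auto simp: fun_eq_iff)
qed (transfer; simp add: fun_eq_iff; fail)+

end

lemma nc_zero [simp]: "nc 0 w = 0" by transfer simp
lemma nc_one: "nc 1 w = (if w = [] then 1 else 0)" by transfer simp
lemma nc_add [simp]: "nc (f + g) w = nc f w + nc g w" by transfer simp
lemma nc_diff [simp]: "nc (f - g) w = nc f w - nc g w" by transfer simp
lemma nc_minus [simp]: "nc (- f) w = - nc f w" by transfer simp
lemma nc_sum: "nc (sum f A) w = (\<Sum>a\<in>A. nc (f a) w)"
  by (induction A rule: infinite_finite_induct) auto
lemma ncps_eqI: "(\<And>w. nc f w = nc g w) \<Longrightarrow> f = g"
  by transfer auto

text \<open>Stripping a leading x. A series is its constant term plus the sum of all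
  \<open>ncvar x * lder x f\<close>. On Magnus expansions this is the Fox derivative, on tensors the
  contraction of the first factor with the dual vector of x.\<close>

lift_definition lder :: "'a \<Rightarrow> 'a ncps \<Rightarrow> 'a ncps" is "\<lambda>x f u. f (x # u)" .
lift_definition ncvar :: "'a \<Rightarrow> 'a ncps" is "\<lambda>x w. if w = [x] then 1 else 0" .

lemma nc_lder [simp]: "nc (lder x f) w = nc f (x # w)" by transfer simp
lemma nc_var: "nc (ncvar x) w = (if w = [x] then 1 else 0)" by transfer simp

lemma nc_mult_Nil: "nc (f * g) [] = nc f [] * nc g []" by transfer simp
lemma nc_mult_Cons: "nc (f * g) (x # w) = nc f [] * nc g (x # w) + nc (lder x f * g) w"
  by transfer simp

lemma nc_of_int: "nc (of_int c) w = (if w = [] then c else 0)"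
proof -
  have "nc (of_nat n) w = (if w = [] then int n else 0)" for n
    by (induction n) (auto simp: nc_one)
  then show ?thesis
    by (cases c rule: int_cases2) auto
qed

lemma lder_simps:
  "lder x 0 = 0" "lder x 1 = 0" "lder x (f + g) = lder x f + lder x g"
  "lder x (f - g) = lder x f - lder x g" "lder x (- f) = - lder x f" "lder x (of_int c) = 0"
  "lder x (ncvar y) = (if x = y then 1 else 0)"
  by (auto intro!: ncps_eqI simp: nc_one nc_of_int nc_var)

lemma lder_sum: "lder x (sum f A) = (\<Sum>a\<in>A. lder x (f a))"
  by (induction A rule: infinite_finite_induct) (auto simp: lder_simps)

lemma nc_of_int_mult: "nc (of_int c * g) w = c * nc g w"
  by (cases w) (auto simp: nc_mult_Nil nc_mult_Cons nc_of_int lder_simps)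

lemma lder_mult: "lder x (f * g) = of_int (nc f []) * lder x g + lder x f * g"
  by (rule ncps_eqI) (simp add: nc_mult_Cons nc_of_int_mult)

lemma nc_var_mult:
  "nc (ncvar x * g) [] = 0" "nc (ncvar x * g) (y # w) = (if x = y then nc g w else 0)"
  by (auto simp: nc_mult_Nil nc_mult_Cons nc_var lder_simps)

lemma nc_mult_nonzero:
  "nc (f * g) w \<noteq> 0 \<Longrightarrow> \<exists>u v. w = u @ v \<and> nc f u \<noteq> 0 \<and> nc g v \<noteq> 0"
proof (induction w arbitrary: f)
  case (Cons x w)
  show ?case
  proof (cases "nc (lder x f * g) w = 0")
    case True
    then have "nc f [] \<noteq> 0" "nc g (x # w) \<noteq> 0" using Cons.prems by (auto simp: nc_mult_Cons)
    then show ?thesis by (intro exI[of _ "[]"] exI[of _ "x # w"]) simp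
  next
    case False
    from Cons.IH[OF this] obtain u v where "w = u @ v" "nc f (x # u) \<noteq> 0" "nc g v \<noteq> 0" by auto
    then show ?thesis by (intro exI[of _ "x # u"] exI[of _ v]) auto
  qed
qed (simp add: nc_mult_Nil)

section \<open>The degree filtration of power series\<close>

definition ord_ge :: "nat \<Rightarrow> 'a ncps \<Rightarrow> bool" where
  "ord_ge n f \<longleftrightarrow> (\<forall>w. length w < n \<longrightarrow> nc f w = 0)"

lemma ord_ge_0 [simp]: "ord_ge 0 f" by (simp add: ord_ge_def)
lemma ord_ge_zero [simp]: "ord_ge n 0" by (simp add: ord_ge_def)
lemma ord_ge_add: "ord_ge n f \<Longrightarrow> ord_ge n g \<Longrightarrow> ord_ge n (f + g)" by (simp add: ord_ge_def)
lemma ord_ge_diff: "ord_ge n f \<Longrightarrow> ord_ge n g \<Longrightarrow> ord_ge n (f - g)" by (simp add: ord_ge_def)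
lemma ord_ge_minus: "ord_ge n f \<Longrightarrow> ord_ge n (- f)" by (simp add: ord_ge_def)
lemma ord_ge_sum: "(\<And>a. a \<in> A \<Longrightarrow> ord_ge n (f a)) \<Longrightarrow> ord_ge n (sum f A)"
  by (simp add: ord_ge_def nc_sum)
lemma ord_ge_mono: "ord_ge n f \<Longrightarrow> m \<le> n \<Longrightarrow> ord_ge m f" by (simp add: ord_ge_def)

lemma ord_ge_mult: "ord_ge m f \<Longrightarrow> ord_ge n g \<Longrightarrow> k \<le> m + n \<Longrightarrow> ord_ge k (f * g)"
proof (unfold ord_ge_def, intro allI impI, rule ccontr)
  fix w :: "'a list"
  assume *: "\<forall>w. length w < m \<longrightarrow> nc f w = 0" "\<forall>w. length w < n \<longrightarrow> nc g w = 0" "k \<le> m + n"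
    "length w < k" "nc (f * g) w \<noteq> 0"
  from nc_mult_nonzero[OF *(5)] obtain u v where "w = u @ v" "nc f u \<noteq> 0" "nc g v \<noteq> 0" by auto
  with * have "m \<le> length u" "n \<le> length v" by (meson not_le)+
  with \<open>w = u @ v\<close> * show False by simp
qed

lemma ord_ge_comm: "ord_ge m f \<Longrightarrow> ord_ge n g \<Longrightarrow> ord_ge (m + n) (f * g - g * f)"
  by (intro ord_ge_diff ord_ge_mult[of m f n] ord_ge_mult[of n g m]) simp_all

lemma ord_ge_mult_left: "ord_ge n g \<Longrightarrow> ord_ge n (f * g)"
  by (rule ord_ge_mult[of 0 _ n]) auto

lemma ord_ge_mult_right: "ord_ge n f \<Longrightarrow> ord_ge n (f * g)"
  by (rule ord_ge_mult[of n _ 0]) auto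

definition hom_deg :: "'a set \<Rightarrow> nat \<Rightarrow> 'a ncps \<Rightarrow> bool" where
  "hom_deg X n f \<longleftrightarrow> (\<forall>w. nc f w \<noteq> 0 \<longrightarrow> length w = n \<and> set w \<subseteq> X)"

lemma hom_deg_mult: "hom_deg X m f \<Longrightarrow> hom_deg X n g \<Longrightarrow> hom_deg X (m + n) (f * g)"
  unfolding hom_deg_def
proof (intro allI impI)
  fix w assume *: "\<forall>w. nc f w \<noteq> 0 \<longrightarrow> length w = m \<and> set w \<subseteq> X"
    "\<forall>w. nc g w \<noteq> 0 \<longrightarrow> length w = n \<and> set w \<subseteq> X" "nc (f * g) w \<noteq> 0"
  from nc_mult_nonzero[OF *(3)] obtain u v where "w = u @ v" "nc f u \<noteq> 0" "nc g v \<noteq> 0" by blast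
  with * show "length w = m + n \<and> set w \<subseteq> X" by simp
qed

lemma hom_deg_diff: "hom_deg X n f \<Longrightarrow> hom_deg X n g \<Longrightarrow> hom_deg X n (f - g)"
  unfolding hom_deg_def
proof (intro allI impI)
  fix w assume *: "\<forall>w. nc f w \<noteq> 0 \<longrightarrow> length w = n \<and> set w \<subseteq> X"
    "\<forall>w. nc g w \<noteq> 0 \<longrightarrow> length w = n \<and> set w \<subseteq> X" "nc (f - g) w \<noteq> 0"
  then have "nc f w \<noteq> 0 \<or> nc g w \<noteq> 0" by auto
  with * show "length w = n \<and> set w \<subseteq> X" by blast
qed

lemma hom_deg_ord_ge: "hom_deg X n f \<Longrightarrow> ord_ge n f"
  unfolding hom_deg_def ord_ge_def by force

lemma hom_deg_eq_zero: "hom_deg X n f \<Longrightarrow> ord_ge (Suc n) f \<Longrightarrow> f = 0"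
  unfolding hom_deg_def ord_ge_def by (metis lessI ncps_eqI nc_zero)

section \<open>Tensors as power series\<close>

lift_definition ser :: "'a tensor \<Rightarrow> 'a ncps" is "\<lambda>f. f" .

lemma nc_ser [simp]: "nc (ser p) w = Poly_Mapping.lookup p w"
  by transfer simp

lemma ser_inject: "ser p = ser q \<Longrightarrow> p = q"
  by (metis nc_ser poly_mapping_eqI)

lemma ser_add: "ser (p + q) = ser p + ser q" and ser_diff: "ser (p - q) = ser p - ser q"
  and ser_minus: "ser (- p) = - ser p" and ser_zero [simp]: "ser 0 = 0"
  by (auto intro!: ncps_eqI simp: lookup_add lookup_minus)

lemma ser_sum: "ser (sum f A) = (\<Sum>a\<in>A. ser (f a))"
  by (induction A rule: infinite_finite_induct) (auto simp: ser_add)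

lemma ser_single_Nil: "ser (Poly_Mapping.single [] a) = of_int a"
  by (rule ncps_eqI) (auto simp: lookup_single nc_of_int when_def)

lemma ser_single_Cons: "ser (Poly_Mapping.single (x # u) a) = ncvar x * ser (Poly_Mapping.single u a)"
proof (rule ncps_eqI)
  fix w show "nc (ser (Poly_Mapping.single (x # u) a)) w = nc (ncvar x * ser (Poly_Mapping.single u a)) w"
    by (cases w) (auto simp: lookup_single nc_var_mult when_def)
qed

lemma ser_single_gen: "ser (Poly_Mapping.single [x] 1) = ncvar x"
  by (simp add: ser_single_Cons ser_single_Nil)

lemma ser_single_mult:
  "ser (Poly_Mapping.single u a * Poly_Mapping.single v b) =
    ser (Poly_Mapping.single u a) * ser (Poly_Mapping.single v b)"
proof -
  have "ser (Poly_Mapping.single (u @ v) (a * b)) = ser (Poly_Mapping.single u a) * ser (Poly_Mapping.single v b)"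
  proof (induction u)
    case Nil
    show ?case
      by (rule ncps_eqI) (simp add: ser_single_Nil nc_of_int_mult lookup_single when_def)
  next
    case (Cons x u)
    then show ?case unfolding append_Cons ser_single_Cons mult.assoc by (rule arg_cong)
  qed
  then show ?thesis unfolding mult_single plus_list_def .
qed

lemma tensor_expand: "p = (\<Sum>w\<in>Poly_Mapping.keys p. Poly_Mapping.single w (Poly_Mapping.lookup p w))"
  by (rule poly_mapping_eqI) (auto simp: lookup_sum lookup_single when_def not_in_keys_iff_lookup_eq_zero)

lemma ser_mult: "ser (p * q) = ser p * ser q"
proof -
  let ?S = "\<lambda>p. (\<Sum>w\<in>Poly_Mapping.keys p. Poly_Mapping.single w (Poly_Mapping.lookup p w))"
  have "ser (?S p * ?S q) = ser (?S p) * ser (?S q)"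
    by (simp only: sum_distrib_left sum_distrib_right ser_sum ser_single_mult)
  then show ?thesis using tensor_expand[of p] tensor_expand[of q] by simp
qed

section \<open>The Magnus expansion\<close>

definition mlet :: "'a \<times> bool \<Rightarrow> 'a ncps" where
  "mlet l = (if snd l then 1 + ncvar (fst l)
     else Abs_ncps (\<lambda>w. if set w \<subseteq> {fst l} then (- 1) ^ length w else 0))"

lemma nc_mlet_False: "nc (mlet (x, False)) w = (if set w \<subseteq> {x} then (- 1) ^ length w else 0)"
  by (simp add: mlet_def Abs_ncps_inverse)

lemma lder_mlet_False: "lder y (mlet (x, False)) = (if x = y then - mlet (x, False) else 0)"
  by (rule ncps_eqI) (auto simp: nc_mlet_False)

lemma nc_mlet_Nil [simp]: "nc (mlet l) [] = 1"
  by (cases l; cases "snd l") (auto simp: mlet_def nc_one nc_var Abs_ncps_inverse)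

text \<open>The expansion of an inverse letter is the geometric series of -x, supported on the
  powers of x with alternating signs.\<close>

lemma mlet_inverse: "mlet l * mlet (fst l, \<not> snd l) = 1"
proof -
  obtain x b where l: "l = (x, b)" by (cases l)
  have 1: "mlet (x, True) * mlet (x, False) = 1"
  proof (rule ncps_eqI)
    fix w show "nc (mlet (x, True) * mlet (x, False)) w = nc 1 w"
      by (cases w) (auto simp: mlet_def[of "(x, True)"] distrib_right nc_var_mult nc_mlet_False nc_one)
  qed
  have 2: "mlet (x, False) * mlet (x, True) = 1"
  proof (rule ncps_eqI)
    fix w show "nc (mlet (x, False) * mlet (x, True)) w = nc 1 w"
    proof (induction w)
      case (Cons y w)
      then show ?case
        by (auto simp: nc_mult_Cons lder_mlet_False nc_one mlet_def[of "(x, True)"] nc_var)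
    qed (simp add: nc_mult_Nil nc_one)
  qed
  show ?thesis using 1 2 l by (cases b) auto
qed

definition magnus :: "'a fword \<Rightarrow> 'a ncps" where
  "magnus w = prod_list (map mlet w)"

lemma magnus_Nil [simp]: "magnus [] = 1" and magnus_Cons: "magnus (l # w) = mlet l * magnus w"
  by (simp_all add: magnus_def)

lemma magnus_push: "magnus (push l w) = mlet l * magnus w"
proof (cases w)
  case (Cons m w')
  then show ?thesis
    using mlet_inverse[of l] by (auto simp: magnus_Cons mult.assoc[symmetric])
qed (simp add: magnus_Cons)

lemma magnus_mult: "magnus (u \<otimes>\<^bsub>free_group X\<^esub> v) = magnus u * magnus v"
  unfolding mult_free_group by (induction u) (simp_all add: magnus_push magnus_Cons mult.assoc)

lemma magnus_inv:
  assumes "x \<in> carrier (free_group X)"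
  shows "magnus (inv\<^bsub>free_group X\<^esub> x) * magnus x = 1" "magnus x * magnus (inv\<^bsub>free_group X\<^esub> x) = 1"
  using magnus_mult[of X "inv\<^bsub>free_group X\<^esub> x" x] magnus_mult[of X x "inv\<^bsub>free_group X\<^esub> x"]
    group.l_inv[OF group_free_group assms] group.r_inv[OF group_free_group assms]
  by (simp_all add: one_free_group)

lemma nc_magnus_Nil [simp]: "nc (magnus w) [] = 1"
  by (induction w) (auto simp: magnus_Cons nc_mult_Nil nc_one)

lemma ord_ge_1_magnus: "ord_ge 1 (magnus w - 1)"
  by (simp add: ord_ge_def nc_one)

text \<open>With X and Y the two expansions, M([x, y]) - 1 = (XY - YX) X^-1 Y^-1. The last two
  factors have constant term 1, so they only affect terms of degree above m + n.\<close>

lemma magnus_commutator: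
  assumes x: "x \<in> carrier (free_group X)" and y: "y \<in> carrier (free_group X)"
    and "ord_ge m (magnus x - 1)" "ord_ge n (magnus y - 1)"
  shows "ord_ge (m + n + 1) (magnus (commutator (free_group X) x y) - 1
      - ((magnus x - 1) * (magnus y - 1) - (magnus y - 1) * (magnus x - 1)))"
proof -
  let ?i = "\<lambda>x. magnus (inv\<^bsub>free_group X\<^esub> x)"
  define E where "E = (magnus x - 1) * (magnus y - 1) - (magnus y - 1) * (magnus x - 1)"
  have E: "E = magnus x * magnus y - magnus y * magnus x"
    by (simp add: E_def algebra_simps)
  have "magnus y * magnus x * (?i x * ?i y) = magnus y * (magnus x * ?i x) * ?i y"
    by (simp add: mult.assoc)
  then have "magnus y * magnus x * (?i x * ?i y) = 1"
    using magnus_inv[OF x] magnus_inv[OF y] by simp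
  then have "magnus (commutator (free_group X) x y) - 1 = E * (?i x * ?i y)"
    by (simp add: commutator_def magnus_mult E left_diff_distrib mult.assoc)
  then have "magnus (commutator (free_group X) x y) - 1 - E = E * (?i x * ?i y - 1)"
    by (simp add: right_diff_distrib)
  moreover have "ord_ge (m + n) E"
    unfolding E_def using assms(3,4) by (rule ord_ge_comm)
  moreover have "ord_ge 1 (?i x * ?i y - 1)" by (simp add: ord_ge_def nc_mult_Nil nc_one)
  ultimately show ?thesis unfolding E_def[symmetric] by (auto intro: ord_ge_mult)
qed

lemma magnus_one_diff_mult:
  "magnus (u \<otimes>\<^bsub>free_group X\<^esub> v) - 1 = (magnus u - 1) + (magnus v - 1) + (magnus u - 1) * (magnus v - 1)"
proof -
  have "a * b - 1 = (a - 1) + (b - 1) + (a - 1) * (b - 1)" for a b :: "'a ncps"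
    by (simp add: left_diff_distrib right_diff_distrib)
  then show ?thesis unfolding magnus_mult .
qed

lemma magnus_one_diff_inv:
  assumes "x \<in> carrier (free_group X)"
  shows "magnus (inv\<^bsub>free_group X\<^esub> x) - 1
    = - (magnus x - 1) - (magnus (inv\<^bsub>free_group X\<^esub> x) - 1) * (magnus x - 1)"
  using magnus_inv[OF assms] by (simp add: algebra_simps)

text \<open>The easy half of Magnus' theorem: commutation with any group element raises the order by
  one.\<close>

lemma magnus_lower_central:
  assumes "x \<in> lower_central (free_group X) n"
  shows "ord_ge n (magnus x - 1)"
  using assms
proof (induction n arbitrary: x rule: induct_nat_012)
  case 1
  then show ?case using ord_ge_1_magnus by simp
next
  case (ge2 n)
  interpret F: group "free_group X" by (rule group_free_group)
  let ?S = "{commutator (free_group X) x y |x y. x \<in> lower_central (free_group X) (Suc n)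
      \<and> y \<in> carrier (free_group X)}"
  have comm: "ord_ge (Suc (Suc n)) (magnus c - 1)" if "c \<in> ?S" for c
  proof -
    from that obtain x y where c: "c = commutator (free_group X) x y"
      and x: "x \<in> lower_central (free_group X) (Suc n)" and y: "y \<in> carrier (free_group X)" by auto
    have 1: "ord_ge (Suc n) (magnus x - 1)" using x ge2 by blast
    define E where "E = (magnus x - 1) * (magnus y - 1) - (magnus y - 1) * (magnus x - 1)"
    have "ord_ge (Suc n + 1 + 1) (magnus c - 1 - E)"
      unfolding c E_def using x y 1 ord_ge_1_magnus[of y] F.lower_central_carrier by (intro magnus_commutator) auto
    moreover have "ord_ge (Suc n + 1) E"
      unfolding E_def using 1 ord_ge_1_magnus[of y] by (rule ord_ge_comm)
    ultimately have "ord_ge (Suc (Suc n)) ((magnus c - 1 - E) + E)"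
      by (intro ord_ge_add) (auto elim: ord_ge_mono)
    then show ?thesis by simp
  qed
  have S: "?S \<subseteq> carrier (free_group X)" using F.lower_central_carrier by auto
  from ge2.prems have "x \<in> generate (free_group X) ?S" by simp
  then show ?case
  proof (induction rule: generate.induct)
    case one
    then show ?case by (simp add: one_free_group)
  next
    case (incl c)
    then show ?case by (rule comm)
  next
    case (inv c)
    then have c: "c \<in> carrier (free_group X)" using S by auto
    show ?case
      by (subst magnus_one_diff_inv[OF c])
        (rule ord_ge_diff[OF ord_ge_minus[OF comm[OF inv]] ord_ge_mult_left[OF comm[OF inv]]])
  next
    case (eng c d)
    show ?case unfolding magnus_one_diff_mult
      by (rule ord_ge_add[OF ord_ge_add[OF eng(3,4)] ord_ge_mult_left[OF eng(4)]])
  qed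
qed simp

lemma lie_tensor_simps [simp]:
  "lie_tensor (lie_gen x) = Poly_Mapping.single [x] 1" "lie_tensor 0 = 0"
  "lie_tensor (- u) = - lie_tensor u" "lie_tensor (u + v) = lie_tensor u + lie_tensor v"
  "lie_tensor (lie_br u v) = lie_tensor u * lie_tensor v - lie_tensor v * lie_tensor u"
  by (transfer; simp)+

lemma lie_tensor_diff [simp]: "lie_tensor (u - v) = lie_tensor u - lie_tensor v"
  unfolding minus_free_lie_def lie_tensor_simps by simp

lemma lie_tensor_sum: "lie_tensor (sum f A) = (\<Sum>a\<in>A. lie_tensor (f a))"
  by (induction A rule: infinite_finite_induct) auto

definition lser :: "'a free_lie \<Rightarrow> 'a ncps" where
  "lser l = ser (lie_tensor l)"

lemma lser_simps:
  "lser (lie_gen x) = ncvar x" "lser 0 = 0" "lser (- u) = - lser u" "lser (u + v) = lser u + lser v"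
  "lser (u - v) = lser u - lser v" "lser (lie_br u v) = lser u * lser v - lser v * lser u"
  by (auto simp: lser_def ser_single_gen ser_minus ser_add ser_diff ser_mult)

lemma hom_deg_lser: "lie_homogeneous X n l \<Longrightarrow> hom_deg X n (lser l)"
proof (induction rule: lie_homogeneous.induct)
  case (br m u n v)
  then show ?case
    using hom_deg_mult[of X n "lser v" m "lser u"]
    by (auto simp: lser_simps add.commute intro!: hom_deg_diff hom_deg_mult)
qed (simp_all add: lser_simps hom_deg_diff, simp_all add: hom_deg_def nc_var)

context group
begin

lemma rcos_mult_cong:
  assumes N: "N \<lhd> G" and "x \<in> carrier G" "y \<in> carrier G" "x' \<in> carrier G" "y' \<in> carrier G"
    and "N #> x = N #> x'" "N #> y = N #> y'"
  shows "N #> (x \<otimes> y) = N #> (x' \<otimes> y')"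
  using assms normal.rcos_sum[OF N] by metis

lemma rcos_inv_cong:
  assumes N: "N \<lhd> G" and "x \<in> carrier G" "x' \<in> carrier G" and "N #> x = N #> x'"
  shows "N #> inv x = N #> inv x'"
  using assms normal.rcos_inv[OF N] by metis

lemma rcos_commute:
  assumes "1 \<le> n" "x \<in> lower_central G n" "y \<in> lower_central G n"
  shows "lower_central G (Suc n) #> (x \<otimes> y) = lower_central G (Suc n) #> (y \<otimes> x)"
proof -
  have c: "x \<in> carrier G" "y \<in> carrier G" using assms lower_central_carrier by auto
  have "commutator G x y \<in> lower_central G (Suc n)"
    using assms c by (intro commutator_lower_central_carrier)
  moreover have "x \<otimes> y \<otimes> inv (y \<otimes> x) = commutator G x y"
    using c by (simp add: commutator_def m_assoc inv_mult_group)
  ultimately show ?thesis using c by (subst rcos_eq_iff[OF lower_central_normal]) auto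
qed

lemma rcos_eq_one_iff:
  assumes N: "N \<lhd> G" and x: "x \<in> carrier G"
  shows "N #> x = N #> \<one> \<longleftrightarrow> x \<in> N"
  using rcos_eq_iff[OF N x one_closed] x by simp

end

section \<open>Lyndon bases of the free Lie ring and of the lower central quotients\<close>

instantiation gen :: linorder
begin

fun gen_key :: "gen \<Rightarrow> nat" where
  "gen_key (Alpha i) = 2 * i"
| "gen_key (Beta i) = 2 * i + 1"

definition less_eq_gen :: "gen \<Rightarrow> gen \<Rightarrow> bool" where "less_eq_gen a b \<longleftrightarrow> gen_key a \<le> gen_key b"
definition less_gen :: "gen \<Rightarrow> gen \<Rightarrow> bool" where "less_gen a b \<longleftrightarrow> gen_key a < gen_key b"

instance
proof
  fix a b :: gen
  show "a \<le> b \<Longrightarrow> b \<le> a \<Longrightarrow> a = b"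
    by (cases a; cases b) (auto simp: less_eq_gen_def, presburger+)
qed (auto simp: less_eq_gen_def less_gen_def)

end

section \<open>Lexicographic order of words\<close>

lemma list_less_Cons: "(x # u :: 'a::linorder list) < y # v \<longleftrightarrow> x < y \<or> (x = y \<and> u < v)"
  by (auto simp: list_less_def)

lemma list_not_less_Nil: "\<not> (u :: 'a::linorder list) < []"
  by (simp add: list_less_def)

lemma list_Nil_less: "([] :: 'a::linorder list) < u \<longleftrightarrow> u \<noteq> []"
  by (cases u) (auto simp: list_less_def)

lemma list_less_append_cancel: "(u @ v :: 'a::linorder list) < u @ w \<longleftrightarrow> v < w"
  by (induction u) (auto simp: list_less_Cons)

lemma list_le_append: "(u :: 'a::linorder list) \<le> u @ v"
proof (cases "v = []")
  case False
  then have "u @ [] < u @ v" unfolding list_less_append_cancel by (simp add: list_Nil_less)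
  then show ?thesis by simp
qed simp

lemma list_less_append:
  "(u :: 'a::linorder list) < v \<Longrightarrow> (\<nexists>r. v = u @ r) \<Longrightarrow> u @ s < v @ t"
proof (induction u arbitrary: v)
  case (Cons x u)
  then show ?case by (cases v) (auto simp: list_less_Cons list_not_less_Nil)
qed auto

lemma list_less_append_same_length:
  "(u :: 'a::linorder list) < v \<Longrightarrow> length u = length v \<Longrightarrow> u @ s < v @ t"
  by (rule list_less_append) auto

lemma list_append_mono:
  assumes "(u :: 'a::linorder list) \<le> a" "length u = length a" "v \<le> b"
  shows "u @ v \<le> a @ b"
proof (cases "u = a")
  case True
  have "\<not> a @ b < a @ v" unfolding list_less_append_cancel using assms(3) by (rule leD)
  then show ?thesis using True by (simp add: not_less)
next
  case False
  with assms(1) have "u < a" by (rule le_neq_trans)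
  from list_less_append_same_length[OF this assms(2)] show ?thesis by (rule less_imp_le)
qed

text \<open>Here w is a Lyndon word, s its right standard factor (empty for a letter), l its
  standard bracketing and x the same bracketing by group commutators. The premise
  \<open>s = [] \<or> v \<le> s\<close> is the condition for u @ v to have v as right standard
  factor; when it fails, the bracket has to be rewritten.\<close>

inductive lyn :: "nat \<Rightarrow> gen list \<Rightarrow> gen list \<Rightarrow> gen free_lie \<Rightarrow> gen fword \<Rightarrow> bool" for g where
  letter: "e \<in> gens g \<Longrightarrow> lyn g [e] [] (lie_gen e) (pi_gen e)"
| node: "lyn g u s l x \<Longrightarrow> lyn g v t m y \<Longrightarrow> u < v \<Longrightarrow> s = [] \<or> v \<le> s \<Longrightarrow>
    lyn g (u @ v) v (lie_br l m) (commutator (surface_group g) x y)"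

lemma lyn_not_Nil: "lyn g w s l x \<Longrightarrow> w \<noteq> []"
  by (induction rule: lyn.induct) auto

lemma lyn_set: "lyn g w s l x \<Longrightarrow> set w \<subseteq> gens g"
  by (induction rule: lyn.induct) auto

lemma lyn_lie_rep: "lyn g w s l x \<Longrightarrow> lie_rep g (length w) l x"
proof (induction rule: lyn.induct)
  case (letter e)
  then show ?case using lie_rep.gen by simp
next
  case node
  then show ?case by (simp add: lie_rep.br)
qed

text \<open>The word of a standard bracketing is a Lyndon word, and its right factor is the least
  proper suffix.\<close>

lemma lyn_suffix:
  assumes "lyn g w s l x" "w = p @ q" "p \<noteq> []" "q \<noteq> []"
  shows "w < q \<and> s \<noteq> [] \<and> s \<le> q"
  using assms
proof (induction arbitrary: p q rule: lyn.induct)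
  case (letter e)
  then show ?case by (auto simp: Cons_eq_append_conv)
next
  case (node u s l x v t m y)
  have v: "v \<noteq> []" and u: "u \<noteq> []" using node.hyps lyn_not_Nil by auto
  have less: "u @ v < v"
  proof (cases "\<exists>r. v = u @ r")
    case True
    then obtain r where r: "v = u @ r" by auto
    with node.hyps have "r \<noteq> []" by auto
    with node.IH(2)[of u r] r u have "v < r" by simp
    then have "u @ v < u @ r" by (simp add: list_less_append_cancel)
    with r show ?thesis by simp
  next
    case False
    from list_less_append[OF \<open>u < v\<close> False, of v "[]"] show ?thesis by simp
  qed
  from node.prems(1) consider (a) r where "u = p @ r" "q = r @ v" | (b) r where "v = r @ q"
    unfolding append_eq_append_conv2 by blast
  \<comment> \<open>A suffix longer than v is r @ v with r a proper suffix of u, so v \<le> s \<le>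
    r. A proper suffix of v is larger than the Lyndon word v.\<close>
  then have "v \<le> q"
  proof cases
    case (a r)
    show ?thesis
    proof (cases "r = []")
      case False
      then have "s \<noteq> [] \<and> s \<le> r" using node.IH(1)[of p r] a node.prems by simp
      then have "v \<le> r" using node.hyps(4) by (meson order_trans)
      then show ?thesis using list_le_append[of r v] a by simp
    qed (use a in simp)
  next
    case (b r)
    show ?thesis
    proof (cases "r = []")
      case False
      then have "v < q" using node.IH(2)[of r q] b node.prems by simp
      then show ?thesis by simp
    qed (use b in simp)
  qed
  with less v show ?case by simp
qed

lemma lyn_cases_suffix:
  assumes "lyn g w s l x"
  shows "(length w = 1 \<and> s = []) \<or> (\<exists>p. w = p @ s \<and> p \<noteq> [] \<and> s \<noteq> [])"
  using assms by (cases rule: lyn.cases) (auto dest: lyn_not_Nil)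

lemma lyn_suffix_unique:
  assumes "lyn g w s l x" "lyn g w s' l' x'"
  shows "s = s'"
proof (cases "length w = 1")
  case True
  then have "\<not> (\<exists>p. w = p @ q \<and> p \<noteq> [] \<and> q \<noteq> [])" for q by (auto simp: length_Suc_conv Cons_eq_append_conv)
  then show ?thesis
    using lyn_cases_suffix[OF assms(1)] lyn_cases_suffix[OF assms(2)] by blast
next
  case False
  obtain p where p: "w = p @ s" "p \<noteq> []" "s \<noteq> []" using lyn_cases_suffix[OF assms(1)] False by blast
  obtain p' where p': "w = p' @ s'" "p' \<noteq> []" "s' \<noteq> []" using lyn_cases_suffix[OF assms(2)] False by blast
  show ?thesis
    using lyn_suffix[OF assms(1) p'] lyn_suffix[OF assms(2) p] by (intro antisym) simp_all
qed

lemma lyn_unique: "lyn g w s l x \<Longrightarrow> lyn g w s' l' x' \<Longrightarrow> l = l' \<and> x = x'"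
proof (induction arbitrary: s' l' x' rule: lyn.induct)
  case (letter e)
  from letter.prems show ?case
    by (cases rule: lyn.cases) (auto simp: Cons_eq_append_conv dest: lyn_not_Nil)
next
  case (node u s l x v t m y)
  have uv: "u \<noteq> []" "v \<noteq> []" using node.hyps lyn_not_Nil by auto
  have s': "s' = v"
    using lyn_suffix_unique[OF lyn.node[OF node.hyps(1-4)] node.prems] by simp
  from node.prems show ?case
  proof (cases rule: lyn.cases)
    case (node u2 s2 l2 x2 m2 t2 y2)
    then show ?thesis using node.IH s' node by auto
  qed (use uv in \<open>auto simp: Cons_eq_append_conv append_eq_Cons_conv\<close>)
qed

lemma nc_mult_hom_deg:
  "hom_deg X m f \<Longrightarrow> length u = m \<Longrightarrow> nc (f * h) (u @ v) = nc f u * nc h v"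
proof (induction u arbitrary: f m)
  case Nil
  then have "lder x f = 0" for x
    by (intro ncps_eqI) (auto simp: hom_deg_def)
  then show ?case by (cases v) (simp_all add: nc_mult_Nil nc_mult_Cons)
next
  case (Cons x u)
  then have *: "nc f w \<noteq> 0 \<Longrightarrow> length w = Suc (length u) \<and> set w \<subseteq> X" for w
    by (simp add: hom_deg_def)
  have "nc f [] = 0" "hom_deg X (length u) (lder x f)"
    unfolding hom_deg_def using *[of "[]"] *[of "x # _"] by auto
  then show ?case using Cons.IH[of "length u" "lder x f"] by (simp add: nc_mult_Cons)
qed

lemma lie_rep_homogeneous: "lie_rep g k l x \<Longrightarrow> 1 \<le> k \<and> l \<in> Lie_part g k"
proof (induction rule: lie_rep.induct)
  case (br m u x n v y)
  then show ?case by (auto simp: lie_part_def intro: lie_homogeneous.br)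
next
  case (add k u x v y)
  then have "lie_homogeneous (gens g) k (0 - v)" "lie_homogeneous (gens g) k u"
    using lie_homogeneous.diff[OF lie_homogeneous.zero, of "gens g" k v] by (auto simp: lie_part_def)
  then have "lie_homogeneous (gens g) k (u - (0 - v))" using lie_homogeneous.diff by blast
  then show ?case using add by (simp add: lie_part_def)
next
  case (neg k u x)
  then have "lie_homogeneous (gens g) k (0 - u)"
    using lie_homogeneous.diff[OF lie_homogeneous.zero, of "gens g" k u] by (auto simp: lie_part_def)
  then show ?case using neg by (simp add: lie_part_def)
qed (auto simp: lie_part_def intro: lie_homogeneous.gen[simplified] lie_homogeneous.zero)

lemma hom_deg_lser_part: "l \<in> Lie_part g k \<Longrightarrow> hom_deg (gens g) k (lser l)"
  by (simp add: lie_part_def hom_deg_lser)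

text \<open>The least word of \<open>lser l * lser m\<close> is u @ v with coefficient 1, while
  every word of \<open>lser m * lser l\<close> is at least v @ u, which exceeds u @ v because u @ v
  < v. The leading coefficient 1 makes the bracketings triangular over the integers.\<close>

lemma lyn_triangular:
  "lyn g w s l x \<Longrightarrow> nc (lser l) w = 1 \<and> (\<forall>w'. nc (lser l) w' \<noteq> 0 \<longrightarrow> w \<le> w')"
proof (induction rule: lyn.induct)
  case (letter e)
  then show ?case by (simp add: lser_simps nc_var)
next
  case (node u s l x v t m y)
  have hl: "hom_deg (gens g) (length u) (lser l)" and hm: "hom_deg (gens g) (length v) (lser m)"
    using node.hyps lyn_lie_rep lie_rep_homogeneous hom_deg_lser_part by blast+
  have lw: "nc (lser l) w \<noteq> 0 \<Longrightarrow> length w = length u \<and> u \<le> w" for w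
    using hl node.IH(1) unfolding hom_deg_def by blast
  have mw: "nc (lser m) w \<noteq> 0 \<Longrightarrow> length w = length v \<and> v \<le> w" for w
    using hm node.IH(2) unfolding hom_deg_def by blast
  have ne: "u \<noteq> []" "v \<noteq> []" using node.hyps lyn_not_Nil by auto
  have "u @ v < v" using lyn_suffix[OF lyn.node[OF node.hyps(1-4)], of u v] ne by simp
  also have "v \<le> v @ u" by (rule list_le_append)
  finally have uv: "u @ v < v @ u" .
  have two: "u @ v < w'" if nz: "nc (lser m * lser l) w' \<noteq> 0" for w'
  proof -
    from nc_mult_nonzero[OF nz] obtain b a where w': "w' = b @ a" "nc (lser m) b \<noteq> 0" "nc (lser l) a \<noteq> 0"
      by blast
    then have "length b = length v" "length a = length u" "v \<le> b" "u \<le> a"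
      using lw mw by blast+
    then have "v @ u \<le> b @ a" by (intro list_append_mono) auto
    with uv w' show ?thesis by simp
  qed
  have one: "u @ v \<le> w'" if nz: "nc (lser l * lser m) w' \<noteq> 0" for w'
  proof -
    from nc_mult_nonzero[OF nz] obtain a b where w': "w' = a @ b" "nc (lser l) a \<noteq> 0" "nc (lser m) b \<noteq> 0"
      by blast
    then have "length b = length v" "length a = length u" "v \<le> b" "u \<le> a"
      using lw mw by blast+
    then show ?thesis unfolding w'(1) by (intro list_append_mono) auto
  qed
  have "nc (lser m * lser l) (u @ v) = 0" using two[of "u @ v"] by auto
  moreover have "nc (lser l * lser m) (u @ v) = 1"
    using nc_mult_hom_deg[OF hl, of u "lser m" v] node.IH by simp
  moreover have "u @ v \<le> w'" if "nc (lser (lie_br l m)) w' \<noteq> 0" for w'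
  proof -
    have "nc (lser l * lser m) w' \<noteq> 0 \<or> nc (lser m * lser l) w' \<noteq> 0"
      using that by (auto simp: lser_simps)
    then show ?thesis using one two by (auto simp: order_le_less)
  qed
  ultimately show ?case by (simp add: lser_simps)
qed

text \<open>\<open>lsp g n B\<close> is the span of the standard bracketings of words in \<open>B\<close> of length \<open>n\<close>,
  simultaneously in the free Lie ring and in \<open>\<Gamma>\<^sub>n / \<Gamma>\<^sub>n\<^sub>+\<^sub>1\<close>.\<close>

inductive lsp :: "nat \<Rightarrow> nat \<Rightarrow> gen list set \<Rightarrow> gen free_lie \<Rightarrow> gen fword \<Rightarrow> bool" for g n B where
  zero: "1 \<le> n \<Longrightarrow> x \<in> Gam g (Suc n) \<Longrightarrow> lsp g n B 0 x"
| base: "lyn g w s l x \<Longrightarrow> length w = n \<Longrightarrow> w \<in> B \<Longrightarrow> lsp g n B l x"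
| add: "lsp g n B l x \<Longrightarrow> lsp g n B m y \<Longrightarrow> lsp g n B (l + m) (x \<otimes>\<^bsub>surface_group g\<^esub> y)"
| neg: "lsp g n B l x \<Longrightarrow> lsp g n B (- l) (inv\<^bsub>surface_group g\<^esub> x)"

lemma lsp_mono: "lsp g n B l x \<Longrightarrow> B \<subseteq> C \<Longrightarrow> lsp g n C l x"
  by (induction rule: lsp.induct) (auto intro: lsp.intros)

lemma lsp_lie_rep: "lsp g n B l x \<Longrightarrow> lie_rep g n l x"
  by (induction rule: lsp.induct) (auto intro: lie_rep.intros lyn_lie_rep)

lemma group_surface_group: "group (surface_group g)"
  by (simp add: surface_group_def group_free_group)

lemma pi_gen_carrier: "e \<in> gens g \<Longrightarrow> pi_gen e \<in> carrier (surface_group g)"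
  by (simp add: surface_group_def pi_gen_def letter_in_free_group)

lemma lie_rep_Gam: "lie_rep g k l x \<Longrightarrow> x \<in> Gam g k"
proof (induction rule: lie_rep.induct)
  case (br m u x n v y)
  then show ?case
    using group.commutator_lower_central[OF group_surface_group] lie_rep_homogeneous by blast
next
  case (zero k x)
  then show ?case using group.lower_central_Suc_subset[OF group_surface_group, of g k] by auto
qed (auto simp: pi_gen_carrier group.lower_central_closed[OF group_surface_group])

lemma lsp_Gam: "lsp g n B l x \<Longrightarrow> x \<in> Gam g n"
  using lsp_lie_rep lie_rep_Gam by blast

lemma lsp_cong:
  assumes "lsp g n B l x" "x' \<in> carrier (surface_group g)"
    and "Gam g (Suc n) #>\<^bsub>surface_group g\<^esub> x = Gam g (Suc n) #>\<^bsub>surface_group g\<^esub> x'"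
  shows "lsp g n B l x'"
proof -
  interpret S: group "surface_group g" by (rule group_surface_group)
  have x: "x \<in> Gam g n" "1 \<le> n"
    using assms(1) lsp_Gam lsp_lie_rep lie_rep_homogeneous by blast+
  then have xc: "x \<in> carrier (surface_group g)" by (simp add: S.lower_central_carrier)
  have "x' \<otimes>\<^bsub>surface_group g\<^esub> inv\<^bsub>surface_group g\<^esub> x \<in> Gam g (Suc n)"
    using S.rcos_eq_iff[OF S.lower_central_normal[of "Suc n"] assms(2) xc] assms(3)[symmetric] by blast
  then have "lsp g n B (0 + l) (x' \<otimes>\<^bsub>surface_group g\<^esub> inv\<^bsub>surface_group g\<^esub> x \<otimes>\<^bsub>surface_group g\<^esub> x)"
    using x assms by (intro lsp.add lsp.zero)
  then show ?thesis using xc assms by (simp add: S.m_assoc)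
qed

text \<open>Bracketing with a fixed element is additive both in the Lie ring and modulo the next
  term of the series, so the words spanning the left entry can be treated one at a time.\<close>

lemma lsp_bracket:
  assumes "lsp g n B l x" and m: "1 \<le> m" "y \<in> Gam g m"
    and base: "\<And>w s l x. lyn g w s l x \<Longrightarrow> length w = n \<Longrightarrow> w \<in> B \<Longrightarrow>
      lsp g (n + m) C (lie_br l k) (commutator (surface_group g) x y)"
  shows "lsp g (n + m) C (lie_br l k) (commutator (surface_group g) x y)"
proof -
  interpret S: group "surface_group g" by (rule group_surface_group)
  have yc: "y \<in> carrier (surface_group g)" using m S.lower_central_carrier by simp
  have n: "1 \<le> n" using assms(1) lsp_lie_rep lie_rep_homogeneous by blast
  have br0: "lie_br 0 k = 0" using lie_br_add_left[of 0 0 k] by simp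
  have brm: "lie_br (- l) k = - lie_br l k" for l
    using lie_br_add_left[of "- l" l k] br0 by (simp add: eq_neg_iff_add_eq_0)
  from assms(1) show ?thesis
  proof (induction rule: lsp.induct)
    case (zero x)
    then have "commutator (surface_group g) x y \<in> Gam g (Suc n + m)"
      using m by (intro S.commutator_lower_central) auto
    then show ?case using n br0 by (simp add: lsp.zero)
  next
    case (base w s l x)
    then show ?case by (rule assms(4))
  next
    case (add l x l' x')
    then have "x \<in> Gam g n" "x' \<in> Gam g n" using lsp_Gam by auto
    then show ?case
      using lsp_cong[OF lsp.add[OF add.IH] _ S.rcos_commutator_mult_left[OF n m(1) _ _ m(2), symmetric, of x x']]
        S.lower_central_carrier yc by (simp add: lie_br_add_left)
  next
    case (neg l x)
    then have "x \<in> Gam g n" using lsp_Gam by auto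
    then show ?case
      using lsp_cong[OF lsp.neg[OF neg.IH] _ S.rcos_commutator_inv_left[OF n m(1) _ m(2), symmetric, of x]]
        S.lower_central_carrier yc by (simp add: brm)
  qed
qed

section \<open>Rewriting brackets into Lyndon words\<close>

lemma lie_br_zero [simp]: "lie_br 0 v = 0" "lie_br v 0 = 0"
  using lie_br_add_left[of 0 0 v] lie_br_add_right[of v 0 0] by simp_all

lemma lie_br_minus: "lie_br (- u) v = - lie_br u v" "lie_br v (- u) = - lie_br v u"
  using lie_br_add_left[of "- u" u v] lie_br_add_right[of v "- u" u] by (simp_all add: eq_neg_iff_add_eq_0)

lemma lie_br_anti: "lie_br u v = - lie_br v u"
proof -
  have "lie_br (u + v) (u + v) = lie_br u v + lie_br v u"
    by (simp add: lie_br_add_left lie_br_add_right lie_br_self[of u] lie_br_self[of v])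
  then show ?thesis unfolding lie_br_self by (simp add: eq_neg_iff_add_eq_0)
qed

lemma lie_br_jacobi': "lie_br (lie_br u v) w = lie_br (lie_br u w) v + lie_br u (lie_br v w)"
proof -
  have "lie_br u (lie_br v w) + (lie_br v (lie_br w u) + lie_br w (lie_br u v)) = 0"
    by (rule lie_br_jacobi)
  moreover have "lie_br v (lie_br w u) = lie_br (lie_br u w) v"
    by (metis lie_br_anti lie_br_minus(2) minus_minus)
  moreover have "lie_br w (lie_br u v) = - lie_br (lie_br u v) w" by (rule lie_br_anti)
  ultimately show ?thesis by (simp add: algebra_simps eq_neg_iff_add_eq_0)
qed

lemma finite_gens [simp]: "finite (gens g)"
  by (simp add: gens_def)

text \<open>The length bound makes initial segments of the lexicographic order finite; their
  cardinality is the measure for the induction on the larger of two words.\<close>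

definition words_below :: "nat \<Rightarrow> nat \<Rightarrow> gen list \<Rightarrow> gen list set" where
  "words_below g n b = {w. set w \<subseteq> gens g \<and> length w \<le> n \<and> w < b}"

lemma finite_words_below: "finite (words_below g n b)"
  by (rule finite_subset[OF _ finite_lists_length_le[of "gens g" n]]) (auto simp: words_below_def)

lemma words_below_psubset:
  "b < c \<Longrightarrow> set b \<subseteq> gens g \<Longrightarrow> length b \<le> n \<Longrightarrow> card (words_below g n b) < card (words_below g n c)"
  by (rule psubset_card_mono[OF finite_words_below]) (auto simp: words_below_def)

text \<open>The bound by \<open>max u v\<close> is the strengthening that lets the induction close.
  If u < v and u = u' @ s is not standard against v, then s < v, and the Jacobi identity gives
  [[l', l''], m] = [[l', m], l''] + [l', [l'', m]]. The inner brackets are shorter, so by the outer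
  induction on length they expand into words below v. Bracketing these with s or u', also below v,
  is covered by the inner induction.\<close>

lemma lyn_bracket:
  assumes "lyn g u s l x" "lyn g v t m y"
  shows "lsp g (length u + length v) {w. w < max u v} (lie_br l m) (commutator (surface_group g) x y)"
  using assms
proof (induction "length u + length v" arbitrary: u s l x v t m y rule: less_induct)
  case outer: (less ua va)
  define n where "n = length ua + length va"
  interpret S: group "surface_group g" by (rule group_surface_group)
  have inner: "length u + length v = n \<Longrightarrow> lyn g u s l x \<Longrightarrow> lyn g v t m y \<Longrightarrow>
      lsp g n {w. w < max u v} (lie_br l m) (commutator (surface_group g) x y)" for u s l x v t m y
  proof (induction "card (words_below g n (max u v))" arbitrary: u s l x v t m y rule: less_induct)
    case less
    have car: "\<And>w s l x. lyn g w s l x \<Longrightarrow> x \<in> Gam g (length w)"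
      using lyn_lie_rep lie_rep_Gam by blast
    \<comment> \<open>The case u < v, with the inner hypothesis as an assumption, so that it also
      serves for v < u by antisymmetry.\<close>
    have main: "lsp g n {w. w < v} (lie_br l m) (commutator (surface_group g) x y)"
      if u: "lyn g u s l x" and v: "lyn g v t m y" and uv: "u < v" and n: "length u + length v = n"
        and IH: "\<And>u2 s l x v2 t m y. max u2 v2 < v \<Longrightarrow> length u2 + length v2 = n \<Longrightarrow>
          lyn g u2 s l x \<Longrightarrow> lyn g v2 t m y \<Longrightarrow>
          lsp g n {w. w < max u2 v2} (lie_br l m) (commutator (surface_group g) x y)"
      for u s l x v t m y
    proof (cases "s = [] \<or> v \<le> s")
      case True
      have ne: "u \<noteq> []" "v \<noteq> []" using u v lyn_not_Nil by auto
      have uvl: "lyn g (u @ v) v (lie_br l m) (commutator (surface_group g) x y)"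
        using u v uv True by (rule lyn.node)
      then have "u @ v < v" using lyn_suffix[OF uvl, of u v] ne by simp
      with uvl show ?thesis using n by (intro lsp.base[OF uvl]) auto
    next
      case False
      from u show ?thesis
      proof (cases rule: lyn.cases)
        case (letter e)
        with False show ?thesis by simp
      next
        case (node u' s' l' x' t' l'' x'')
        note nd = node
        have s: "s < v" using False by (simp add: not_le)
        have ne: "u' \<noteq> []" "s \<noteq> []" "v \<noteq> []" using nd v lyn_not_Nil by auto
        have u'v: "u' < v" using list_le_append[of u' s] uv nd by simp
        have G: "x' \<in> Gam g (length u')" "x'' \<in> Gam g (length s)" "y \<in> Gam g (length v)"
          using nd v car by auto
        have len: "1 \<le> length u'" "1 \<le> length s" "1 \<le> length v" using ne by (auto simp: Suc_leI)
        have cc: "x' \<in> carrier (surface_group g)" "x'' \<in> carrier (surface_group g)" "y \<in> carrier (surface_group g)"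
          using G S.lower_central_carrier by auto
        have 1: "lsp g (length u' + length v) {w. w < v} (lie_br l' m) (commutator (surface_group g) x' y)"
        proof -
          have "length u' + length v < length ua + length va" using nd len n n_def by simp
          from outer.hyps[OF this \<open>lyn g u' s' l' x'\<close> v] show ?thesis using max.absorb4[OF u'v] by simp
        qed
        have 2: "lsp g (length s + length v) {w. w < v} (lie_br l'' m) (commutator (surface_group g) x'' y)"
        proof -
          have "length s + length v < length ua + length va" using nd len n n_def by simp
          from outer.hyps[OF this \<open>lyn g s t' l'' x''\<close> v] show ?thesis using max.absorb4[OF s] by simp
        qed
        have n1: "length u' + length v + length s = n" "length s + length v + length u' = n"
          using n nd by auto
        \<comment> \<open>The words w in the expansion of [l', m] and the word s are all below v, so
          \<open>max w s\<close> has decreased.\<close>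
        have 3: "lsp g (length u' + length v + length s) {w. w < v} (lie_br (lie_br l' m) l'')
            (commutator (surface_group g) (commutator (surface_group g) x' y) x'')"
        proof (rule lsp_bracket[OF 1 len(2) G(2)])
          fix w r q z assume w: "lyn g w r q z" "length w = length u' + length v" "w \<in> {w. w < v}"
          have "lsp g n {z. z < max w s} (lie_br q l'') (commutator (surface_group g) z x'')"
            using IH[OF _ _ w(1) nd(5)] w s n1 by simp
          then show "lsp g (length u' + length v + length s) {w. w < v} (lie_br q l'') (commutator (surface_group g) z x'')"
            unfolding n1
          proof (rule lsp_mono)
            have "max w s < v" using w s by simp
            then show "{z. z < max w s} \<subseteq> {w. w < v}" by (blast intro: less_trans)
          qed
        qed
        have 4: "lsp g (length s + length v + length u') {w. w < v} (lie_br (lie_br l'' m) l')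
            (commutator (surface_group g) (commutator (surface_group g) x'' y) x')"
        proof (rule lsp_bracket[OF 2 len(1) G(1)])
          fix w r q z assume w: "lyn g w r q z" "length w = length s + length v" "w \<in> {w. w < v}"
          have "lsp g n {z. z < max w u'} (lie_br q l') (commutator (surface_group g) z x')"
            using IH[OF _ _ w(1) nd(4)] w u'v n1 by simp
          then show "lsp g (length s + length v + length u') {w. w < v} (lie_br q l') (commutator (surface_group g) z x')"
            unfolding n1
          proof (rule lsp_mono)
            have "max w u' < v" using w u'v by simp
            then show "{z. z < max w u'} \<subseteq> {w. w < v}" by (blast intro: less_trans)
          qed
        qed
        have "lsp g n {w. w < v} (lie_br (lie_br l' m) l'' + - lie_br (lie_br l'' m) l')
          (commutator (surface_group g) (commutator (surface_group g) x' y) x'' \<otimes>\<^bsub>surface_group g\<^esub>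
           inv\<^bsub>surface_group g\<^esub> commutator (surface_group g) (commutator (surface_group g) x'' y) x')"
          using lsp.add[OF 3[unfolded n1] lsp.neg[OF 4[unfolded n1]]] .
        then have "lsp g n {w. w < v} (lie_br (lie_br l' l'') m)
          (commutator (surface_group g) (commutator (surface_group g) x' y) x'' \<otimes>\<^bsub>surface_group g\<^esub>
           commutator (surface_group g) x' (commutator (surface_group g) x'' y))"
          using cc by (simp add: S.inv_commutator lie_br_jacobi'[of l' l'' m] lie_br_anti[of l' "lie_br l'' m"])
        then have "lsp g n {w. w < v} (lie_br (lie_br l' l'') m)
            (commutator (surface_group g) (commutator (surface_group g) x' x'') y)"
          by (rule lsp_cong)
            (use cc S.rcos_commutator_jacobi[OF len G, of n] n nd in auto)
        then show ?thesis using nd by simp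
      qed
    qed
    have wl: "set u \<subseteq> gens g" "set v \<subseteq> gens g" "length u \<le> n" "length v \<le> n"
      using less.prems lyn_set by auto
    consider "u < v" | "u = v" | "v < u" by fastforce
    then show ?case
    proof cases
      case 1
      have "lsp g n {w. w < v} (lie_br l m) (commutator (surface_group g) x y)"
      proof (rule main[OF less.prems(2,3) 1 less.prems(1)])
        fix u2 s l x v2 t m y
        assume *: "max u2 v2 < v" "length u2 + length v2 = n" "lyn g u2 s l x" "lyn g v2 t m y"
        have "card (words_below g n (max u2 v2)) < card (words_below g n (max u v))"
          using * 1 lyn_set[OF *(3)] lyn_set[OF *(4)] by (intro words_below_psubset) (auto simp: max_def)
        from less.hyps[OF this *(2,3,4)]
        show "lsp g n {w. w < max u2 v2} (lie_br l m) (commutator (surface_group g) x y)" .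
      qed
      then show ?thesis using max.absorb4[OF 1] by simp
    next
      \<comment> \<open>By uniqueness both bracketings coincide; the bracket is zero and the
        commutator is trivial.\<close>
      case 2
      then have "l = m" "x = y" using lyn_unique less.prems by blast+
      moreover have "y \<in> carrier (surface_group g)" using car less.prems S.lower_central_carrier by blast
      moreover have "1 \<le> n" using less.prems lyn_not_Nil[OF less.prems(2)] by (cases u) auto
      ultimately show ?thesis
        by (simp add: lie_br_self commutator_def S.m_assoc lsp.zero)
    next
      case 3
      have "lsp g n {w. w < u} (lie_br m l) (commutator (surface_group g) y x)"
      proof (rule main[OF less.prems(3,2) 3])
        fix u2 s l x v2 t m y
        assume *: "max u2 v2 < u" "length u2 + length v2 = n" "lyn g u2 s l x" "lyn g v2 t m y"
        have "card (words_below g n (max u2 v2)) < card (words_below g n (max u v))"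
          using * 3 lyn_set[OF *(3)] lyn_set[OF *(4)] by (intro words_below_psubset) (auto simp: max_def)
        from less.hyps[OF this *(2,3,4)]
        show "lsp g n {w. w < max u2 v2} (lie_br l m) (commutator (surface_group g) x y)" .
      qed (use less.prems in simp)
      from lsp.neg[OF this] have "lsp g n {w. w < u} (lie_br l m) (commutator (surface_group g) x y)"
        using car[OF less.prems(2)] car[OF less.prems(3)] S.lower_central_carrier
        by (simp add: S.inv_commutator lie_br_anti[of l m])
      then show ?thesis using max.absorb3[OF 3] by simp
    qed
  qed
  show ?case using inner[OF n_def[symmetric] outer.prems] n_def by simp
qed

lemma lie_rep_lsp: "lie_rep g k l x \<Longrightarrow> lsp g k UNIV l x"
proof (induction rule: lie_rep.induct)
  case (gen e)
  then show ?case by (intro lsp.base[OF lyn.letter]) auto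
next
  case (br m u x n v y)
  interpret S: group "surface_group g" by (rule group_surface_group)
  have mn: "1 \<le> m" "1 \<le> n" and G: "x \<in> Gam g m" "y \<in> Gam g n"
    using br.hyps lie_rep_homogeneous lie_rep_Gam by blast+
  have c: "x \<in> carrier (surface_group g)" "y \<in> carrier (surface_group g)"
    using G S.lower_central_carrier by auto
  show ?case
  proof (rule lsp_bracket[OF br.IH(1) mn(2) G(2)])
    fix w s l z assume w: "lyn g w s l z" "length w = m"
    have z: "z \<in> Gam g m" "z \<in> carrier (surface_group g)"
      using lie_rep_Gam[OF lyn_lie_rep[OF w(1)]] w S.lower_central_carrier by auto
    \<comment> \<open>The first argument is now a basis element. The second one is expanded after an
      exchange of the two, whose sign is undone by \<open>lsp.neg\<close>.\<close>
    have "lsp g (n + m) UNIV (lie_br v l) (commutator (surface_group g) y z)"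
    proof (rule lsp_bracket[OF br.IH(2) mn(1) z(1)])
      fix w' s' l' z' assume w': "lyn g w' s' l' z'" "length w' = n"
      show "lsp g (n + m) UNIV (lie_br l' l) (commutator (surface_group g) z' z)"
        using lsp_mono[OF lyn_bracket[OF w'(1) w(1)]] w w' by simp
    qed
    from lsp.neg[OF this] show "lsp g (m + n) UNIV (lie_br l v) (commutator (surface_group g) z y)"
      using z c by (simp add: S.inv_commutator lie_br_anti[of l v] add.commute)
  qed
qed (auto intro: lsp.intros)

section \<open>Triangularity and injectivity of leading terms\<close>

lemma lsp_min_word:
  "lsp g n B l x \<Longrightarrow> nc (lser l) w \<noteq> 0 \<Longrightarrow> \<exists>w'\<in>B. w' \<le> w"
proof (induction rule: lsp.induct)
  case (base w' s l x)
  then show ?case using lyn_triangular[OF base(1)] by blast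
next
  case (add l x m y)
  then have "nc (lser l) w \<noteq> 0 \<or> nc (lser m) w \<noteq> 0" by (auto simp: lser_simps)
  then show ?case using add by blast
qed (auto simp: lser_simps)

lemma lsp_empty: "lsp g n {} l x \<Longrightarrow> l = 0 \<and> x \<in> Gam g (Suc n)"
  by (induction rule: lsp.induct) (auto simp: group.lower_central_closed[OF group_surface_group]
      simp del: lower_central.simps)

lemma sum_const_add: "(\<Sum>i<(a + b :: nat). p) = (\<Sum>i<a. p) + (\<Sum>i<b. (p :: 'a::ab_group_add))"
  by (induction b) (simp_all add: algebra_simps)

text \<open>Over a single word everything is an integral multiple of one bracketing p and, modulo
  the next term, the same power of z. The coefficient at w is that multiple, since p has coefficient
  1 there.\<close>

lemma lsp_singleton:
  assumes "lsp g n {w} l x" "nc (lser l) w = 0"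
  shows "l = 0 \<and> x \<in> Gam g (Suc n)"
proof (cases "\<exists>s p z. lyn g w s p z \<and> length w = n")
  case False
  from assms(1) have "lsp g n {} l x"
    by (induction rule: lsp.induct) (use False in \<open>auto intro: lsp.intros\<close>)
  then show ?thesis by (rule lsp_empty)
next
  case True
  then obtain s p z where w: "lyn g w s p z" "length w = n" by blast
  interpret S: group "surface_group g" by (rule group_surface_group)
  let ?N = "Gam g (Suc n)"
  note N = S.lower_central_normal[of "Suc n"]
  have z: "z \<in> carrier (surface_group g)"
    using lie_rep_Gam[OF lyn_lie_rep[OF w(1)]] S.lower_central_carrier by blast
  \<comment> \<open>The integer a - b is kept as two natural numbers, so that multiples of p can be
    written as finite sums.\<close>
  have "\<exists>a b. l = (\<Sum>i<a. p) - (\<Sum>i<b. p) \<and> ?N #>\<^bsub>surface_group g\<^esub> x =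
      ?N #>\<^bsub>surface_group g\<^esub> (z [^]\<^bsub>surface_group g\<^esub> (int a - int b))"
    using assms(1)
  proof (induction rule: lsp.induct)
    case (zero x)
    then show ?case
      using S.rcos_eq_one_iff[OF N, of x] S.lower_central_carrier by (intro exI[of _ 0]) auto
  next
    case (base w' s' l x)
    then have "l = p" "x = z" using lyn_unique w by blast+
    then show ?case using z by (intro exI[of _ 1] exI[of _ 0]) (simp add: S.int_pow_1)
  next
    case (add l x m y)
    then obtain a b a' b' where ab: "l = (\<Sum>i<a. p) - (\<Sum>i<b. p)" "m = (\<Sum>i<a'. p) - (\<Sum>i<b'. p)"
      "?N #>\<^bsub>surface_group g\<^esub> x = ?N #>\<^bsub>surface_group g\<^esub> (z [^]\<^bsub>surface_group g\<^esub> (int a - int b))"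
      "?N #>\<^bsub>surface_group g\<^esub> y = ?N #>\<^bsub>surface_group g\<^esub> (z [^]\<^bsub>surface_group g\<^esub> (int a' - int b'))"
      by blast
    have c: "x \<in> carrier (surface_group g)" "y \<in> carrier (surface_group g)"
      using add.hyps lsp_Gam S.lower_central_carrier by blast+
    have e: "int (a + a') - int (b + b') = (int a - int b) + (int a' - int b')" by simp
    have "l + m = (\<Sum>i<a + a'. p) - (\<Sum>i<b + b'. p)"
      by (simp add: ab sum_const_add)
    moreover have "?N #>\<^bsub>surface_group g\<^esub> (x \<otimes>\<^bsub>surface_group g\<^esub> y) =
        ?N #>\<^bsub>surface_group g\<^esub> (z [^]\<^bsub>surface_group g\<^esub> (int (a + a') - int (b + b')))"
      unfolding e S.int_pow_mult[OF z]
      using z by (intro S.rcos_mult_cong[OF N c _ _ ab(3,4)]) simp_all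
    ultimately show ?case by blast
  next
    case (neg l x)
    then obtain a b where ab: "l = (\<Sum>i<a. p) - (\<Sum>i<b. p)"
      "?N #>\<^bsub>surface_group g\<^esub> x = ?N #>\<^bsub>surface_group g\<^esub> (z [^]\<^bsub>surface_group g\<^esub> (int a - int b))" by blast
    have c: "x \<in> carrier (surface_group g)" using neg.hyps lsp_Gam S.lower_central_carrier by blast
    have "- l = (\<Sum>i<b. p) - (\<Sum>i<a. p)" by (simp add: ab)
    moreover have "?N #>\<^bsub>surface_group g\<^esub> inv\<^bsub>surface_group g\<^esub> x =
        ?N #>\<^bsub>surface_group g\<^esub> (z [^]\<^bsub>surface_group g\<^esub> (int b - int a))"
      using S.rcos_inv_cong[OF N c _ ab(2)] z by (simp add: S.int_pow_neg[symmetric])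
    ultimately show ?case by blast
  qed
  then obtain a b where ab: "l = (\<Sum>i<a. p) - (\<Sum>i<b. p)"
    "?N #>\<^bsub>surface_group g\<^esub> x = ?N #>\<^bsub>surface_group g\<^esub> (z [^]\<^bsub>surface_group g\<^esub> (int a - int b))" by blast
  have sm: "nc (lser (\<Sum>i<k. p)) w = int k" for k
    by (induction k) (use lyn_triangular[OF w(1)] in \<open>simp_all add: lser_simps\<close>)
  have "a = b" using assms(2) by (simp add: ab lser_simps sm)
  then have "l = 0" "?N #>\<^bsub>surface_group g\<^esub> x = ?N #>\<^bsub>surface_group g\<^esub> \<one>\<^bsub>surface_group g\<^esub>"
    using ab by auto
  moreover have "x \<in> carrier (surface_group g)" using assms lsp_Gam S.lower_central_carrier by blast
  ultimately show ?thesis using S.rcos_eq_one_iff[OF N] by blast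
qed

text \<open>Gamma_n is abelian modulo Gamma_(n+1), so the contributions of w can be collected in
  front.\<close>

lemma lsp_split:
  assumes "lsp g n (insert w B) l x"
  shows "\<exists>l1 x1 l2 x2. lsp g n {w} l1 x1 \<and> lsp g n B l2 x2 \<and> l = l1 + l2 \<and>
    Gam g (Suc n) #>\<^bsub>surface_group g\<^esub> x = Gam g (Suc n) #>\<^bsub>surface_group g\<^esub> (x1 \<otimes>\<^bsub>surface_group g\<^esub> x2)"
proof -
  interpret S: group "surface_group g" by (rule group_surface_group)
  let ?N = "Gam g (Suc n)"
  note N = S.lower_central_normal[of "Suc n"]
  have n: "1 \<le> n" using assms lsp_lie_rep lie_rep_homogeneous by blast
  have z: "lsp g n B 0 \<one>\<^bsub>surface_group g\<^esub>" for B using n by (simp add: lsp.zero del: lower_central.simps)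
  have car: "\<And>B l x. lsp g n B l x \<Longrightarrow> x \<in> carrier (surface_group g)"
    using lsp_Gam S.lower_central_carrier by blast
  show ?thesis
    using assms
  proof (induction rule: lsp.induct)
    case (zero x)
    then have "lsp g n B 0 x" by (rule lsp.zero)
    then show ?case using z[of "{w}"] car[of B 0 x]
      by (intro exI[of _ 0] exI[of _ "\<one>\<^bsub>surface_group g\<^esub>"] exI[of _ x]) simp
  next
    case (base w' s l x)
    show ?case
    proof (cases "w' = w")
      case True
      then have "lsp g n {w} l x" using base by (auto intro: lsp.base)
      then show ?thesis using z[of B] car[of "{w}" l x]
        by (intro exI[of _ l] exI[of _ x] exI[of _ 0] exI[of _ "\<one>\<^bsub>surface_group g\<^esub>"]) simp
    next
      case False
      then have "lsp g n B l x" using base by (auto intro: lsp.base)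
      then show ?thesis using z[of "{w}"] car[of B l x]
        by (intro exI[of _ l] exI[of _ x] exI[of _ 0] exI[of _ "\<one>\<^bsub>surface_group g\<^esub>"]) simp
    qed
  next
    case (add l x m y)
    then obtain l1 x1 l2 x2 m1 y1 m2 y2 where *: "lsp g n {w} l1 x1" "lsp g n B l2 x2" "l = l1 + l2"
      "?N #>\<^bsub>surface_group g\<^esub> x = ?N #>\<^bsub>surface_group g\<^esub> (x1 \<otimes>\<^bsub>surface_group g\<^esub> x2)"
      "lsp g n {w} m1 y1" "lsp g n B m2 y2" "m = m1 + m2"
      "?N #>\<^bsub>surface_group g\<^esub> y = ?N #>\<^bsub>surface_group g\<^esub> (y1 \<otimes>\<^bsub>surface_group g\<^esub> y2)" by blast
    have c: "x1 \<in> carrier (surface_group g)" "x2 \<in> carrier (surface_group g)" "y1 \<in> carrier (surface_group g)"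
      "y2 \<in> carrier (surface_group g)" "x \<in> carrier (surface_group g)" "y \<in> carrier (surface_group g)"
      using * add.hyps car by blast+
    have "?N #>\<^bsub>surface_group g\<^esub> (x \<otimes>\<^bsub>surface_group g\<^esub> y) = ?N #>\<^bsub>surface_group g\<^esub>
        (x1 \<otimes>\<^bsub>surface_group g\<^esub> x2 \<otimes>\<^bsub>surface_group g\<^esub> (y1 \<otimes>\<^bsub>surface_group g\<^esub> y2))"
      using c by (intro S.rcos_mult_cong[OF N c(5,6) _ _ *(4,8)]) simp_all
    also have "\<dots> = ?N #>\<^bsub>surface_group g\<^esub>
        (x1 \<otimes>\<^bsub>surface_group g\<^esub> ((x2 \<otimes>\<^bsub>surface_group g\<^esub> y1) \<otimes>\<^bsub>surface_group g\<^esub> y2))"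
      using c by (simp add: S.m_assoc)
    also have "\<dots> = ?N #>\<^bsub>surface_group g\<^esub>
        (x1 \<otimes>\<^bsub>surface_group g\<^esub> ((y1 \<otimes>\<^bsub>surface_group g\<^esub> x2) \<otimes>\<^bsub>surface_group g\<^esub> y2))"
    proof -
      have "?N #>\<^bsub>surface_group g\<^esub> ((x2 \<otimes>\<^bsub>surface_group g\<^esub> y1) \<otimes>\<^bsub>surface_group g\<^esub> y2) =
          ?N #>\<^bsub>surface_group g\<^esub> ((y1 \<otimes>\<^bsub>surface_group g\<^esub> x2) \<otimes>\<^bsub>surface_group g\<^esub> y2)"
        by (rule S.rcos_mult_cong[OF N _ _ _ _ S.rcos_commute[OF n lsp_Gam[OF *(2)] lsp_Gam[OF *(5)]] HOL.refl])
          (use c in simp_all)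
      then show ?thesis by (intro S.rcos_mult_cong[OF N c(1) _ c(1) _ HOL.refl]) (use c in simp_all)
    qed
    also have "\<dots> = ?N #>\<^bsub>surface_group g\<^esub>
        ((x1 \<otimes>\<^bsub>surface_group g\<^esub> y1) \<otimes>\<^bsub>surface_group g\<^esub> (x2 \<otimes>\<^bsub>surface_group g\<^esub> y2))"
      using c by (simp add: S.m_assoc)
    finally have e: "?N #>\<^bsub>surface_group g\<^esub> (x \<otimes>\<^bsub>surface_group g\<^esub> y) = \<dots>" .
    have "l + m = (l1 + m1) + (l2 + m2)" using * by (simp add: algebra_simps)
    with e lsp.add[OF *(1,5)] lsp.add[OF *(2,6)] show ?case by blast
  next
    case (neg l x)
    then obtain l1 x1 l2 x2 where *: "lsp g n {w} l1 x1" "lsp g n B l2 x2" "l = l1 + l2"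
      "?N #>\<^bsub>surface_group g\<^esub> x = ?N #>\<^bsub>surface_group g\<^esub> (x1 \<otimes>\<^bsub>surface_group g\<^esub> x2)" by blast
    have c: "x1 \<in> carrier (surface_group g)" "x2 \<in> carrier (surface_group g)" "x \<in> carrier (surface_group g)"
      using * neg.hyps car by blast+
    have "?N #>\<^bsub>surface_group g\<^esub> x = ?N #>\<^bsub>surface_group g\<^esub> (x2 \<otimes>\<^bsub>surface_group g\<^esub> x1)"
      using *(4) S.rcos_commute[OF n lsp_Gam[OF *(1)] lsp_Gam[OF *(2)]] by simp
    then have e: "?N #>\<^bsub>surface_group g\<^esub> inv\<^bsub>surface_group g\<^esub> x = ?N #>\<^bsub>surface_group g\<^esub>
        (inv\<^bsub>surface_group g\<^esub> x1 \<otimes>\<^bsub>surface_group g\<^esub> inv\<^bsub>surface_group g\<^esub> x2)"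
      using S.rcos_inv_cong[OF N c(3), of "x2 \<otimes>\<^bsub>surface_group g\<^esub> x1"] c by (simp add: S.inv_mult_group)
    have "- l = - l1 + - l2" using * by simp
    with e lsp.neg[OF *(1)] lsp.neg[OF *(2)] show ?case by blast
  qed
qed

text \<open>The induction removes the least word w of B. The other bracketings involve only words
  above w, so the coefficient at w isolates the contribution of w and forces it to vanish.\<close>

lemma lsp_lser_zero:
  assumes "finite B" "lsp g n B l x" "lser l = 0"
  shows "l = 0 \<and> x \<in> Gam g (Suc n)"
  using assms
proof (induction B arbitrary: l x rule: finite_linorder_min_induct)
  case empty
  then show ?case by (intro lsp_empty)
next
  case (insert w B)
  interpret S: group "surface_group g" by (rule group_surface_group)
  let ?N = "Gam g (Suc n)"
  note N = S.lower_central_normal[of "Suc n"]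
  from lsp_split[OF insert.prems(1)] obtain l1 x1 l2 x2 where
    *: "lsp g n {w} l1 x1" "lsp g n B l2 x2" "l = l1 + l2"
      "?N #>\<^bsub>surface_group g\<^esub> x = ?N #>\<^bsub>surface_group g\<^esub> (x1 \<otimes>\<^bsub>surface_group g\<^esub> x2)" by blast
  have "nc (lser l2) w = 0"
    using lsp_min_word[OF *(2), of w] insert.hyps by (meson not_le)
  then have "nc (lser l1) w = 0"
    using insert.prems(2) *(3) nc_add[of "lser l1" "lser l2" w] by (simp add: lser_simps)
  from lsp_singleton[OF *(1) this] have 1: "l1 = 0" "x1 \<in> ?N" by auto
  then have "lser l2 = 0" using insert.prems(2) *(3) by simp
  from insert.IH[OF *(2) this] have 2: "l2 = 0" "x2 \<in> ?N" by auto
  have "x1 \<otimes>\<^bsub>surface_group g\<^esub> x2 \<in> ?N" using 1 2 S.lower_central_closed(3) by blast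
  moreover have c: "x \<in> carrier (surface_group g)" "x1 \<otimes>\<^bsub>surface_group g\<^esub> x2 \<in> carrier (surface_group g)"
    using insert.prems(1) lsp_Gam S.lower_central_carrier calculation by blast+
  ultimately have "x \<in> ?N" using *(4) S.rcos_eq_one_iff[OF N c(1)] S.rcos_eq_one_iff[OF N c(2)] by simp
  with 1 2 * show ?case by simp
qed

text \<open>One argument for two injectivity statements: \<open>l = 0\<close> is the embedding of
  the free Lie ring into the tensor algebra over the integers, and the membership of x is the hard
  half of Magnus' theorem.\<close>

theorem lie_rep_lser_zero:
  assumes "lie_rep g k l x" "lser l = 0"
  shows "l = 0" "x \<in> Gam g (Suc k)"
proof -
  let ?W = "{w. set w \<subseteq> gens g \<and> length w = k}"
  have "lsp g k ?W l x"
    using lie_rep_lsp[OF assms(1)]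
    by (induction rule: lsp.induct) (auto intro: lsp.intros dest: lyn_set)
  moreover have "finite ?W" by (simp add: finite_lists_length_eq)
  ultimately show "l = 0" "x \<in> Gam g (Suc k)" using lsp_lser_zero[of ?W g k l x] assms(2) by auto
qed

section \<open>The graded quotients of the lower central series\<close>

interpretation S: group "surface_group g" for g
  by (rule group_surface_group)

abbreviation PI :: "nat \<Rightarrow> gen fword set" where "PI g \<equiv> carrier (surface_group g)"

declare lower_central.simps [simp del]

lemma magnus_surface_mult: "magnus (x \<otimes>\<^bsub>surface_group g\<^esub> y) = magnus x * magnus y"
  by (simp add: surface_group_def magnus_mult)

lemma magnus_surface_one: "magnus \<one>\<^bsub>surface_group g\<^esub> = 1"
  by (simp add: surface_group_def one_free_group)

lemma magnus_surface_inv: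
  assumes "x \<in> PI g"
  shows "magnus (inv\<^bsub>surface_group g\<^esub> x) * magnus x = 1" "magnus x * magnus (inv\<^bsub>surface_group g\<^esub> x) = 1"
  using magnus_inv[of x "gens g"] assms by (simp_all add: surface_group_def)

lemma magnus_right_quotient:
  assumes "x \<in> PI g" "y \<in> PI g"
  shows "magnus (x \<otimes>\<^bsub>surface_group g\<^esub> inv\<^bsub>surface_group g\<^esub> y) - 1
    = (magnus x - magnus y) * magnus (inv\<^bsub>surface_group g\<^esub> y)"
  by (simp add: magnus_surface_mult left_diff_distrib magnus_surface_inv[OF assms(2)])

lemma ord_ge_mult_unit_iff:
  assumes "u * v = 1"
  shows "ord_ge n (f * u) \<longleftrightarrow> ord_ge n f"
proof
  assume "ord_ge n (f * u)"
  then have "ord_ge n (f * u * v)" by (rule ord_ge_mult_right)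
  then show "ord_ge n f" by (simp add: mult.assoc assms)
qed (rule ord_ge_mult_right)

lemma ord_ge_right_quotient_iff:
  assumes "x \<in> PI g" "y \<in> PI g"
  shows "ord_ge n (magnus (x \<otimes>\<^bsub>surface_group g\<^esub> inv\<^bsub>surface_group g\<^esub> y) - 1) \<longleftrightarrow> ord_ge n (magnus x - magnus y)"
  unfolding magnus_right_quotient[OF assms]
  by (rule ord_ge_mult_unit_iff[OF magnus_surface_inv(1)[OF assms(2)]])

lemma magnus_pi_gen: "magnus (pi_gen e) = 1 + ncvar e"
  by (simp add: pi_gen_def magnus_Cons mlet_def)

lemma magnus_Gam: "x \<in> Gam g k \<Longrightarrow> ord_ge k (magnus x - 1)"
  unfolding surface_group_def by (rule magnus_lower_central)

lemma ord_ge_lser: "l \<in> Lie_part g k \<Longrightarrow> ord_ge k (lser l)"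
  using hom_deg_ord_ge hom_deg_lser_part by blast

lemma lie_rep_magnus: "lie_rep g k l x \<Longrightarrow> ord_ge (Suc k) (magnus x - 1 - lser l)"
proof (induction rule: lie_rep.induct)
  case (gen e)
  then show ?case by (simp add: magnus_pi_gen lser_simps)
next
  case (br m u x n v y)
  define a where "a = magnus x - 1"
  define b where "b = magnus y - 1"
  have x: "x \<in> Gam g m" "y \<in> Gam g n" and uv: "u \<in> Lie_part g m" "v \<in> Lie_part g n"
    using br.hyps lie_rep_Gam lie_rep_homogeneous by blast+
  have a: "ord_ge m a" and b: "ord_ge n b" unfolding a_def b_def using x magnus_Gam by blast+
  have l: "ord_ge m (lser u)" "ord_ge n (lser v)" using uv ord_ge_lser by blast+
  have d: "ord_ge (Suc m) (a - lser u)" "ord_ge (Suc n) (b - lser v)"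
    using br.IH unfolding a_def b_def .
  have "x \<in> PI g" "y \<in> PI g" using x S.lower_central_carrier by blast+
  then have "ord_ge (m + n + 1) (magnus (commutator (surface_group g) x y) - 1 - (a * b - b * a))"
    using magnus_commutator[of x "gens g" y m n] a b unfolding a_def b_def surface_group_def by simp
  moreover have "ord_ge (m + n + 1) ((a - lser u) * b + lser u * (b - lser v) - ((b - lser v) * a + lser v * (a - lser u)))"
    using a b l d
    by (intro ord_ge_diff ord_ge_add ord_ge_mult[OF d(1) b] ord_ge_mult[OF l(1) d(2)]
        ord_ge_mult[OF d(2) a] ord_ge_mult[OF l(2) d(1)]) simp_all
  moreover have "(a - lser u) * b + lser u * (b - lser v) - ((b - lser v) * a + lser v * (a - lser u))
      = (a * b - b * a) - lser (lie_br u v)"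
    by (simp add: lser_simps left_diff_distrib right_diff_distrib)
  ultimately have "ord_ge (m + n + 1) ((magnus (commutator (surface_group g) x y) - 1 - (a * b - b * a))
      + ((a * b - b * a) - lser (lie_br u v)))"
    by (metis ord_ge_add)
  then show ?case by simp
next
  case (add k u x v y)
  have x: "ord_ge k (magnus x - 1)" "ord_ge k (magnus y - 1)" "1 \<le> k"
    using add.hyps lie_rep_Gam magnus_Gam lie_rep_homogeneous by blast+
  have "ord_ge (Suc k) ((magnus x - 1) * (magnus y - 1))"
    using x by (intro ord_ge_mult[OF x(1,2)]) simp
  from ord_ge_add[OF ord_ge_add[OF add.IH] this] show ?case
    by (simp add: magnus_surface_mult lser_simps algebra_simps)
next
  case (neg k u x)
  have x: "ord_ge k (magnus x - 1)" "1 \<le> k" "x \<in> PI g"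
    using neg.hyps lie_rep_Gam magnus_Gam lie_rep_homogeneous S.lower_central_carrier by blast+
  have "ord_ge (Suc k) ((magnus (inv\<^bsub>surface_group g\<^esub> x) - 1) * (magnus x - 1))"
    using x by (intro ord_ge_mult[OF ord_ge_1_magnus x(1)]) simp
  moreover have "magnus (inv\<^bsub>surface_group g\<^esub> x) - 1 - lser (- u) = - (magnus x - 1 - lser u)
      - (magnus (inv\<^bsub>surface_group g\<^esub> x) - 1) * (magnus x - 1)"
    by (simp add: lser_simps left_diff_distrib right_diff_distrib magnus_surface_inv[OF x(3)])
  ultimately show ?case using ord_ge_diff[OF ord_ge_minus[OF neg.IH]] by simp
next
  case (zero k x)
  then show ?case using magnus_Gam[of x g "Suc k"] by (simp add: lser_simps)
qed

section \<open>The graded pieces and Magnus' theorem\<close>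

lemma pi_letter: "e \<in> gens g \<Longrightarrow> [(e, b)] = (if b then pi_gen e else inv\<^bsub>surface_group g\<^esub> pi_gen e)"
  by (simp add: pi_gen_def surface_group_def inv_letter_free_group)

lemma lie_rep_zero_one: "1 \<le> k \<Longrightarrow> lie_rep g k 0 \<one>\<^bsub>surface_group g\<^esub>"
  by (rule lie_rep.zero) auto

lemma word_lie_Nil [simp]: "word_lie [] = 0"
  by (simp add: word_lie_def)

lemma word_lie_push:
  "word_lie (push l w) = (if snd l then lie_gen (fst l) else - lie_gen (fst l)) + word_lie w"
  by (cases w) (auto simp: word_lie_def)

lemma lie_rep_word_lie:
  assumes "x \<in> PI g"
  shows "lie_rep g 1 (word_lie x) x"
  using assms[unfolded surface_group_def]
proof (induction rule: free_group_induct)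
  case Nil
  then show ?case using lie_rep_zero_one[of 1 g] by (simp add: surface_group_def one_free_group)
next
  case (Cons e b w)
  have "lie_rep g 1 (if b then lie_gen e else - lie_gen e) [(e, b)]"
    unfolding pi_letter[OF Cons(1)]
    using lie_rep.gen[OF Cons(1)] lie_rep.neg[OF lie_rep.gen[OF Cons(1)]] by simp
  from lie_rep.add[OF this Cons(3)] show ?case
    by (cases b) (simp_all add: surface_group_def mult_free_group word_lie_push)
qed

lemma Gam_lie_rep: "1 \<le> k \<Longrightarrow> x \<in> Gam g k \<Longrightarrow> \<exists>l. lie_rep g k l x"
proof (induction k arbitrary: x rule: nat_induct_at_least)
  case base
  then show ?case using lie_rep_word_lie[of x g] by (auto simp: lower_central.simps)
next
  case (Suc k)
  let ?S = "{commutator (surface_group g) x y |x y. x \<in> Gam g k \<and> y \<in> PI g}"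
  have comm: "\<exists>l. lie_rep g (Suc k) l c" if "c \<in> ?S" for c
  proof -
    from that obtain x y where xy: "c = commutator (surface_group g) x y" "x \<in> Gam g k" "y \<in> PI g" by blast
    from Suc.IH[OF xy(2)] obtain l where "lie_rep g k l x" by blast
    from lie_rep.br[OF this lie_rep_word_lie[OF xy(3)]] show ?thesis using xy by auto
  qed
  from Suc have "x \<in> generate (surface_group g) ?S" by (cases k) (auto simp: lower_central.simps)
  then show ?case
  proof (induction rule: generate.induct)
    case one
    then show ?case using lie_rep_zero_one[of "Suc k" g] by auto
  next
    case (incl c)
    then show ?case by (rule comm)
  next
    case (inv c)
    then show ?case using comm[OF inv] lie_rep.neg by blast
  next
    case (eng c d)
    then show ?case using lie_rep.add by blast
  qed
qed

text \<open>Magnus' theorem. If x in Gamma_k has an expansion of order k + 1, the leading term of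
  its class is homogeneous of degree k and of order k + 1, hence zero, and injectivity moves x to
  the next term.\<close>

lemma Gam_iff: "x \<in> Gam g k \<longleftrightarrow> x \<in> PI g \<and> ord_ge k (magnus x - 1)"
proof
  assume *: "x \<in> PI g \<and> ord_ge k (magnus x - 1)"
  then show "x \<in> Gam g k"
  proof (induction k)
    case 0
    then show ?case by (simp add: lower_central.simps)
  next
    case (Suc k)
    show ?case
    proof (cases k)
      case 0
      with Suc.prems show ?thesis by (simp add: lower_central.simps)
    next
      case (Suc m)
      have "x \<in> Gam g k" using Suc.prems Suc.IH ord_ge_mono[of "Suc k" _ k] by auto
      then obtain l where l: "lie_rep g k l x" using Gam_lie_rep[of k x g] Suc by auto
      have "ord_ge (Suc k) ((magnus x - 1) - (magnus x - 1 - lser l))"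
        using Suc.prems by (intro ord_ge_diff[OF _ lie_rep_magnus[OF l]]) simp
      then have "lser l = 0"
        using hom_deg_eq_zero hom_deg_lser_part lie_rep_homogeneous[OF l] by fastforce
      then show ?thesis using lie_rep_lser_zero(2)[OF l] by simp
    qed
  qed
qed (use magnus_Gam S.lower_central_carrier in blast)

lemma Lie_part_zero [simp]: "0 \<in> Lie_part g k"
  by (simp add: lie_part_def lie_homogeneous.zero)

lemma Lie_part_diff: "u \<in> Lie_part g k \<Longrightarrow> v \<in> Lie_part g k \<Longrightarrow> u - v \<in> Lie_part g k"
  by (simp add: lie_part_def lie_homogeneous.diff)

lemma Lie_part_minus: "u \<in> Lie_part g k \<Longrightarrow> - u \<in> Lie_part g k"
  using Lie_part_diff[OF Lie_part_zero, of u g k] by simp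

lemma Lie_part_add: "u \<in> Lie_part g k \<Longrightarrow> v \<in> Lie_part g k \<Longrightarrow> u + v \<in> Lie_part g k"
  using Lie_part_diff[of u g k "- v"] Lie_part_minus[of v g k] by simp

lemma Lie_part_br: "u \<in> Lie_part g m \<Longrightarrow> v \<in> Lie_part g n \<Longrightarrow> lie_br u v \<in> Lie_part g (m + n)"
  by (simp add: lie_part_def lie_homogeneous.br)

lemma Lie_part_gen: "e \<in> gens g \<Longrightarrow> lie_gen e \<in> Lie_part g 1"
  unfolding lie_part_def mem_Collect_eq by (rule lie_homogeneous.gen)

lemma Lie_part_lie_rep: "l \<in> Lie_part g k \<Longrightarrow> (k = 0 \<longrightarrow> l = 0) \<and> (1 \<le> k \<longrightarrow> (\<exists>x. lie_rep g k l x))"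
  unfolding lie_part_def mem_Collect_eq
proof (induction rule: lie_homogeneous.induct)
  case (gen x)
  then show ?case using lie_rep.gen by auto
next
  case (br m u n v)
  show ?case
  proof (cases "m = 0 \<or> n = 0")
    case True
    then have "lie_br u v = 0" using br by auto
    then show ?thesis using lie_rep_zero_one[of "m + n" g] by auto
  next
    case False
    then obtain x y where "lie_rep g m u x" "lie_rep g n v y" using br by auto
    from lie_rep.br[OF this] show ?thesis using False by blast
  qed
next
  case (zero k)
  then show ?case using lie_rep_zero_one[of k g] by auto
next
  case (diff k u v)
  show ?case
  proof (cases "k = 0")
    case False
    then obtain x y where "lie_rep g k u x" "lie_rep g k v y" using diff by auto
    from lie_rep.add[OF this(1) lie_rep.neg[OF this(2)]] show ?thesis using False by auto
  qed (use diff in simp)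
qed

lemma lser_eq_zero: "l \<in> Lie_part g k \<Longrightarrow> lser l = 0 \<Longrightarrow> l = 0"
  using Lie_part_lie_rep[of l g k] lie_rep_lser_zero(1)[of g k l] by (cases "k = 0") auto

lemma lser_inj: "l \<in> Lie_part g k \<Longrightarrow> l' \<in> Lie_part g k \<Longrightarrow> lser l = lser l' \<Longrightarrow> l = l'"
  using lser_eq_zero[OF Lie_part_diff[of l g k l']] by (simp add: lser_simps)

lemma lser_eqI:
  assumes "l \<in> Lie_part g k" "l' \<in> Lie_part g k" "ord_ge (Suc k) (lser l - lser l')"
  shows "l = l'"
  using assms hom_deg_eq_zero[OF hom_deg_lser_part[OF Lie_part_diff[OF assms(1,2)]]]
  by (intro lser_inj[OF assms(1,2)]) (simp add: lser_simps)

text \<open>Trades the inductive relation for a condition on leading terms, so that later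
  computations take place in the power series ring. For the converse, the order of the expansion
  provides some class of x, and two classes with the same leading term agree.\<close>

lemma lie_rep_iff:
  "lie_rep g k l x \<longleftrightarrow> 1 \<le> k \<and> l \<in> Lie_part g k \<and> x \<in> PI g \<and> ord_ge (Suc k) (magnus x - 1 - lser l)"
proof
  assume "lie_rep g k l x"
  then show "1 \<le> k \<and> l \<in> Lie_part g k \<and> x \<in> PI g \<and> ord_ge (Suc k) (magnus x - 1 - lser l)"
    using lie_rep_homogeneous lie_rep_magnus lie_rep_Gam S.lower_central_carrier by blast
next
  assume *: "1 \<le> k \<and> l \<in> Lie_part g k \<and> x \<in> PI g \<and> ord_ge (Suc k) (magnus x - 1 - lser l)"
  then have "ord_ge k ((magnus x - 1 - lser l) + lser l)"
    using ord_ge_lser ord_ge_mono[of "Suc k" _ k] by (intro ord_ge_add) auto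
  with * have "x \<in> Gam g k" by (simp add: Gam_iff)
  with * obtain l' where l': "lie_rep g k l' x" using Gam_lie_rep by blast
  have "ord_ge (Suc k) ((magnus x - 1 - lser l') - (magnus x - 1 - lser l))"
    using * by (intro ord_ge_diff[OF lie_rep_magnus[OF l']]) simp
  then have "ord_ge (Suc k) (lser l - lser l')" by simp
  then have "l = l'"
    using * lie_rep_homogeneous[OF l'] by (intro lser_eqI) auto
  with l' show "lie_rep g k l x" by simp
qed

lemma lie_class_eq: "lie_rep g k l x \<Longrightarrow> lie_class g k x = l"
  unfolding lie_class_def
proof (rule the_equality)
  fix l' assume "lie_rep g k l x" "lie_rep g k l' x"
  then have *: "l \<in> Lie_part g k" "l' \<in> Lie_part g k" "ord_ge (Suc k) (magnus x - 1 - lser l)"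
     "ord_ge (Suc k) (magnus x - 1 - lser l')" by (auto simp: lie_rep_iff)
  from ord_ge_diff[OF *(3,4)] have "ord_ge (Suc k) (lser l' - lser l)" by (simp add: algebra_simps)
  then show "l' = l" by (rule lser_eqI[OF *(2,1)])
qed

lemma lie_rep_lie_class: "1 \<le> k \<Longrightarrow> x \<in> Gam g k \<Longrightarrow> lie_rep g k (lie_class g k x) x"
  using Gam_lie_rep lie_class_eq by blast

section \<open>Homology\<close>

lemma rcos_Gam_iff:
  "x \<in> PI g \<Longrightarrow> y \<in> PI g \<Longrightarrow> Gam g k #>\<^bsub>surface_group g\<^esub> x = Gam g k #>\<^bsub>surface_group g\<^esub> y \<longleftrightarrow>
    ord_ge k (magnus x - magnus y)"
  by (simp add: S.rcos_eq_iff[OF S.lower_central_normal] Gam_iff ord_ge_right_quotient_iff)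

lemma nc_magnus_single: "nc (magnus w) [e] = exponent_sum e w"
  by (induction w)
    (auto simp: exponent_sum_def magnus_Cons nc_mult_Cons nc_one nc_mult_Nil mlet_def nc_var
      lder_simps Abs_ncps_inverse)

lemma ord_ge_2_iff: "nc f [] = 0 \<Longrightarrow> ord_ge 2 f \<longleftrightarrow> (\<forall>e. nc f [e] = 0)"
proof
  assume *: "nc f [] = 0" "\<forall>e. nc f [e] = 0"
  show "ord_ge 2 f" unfolding ord_ge_def
  proof (intro allI impI)
    fix w :: "'a list" assume "length w < 2"
    then show "nc f w = 0" using * by (cases w) auto
  qed
qed (auto simp: ord_ge_def)

lemma exponent_sum_not_gen: "x \<in> PI g \<Longrightarrow> e \<notin> gens g \<Longrightarrow> exponent_sum e x = 0"
proof -
  assume x: "x \<in> PI g" and e: "e \<notin> gens g"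
  have 0: "map (\<lambda>l. if fst l = e then (if snd l then 1 else - 1 :: int) else 0) x = map (\<lambda>l. 0) x"
    using x e unfolding surface_group_def carrier_free_group by auto
  show ?thesis unfolding exponent_sum_def 0 by simp
qed

lemma hclass_eq_iff:
  "x \<in> PI g \<Longrightarrow> y \<in> PI g \<Longrightarrow> hclass g x = hclass g y \<longleftrightarrow> (\<forall>e\<in>gens g. exponent_sum e x = exponent_sum e y)"
  unfolding hclass_def
  by (subst rcos_Gam_iff) (auto simp: ord_ge_2_iff nc_magnus_single, metis exponent_sum_not_gen)

lemma hclass_mem:
  assumes "x \<in> PI g" "y \<in> hclass g x"
  shows "y \<in> PI g" "hclass g y = hclass g x"
proof -
  have *: "y \<in> Gam g 2 #>\<^bsub>surface_group g\<^esub> x" using assms(2) unfolding hclass_def .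
  from S.repr_independence[OF this assms(1) S.lower_central_subgroup]
  show "hclass g y = hclass g x" unfolding hclass_def by simp
  show "y \<in> PI g"
    by (rule subsetD[OF S.r_coset_subset_G[OF subgroup.subset[OF S.lower_central_subgroup] assms(1)] *])
qed

lemma hclass_self: "x \<in> PI g \<Longrightarrow> x \<in> hclass g x"
  unfolding hclass_def by (rule S.rcos_self[OF _ S.lower_central_subgroup])

lemma dual_basis_hclass: "x \<in> PI g \<Longrightarrow> e \<in> gens g \<Longrightarrow> dual_basis e (hclass g x) = exponent_sum e x"
proof -
  assume x: "x \<in> PI g" and e: "e \<in> gens g"
  have "exponent_sum e ` hclass g x = {exponent_sum e x}"
  proof (intro equalityI subsetI)
    fix z assume "z \<in> exponent_sum e ` hclass g x"
    then obtain y where y: "z = exponent_sum e y" "y \<in> hclass g x" by blast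
    show "z \<in> {exponent_sum e x}"
      using hclass_eq_iff[OF hclass_mem(1)[OF x y(2)] x] hclass_mem(2)[OF x y(2)] e y(1) by simp
  qed (use hclass_self[OF x] in simp)
  then show ?thesis by (simp add: dual_basis_def)
qed

lemma word_lie_part: "x \<in> PI g \<Longrightarrow> word_lie x \<in> Lie_part g 1"
  using lie_rep_word_lie by (simp add: lie_rep_iff)

lemma homology_lie_hclass: "x \<in> PI g \<Longrightarrow> homology_lie (hclass g x) = word_lie x"
proof -
  assume x: "x \<in> PI g"
  have "word_lie y = word_lie x" if y: "y \<in> hclass g x" for y
  proof (rule lser_eqI)
    have yc: "y \<in> PI g" and "hclass g y = hclass g x" using hclass_mem[OF x y] by auto
    then have "ord_ge (Suc 1) (magnus y - magnus x)"
      using rcos_Gam_iff[OF yc x, of 2] unfolding hclass_def by (simp add: numeral_2_eq_2)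
    from ord_ge_add[OF ord_ge_diff[OF this lie_rep_magnus[OF lie_rep_word_lie[OF yc]]]
        lie_rep_magnus[OF lie_rep_word_lie[OF x]]]
    show "ord_ge (Suc 1) (lser (word_lie y) - lser (word_lie x))" by (simp add: algebra_simps)
    show "word_lie y \<in> Lie_part g 1" "word_lie x \<in> Lie_part g 1" using x yc word_lie_part by blast+
  qed
  then have "word_lie ` hclass g x = {word_lie x}" using hclass_self[OF x] by blast
  then show ?thesis by (simp add: homology_lie_def)
qed

lemma nc_lser_word_lie: "x \<in> PI g \<Longrightarrow> nc (lser (word_lie x)) [e] = exponent_sum e x"
proof -
  assume "x \<in> PI g"
  then have "ord_ge (Suc 1) (magnus x - 1 - lser (word_lie x))"
    using lie_rep_word_lie unfolding lie_rep_iff by blast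
  then have "nc (magnus x - 1 - lser (word_lie x)) [e] = 0" unfolding ord_ge_def by simp
  then show ?thesis by (simp add: nc_magnus_single nc_one)
qed

section \<open>Derivations\<close>

text \<open>The derivation with prescribed values on the generators, defined on terms first. In the
  bracket clause \<open>lie_term_subst lie_gen\<close> is the projection of a term to the free Lie
  ring.\<close>

primrec lie_term_der :: "('a \<Rightarrow> 'a free_lie) \<Rightarrow> 'a lie_term \<Rightarrow> 'a free_lie" where
  "lie_term_der t (LGen x) = t x"
| "lie_term_der t LZero = 0"
| "lie_term_der t (LNeg s) = - lie_term_der t s"
| "lie_term_der t (LAdd s u) = lie_term_der t s + lie_term_der t u"
| "lie_term_der t (LBr s u) = lie_br (lie_term_der t s) (lie_term_subst lie_gen u)
     + lie_br (lie_term_subst lie_gen s) (lie_term_der t u)"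

lemma lie_term_der_cong: "lie_eq s u \<Longrightarrow> lie_term_der t s = lie_term_der t u"
proof (induction rule: lie_eq.induct)
  case (br_cong r u r' u')
  then show ?case
    using lie_term_subst_cong[OF br_cong.hyps(1), of lie_gen] lie_term_subst_cong[OF br_cong.hyps(2), of lie_gen]
    by simp
next
  case (br_self s)
  then show ?case using lie_br_anti[of "lie_term_der t s" "lie_term_subst lie_gen s"] by simp
next
  case (jacobi s u v)
  let ?d = "lie_term_der t" and ?i = "lie_term_subst lie_gen"
  \<comment> \<open>Leibniz turns the Jacobi expression into three Jacobi expressions, each with one
    argument differentiated.\<close>
  let ?J = "\<lambda>x y z. lie_br x (lie_br y z) + (lie_br y (lie_br z x) + lie_br z (lie_br x y))"
  have "?J (?d s) (?i u) (?i v) + ?J (?i s) (?d u) (?i v) + ?J (?i s) (?i u) (?d v) = 0"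
    by (simp add: lie_br_jacobi)
  then show ?case by (simp add: lie_br_add_left lie_br_add_right ac_simps)
qed (simp_all add: lie_br_add_left lie_br_add_right ac_simps)

lift_definition lie_der :: "('a \<Rightarrow> 'a free_lie) \<Rightarrow> 'a free_lie \<Rightarrow> 'a free_lie" is lie_term_der
  by (rule lie_term_der_cong)

lemma lie_subst_simps [simp]:
  "lie_subst \<sigma> (lie_gen x) = \<sigma> x" "lie_subst \<sigma> 0 = 0" "lie_subst \<sigma> (- u) = - lie_subst \<sigma> u"
  "lie_subst \<sigma> (u + v) = lie_subst \<sigma> u + lie_subst \<sigma> v"
  "lie_subst \<sigma> (lie_br u v) = lie_br (lie_subst \<sigma> u) (lie_subst \<sigma> v)"
  by (transfer; simp)+

lemma free_lie_induct [case_names gen zero neg add br]: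
  assumes "\<And>x. P (lie_gen x)" "P 0" "\<And>u. P u \<Longrightarrow> P (- u)" "\<And>u v. P u \<Longrightarrow> P v \<Longrightarrow> P (u + v)"
    "\<And>u v. P u \<Longrightarrow> P v \<Longrightarrow> P (lie_br u v)"
  shows "P l"
proof (induction l rule: free_lie.abs_induct)
  case (1 y)
  show ?case
    by (induction y) (use assms in \<open>simp_all add: lie_gen.abs_eq[symmetric] zero_free_lie.abs_eq[symmetric]
      uminus_free_lie.abs_eq[symmetric] plus_free_lie.abs_eq[symmetric] lie_br.abs_eq[symmetric]\<close>)
qed

lemma lie_subst_gen: "lie_subst lie_gen l = l"
  by (induction l rule: free_lie_induct) simp_all

lemma lie_der_simps [simp]:
  "lie_der t (lie_gen x) = t x" "lie_der t 0 = 0" "lie_der t (- u) = - lie_der t u"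
  "lie_der t (u + v) = lie_der t u + lie_der t v"
  by (transfer; simp)+

lemma lie_der_br: "lie_der t (lie_br u v) = lie_br (lie_der t u) v + lie_br u (lie_der t v)"
proof -
  have "lie_der t (lie_br u v) = lie_br (lie_der t u) (lie_subst lie_gen v) + lie_br (lie_subst lie_gen u) (lie_der t v)"
    by transfer simp
  then show ?thesis by (simp add: lie_subst_gen)
qed

lemma lie_der_diff: "lie_der t (u - v) = lie_der t u - lie_der t v"
  using lie_der_simps(4)[of t u "- v"] lie_der_simps(3)[of t v] by (simp del: lie_der_simps)

lemma Lie_part_subset: "l \<in> Lie_part g k \<Longrightarrow> l \<in> Lie g"
  unfolding lie_part_def mem_Collect_eq
  by (induction rule: lie_homogeneous.induct) (auto intro: lie_ring_on.intros)

lemma Lie_minus: "u \<in> Lie g \<Longrightarrow> - u \<in> Lie g"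
  using lie_ring_on.diff[OF lie_ring_on.zero, of u "gens g"] by simp

lemma Lie_add: "u \<in> Lie g \<Longrightarrow> v \<in> Lie g \<Longrightarrow> u + v \<in> Lie g"
  using lie_ring_on.diff[of u "gens g" "- v"] Lie_minus[of v g] by simp

definition der_ext :: "nat \<Rightarrow> (gen \<Rightarrow> gen free_lie) \<Rightarrow> gen free_lie \<Rightarrow> gen free_lie" where
  "der_ext g t = restrict (lie_der t) (Lie g)"

lemma lie_der_part:
  assumes t: "\<And>e. e \<in> gens g \<Longrightarrow> t e \<in> Lie_part g (k + 1)" and "l \<in> Lie_part g m"
  shows "lie_der t l \<in> Lie_part g (m + k)"
  using assms(2) unfolding lie_part_def mem_Collect_eq
proof (induction rule: lie_homogeneous.induct)
  case (gen x)
  then show ?case using t[of x] by (simp add: lie_part_def add.commute)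
next
  case (br m u n v)
  have "lie_br (lie_der t u) v \<in> Lie_part g ((m + k) + n)" "lie_br u (lie_der t v) \<in> Lie_part g (m + (n + k))"
    using br Lie_part_br[of "lie_der t u" g "m + k" v n] Lie_part_br[of u g m "lie_der t v" "n + k"]
    by (simp_all add: lie_part_def)
  then show ?case using Lie_part_add[of "lie_br (lie_der t u) v" g "m + n + k" "lie_br u (lie_der t v)"]
    by (simp add: lie_der_br lie_part_def ac_simps)
qed (auto simp: lie_der_diff intro: lie_homogeneous.intros)

lemma der_ext_Der: "(\<And>e. e \<in> gens g \<Longrightarrow> t e \<in> Lie_part g (k + 1)) \<Longrightarrow> der_ext g t \<in> Der g k"
  using lie_der_part[of g t k]
  by (auto simp: Der_def der_ext_def lie_der_br Lie_add lie_ring_on.br Lie_part_subset)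

lemma der_ext_gen: "e \<in> gens g \<Longrightarrow> der_ext g t (lie_gen e) = t e"
  by (simp add: der_ext_def lie_ring_on.gen)

lemma Der_add: "d \<in> Der g k \<Longrightarrow> u \<in> Lie g \<Longrightarrow> v \<in> Lie g \<Longrightarrow> d (u + v) = d u + d v"
  by (simp add: Der_def)

lemma Der_br: "d \<in> Der g k \<Longrightarrow> u \<in> Lie g \<Longrightarrow> v \<in> Lie g \<Longrightarrow> d (lie_br u v) = lie_br (d u) v + lie_br u (d v)"
  by (simp add: Der_def)

lemma Der_zero: "d \<in> Der g k \<Longrightarrow> d 0 = 0"
  using Der_add[of d g k 0 0] by (simp add: lie_ring_on.zero)

lemma Der_diff: "d \<in> Der g k \<Longrightarrow> u \<in> Lie g \<Longrightarrow> v \<in> Lie g \<Longrightarrow> d (u - v) = d u - d v"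
  using Der_add[of d g k "u - v" v] by (simp add: lie_ring_on.diff eq_diff_eq)

lemma Der_minus: "d \<in> Der g k \<Longrightarrow> u \<in> Lie g \<Longrightarrow> d (- u) = - d u"
  using Der_diff[of d g k 0 u] by (simp add: lie_ring_on.zero Der_zero)

lemma Der_part: "d \<in> Der g k \<Longrightarrow> u \<in> Lie_part g m \<Longrightarrow> d u \<in> Lie_part g (m + k)"
  by (simp add: Der_def)

lemma Der_gen_part: "d \<in> Der g k \<Longrightarrow> e \<in> gens g \<Longrightarrow> d (lie_gen e) \<in> Lie_part g (k + 1)"
  using Der_part[OF _ Lie_part_gen] by (metis add.commute)

lemma Der_eqI:
  assumes "d \<in> Der g k" "d' \<in> Der g k'" "\<And>e. e \<in> gens g \<Longrightarrow> d (lie_gen e) = d' (lie_gen e)"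
  shows "d = d'"
proof
  fix l
  show "d l = d' l"
  proof (cases "l \<in> Lie g")
    case True
    then show ?thesis
    proof (induction rule: lie_ring_on.induct)
      case (gen x)
      then show ?case using assms by simp
    next
      case (br u v)
      then show ?case using Der_br[OF assms(1)] Der_br[OF assms(2)] by simp
    next
      case zero
      then show ?case using Der_zero[OF assms(1)] Der_zero[OF assms(2)] by simp
    next
      case (diff u v)
      then show ?case using Der_diff[OF assms(1)] Der_diff[OF assms(2)] by simp
    qed
  next
    case False
    then show ?thesis using assms by (simp add: Der_def extensional_def)
  qed
qed

section \<open>The Andreadakis filtration and the Johnson homomorphisms\<close>

lemma auto_homD:
  assumes "f \<in> auto (surface_group g)"
  shows "group_hom (surface_group g) (surface_group g) f" "bij_betw f (PI g) (PI g)" "f \<in> extensional (PI g)"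
    "\<And>x. x \<in> PI g \<Longrightarrow> f x \<in> PI g"
  using assms
  by (auto simp: auto_def Bij_def group_hom_def group_hom_axioms_def group_surface_group bij_betw_def)

lemma autoI:
  assumes "f \<in> hom (surface_group g) (surface_group g)" "bij_betw f (PI g) (PI g)" "f \<in> extensional (PI g)"
  shows "f \<in> auto (surface_group g)"
  using assms by (simp add: auto_def Bij_def)

lemma auto_compose:
  assumes f: "f \<in> auto (surface_group g)" and h: "h \<in> auto (surface_group g)"
  shows "compose (PI g) f h \<in> auto (surface_group g)"
proof (rule autoI)
  interpret f: group_hom "surface_group g" "surface_group g" f by (rule auto_homD(1)[OF f])
  interpret h: group_hom "surface_group g" "surface_group g" h by (rule auto_homD(1)[OF h])
  show "compose (PI g) f h \<in> hom (surface_group g) (surface_group g)"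
    by (rule homI) (simp_all add: compose_def)
  show "bij_betw (compose (PI g) f h) (PI g) (PI g)"
    by (rule bij_betw_compose[OF auto_homD(2)[OF h] auto_homD(2)[OF f]])
qed (simp add: compose_def)

definition auto_inv :: "nat \<Rightarrow> (gen fword \<Rightarrow> gen fword) \<Rightarrow> gen fword \<Rightarrow> gen fword" where
  "auto_inv g f = restrict (inv_into (PI g) f) (PI g)"

lemma auto_inv_cancel:
  assumes f: "f \<in> auto (surface_group g)" and x: "x \<in> PI g"
  shows "f (auto_inv g f x) = x" "auto_inv g f (f x) = x"
proof -
  have b: "inj_on f (PI g)" "f ` PI g = PI g" using auto_homD(2)[OF f] by (auto simp: bij_betw_def)
  show "f (auto_inv g f x) = x" using f_inv_into_f[of x f "PI g"] b x by (simp add: auto_inv_def)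
  show "auto_inv g f (f x) = x"
    using inv_into_f_f[OF b(1) x] auto_homD(4)[OF f x] by (simp add: auto_inv_def)
qed

lemma auto_inv_auto:
  assumes f: "f \<in> auto (surface_group g)"
  shows "auto_inv g f \<in> auto (surface_group g)"
proof (rule autoI)
  interpret f: group_hom "surface_group g" "surface_group g" f by (rule auto_homD(1)[OF f])
  have b: "bij_betw (inv_into (PI g) f) (PI g) (PI g)" by (rule bij_betw_inv_into[OF auto_homD(2)[OF f]])
  show b': "bij_betw (auto_inv g f) (PI g) (PI g)"
    using bij_betw_cong[of "PI g" "auto_inv g f" "inv_into (PI g) f"] b by (simp add: auto_inv_def)
  have cl: "auto_inv g f x \<in> PI g" if "x \<in> PI g" for x using b' that by (auto simp: bij_betw_def)
  have inj: "inj_on f (PI g)" using auto_homD(2)[OF f] by (auto simp: bij_betw_def)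
  show "auto_inv g f \<in> hom (surface_group g) (surface_group g)"
  proof (rule homI)
    fix x y assume x: "x \<in> PI g" and y: "y \<in> PI g"
    have "f (auto_inv g f (x \<otimes>\<^bsub>surface_group g\<^esub> y)) = f (auto_inv g f x \<otimes>\<^bsub>surface_group g\<^esub> auto_inv g f y)"
      using x y cl by (simp add: auto_inv_cancel(1)[OF f])
    from inj_onD[OF inj this]
    show "auto_inv g f (x \<otimes>\<^bsub>surface_group g\<^esub> y) = auto_inv g f x \<otimes>\<^bsub>surface_group g\<^esub> auto_inv g f y"
      using S.m_closed x y cl by blast
  qed (rule cl)
qed (simp add: auto_inv_def)

text \<open>This has the same leading term as M(f(x) x^-1) - 1, but it is a plain difference, with a
  Leibniz-type rule in x. Statements about the depth of f(x) x^-1 are moved to it.\<close>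

definition dM :: "(gen fword \<Rightarrow> gen fword) \<Rightarrow> gen fword \<Rightarrow> gen ncps" where
  "dM f x = magnus (f x) - magnus x"

lemma Johnson_A_iff:
  "f \<in> Johnson_A g k \<longleftrightarrow> f \<in> auto (surface_group g) \<and> (\<forall>x\<in>PI g. ord_ge (k + 1) (dM f x))"
proof -
  let ?N = "Gam g (k + 1)" and ?Q = "surface_group g Mod Gam g (k + 1)"
  have carQ: "carrier ?Q = (\<lambda>x. ?N #>\<^bsub>surface_group g\<^esub> x) ` PI g"
    by (auto simp: FactGroup_def RCOSETS_def)
  have "(restrict ((`) f) (carrier ?Q) = (\<lambda>c\<in>carrier ?Q. c)) \<longleftrightarrow> (\<forall>x\<in>PI g. ord_ge (k + 1) (dM f x))"
    if f: "f \<in> auto (surface_group g)"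
  proof -
    interpret f: group_hom "surface_group g" "surface_group g" f by (rule auto_homD(1)[OF f])
    have A: "f ` (?N #>\<^bsub>surface_group g\<^esub> x) = ?N #>\<^bsub>surface_group g\<^esub> x" if *: "\<forall>x\<in>PI g. ord_ge (k + 1) (dM f x)" and x: "x \<in> PI g" for x
    proof -
      have fz: "?N #>\<^bsub>surface_group g\<^esub> f z = ?N #>\<^bsub>surface_group g\<^esub> z" if "z \<in> PI g" for z
        using * that rcos_Gam_iff[of "f z" g z "k + 1"] by (simp add: dM_def)
      have mem: "z \<in> ?N #>\<^bsub>surface_group g\<^esub> x \<longleftrightarrow> z \<in> PI g \<and> ?N #>\<^bsub>surface_group g\<^esub> z = ?N #>\<^bsub>surface_group g\<^esub> x" for z
      proof
        assume z: "z \<in> ?N #>\<^bsub>surface_group g\<^esub> x"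
        show "z \<in> PI g \<and> ?N #>\<^bsub>surface_group g\<^esub> z = ?N #>\<^bsub>surface_group g\<^esub> x"
          using S.repr_independence[OF z x S.lower_central_subgroup]
            subsetD[OF S.r_coset_subset_G[OF subgroup.subset[OF S.lower_central_subgroup] x] z] by simp
      next
        assume "z \<in> PI g \<and> ?N #>\<^bsub>surface_group g\<^esub> z = ?N #>\<^bsub>surface_group g\<^esub> x"
        then show "z \<in> ?N #>\<^bsub>surface_group g\<^esub> x" using S.rcos_self[OF _ S.lower_central_subgroup, of z] by metis
      qed
      show ?thesis
      proof (intro equalityI subsetI)
        fix y assume "y \<in> f ` (?N #>\<^bsub>surface_group g\<^esub> x)"
        then obtain z where z: "y = f z" "z \<in> ?N #>\<^bsub>surface_group g\<^esub> x" by blast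
        then show "y \<in> ?N #>\<^bsub>surface_group g\<^esub> x" using fz[of z] mem[of z] mem[of y] by simp
      next
        \<comment> \<open>The coset is mapped onto itself, not only into itself: the preimage of y
          under the bijection f lies in the coset because f fixes all cosets.\<close>
        fix y assume y: "y \<in> ?N #>\<^bsub>surface_group g\<^esub> x"
        then have "y \<in> PI g" unfolding mem by simp
        then obtain z where z: "z \<in> PI g" "y = f z" using auto_homD(2)[OF f] by (auto simp: bij_betw_def)
        then have "z \<in> ?N #>\<^bsub>surface_group g\<^esub> x" using y fz[of z] unfolding mem by simp
        then show "y \<in> f ` (?N #>\<^bsub>surface_group g\<^esub> x)" using z by simp
      qed
    qed
    have B: "ord_ge (k + 1) (dM f x)" if *: "f ` (?N #>\<^bsub>surface_group g\<^esub> x) = ?N #>\<^bsub>surface_group g\<^esub> x" and x: "x \<in> PI g" for x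
    proof -
      have "f x \<in> ?N #>\<^bsub>surface_group g\<^esub> x" using * S.rcos_self[OF x S.lower_central_subgroup] by blast
      from S.repr_independence[OF this x S.lower_central_subgroup]
      show ?thesis using rcos_Gam_iff[of "f x" g x "k + 1"] x by (simp add: dM_def)
    qed
    show ?thesis
    proof
      assume L: "restrict ((`) f) (carrier ?Q) = (\<lambda>c\<in>carrier ?Q. c)"
      show "\<forall>x\<in>PI g. ord_ge (k + 1) (dM f x)"
      proof
        fix x assume x: "x \<in> PI g"
        then have "?N #>\<^bsub>surface_group g\<^esub> x \<in> carrier ?Q" unfolding carQ by (rule imageI)
        with fun_cong[OF L, of "?N #>\<^bsub>surface_group g\<^esub> x"]
        have "f ` (?N #>\<^bsub>surface_group g\<^esub> x) = ?N #>\<^bsub>surface_group g\<^esub> x" by simp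
        then show "ord_ge (k + 1) (dM f x)" using x by (rule B)
      qed
    next
      assume *: "\<forall>x\<in>PI g. ord_ge (k + 1) (dM f x)"
      show "restrict ((`) f) (carrier ?Q) = (\<lambda>c\<in>carrier ?Q. c)"
      proof (rule restrict_ext)
        fix c assume "c \<in> carrier ?Q"
        then obtain x where "c = ?N #>\<^bsub>surface_group g\<^esub> x" "x \<in> PI g" unfolding carQ by (rule imageE)
        with A[OF *] show "f ` c = c" by simp
      qed
    qed
  qed
  then show ?thesis
    by (auto simp: Johnson_A_def kernel_def induced_auto_def AutoGroup_def BijGroup_def)
qed

lemma Johnson_A_D:
  assumes "f \<in> Johnson_A g k"
  shows "f \<in> auto (surface_group g)" "\<And>x. x \<in> PI g \<Longrightarrow> ord_ge (k + 1) (dM f x)"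
  using assms by (auto simp: Johnson_A_iff)

section \<open>How automorphisms move the lower central series\<close>

lemma magnus_commutator_eq:
  assumes "x \<in> PI g" "y \<in> PI g"
  shows "magnus (commutator (surface_group g) x y) = 1 + (magnus x * magnus y - magnus y * magnus x) *
    (magnus (inv\<^bsub>surface_group g\<^esub> x) * magnus (inv\<^bsub>surface_group g\<^esub> y))"
proof -
  have "magnus y * magnus x * (magnus (inv\<^bsub>surface_group g\<^esub> x) * magnus (inv\<^bsub>surface_group g\<^esub> y))
      = magnus y * (magnus x * magnus (inv\<^bsub>surface_group g\<^esub> x)) * magnus (inv\<^bsub>surface_group g\<^esub> y)"
    by (simp only: mult.assoc)
  also have "\<dots> = 1" using assms by (simp add: magnus_surface_inv)
  finally show ?thesis
    by (simp add: commutator_def magnus_surface_mult left_diff_distrib mult.assoc)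
qed

lemma dM_mult:
  assumes "f \<in> auto (surface_group g)" "x \<in> PI g" "y \<in> PI g"
  shows "dM f (x \<otimes>\<^bsub>surface_group g\<^esub> y) = dM f x * magnus (f y) + magnus x * dM f y"
proof -
  interpret f: group_hom "surface_group g" "surface_group g" f by (rule auto_homD(1)[OF assms(1)])
  show ?thesis
    using assms by (simp add: dM_def magnus_surface_mult left_diff_distrib right_diff_distrib)
qed

lemma dM_inv:
  assumes "f \<in> auto (surface_group g)" "x \<in> PI g"
  shows "dM f (inv\<^bsub>surface_group g\<^esub> x) = - (magnus (inv\<^bsub>surface_group g\<^esub> f x) * dM f x * magnus (inv\<^bsub>surface_group g\<^esub> x))"
proof -
  interpret f: group_hom "surface_group g" "surface_group g" f by (rule auto_homD(1)[OF assms(1)])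
  have "magnus (inv\<^bsub>surface_group g\<^esub> f x) * dM f x * magnus (inv\<^bsub>surface_group g\<^esub> x) =
     (magnus (inv\<^bsub>surface_group g\<^esub> f x) * magnus (f x)) * magnus (inv\<^bsub>surface_group g\<^esub> x)
     - magnus (inv\<^bsub>surface_group g\<^esub> f x) * (magnus x * magnus (inv\<^bsub>surface_group g\<^esub> x))"
    by (simp add: dM_def left_diff_distrib right_diff_distrib mult.assoc)
  also have "\<dots> = magnus (inv\<^bsub>surface_group g\<^esub> x) - magnus (inv\<^bsub>surface_group g\<^esub> f x)"
    using assms by (simp add: magnus_surface_inv)
  finally show ?thesis using assms by (simp add: dM_def)
qed

text \<open>With \<open>E = [magnus x, magnus y]\<close> and \<open>V = magnus (inv x) * magnus (inv y)\<close>, the difference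
  of \<open>magnus (commutator x y) = 1 + E * V\<close> is \<open>(E' - E) * V' + E * (V' - V)\<close>.\<close>

lemma dM_commutator:
  assumes f: "f \<in> Johnson_A g k" and x: "x \<in> PI g" and y: "y \<in> PI g"
    and a: "ord_ge m (magnus x - 1)" and b: "ord_ge n (magnus y - 1)"
    and da: "ord_ge (m + k) (dM f x)" and db: "ord_ge (n + k) (dM f y)"
  shows "ord_ge (m + n + k + 1) (dM f (commutator (surface_group g) x y) -
    (dM f x * (magnus y - 1) - (magnus y - 1) * dM f x + ((magnus (f x) - 1) * dM f y - dM f y * (magnus (f x) - 1))))"
proof -
  interpret f: group_hom "surface_group g" "surface_group g" f by (rule auto_homD(1)[OF Johnson_A_D(1)[OF f]])
  let ?i = "\<lambda>x. magnus (inv\<^bsub>surface_group g\<^esub> x)"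
  define D where "D = dM f x * (magnus y - 1) - (magnus y - 1) * dM f x + ((magnus (f x) - 1) * dM f y - dM f y * (magnus (f x) - 1))"
  define E where "E = magnus x * magnus y - magnus y * magnus x"
  define E' where "E' = magnus (f x) * magnus (f y) - magnus (f y) * magnus (f x)"
  define V where "V = ?i x * ?i y"
  define V' where "V' = ?i (f x) * ?i (f y)"
  have E'E: "E' - E = D"
    unfolding D_def E_def E'_def dM_def by (simp add: left_diff_distrib right_diff_distrib)
  have "dM f (commutator (surface_group g) x y) = E' * V' - E * V"
    using x y by (simp add: dM_def f.hom_commutator magnus_commutator_eq E_def E'_def V_def V'_def)
  then have "dM f (commutator (surface_group g) x y) - D = D * (V' - 1) + E * (V' - V)"
    unfolding E'E[symmetric] by (simp add: left_diff_distrib right_diff_distrib)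
  moreover have "ord_ge (m + n + k + 1) (D * (V' - 1))"
  proof (rule ord_ge_mult)
    have fa: "ord_ge m (magnus (f x) - 1)"
      using ord_ge_add[OF ord_ge_mono[OF da, of m] a] by (simp add: dM_def)
    show "ord_ge (m + n + k) D"
      unfolding D_def
      by (intro ord_ge_add ord_ge_mono[OF ord_ge_comm[OF da b]] ord_ge_mono[OF ord_ge_comm[OF fa db]]) simp_all
    show "ord_ge 1 (V' - 1)" by (simp add: V'_def ord_ge_def nc_mult_Nil nc_one)
  qed simp
  moreover have "ord_ge (m + n + k + 1) (E * (V' - V))"
  proof (rule ord_ge_mult)
    have "E = (magnus x - 1) * (magnus y - 1) - (magnus y - 1) * (magnus x - 1)"
      by (simp add: E_def left_diff_distrib right_diff_distrib)
    then show "ord_ge (m + n) E" using ord_ge_comm[OF a b] by simp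
    have i: "ord_ge (k + 1) (?i (f z) - ?i z)" if z: "z \<in> PI g" for z
      using Johnson_A_D(2)[OF f, of "inv\<^bsub>surface_group g\<^esub> z"] z by (simp add: dM_def)
    have "V' - V = (?i (f x) - ?i x) * ?i (f y) + ?i x * (?i (f y) - ?i y)"
      by (simp add: V_def V'_def left_diff_distrib right_diff_distrib)
    then show "ord_ge (k + 1) (V' - V)"
      by (simp only:) (intro ord_ge_add ord_ge_mult_right[OF i[OF x]] ord_ge_mult_left[OF i[OF y]])
  qed simp
  ultimately show ?thesis unfolding D_def[symmetric] by (simp add: ord_ge_add)
qed

text \<open>Andreadakis' estimate. For a commutator [x, y] with x in Gamma_m, each of the two
  brackets in D contains one moved entry, which has gained k, and the other entry contributes its
  usual order.\<close>

lemma dM_Gam: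
  assumes f: "f \<in> Johnson_A g k"
  shows "1 \<le> m \<Longrightarrow> x \<in> Gam g m \<Longrightarrow> ord_ge (m + k) (dM f x)"
proof (induction m arbitrary: x rule: nat_induct_at_least)
  case base
  then show ?case using Johnson_A_D(2)[OF f, of x] S.lower_central_carrier by simp
next
  case (Suc m)
  note af = Johnson_A_D(1)[OF f]
  interpret f: group_hom "surface_group g" "surface_group g" f by (rule auto_homD(1)[OF af])
  let ?S = "{commutator (surface_group g) x y |x y. x \<in> Gam g m \<and> y \<in> PI g}"
  have comm: "ord_ge (Suc m + k) (dM f c)" if "c \<in> ?S" for c
  proof -
    from that obtain x y where c: "c = commutator (surface_group g) x y" "x \<in> Gam g m" "y \<in> PI g" by blast
    have x: "x \<in> PI g" using c S.lower_central_carrier by blast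
    have 1: "ord_ge m (magnus x - 1)" "ord_ge (m + k) (dM f x)" "ord_ge (1 + k) (dM f y)"
      using c Suc.IH Johnson_A_D(2)[OF f c(3)] magnus_Gam by auto
    have fa: "ord_ge m (magnus (f x) - 1)"
      using ord_ge_add[OF ord_ge_mono[OF 1(2), of m] 1(1)] by (simp add: dM_def)
    define D where "D = dM f x * (magnus y - 1) - (magnus y - 1) * dM f x + ((magnus (f x) - 1) * dM f y - dM f y * (magnus (f x) - 1))"
    have "ord_ge (m + 1 + k + 1) (dM f c - D)"
      unfolding D_def c(1) by (rule dM_commutator[OF f x c(3) 1(1) ord_ge_1_magnus 1(2,3)])
    moreover have "ord_ge (m + k + 1) D"
      unfolding D_def
      by (intro ord_ge_add ord_ge_mono[OF ord_ge_comm[OF 1(2) ord_ge_1_magnus]]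
          ord_ge_mono[OF ord_ge_comm[OF fa 1(3)]]) simp_all
    ultimately have "ord_ge (m + k + 1) ((dM f c - D) + D)"
      by (intro ord_ge_add) (auto elim: ord_ge_mono)
    then show ?thesis by simp
  qed
  have car: "?S \<subseteq> PI g" using S.lower_central_carrier by auto
  have "x \<in> generate (surface_group g) ?S" using Suc by (cases m) (auto simp: lower_central.simps)
  then show ?case
  proof (induction rule: generate.induct)
    case one
    then show ?case by (simp add: dM_def)
  next
    case (incl c)
    then show ?case by (rule comm)
  next
    case (inv c)
    then have "c \<in> PI g" using car by blast
    then show ?case using comm[OF inv]
      by (simp add: dM_inv[OF af] ord_ge_minus ord_ge_mult_left ord_ge_mult_right)
  next
    case (eng c d)
    then have "c \<in> PI g" "d \<in> PI g" using car S.generate_in_carrier by blast+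
    then show ?case using eng.IH
      by (simp add: dM_mult[OF af] ord_ge_add ord_ge_mult_left ord_ge_mult_right)
  qed
qed

text \<open>Right multiplication by \<open>magnus (inv x)\<close>, of constant term 1, leaves the
  terms of lowest degree unchanged.\<close>

lemma ord_ge_quotient_lead:
  assumes x: "x \<in> PI g" and y: "y \<in> PI g" and L: "ord_ge n L"
  shows "ord_ge (Suc n) (magnus (y \<otimes>\<^bsub>surface_group g\<^esub> inv\<^bsub>surface_group g\<^esub> x) - 1 - L)
    \<longleftrightarrow> ord_ge (Suc n) (magnus y - magnus x - L)"
proof -
  define u where "u = magnus x"
  define v where "v = magnus (inv\<^bsub>surface_group g\<^esub> x)"
  define D where "D = magnus y - magnus x"
  have vu: "v * u = 1" using magnus_surface_inv[OF x] by (simp add: u_def v_def)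
  have L1: "ord_ge (Suc n) (L * (u - 1))" "ord_ge (Suc n) (L * (v - 1))"
    unfolding u_def v_def using ord_ge_mult[OF L ord_ge_1_magnus] by auto
  have e: "D - L = (D * v - L) * u + L * (u - 1)" "D * v - L = (D - L) * v + L * (v - 1)"
    by (simp_all add: left_diff_distrib right_diff_distrib mult.assoc vu)
  have "ord_ge (Suc n) (D * v - L) \<longleftrightarrow> ord_ge (Suc n) (D - L)"
    using e L1 ord_ge_add ord_ge_mult_right by metis
  then show ?thesis by (simp add: magnus_right_quotient[OF y x] D_def v_def)
qed

section \<open>Johnson homomorphisms as leading terms\<close>

definition tau_gen :: "nat \<Rightarrow> nat \<Rightarrow> (gen fword \<Rightarrow> gen fword) \<Rightarrow> gen \<Rightarrow> gen free_lie" where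
  "tau_gen g k f e = lie_class g (k + 1) (f (pi_gen e) \<otimes>\<^bsub>surface_group g\<^esub> inv\<^bsub>surface_group g\<^esub> pi_gen e)"

lemma lie_rep_dM_iff:
  assumes "f \<in> auto (surface_group g)" "x \<in> PI g"
  shows "lie_rep g n l (f x \<otimes>\<^bsub>surface_group g\<^esub> inv\<^bsub>surface_group g\<^esub> x) \<longleftrightarrow>
    1 \<le> n \<and> l \<in> Lie_part g n \<and> ord_ge (Suc n) (dM f x - lser l)"
  using assms auto_homD(4)[OF assms] ord_ge_quotient_lead[OF assms(2) auto_homD(4)[OF assms], of n "lser l"]
    ord_ge_lser[of l g n]
  by (auto simp: lie_rep_iff dM_def)

lemma quotient_Gam_iff:
  assumes "f \<in> auto (surface_group g)" "x \<in> PI g"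
  shows "f x \<otimes>\<^bsub>surface_group g\<^esub> inv\<^bsub>surface_group g\<^esub> x \<in> Gam g n \<longleftrightarrow> ord_ge n (dM f x)"
  using assms auto_homD(4)[OF assms] ord_ge_right_quotient_iff[OF auto_homD(4)[OF assms] assms(2)]
  by (simp add: Gam_iff dM_def)

lemma lie_rep_tau_gen:
  assumes "f \<in> Johnson_A g k" "e \<in> gens g"
  shows "lie_rep g (k + 1) (tau_gen g k f e) (f (pi_gen e) \<otimes>\<^bsub>surface_group g\<^esub> inv\<^bsub>surface_group g\<^esub> pi_gen e)"
  unfolding tau_gen_def
  using assms Johnson_A_D[OF assms(1)] pi_gen_carrier[OF assms(2)]
  by (intro lie_rep_lie_class) (simp_all add: quotient_Gam_iff)

lemma tau_gen_part: "f \<in> Johnson_A g k \<Longrightarrow> e \<in> gens g \<Longrightarrow> tau_gen g k f e \<in> Lie_part g (k + 1)"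
  using lie_rep_tau_gen lie_rep_homogeneous by blast

text \<open>Leading terms of f(x) x^-1 obey the Leibniz rule on commutators, so in every degree they
  are given by the derivation that extends the values on generators.\<close>

lemma dM_lie_rep:
  assumes f: "f \<in> Johnson_A g k" and k: "1 \<le> k"
  shows "lie_rep g m l x \<Longrightarrow> ord_ge (m + k + 1) (dM f x - lser (lie_der (tau_gen g k f) l))"
proof (induction rule: lie_rep.induct)
  case (gen e)
  have "ord_ge (Suc (k + 1)) (dM f (pi_gen e) - lser (tau_gen g k f e))"
    using lie_rep_dM_iff[OF Johnson_A_D(1)[OF f] pi_gen_carrier[OF gen]] lie_rep_tau_gen[OF f gen] by blast
  then show ?case by simp
next
  case (br m u x n v y)
  let ?d = "lie_der (tau_gen g k f)"
  have G: "x \<in> Gam g m" "y \<in> Gam g n" and mn: "1 \<le> m" "1 \<le> n" and uv: "u \<in> Lie_part g m" "v \<in> Lie_part g n"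
    using br.hyps lie_rep_Gam lie_rep_homogeneous by blast+
  have c: "x \<in> PI g" "y \<in> PI g" using G S.lower_central_carrier by blast+
  define a where "a = magnus x - 1"
  define b where "b = magnus y - 1"
  have ab: "ord_ge m a" "ord_ge n b" unfolding a_def b_def using G magnus_Gam by blast+
  have da: "ord_ge (m + k) (dM f x)" and db: "ord_ge (n + k) (dM f y)"
    using dM_Gam[OF f mn(1) G(1)] dM_Gam[OF f mn(2) G(2)] .
  have lu: "ord_ge m (lser u)" "ord_ge n (lser v)" using uv ord_ge_lser by blast+
  have ld: "ord_ge (m + k) (lser (?d u))" "ord_ge (n + k) (lser (?d v))"
    using ord_ge_lser[OF lie_der_part[of g "tau_gen g k f" k, OF tau_gen_part[OF f] uv(1)]]
      ord_ge_lser[OF lie_der_part[of g "tau_gen g k f" k, OF tau_gen_part[OF f] uv(2)]] by simp_all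
  have alu: "ord_ge (Suc m) (a - lser u)" and blv: "ord_ge (Suc n) (b - lser v)"
    unfolding a_def b_def using br.hyps lie_rep_magnus by blast+
  have fxa: "magnus (f x) - 1 = a + dM f x" by (simp add: a_def dM_def)
  define X where "X = dM f x"
  define Y where "Y = dM f y"
  note XY = X_def[symmetric] Y_def[symmetric]
  \<comment> \<open>Factors are replaced by their leading terms one at a time. The last bracket
    comes from f(x) in place of x; it has order m + n + 2k, which is large enough because k \<ge>
    1.\<close>
  have R: "X * b - b * X + ((a + X) * Y - Y * (a + X)) - lser (?d (lie_br u v)) =
      ((X - lser (?d u)) * b + lser (?d u) * (b - lser v)) - (b * (X - lser (?d u)) + (b - lser v) * lser (?d u))
    + ((a - lser u) * Y + lser u * (Y - lser (?d v))) - ((Y - lser (?d v)) * a + lser (?d v) * (a - lser u))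
    + (X * Y - Y * X)"
    by (simp add: lie_der_br lser_simps left_diff_distrib right_diff_distrib distrib_left distrib_right)
  have o: "ord_ge (m + n + k + 1) (X * b - b * X + ((a + X) * Y - Y * (a + X)) - lser (?d (lie_br u v)))"
    unfolding R
    by (intro ord_ge_add ord_ge_diff ord_ge_mult[OF br.IH(1)[unfolded XY] ab(2)] ord_ge_mult[OF ld(1) blv]
        ord_ge_mult[OF ab(2) br.IH(1)[unfolded XY]] ord_ge_mult[OF blv ld(1)]
        ord_ge_mult[OF alu db[unfolded XY]] ord_ge_mult[OF lu(1) br.IH(2)[unfolded XY]]
        ord_ge_mult[OF br.IH(2)[unfolded XY] ab(1)] ord_ge_mult[OF ld(2) alu]
        ord_ge_mult[OF da[unfolded XY] db[unfolded XY]] ord_ge_mult[OF db[unfolded XY] da[unfolded XY]])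
      (use k in simp_all)
  have "ord_ge (m + n + k + 1) (dM f (commutator (surface_group g) x y)
      - (X * b - b * X + ((a + X) * Y - Y * (a + X))))"
    using dM_commutator[OF f c ab[unfolded a_def b_def] da db] unfolding fxa XY b_def .
  from ord_ge_add[OF this o] show ?case by simp
next
  case (add m u x v y)
  have G: "x \<in> Gam g m" "y \<in> Gam g m" and m: "1 \<le> m"
    using add.hyps lie_rep_Gam lie_rep_homogeneous by blast+
  have c: "x \<in> PI g" "y \<in> PI g" using G S.lower_central_carrier by blast+
  have "dM f (x \<otimes>\<^bsub>surface_group g\<^esub> y) - lser (lie_der (tau_gen g k f) (u + v)) =
      (dM f x - lser (lie_der (tau_gen g k f) u)) + (dM f y - lser (lie_der (tau_gen g k f) v))
      + dM f x * (magnus (f y) - 1) + (magnus x - 1) * dM f y"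
    by (simp add: dM_mult[OF Johnson_A_D(1)[OF f] c] lser_simps left_diff_distrib right_diff_distrib)
  moreover have "ord_ge (m + k + 1) \<dots>"
    by (intro ord_ge_add add.IH ord_ge_mult[OF dM_Gam[OF f m G(1)] ord_ge_1_magnus]
        ord_ge_mult[OF ord_ge_1_magnus dM_Gam[OF f m G(2)]]) simp_all
  ultimately show ?case by simp
next
  case (neg m u x)
  have G: "x \<in> Gam g m" and m: "1 \<le> m"
    using neg.hyps lie_rep_Gam lie_rep_homogeneous by blast+
  have c: "x \<in> PI g" using G S.lower_central_carrier by blast
  let ?U = "magnus (inv\<^bsub>surface_group g\<^esub> f x)" and ?V = "magnus (inv\<^bsub>surface_group g\<^esub> x)"
  have "dM f (inv\<^bsub>surface_group g\<^esub> x) - lser (lie_der (tau_gen g k f) (- u)) =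
      - (dM f x - lser (lie_der (tau_gen g k f) u)) - (?U - 1) * (dM f x * ?V) - dM f x * (?V - 1)"
    by (simp add: dM_inv[OF Johnson_A_D(1)[OF f] c] lser_simps left_diff_distrib right_diff_distrib mult.assoc)
  moreover have "ord_ge (m + k + 1) \<dots>"
    by (intro ord_ge_diff[OF ord_ge_diff[OF ord_ge_minus[OF neg.IH]]]
        ord_ge_mult[OF ord_ge_1_magnus ord_ge_mult_right[OF dM_Gam[OF f m G]]]
        ord_ge_mult[OF dM_Gam[OF f m G] ord_ge_1_magnus]) simp_all
  ultimately show ?case by simp
next
  case (zero m x)
  then show ?case using dM_Gam[OF f, of "Suc m" x] by (simp add: lser_simps)
qed

lemma word_lie_pi_gen [simp]: "word_lie (pi_gen e) = lie_gen e"
  by (simp add: word_lie_def pi_gen_def)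

lemma tau'_eq:
  assumes f: "f \<in> Johnson_A g k" and k: "1 \<le> k"
  shows "tau' g k f = der_ext g (tau_gen g k f)"
  unfolding tau'_def
proof (rule the_equality)
  let ?d = "der_ext g (tau_gen g k f)"
  have d: "?d \<in> Der g k" by (rule der_ext_Der[OF tau_gen_part[OF f]])
  have "?d (homology_lie (hclass g x)) = lie_class g (k + 1) (f x \<otimes>\<^bsub>surface_group g\<^esub> inv\<^bsub>surface_group g\<^esub> x)"
    if x: "x \<in> PI g" for x
  proof -
    have "lie_rep g (1 + k) (lie_der (tau_gen g k f) (word_lie x)) (f x \<otimes>\<^bsub>surface_group g\<^esub> inv\<^bsub>surface_group g\<^esub> x)"
      unfolding lie_rep_dM_iff[OF Johnson_A_D(1)[OF f] x]
      using dM_lie_rep[OF f k lie_rep_word_lie[OF x]] lie_der_part[OF tau_gen_part[OF f] word_lie_part[OF x]] by simp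
    then have "lie_class g (k + 1) (f x \<otimes>\<^bsub>surface_group g\<^esub> inv\<^bsub>surface_group g\<^esub> x) = lie_der (tau_gen g k f) (word_lie x)"
      using lie_class_eq by simp
    then show ?thesis
      using x by (simp add: homology_lie_hclass der_ext_def Lie_part_subset[OF word_lie_part])
  qed
  with d show "?d \<in> Der g k \<and> (\<forall>x\<in>PI g. ?d (homology_lie (hclass g x)) =
      lie_class g (k + 1) (f x \<otimes>\<^bsub>surface_group g\<^esub> inv\<^bsub>surface_group g\<^esub> x))" by blast
  fix d' assume d': "d' \<in> Der g k \<and> (\<forall>x\<in>PI g. d' (homology_lie (hclass g x)) =
      lie_class g (k + 1) (f x \<otimes>\<^bsub>surface_group g\<^esub> inv\<^bsub>surface_group g\<^esub> x))"
  show "d' = ?d"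
  proof (rule Der_eqI[of d' g k _ k])
    fix e assume e: "e \<in> gens g"
    have "d' (homology_lie (hclass g (pi_gen e))) = tau_gen g k f e"
      using d' pi_gen_carrier[OF e] by (simp add: tau_gen_def)
    then show "d' (lie_gen e) = ?d (lie_gen e)"
      using e by (simp add: homology_lie_hclass pi_gen_carrier der_ext_gen)
  qed (use d d' in auto)
qed

lemma tau'_Der: "f \<in> Johnson_A g k \<Longrightarrow> 1 \<le> k \<Longrightarrow> tau' g k f \<in> Der g k"
  by (simp add: tau'_eq der_ext_Der[OF tau_gen_part])

lemma dM_tau':
  assumes f: "f \<in> Johnson_A g k" and k: "1 \<le> k" and l: "lie_rep g m l x"
  shows "ord_ge (m + k + 1) (dM f x - lser (tau' g k f l))"
  using dM_lie_rep[OF assms] Lie_part_subset[OF conjunct2[OF lie_rep_homogeneous[OF l]]]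
  by (simp add: tau'_eq[OF f k] der_ext_def)

lemma tau'_eqI:
  assumes f: "f \<in> Johnson_A g k" and k: "1 \<le> k" and d: "d \<in> Der g k"
    and eq: "\<And>e. e \<in> gens g \<Longrightarrow> ord_ge (k + 2) (dM f (pi_gen e) - lser (d (lie_gen e)))"
  shows "tau' g k f = d"
proof (rule Der_eqI[OF tau'_Der[OF f k] d])
  fix e assume e: "e \<in> gens g"
  have "ord_ge (1 + k + 1) (dM f (pi_gen e) - lser (tau' g k f (lie_gen e)))"
    by (rule dM_tau'[OF f k lie_rep.gen[OF e]])
  then have "ord_ge (Suc (k + 1)) (dM f (pi_gen e) - lser (tau' g k f (lie_gen e)))" by simp
  moreover have "ord_ge (Suc (k + 1)) (dM f (pi_gen e) - lser (d (lie_gen e)))" using eq[OF e] by simp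
  ultimately have "ord_ge (Suc (k + 1)) ((dM f (pi_gen e) - lser (d (lie_gen e))) - (dM f (pi_gen e) - lser (tau' g k f (lie_gen e))))"
    using ord_ge_diff by blast
  then have "ord_ge (Suc (k + 1)) (lser (tau' g k f (lie_gen e)) - lser (d (lie_gen e)))" by simp
  then show "tau' g k f (lie_gen e) = d (lie_gen e)"
    using Der_gen_part[OF _ e] d tau'_Der[OF f k] by (intro lser_eqI[of _ g "k + 1"]) auto
qed

section \<open>The boundary element\<close>

lemma Alpha_Beta_gens: "i \<in> {1..g} \<Longrightarrow> Alpha i \<in> gens g" "i \<in> {1..g} \<Longrightarrow> Beta i \<in> gens g"
  by (simp_all add: gens_def)

text \<open>Each [beta_i^-1, alpha_i] has class -[b_i, a_i] = [a_i, b_i], and zeta is the inverse of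
  their product. This minus sign is the source of the signs in \<open>dM_zeta\<close> and in the
  comparison of two lifts.\<close>

lemma lie_rep_zeta: "lie_rep g 2 (- omega g) (zeta g)"
proof -
  let ?F = "foldr (\<lambda>i w. commutator (surface_group g) (inv\<^bsub>surface_group g\<^esub> pi_gen (Beta i)) (pi_gen (Alpha i))
                    \<otimes>\<^bsub>surface_group g\<^esub> w)"
  have "lie_rep g 2 (\<Sum>i\<leftarrow>xs. lie_br (lie_gen (Alpha i)) (lie_gen (Beta i))) (?F xs \<one>\<^bsub>surface_group g\<^esub>)"
    if "set xs \<subseteq> {1..g}" for xs
    using that
  proof (induction xs)
    case Nil
    then show ?case using lie_rep_zero_one[of 2 g] by simp
  next
    case (Cons i xs)
    then have "lie_rep g (1 + 1) (lie_br (- lie_gen (Beta i)) (lie_gen (Alpha i)))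
      (commutator (surface_group g) (inv\<^bsub>surface_group g\<^esub> pi_gen (Beta i)) (pi_gen (Alpha i)))"
      by (intro lie_rep.br lie_rep.neg lie_rep.gen Alpha_Beta_gens) simp_all
    moreover have "lie_br (- lie_gen (Beta i)) (lie_gen (Alpha i)) = lie_br (lie_gen (Alpha i)) (lie_gen (Beta i))"
      using lie_br_anti[of "lie_gen (Alpha i)" "lie_gen (Beta i)"] by (simp add: lie_br_minus)
    ultimately have "lie_rep g 2 (lie_br (lie_gen (Alpha i)) (lie_gen (Beta i)))
      (commutator (surface_group g) (inv\<^bsub>surface_group g\<^esub> pi_gen (Beta i)) (pi_gen (Alpha i)))"
      by (simp add: numeral_2_eq_2)
    from lie_rep.add[OF this Cons.IH] Cons.prems show ?case by simp
  qed
  moreover have "set [1..<Suc g] \<subseteq> {1..g}" by auto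
  ultimately have "lie_rep g 2 (- (\<Sum>i\<leftarrow>[1..<Suc g]. lie_br (lie_gen (Alpha i)) (lie_gen (Beta i)))) (zeta g)"
    unfolding zeta_def by (intro lie_rep.neg) blast
  moreover have "(\<Sum>i\<leftarrow>[1..<Suc g]. lie_br (lie_gen (Alpha i)) (lie_gen (Beta i))) = omega g"
    unfolding omega_def by (simp only: interv_sum_list_conv_sum_set_nat set_upt atLeastLessThanSuc_atLeastAtMost)
  ultimately show ?thesis by (simp only:)
qed

lemma zeta_carrier: "zeta g \<in> PI g"
  by (rule S.lower_central_carrier[OF lie_rep_Gam[OF lie_rep_zeta]])

lemma omega_part: "omega g \<in> Lie_part g 2"
  using lie_rep_homogeneous[OF lie_rep_zeta] Lie_part_minus by fastforce

lemma dM_zeta: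
  assumes f: "f \<in> Johnson_A g k" and k: "1 \<le> k"
  shows "ord_ge (k + 3) (dM f (zeta g) + lser (tau' g k f (omega g)))"
proof -
  have "tau' g k f (- omega g) = - tau' g k f (omega g)"
    by (rule Der_minus[OF tau'_Der[OF f k] Lie_part_subset[OF omega_part]])
  then show ?thesis
    using dM_tau'[OF f k lie_rep_zeta] by (simp add: lser_simps numeral_3_eq_3)
qed

lemma Johnson_G_iff:
  assumes f: "f \<in> Johnson_A g k" and k: "1 \<le> k"
  shows "f \<in> Johnson_G g k \<longleftrightarrow> tau' g k f \<in> Der_symp g k"
proof -
  have d: "tau' g k f \<in> Der g k" by (rule tau'_Der[OF f k])
  have part: "tau' g k f (omega g) \<in> Lie_part g (k + 2)"
    using Der_part[OF d omega_part] by (simp add: add.commute)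
  have "f \<in> Johnson_G g k \<longleftrightarrow> ord_ge (k + 3) (dM f (zeta g))"
    using f quotient_Gam_iff[OF Johnson_A_D(1)[OF f] zeta_carrier] by (simp add: Johnson_G_def)
  also have "\<dots> \<longleftrightarrow> ord_ge (k + 3) (lser (tau' g k f (omega g)))"
    using ord_ge_diff[OF dM_zeta[OF f k], of "dM f (zeta g)"] ord_ge_diff[OF dM_zeta[OF f k], of "lser (tau' g k f (omega g))"]
    by auto
  also have "\<dots> \<longleftrightarrow> tau' g k f (omega g) = 0"
    using lser_eqI[OF part Lie_part_zero] by (auto simp: lser_simps numeral_3_eq_3)
  finally show ?thesis using d by (simp add: Der_symp_def)
qed

lemma mu_eqI:
  assumes f: "f \<in> Johnson_A g k" and l: "l \<in> Lie_part g (k + 3)" and o: "ord_ge (k + 4) (dM f (zeta g) - lser l)"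
  shows "mu g k f = l"
  unfolding mu_def
  using lie_rep_dM_iff[OF Johnson_A_D(1)[OF f] zeta_carrier, of "k + 3" l] l o
  by (intro lie_class_eq) (simp add: eval_nat_numeral)

lemma mu_dM:
  assumes f: "f \<in> Johnson_G g k"
  shows "mu g k f \<in> Lie_part g (k + 3)" "ord_ge (k + 4) (dM f (zeta g) - lser (mu g k f))"
proof -
  have "f \<in> Johnson_A g k" using f by (simp add: Johnson_G_def)
  then have a: "f \<in> auto (surface_group g)" by (rule Johnson_A_D)
  have "lie_rep g (k + 3) (mu g k f) (f (zeta g) \<otimes>\<^bsub>surface_group g\<^esub> inv\<^bsub>surface_group g\<^esub> zeta g)"
    unfolding mu_def using f by (intro lie_rep_lie_class) (simp_all add: Johnson_G_def)
  then show "mu g k f \<in> Lie_part g (k + 3)" "ord_ge (k + 4) (dM f (zeta g) - lser (mu g k f))"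
    unfolding lie_rep_dM_iff[OF a zeta_carrier] by (simp_all add: eval_nat_numeral)
qed

section \<open>Cyclic coefficients of power series\<close>

lemma nc_mult_sum: "nc (s * t) u = (\<Sum>i\<le>length u. nc s (take i u) * nc t (drop i u))"
proof (induction u arbitrary: s)
  case (Cons x u)
  then show ?case by (simp add: nc_mult_Cons sum.atMost_Suc_shift del: sum.atMost_Suc)
qed (simp add: nc_mult_Nil)

definition rots :: "'a list \<Rightarrow> 'a list set" where
  "rots v = range (\<lambda>i. rotate i v)"

text \<open>The coefficient at the necklace of v. Summing over the set of rotations counts each
  distinct rotation once, also when v is a proper power, so these are coordinates on C(H) in its
  basis of necklaces.\<close>

definition cyc :: "'a list \<Rightarrow> 'a ncps \<Rightarrow> int" where
  "cyc v s = (\<Sum>u\<in>rots v. nc s u)"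

lemma finite_rots [simp]: "finite (rots v)"
proof (rule finite_subset)
  show "rots v \<subseteq> {w. set w \<subseteq> set v \<and> length w = length v}" by (auto simp: rots_def)
qed (simp add: finite_lists_length_eq)

lemma rots_self: "v \<in> rots v"
  unfolding rots_def by (rule range_eqI[of _ _ 0]) simp

lemma rots_rotate: "u \<in> rots v \<Longrightarrow> rotate i u \<in> rots v"
  by (auto simp: rots_def rotate_rotate)

lemma rots_length: "u \<in> rots v \<Longrightarrow> length u = length v"
  and rots_set: "u \<in> rots v \<Longrightarrow> set u = set v"
  by (auto simp: rots_def)

lemma cyc_simps [simp]:
  "cyc v 0 = 0" "cyc v (s + t) = cyc v s + cyc v t" "cyc v (s - t) = cyc v s - cyc v t" "cyc v (- s) = - cyc v s"
  by (simp_all add: cyc_def sum.distrib sum_subtractf sum_negf)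

lemma cyc_sum: "cyc v (sum f A) = (\<Sum>a\<in>A. cyc v (f a))"
  by (induction A rule: infinite_finite_induct) auto

lemma cyc_ord_ge: "ord_ge n s \<Longrightarrow> length v < n \<Longrightarrow> cyc v s = 0"
  unfolding cyc_def by (rule sum.neutral) (auto simp: ord_ge_def dest: rots_length)

text \<open>A rotation by i exchanges the two pieces of a splitting at i and turns it into a
  splitting at n - i. Rotations permute \<open>rots v\<close>, so the sum over all splittings is
  symmetric in the two series.\<close>

lemma cyc_mult_commute: "cyc v (s * t) = cyc v (t * s)"
proof -
  let ?n = "length v"
  have "cyc v (s * t) = (\<Sum>u\<in>rots v. \<Sum>i\<le>?n. nc s (take i u) * nc t (drop i u))"
    unfolding cyc_def nc_mult_sum by (rule sum.cong) (auto dest: rots_length)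
  also have "\<dots> = (\<Sum>i\<le>?n. \<Sum>u\<in>rots v. nc s (take i u) * nc t (drop i u))" by (rule sum.swap)
  also have "\<dots> = (\<Sum>i\<le>?n. \<Sum>u\<in>rots v. nc t (take (?n - i) u) * nc s (drop (?n - i) u))"
  proof (rule sum.cong[OF HOL.refl])
    fix i assume i: "i \<in> {..?n}"
    have rot: "rotate i u = drop i u @ take i u" if "length u = ?n" for u :: "'a list"
      using i that rotate_append[of "take i u" "drop i u"] by simp
    show "(\<Sum>u\<in>rots v. nc s (take i u) * nc t (drop i u)) = (\<Sum>u\<in>rots v. nc t (take (?n - i) u) * nc s (drop (?n - i) u))"
    proof (rule sum.reindex_bij_witness[of _ "rotate (?n - i)" "rotate i"])
      fix u assume u: "u \<in> rots v"
      show "rotate (?n - i) (rotate i u) = u" "rotate i (rotate (?n - i) u) = u"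
        using i rots_length[OF u] by (simp_all add: rotate_rotate)
      show "rotate i u \<in> rots v" "rotate (?n - i) u \<in> rots v" using u by (simp_all add: rots_rotate)
      show "nc t (take (?n - i) (rotate i u)) * nc s (drop (?n - i) (rotate i u)) = nc s (take i u) * nc t (drop i u)"
        using rots_length[OF u] by (simp add: rot)
    qed
  qed
  also have "\<dots> = (\<Sum>i\<le>?n. \<Sum>u\<in>rots v. nc t (take i u) * nc s (drop i u))"
    by (rule sum.reindex_bij_witness[of _ "\<lambda>i. ?n - i" "\<lambda>i. ?n - i"]) auto
  also have "\<dots> = (\<Sum>u\<in>rots v. \<Sum>i\<le>?n. nc t (take i u) * nc s (drop i u))" by (rule sum.swap)
  also have "\<dots> = cyc v (t * s)"
    unfolding cyc_def nc_mult_sum by (rule sum.cong) (auto dest: rots_length)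
  finally show ?thesis .
qed

lift_definition euler :: "'a ncps \<Rightarrow> 'a ncps" is "\<lambda>s w. int (length w) * s w" .

lemma nc_euler [simp]: "nc (euler s) w = int (length w) * nc s w"
  by transfer simp

lemma euler_simps: "euler 0 = 0" "euler 1 = 0" "euler (s + t) = euler s + euler t"
  "euler (s - t) = euler s - euler t" "euler (- s) = - euler s"
  by (auto intro!: ncps_eqI simp: algebra_simps nc_one)

lemma euler_sum: "euler (sum f A) = (\<Sum>a\<in>A. euler (f a))"
  by (induction A rule: infinite_finite_induct) (auto simp: euler_simps)

lemma euler_mult: "euler (s * t) = euler s * t + s * euler t"
proof (rule ncps_eqI)
  fix w
  show "nc (euler (s * t)) w = nc (euler s * t + s * euler t) w"
    unfolding nc_euler nc_add nc_mult_sum sum_distrib_left sum.distrib[symmetric]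
    by (rule sum.cong) (auto simp: algebra_simps of_nat_diff)
qed

lemma ord_ge_euler: "ord_ge n s \<Longrightarrow> ord_ge n (euler s)"
  by (simp add: ord_ge_def)

section \<open>Logarithmic derivatives of matrices\<close>

definition mmult :: "'i set \<Rightarrow> ('i \<Rightarrow> 'i \<Rightarrow> 'a ncps) \<Rightarrow> ('i \<Rightarrow> 'i \<Rightarrow> 'a ncps) \<Rightarrow> 'i \<Rightarrow> 'i \<Rightarrow> 'a ncps" where
  "mmult I P Q i j = (\<Sum>l\<in>I. P i l * Q l j)"

definition mone :: "'i \<Rightarrow> 'i \<Rightarrow> 'a ncps" where
  "mone i j = (if i = j then 1 else 0)"

definition minverse :: "'i set \<Rightarrow> ('i \<Rightarrow> 'i \<Rightarrow> 'a ncps) \<Rightarrow> ('i \<Rightarrow> 'i \<Rightarrow> 'a ncps) \<Rightarrow> bool" where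
  "minverse I P Q \<longleftrightarrow> (\<forall>i\<in>I. \<forall>j\<in>I. mmult I P Q i j = mone i j \<and> mmult I Q P i j = mone i j)"

text \<open>The trace of Q E(P), meant for Q the inverse of P: a logarithmic derivative of the
  determinant that avoids the determinant.\<close>

definition dlog :: "'i set \<Rightarrow> ('i \<Rightarrow> 'i \<Rightarrow> 'a ncps) \<Rightarrow> ('i \<Rightarrow> 'i \<Rightarrow> 'a ncps) \<Rightarrow> 'a ncps" where
  "dlog I P Q = (\<Sum>i\<in>I. \<Sum>j\<in>I. Q i j * euler (P j i))"

lemma mmult_assoc: "mmult I (mmult I A B) C i j = mmult I A (mmult I B C) i j"
proof -
  have "mmult I (mmult I A B) C i j = (\<Sum>l\<in>I. \<Sum>m\<in>I. A i m * B m l * C l j)"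
    by (simp add: mmult_def sum_distrib_right)
  also have "\<dots> = (\<Sum>m\<in>I. \<Sum>l\<in>I. A i m * B m l * C l j)" by (rule sum.swap)
  also have "\<dots> = mmult I A (mmult I B C) i j" by (simp add: mmult_def sum_distrib_left mult.assoc)
  finally show ?thesis .
qed

lemma mmult_cong:
  "(\<And>l. l \<in> I \<Longrightarrow> A i l = A' i l) \<Longrightarrow> (\<And>l. l \<in> I \<Longrightarrow> B l j = B' l j) \<Longrightarrow> mmult I A B i j = mmult I A' B' i j"
  unfolding mmult_def by (rule sum.cong) auto

lemma mmult_mone:
  assumes "finite I"
  shows "i \<in> I \<Longrightarrow> mmult I mone A i j = A i j" "j \<in> I \<Longrightarrow> mmult I A mone i j = A i j"
proof -
  assume i: "i \<in> I"
  have "mmult I mone A i j = (\<Sum>l\<in>I. if i = l then A l j else 0)"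
    unfolding mmult_def mone_def by (rule sum.cong) auto
  then show "mmult I mone A i j = A i j" using assms i by simp
next
  assume j: "j \<in> I"
  have "mmult I A mone i j = (\<Sum>l\<in>I. if l = j then A i l else 0)"
    unfolding mmult_def mone_def by (rule sum.cong) auto
  then show "mmult I A mone i j = A i j" using assms j by simp
qed

lemma mmult_inverse_left:
  assumes I: "finite I" and P: "minverse I P Q" and i: "i \<in> I"
  shows "mmult I P (mmult I Q A) i j = A i j" "mmult I Q (mmult I P A) i j = A i j"
  unfolding mmult_assoc[symmetric]
  using mmult_cong[of I "mmult I P Q" i mone A j A] mmult_cong[of I "mmult I Q P" i mone A j A]
    mmult_mone(1)[OF I i, of A j] P i by (simp_all add: minverse_def)

lemma minverse_mult:
  assumes I: "finite I" and P: "minverse I P Q" and P': "minverse I P' Q'"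
  shows "minverse I (mmult I P P') (mmult I Q' Q)"
  unfolding minverse_def
proof (intro ballI conjI)
  fix i j assume ij: "i \<in> I" "j \<in> I"
  show "mmult I (mmult I P P') (mmult I Q' Q) i j = mone i j"
    unfolding mmult_assoc
    using mmult_cong[of I P i P "mmult I P' (mmult I Q' Q)" j Q] mmult_inverse_left(1)[OF I P', of _ Q j] P ij
    by (simp add: minverse_def)
  show "mmult I (mmult I Q' Q) (mmult I P P') i j = mone i j"
    unfolding mmult_assoc
    using mmult_cong[of I Q' i Q' "mmult I Q (mmult I P P')" j P'] mmult_inverse_left(2)[OF I P, of _ P' j] P' ij
    by (simp add: minverse_def)
qed

text \<open>Leibniz splits E(P P') into E(P) P' + P E(P'). In the second part Q P cancels at once.
  In the first part P' at one end meets Q' at the other only after a cyclic rotation, which is why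
  additivity is claimed for cyclic coefficients rather than for the series.\<close>

lemma cyc_dlog_mult:
  assumes I: "finite I" and P: "minverse I P Q" and P': "minverse I P' Q'"
  shows "cyc v (dlog I (mmult I P P') (mmult I Q' Q)) = cyc v (dlog I P Q) + cyc v (dlog I P' Q')"
proof -
  have "cyc v (dlog I (mmult I P P') (mmult I Q' Q)) =
      (\<Sum>i\<in>I. cyc v (mmult I (mmult I Q' Q) (mmult I (\<lambda>a b. euler (P a b)) P') i i))
    + (\<Sum>i\<in>I. cyc v (mmult I (mmult I Q' Q) (mmult I P (\<lambda>a b. euler (P' a b))) i i))"
    unfolding dlog_def
    by (simp add: mmult_def[of I "mmult I Q' Q"] mmult_def[of I P P'] euler_sum euler_mult sum.distrib cyc_sum
        distrib_left mmult_def[of I "\<lambda>a b. euler (P a b)"] mmult_def[of I P "\<lambda>a b. euler (P' a b)"])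
  also have "(\<Sum>i\<in>I. cyc v (mmult I (mmult I Q' Q) (mmult I P (\<lambda>a b. euler (P' a b))) i i))
      = (\<Sum>i\<in>I. cyc v (mmult I Q' (\<lambda>a b. euler (P' a b)) i i))"
  proof (rule sum.cong[OF HOL.refl])
    fix i assume "i \<in> I"
    have "mmult I (mmult I Q' Q) (mmult I P (\<lambda>a b. euler (P' a b))) i i = mmult I Q' (\<lambda>a b. euler (P' a b)) i i"
      unfolding mmult_assoc[of I Q' Q] by (rule mmult_cong) (simp_all add: mmult_inverse_left(2)[OF I P])
    then show "cyc v (mmult I (mmult I Q' Q) (mmult I P (\<lambda>a b. euler (P' a b))) i i) =
      cyc v (mmult I Q' (\<lambda>a b. euler (P' a b)) i i)" by simp
  qed
  also have "(\<Sum>i\<in>I. cyc v (mmult I (mmult I Q' Q) (mmult I (\<lambda>a b. euler (P a b)) P') i i))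
      = (\<Sum>i\<in>I. \<Sum>l\<in>I. cyc v (Q' i l * mmult I (mmult I Q (\<lambda>a b. euler (P a b))) P' l i))"
    unfolding mmult_assoc mmult_def[of I Q'] cyc_sum ..
  also have "\<dots> = (\<Sum>i\<in>I. \<Sum>l\<in>I. \<Sum>m\<in>I. cyc v (Q' i l * (mmult I Q (\<lambda>a b. euler (P a b)) l m * P' m i)))"
    by (simp add: mmult_def[of I _ P'] sum_distrib_left cyc_sum)
  also have "\<dots> = (\<Sum>i\<in>I. \<Sum>l\<in>I. \<Sum>m\<in>I. cyc v (P' m i * Q' i l * mmult I Q (\<lambda>a b. euler (P a b)) l m))"
    by (intro sum.cong HOL.refl) (metis cyc_mult_commute mult.assoc)
  also have "\<dots> = (\<Sum>l\<in>I. \<Sum>i\<in>I. \<Sum>m\<in>I. cyc v (P' m i * Q' i l * mmult I Q (\<lambda>a b. euler (P a b)) l m))"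
    by (rule sum.swap)
  also have "\<dots> = (\<Sum>l\<in>I. \<Sum>m\<in>I. \<Sum>i\<in>I. cyc v (P' m i * Q' i l * mmult I Q (\<lambda>a b. euler (P a b)) l m))"
    by (rule sum.cong[OF HOL.refl], rule sum.swap)
  also have "\<dots> = (\<Sum>l\<in>I. \<Sum>m\<in>I. cyc v (mmult I P' Q' m l * mmult I Q (\<lambda>a b. euler (P a b)) l m))"
    by (simp add: mmult_def[of I P'] sum_distrib_right cyc_sum)
  also have "\<dots> = (\<Sum>l\<in>I. \<Sum>m\<in>I. if m = l then cyc v (mmult I Q (\<lambda>a b. euler (P a b)) l m) else 0)"
    using P' by (intro sum.cong HOL.refl) (auto simp: minverse_def mone_def)
  also have "\<dots> = (\<Sum>l\<in>I. cyc v (mmult I Q (\<lambda>a b. euler (P a b)) l l))"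
    using I by simp
  finally show ?thesis by (simp add: dlog_def mmult_def cyc_sum)
qed

lemma dlog_cong:
  "(\<And>i j. i \<in> I \<Longrightarrow> j \<in> I \<Longrightarrow> P i j = P' i j \<and> Q i j = Q' i j) \<Longrightarrow> dlog I P Q = dlog I P' Q'"
  unfolding dlog_def by (intro sum.cong) auto

section \<open>Elementary matrices\<close>

lift_definition mono :: "'a list \<Rightarrow> int \<Rightarrow> 'a ncps" is "\<lambda>w c u. if u = w then c else 0" .

lemma nc_mono: "nc (mono w c) u = (if u = w then c else 0)"
  by transfer simp

definition wpow :: "nat \<Rightarrow> 'a list \<Rightarrow> 'a list" where
  "wpow m w = concat (replicate m w)"

lemma wpow_simps [simp]: "wpow 0 w = []" "wpow (Suc m) w = w @ wpow m w"
  by (simp_all add: wpow_def)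

lemma wpow_add: "wpow (m + n) w = wpow m w @ wpow n w"
  by (induction m) auto

lemma wpow_Suc': "wpow (Suc m) w = wpow m w @ w"
  using wpow_add[of m 1 w] by simp

lemma length_wpow [simp]: "length (wpow m w) = m * length w"
  by (induction m) auto

lemma wpow_mult: "wpow (m * n) w = wpow m (wpow n w)"
  by (induction m) (auto simp: wpow_add)

lemma rotate_wpow: "rotate i (wpow m w) = wpow m (rotate i w)"
proof -
  have sw: "wpow n (u @ s) @ u = u @ wpow n (s @ u)" for n and u s :: "'a list"
    by (induction n) auto
  have r1: "rotate1 (wpow m w) = wpow m (rotate1 w)" for w :: "'a list"
  proof (cases w)
    case (Cons x v)
    show ?thesis
    proof (cases m)
      case (Suc n)
      have "rotate1 (wpow m w) = v @ (wpow n ([x] @ v) @ [x])" using Cons Suc by simp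
      also have "\<dots> = v @ [x] @ wpow n (v @ [x])" using sw[of n "[x]" v] by simp
      also have "\<dots> = wpow m (rotate1 w)" using Cons Suc by simp
      finally show ?thesis .
    qed simp
  qed (simp add: wpow_def)
  show ?thesis by (induction i) (simp_all add: r1)
qed

lemma wpow_rots: "u \<in> rots v \<Longrightarrow> wpow m u \<in> rots (wpow m v)"
  by (auto simp: rots_def rotate_wpow[symmetric])

lemma rots_wpowD: "u \<in> rots (wpow m v) \<Longrightarrow> \<exists>y\<in>rots v. u = wpow m y"
  by (auto simp: rots_def rotate_wpow)

lemma wpow_eq_wpow:
  assumes "wpow p y = wpow p z" "0 < p"
  shows "y = z"
proof -
  have "length (wpow p y) = length (wpow p z)" using assms by simp
  then have "length y = length z" using assms(2) by simp
  moreover obtain q where "p = Suc q" using assms(2) by (cases p) auto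
  ultimately show ?thesis using assms(1) by simp
qed

text \<open>The inverse of 1 + c w, a geometric series with coefficient (-c)^m at w^m. The exponent
  m is recovered from lengths, which presupposes a nonempty w.\<close>

definition geo :: "'a list \<Rightarrow> int \<Rightarrow> 'a ncps" where
  "geo w c = Abs_ncps (\<lambda>u. if \<exists>m. u = wpow m w then (- c) ^ (length u div length w) else 0)"

lemma nc_geo: "nc (geo w c) u = (if \<exists>m. u = wpow m w then (- c) ^ (length u div length w) else 0)"
  by (simp add: geo_def Abs_ncps_inverse)

lemma nc_geo_wpow: "w \<noteq> [] \<Longrightarrow> nc (geo w c) (wpow m w) = (- c) ^ m"
  by (auto simp: nc_geo)

lemma nc_mult_mono: "nc (f * mono w c) u = (if \<exists>a. u = a @ w then nc f (take (length u - length w) u) * c else 0)"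
proof -
  have "nc (f * mono w c) u = (\<Sum>i\<le>length u. nc f (take i u) * (if drop i u = w then c else 0))"
    by (simp add: nc_mult_sum nc_mono)
  also have "\<dots> = (\<Sum>i\<le>length u. if i = length u - length w then (if \<exists>a. u = a @ w then nc f (take i u) * c else 0) else 0)"
  proof (rule sum.cong[OF HOL.refl])
    fix i assume i: "i \<in> {..length u}"
    have "drop i u = w \<longleftrightarrow> i = length u - length w \<and> (\<exists>a. u = a @ w)"
    proof
      assume d: "drop i u = w"
      then have "i = length u - length w" using i by auto
      with d show "i = length u - length w \<and> (\<exists>a. u = a @ w)" by (metis append_take_drop_id)
    qed auto
    then show "nc f (take i u) * (if drop i u = w then c else 0) =
      (if i = length u - length w then (if \<exists>a. u = a @ w then nc f (take i u) * c else 0) else 0)" by auto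
  qed
  also have "\<dots> = (if \<exists>a. u = a @ w then nc f (take (length u - length w) u) * c else 0)"
    by (simp add: sum.delta)
  finally show ?thesis .
qed

lemma nc_mono_mult: "nc (mono w c * f) u = (if \<exists>a. u = w @ a then c * nc f (drop (length w) u) else 0)"
proof -
  have "nc (mono w c * f) u = (\<Sum>i\<le>length u. (if take i u = w then c else 0) * nc f (drop i u))"
    by (simp add: nc_mult_sum nc_mono)
  also have "\<dots> = (\<Sum>i\<le>length u. if i = length w then (if \<exists>a. u = w @ a then c * nc f (drop i u) else 0) else 0)"
  proof (rule sum.cong[OF HOL.refl])
    fix i assume i: "i \<in> {..length u}"
    have "take i u = w \<longleftrightarrow> i = length w \<and> (\<exists>a. u = w @ a)"
    proof
      assume d: "take i u = w"
      then have "i = length w" using i by auto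
      with d show "i = length w \<and> (\<exists>a. u = w @ a)" by (metis append_take_drop_id)
    qed auto
    then show "(if take i u = w then c else 0) * nc f (drop i u) =
      (if i = length w then (if \<exists>a. u = w @ a then c * nc f (drop i u) else 0) else 0)" by auto
  qed
  also have "\<dots> = (if \<exists>a. u = w @ a then c * nc f (drop (length w) u) else 0)"
    by (auto simp: sum.delta)
  finally show ?thesis .
qed

lemma nc_geo_mono:
  assumes w: "w \<noteq> []"
  shows "nc (geo w c * mono w b) u = (if \<exists>m. u = wpow (Suc m) w then b * (- c) ^ (length u div length w - 1) else 0)"
    "nc (mono w b * geo w c) u = (if \<exists>m. u = wpow (Suc m) w then b * (- c) ^ (length u div length w - 1) else 0)"
proof -
  have 1: "(\<exists>a. u = a @ w \<and> (\<exists>m. a = wpow m w)) \<longleftrightarrow> (\<exists>m. u = wpow (Suc m) w)" by (auto simp only: wpow_Suc')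
  have 2: "(\<exists>a. u = w @ a \<and> (\<exists>m. a = wpow m w)) \<longleftrightarrow> (\<exists>m. u = wpow (Suc m) w)" by auto
  have l: "(length u - length w) div length w = length u div length w - 1"
    using w by (cases "length u < length w") (simp_all add: le_div_geq)
  show "nc (geo w c * mono w b) u = (if \<exists>m. u = wpow (Suc m) w then b * (- c) ^ (length u div length w - 1) else 0)"
    unfolding 1[symmetric] nc_mult_mono using l by (auto simp: nc_geo)
  show "nc (mono w b * geo w c) u = (if \<exists>m. u = wpow (Suc m) w then b * (- c) ^ (length u div length w - 1) else 0)"
    unfolding 2[symmetric] nc_mono_mult using l by (auto simp: nc_geo)
qed

lemma geo_inverse:
  assumes w: "w \<noteq> []"
  shows "(1 + mono w c) * geo w c = 1" "geo w c * (1 + mono w c) = 1"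
proof -
  have "nc (geo w c) u + (if \<exists>m. u = wpow (Suc m) w then c * (- c) ^ (length u div length w - 1) else 0) = nc 1 u" for u
  proof (cases "\<exists>m. u = wpow m w")
    case True
    then obtain m where u: "u = wpow m w" by auto
    show ?thesis
    proof (cases m)
      case 0
      then have "\<not> (\<exists>m. u = wpow (Suc m) w)" using u w by auto
      then show ?thesis using 0 u w nc_geo_wpow[OF w, of c 0] by (simp add: nc_one)
    next
      case (Suc n)
      then have "\<exists>m. u = wpow (Suc m) w" using u by blast
      moreover have "u \<noteq> []" using Suc u w by simp
      moreover have "nc (geo w c) u = (- c) ^ Suc n" using u Suc nc_geo_wpow[OF w] by blast
      moreover have "length u div length w - 1 = n" using u Suc w by simp
      ultimately show ?thesis by (simp add: nc_one)
    qed
  next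
    case False
    then have "u \<noteq> []" by (metis wpow_simps(1))
    moreover have "\<not> (\<exists>m. u = wpow (Suc m) w)" using False by blast
    ultimately show ?thesis using False by (simp add: nc_geo nc_one)
  qed
  then show "(1 + mono w c) * geo w c = 1" "geo w c * (1 + mono w c) = 1"
    by (auto intro!: ncps_eqI simp: distrib_left distrib_right nc_geo_mono[OF w] simp del: wpow_simps)
qed

definition elem_mat :: "'i \<Rightarrow> 'i \<Rightarrow> 'a ncps \<Rightarrow> 'i \<Rightarrow> 'i \<Rightarrow> 'a ncps" where
  "elem_mat a b h i j = mone i j + (if i = a \<and> j = b then h else 0)"

text \<open>What the inverse of 1 + c w E_ab adds to the identity at the place (a, b): for distinct
  a and b the matrix E_ab squares to zero and only the sign changes, while on the diagonal a
  geometric series appears.\<close>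

definition elem_coinv :: "'i \<Rightarrow> 'i \<Rightarrow> 'a list \<Rightarrow> int \<Rightarrow> 'a ncps" where
  "elem_coinv a b w c = (if a = b then geo w c - 1 else - mono w c)"

lemma mmult_elem:
  assumes I: "finite I" and ab: "a \<in> I" "b \<in> I"
  shows "i \<in> I \<Longrightarrow> mmult I (elem_mat a b h) P i j = P i j + (if i = a then h * P b j else 0)"
    "j \<in> I \<Longrightarrow> mmult I P (elem_mat a b h) i j = P i j + (if j = b then P i a * h else 0)"
proof -
  assume i: "i \<in> I"
  have "mmult I (elem_mat a b h) P i j = mmult I mone P i j + (\<Sum>l\<in>I. if l = b then (if i = a then h * P l j else 0) else 0)"
    unfolding mmult_def elem_mat_def sum.distrib[symmetric] by (rule sum.cong) (auto simp: distrib_right)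
  then show "mmult I (elem_mat a b h) P i j = P i j + (if i = a then h * P b j else 0)"
    using I ab mmult_mone(1)[OF I i] by simp
next
  assume j: "j \<in> I"
  have "mmult I P (elem_mat a b h) i j = mmult I P mone i j + (\<Sum>l\<in>I. if l = a then (if j = b then P i l * h else 0) else 0)"
    unfolding mmult_def elem_mat_def sum.distrib[symmetric] by (rule sum.cong) (auto simp: distrib_left)
  then show "mmult I P (elem_mat a b h) i j = P i j + (if j = b then P i a * h else 0)"
    using I ab mmult_mone(2)[OF I j] by simp
qed

lemma elem_minverse:
  assumes I: "finite I" and ab: "a \<in> I" "b \<in> I" and w: "w \<noteq> []"
  shows "minverse I (elem_mat a b (mono w c)) (elem_mat a b (elem_coinv a b w c))"
proof -
  have "mono w c + elem_coinv a b w c + (if a = b then mono w c * elem_coinv a b w c else 0) = 0"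
    "mono w c + elem_coinv a b w c + (if a = b then elem_coinv a b w c * mono w c else 0) = 0"
    using geo_inverse[OF w, of c] by (auto simp: elem_coinv_def algebra_simps)
  then show ?thesis
    unfolding minverse_def
    by (auto simp: mmult_elem[OF I ab]) (auto simp: elem_mat_def mone_def algebra_simps)
qed

text \<open>For distinct a and b the trace vanishes, as the inverse has no entry at (b, a). For a =
  b it is (1 + c w)^-1 times |w| c w, the sum of all |w| c (-c)^n w^(n+1), and the length of v
  leaves a single power of w to consider.\<close>

lemma dlog_elem:
  assumes I: "finite I" and ab: "a \<in> I" "b \<in> I" and w: "w \<noteq> []"
  shows "cyc v (dlog I (elem_mat a b (mono w c)) (elem_mat a b (elem_coinv a b w c))) =
    (if a = b \<and> (\<exists>m. wpow (Suc m) w \<in> rots v) then int (length w) * c * (- c) ^ (length v div length w - 1) else 0)"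
proof -
  have e: "euler (elem_mat a b (mono w c) j i) = (if j = a \<and> i = b then mono w (int (length w) * c) else 0)" for i j
    by (auto intro!: ncps_eqI simp: elem_mat_def euler_simps mone_def nc_mono nc_one)
  have "dlog I (elem_mat a b (mono w c)) (elem_mat a b (elem_coinv a b w c)) =
     (\<Sum>i\<in>I. if i = b then (\<Sum>j\<in>I. if j = a then elem_mat a b (elem_coinv a b w c) i j * mono w (int (length w) * c) else 0) else 0)"
    unfolding dlog_def e by (rule sum.cong[OF HOL.refl]) (auto intro!: sum.cong)
  also have "\<dots> = elem_mat a b (elem_coinv a b w c) b a * mono w (int (length w) * c)"
    using I ab by simp
  also have "\<dots> = (if a = b then geo w c * mono w (int (length w) * c) else 0)"
    by (auto simp: elem_mat_def elem_coinv_def mone_def)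
  finally have d: "dlog I (elem_mat a b (mono w c)) (elem_mat a b (elem_coinv a b w c)) =
    (if a = b then geo w c * mono w (int (length w) * c) else 0)" .
  show ?thesis
  proof (cases "a = b \<and> (\<exists>m. wpow (Suc m) w \<in> rots v)")
    case True
    then obtain m where m: "wpow (Suc m) w \<in> rots v" by blast
    have lv: "length v = Suc m * length w" using rots_length[OF m] length_wpow[of "Suc m" w] by simp
    then have dv: "length v div length w - 1 = m" using w by simp
    have "nc (geo w c * mono w (int (length w) * c)) u =
        (if u = wpow (Suc m) w then int (length w) * c * (- c) ^ (length v div length w - 1) else 0)"
      if u: "u \<in> rots v" for u
    proof -
      have "(\<exists>n. u = wpow (Suc n) w) \<longleftrightarrow> u = wpow (Suc m) w"
      proof
        assume "\<exists>n. u = wpow (Suc n) w"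
        then obtain n where n: "u = wpow (Suc n) w" by blast
        then have "Suc n * length w = Suc m * length w"
          using rots_length[OF u] lv length_wpow[of "Suc n" w] by simp
        then have "Suc n = Suc m" using w by (simp only: mult_cancel2) simp
        with n show "u = wpow (Suc m) w" by simp
      qed blast
      then show ?thesis unfolding nc_geo_mono(1)[OF w] using rots_length[OF u] by (simp add: dv[simplified] del: wpow_simps)
    qed
    then have "cyc v (geo w c * mono w (int (length w) * c)) =
       (\<Sum>u\<in>rots v. if u = wpow (Suc m) w then int (length w) * c * (- c) ^ (length v div length w - 1) else 0)"
      unfolding cyc_def by (rule sum.cong[OF HOL.refl])
    also have "\<dots> = int (length w) * c * (- c) ^ (length v div length w - 1)" using m by (simp del: wpow_simps)
    finally show ?thesis using True d by simp
  next
    case False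
    have "cyc v (geo w c * mono w (int (length w) * c)) = 0" if "a = b"
      unfolding cyc_def using False that
      by (intro sum.neutral) (auto simp: nc_geo_mono(1)[OF w] simp del: wpow_simps)
    then show ?thesis unfolding if_not_P[OF False] d by simp
  qed
qed

section \<open>A Dwork congruence for logarithmic derivatives\<close>

lemma binomial_prime_dvd:
  assumes p: "prime (p :: nat)" and i: "i \<noteq> 0" "i \<noteq> p"
  shows "int p dvd int (p choose i)"
proof (cases "i < p")
  case True
  then have "p dvd (p choose i)" using dvd_choose_prime[OF True i(1) _ p] prime_gt_0_nat[OF p] by simp
  then show ?thesis by simp
next
  case False
  with i show ?thesis by (simp add: binomial_eq_0)
qed

lemma fermat_int: "prime (p :: nat) \<Longrightarrow> int p dvd a ^ p - a"
proof -
  assume p: "prime p"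
  have p0: "0 < p" using prime_gt_0_nat[OF p] .
  have step: "int p dvd (a + 1) ^ p - a ^ p - 1" for a
  proof -
    have "(a + 1) ^ p = (\<Sum>k\<le>p. int (p choose k) * a ^ k)" by (simp add: binomial_ring)
    also have "\<dots> = (\<Sum>k\<in>{..p} - {0, p}. int (p choose k) * a ^ k) + (\<Sum>k\<in>{0, p}. int (p choose k) * a ^ k)"
      by (rule sum.subset_diff) auto
    finally have "(a + 1) ^ p - a ^ p - 1 = (\<Sum>k\<in>{..p} - {0, p}. int (p choose k) * a ^ k)"
      using p0 by simp
    moreover have "int p dvd (\<Sum>k\<in>{..p} - {0, p}. int (p choose k) * a ^ k)"
      by (intro dvd_sum dvd_mult2 binomial_prime_dvd[OF p]) auto
    ultimately show ?thesis by simp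
  qed
  show ?thesis
  proof (induction a rule: int_induct[where k = 0])
    case base
    then show ?case using p0 by (simp add: power_0_left)
  next
    case (step1 i)
    from dvd_add[OF step[of i] step1(2)] show ?case by (simp add: algebra_simps)
  next
    case (step2 i)
    from dvd_diff[OF step2(2) step[of "i - 1"]] show ?case by (simp add: algebra_simps)
  qed
qed

definition sup_on :: "'a set \<Rightarrow> 'a ncps \<Rightarrow> bool" where
  "sup_on X f \<longleftrightarrow> (\<forall>w. nc f w \<noteq> 0 \<longrightarrow> set w \<subseteq> X)"

lemma sup_on_add: "sup_on X f \<Longrightarrow> sup_on X h \<Longrightarrow> sup_on X (f + h)"
  unfolding sup_on_def by (metis add_0 nc_add)

lemma sup_on_mult: "sup_on X f \<Longrightarrow> sup_on X h \<Longrightarrow> sup_on X (f * h)"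
  unfolding sup_on_def by (metis Un_least nc_mult_nonzero set_append)

lemma set_wpow: "set (wpow m w) \<subseteq> set w"
  by (induction m) auto

lemma sup_on_elem_coinv: "set w \<subseteq> X \<Longrightarrow> sup_on X (elem_coinv a b w c)"
  using set_wpow[of _ w] by (fastforce simp: sup_on_def elem_coinv_def nc_mono nc_geo nc_one split: if_splits)

lemma elem_coinv_lead:
  assumes w: "w \<noteq> []"
  shows "ord_ge (length w + 1) (elem_coinv a b w c + mono w c)"
proof (cases "a = b")
  case True
  have "nc (geo w c) u - nc 1 u + nc (mono w c) u = 0" if u: "length u \<le> length w" for u
  proof (cases "\<exists>m. u = wpow m w")
    case True
    then obtain m where m: "u = wpow m w" by blast
    then have "m \<le> 1" using u w by simp
    then consider "m = 0" | "m = 1" by linarith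
    then show ?thesis
      by cases (use m w nc_geo_wpow[OF w, of c m] in \<open>auto simp: nc_mono nc_one\<close>)
  next
    case False
    moreover have "wpow 0 w = []" "wpow 1 w = w" by simp_all
    ultimately have "u \<noteq> []" "u \<noteq> w" by metis+
    then show ?thesis using False by (simp add: nc_geo nc_mono nc_one)
  qed
  then show ?thesis using True by (simp add: ord_ge_def elem_coinv_def less_Suc_eq_le)
qed (simp add: elem_coinv_def)

text \<open>Three cases on the diagonal. If w^m is a rotation of v, the two coefficients are -|w|
  (-c)^(p m) and -|w| (-c)^m, congruent by Fermat. If only v^p has a power of w among its rotations,
  then p divides |w|, which is a factor of the coefficient. Otherwise both coefficients
  vanish.\<close>

lemma dwork_elem:
  assumes I: "finite I" and ab: "a \<in> I" "b \<in> I" and w: "w \<noteq> []" and p: "prime p"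
  shows "int p dvd cyc (wpow p v) (dlog I (elem_mat a b (mono w c)) (elem_mat a b (elem_coinv a b w c)))
    - cyc v (dlog I (elem_mat a b (mono w c)) (elem_mat a b (elem_coinv a b w c)))"
proof (cases "a = b")
  case True
  let ?L = "length w"
  have p0: "0 < p" using prime_gt_0_nat[OF p] .
  show ?thesis
  proof (cases "\<exists>m. wpow (Suc m) w \<in> rots v")
    case A: True
    then obtain m where m: "wpow (Suc m) w \<in> rots v" by blast
    have lv: "length v = Suc m * ?L" using rots_length[OF m] length_wpow[of "Suc m" w] by simp
    obtain m' where m': "p * Suc m = Suc m'" using p0 by (cases "p * Suc m") auto
    have "wpow (Suc m') w \<in> rots (wpow p v)"
      using wpow_rots[OF m, of p] unfolding wpow_mult[symmetric] m' .
    then have B: "\<exists>m. wpow (Suc m) w \<in> rots (wpow p v)" by blast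
    have d: "length v div ?L - 1 = m" using lv w by simp
    have "length (wpow p v) = Suc m' * ?L" unfolding length_wpow lv m'[symmetric] by (simp only: mult.assoc)
    then have d': "length (wpow p v) div ?L - 1 = m'" using w by simp
    have "int ?L * c * (- c) ^ m' - int ?L * c * (- c) ^ m = - int ?L * ((- c) ^ Suc m' - (- c) ^ Suc m)"
      by (simp add: algebra_simps)
    also have "(- c) ^ Suc m' = ((- c) ^ Suc m) ^ p" by (metis m' mult.commute power_mult)
    finally show ?thesis
      unfolding dlog_elem[OF I ab w] using True A B d d' fermat_int[OF p, of "(- c) ^ Suc m"] by simp
  next
    case A: False
    show ?thesis
    proof (cases "\<exists>m. wpow (Suc m) w \<in> rots (wpow p v)")
      case B: True
      then obtain m y where m: "wpow (Suc m) w = wpow p y" "y \<in> rots v" using rots_wpowD by metis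
      have len: "Suc m * ?L = p * length y" using arg_cong[OF m(1), of length] unfolding length_wpow .
      \<comment> \<open>If p divided the exponent, extracting p-th roots would exhibit the rotation
        y of v as a power of w, contrary to the case. Comparing lengths then shows that p divides
        |w|.\<close>
      have "\<not> p dvd Suc m"
      proof
        assume "p dvd Suc m"
        then obtain q where q: "Suc m = p * q" by blast
        then have "wpow p (wpow q w) = wpow p y" using m unfolding wpow_mult[symmetric] by simp
        from wpow_eq_wpow[OF this p0] have "wpow q w = y" .
        moreover obtain q' where "q = Suc q'" using q by (cases q) auto
        ultimately show False using A m(2) by blast
      qed
      moreover have "p dvd Suc m * ?L" unfolding len by simp
      ultimately have "p dvd ?L" using p prime_dvd_mult_iff by blast
      then have "int p dvd int ?L" by simp
      then show ?thesis unfolding dlog_elem[OF I ab w] using A by simp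
    next
      case False
      with A show ?thesis unfolding dlog_elem[OF I ab w] by simp
    qed
  qed
qed (simp add: dlog_elem[OF I ab w])

text \<open>A matrix congruent to the identity is, in each degree, a finite product of elementary
  matrices \<open>1 + c w E\<^sub>a\<^sub>b\<close>, which are split off one at a time.\<close>

lemma dwork_congruence:
  fixes P Q :: "'i \<Rightarrow> 'i \<Rightarrow> 'a ncps"
  assumes I: "finite I" and X: "finite X" and p: "prime p" and j: "1 \<le> j"
    and "\<And>a b. a \<in> I \<Longrightarrow> b \<in> I \<Longrightarrow> sup_on X (P a b)"
    and "\<And>a b. a \<in> I \<Longrightarrow> b \<in> I \<Longrightarrow> ord_ge j (P a b - mone a b)"
    and "minverse I P Q"
  shows "int p dvd cyc (wpow p v) (dlog I P Q) - cyc v (dlog I P Q)"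
  using j assms(5-)
proof (induction "Suc (p * length v) - j" arbitrary: j P Q rule: less_induct)
  case outer: less
  show ?case
  \<comment> \<open>The induction raises j until P agrees with the identity up to the length of v^p;
    then the logarithmic derivative reaches neither of the two words.\<close>
  proof (cases "p * length v < j")
    case True
    have 1: "1 \<le> p" using prime_gt_0_nat[OF p] by simp
    have e: "euler (P a b) = euler (P a b - mone a b)" for a b
      by (simp add: euler_simps mone_def)
    have "ord_ge j (dlog I P Q)" unfolding dlog_def
      by (subst e) (intro ord_ge_sum ord_ge_mult_left ord_ge_euler outer.prems)
    moreover have "length v \<le> p * length v" using 1 by simp
    ultimately have "cyc v (dlog I P Q) = 0" "cyc (wpow p v) (dlog I P Q) = 0"
      using True cyc_ord_ge[of j "dlog I P Q" v] cyc_ord_ge[of j "dlog I P Q" "wpow p v"]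
      by (auto simp only: length_wpow)
    then show ?thesis by simp
  next
    case False
    \<comment> \<open>The coefficients still to be removed in degree j, finite in number because I
      and X are finite; the inner induction lowers this number.\<close>
    define T where "T P = {(a, b, w). a \<in> I \<and> b \<in> I \<and> length w = j \<and> nc (P a b) w \<noteq> 0}" for P :: "'i \<Rightarrow> 'i \<Rightarrow> 'a ncps"
    have mone0: "nc (mone a b) w = 0" if "length w = j" for w :: "'a list" and a b :: 'i
      using that outer.prems(1) by (auto simp: mone_def nc_one)
    show ?thesis
      using outer.prems(2-)
    proof (induction "card (T P)" arbitrary: P Q rule: less_induct)
      case less
      have finT: "finite (T P)"
      proof (rule finite_subset)
        show "T P \<subseteq> I \<times> I \<times> {w. set w \<subseteq> X \<and> length w = j}"
          using less.prems(1) by (auto simp: T_def sup_on_def)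
      qed (use I X in \<open>simp add: finite_lists_length_eq\<close>)
      show ?case
      proof (cases "T P = {}")
        case True
        have "ord_ge (Suc j) (P a b - mone a b)" if "a \<in> I" "b \<in> I" for a b
          unfolding ord_ge_def
        proof (intro allI impI)
          fix w :: "'a list" assume "length w < Suc j"
          then consider "length w < j" | "length w = j" by linarith
          then show "nc (P a b - mone a b) w = 0"
          proof cases
            case 1
            then show ?thesis using less.prems(2)[OF that] unfolding ord_ge_def by blast
          next
            case 2
            then have "nc (P a b) w = 0" using True that by (auto simp: T_def)
            then show ?thesis using mone0[OF 2] by simp
          qed
        qed
        then show ?thesis
          using False less.prems by (intro outer.hyps[of "Suc j"]) auto
      next
        case ne: False
        then obtain a b w where t: "(a, b, w) \<in> T P" by (metis all_not_in_conv prod_cases3)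
        then have ab: "a \<in> I" "b \<in> I" and lw: "length w = j" and nz: "nc (P a b) w \<noteq> 0"
          by (auto simp: T_def)
        have w: "w \<noteq> []" using lw outer.prems(1) by auto
        define c where "c = nc (P a b) w"
        define h where "h = elem_coinv a b w c"
        let ?E = "elem_mat a b (mono w c)" and ?E' = "elem_mat a b h"
        define P' where "P' = mmult I ?E' P"
        define Q' where "Q' = mmult I Q ?E"
        have E: "minverse I ?E ?E'" unfolding h_def by (rule elem_minverse[OF I ab w])
        then have E': "minverse I ?E' ?E" by (auto simp: minverse_def)
        have inv: "minverse I P' Q'" unfolding P'_def Q'_def by (rule minverse_mult[OF I E' less.prems(3)])
        have P'v: "P' i l = P i l + (if i = a then h * P b l else 0)" if "i \<in> I" for i l
          unfolding P'_def by (rule mmult_elem(1)[OF I ab that])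
        have sw: "set w \<subseteq> X" using less.prems(1)[OF ab] nz by (auto simp: sup_on_def)
        have sup: "sup_on X (P' i l)" if "i \<in> I" "l \<in> I" for i l
          using less.prems(1) that ab sup_on_elem_coinv[OF sw, of a b c]
          by (auto simp: P'v h_def intro!: sup_on_add sup_on_mult)
        have hl: "ord_ge (Suc j) (h + mono w c)" unfolding h_def using elem_coinv_lead[OF w, of a b c] lw by simp
        have ordm: "ord_ge j (mono w c)" using lw by (auto simp: ord_ge_def nc_mono)
        have hj: "ord_ge j h" using ord_ge_diff[OF ord_ge_mono[OF hl, of j] ordm] by simp
        \<comment> \<open>In degree j the row correction \<open>h * P b l\<close> is -c w in column
          b and zero elsewhere, since h has order j and P differs from the identity by order j \<ge>
          1. So the chosen coefficient is removed and no other coefficient of degree j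
          changes.\<close>
        have key: "ord_ge (Suc j) (h * P b l + (if l = b then mono w c else 0))" if l: "l \<in> I" for l
        proof -
          have "h * P b l + (if l = b then mono w c else 0) =
              (if l = b then h + mono w c else 0) + h * (P b l - mone b l)"
            by (auto simp: mone_def right_diff_distrib)
          moreover have "ord_ge (Suc j) (h * (P b l - mone b l))"
            using ord_ge_mult[OF hj less.prems(2)[OF ab(2) l], of "Suc j"] outer.prems(1) by simp
          ultimately show ?thesis using hl by (simp add: ord_ge_add)
        qed
        have ord: "ord_ge j (P' i l - mone i l)" if "i \<in> I" "l \<in> I" for i l
        proof -
          have "ord_ge j ((P i l - mone i l) + (if i = a then h * P b l else 0))"
            using less.prems(2)[OF that] ord_ge_mult_right[OF hj] by (simp add: ord_ge_add)
          then show ?thesis using P'v[OF that(1)] by (simp add: algebra_simps)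
        qed
        have nc': "nc (P' i l) u = nc (P i l) u - (if i = a \<and> l = b \<and> u = w then c else 0)"
          if "i \<in> I" "l \<in> I" "length u = j" for i l u
        proof -
          have "nc (h * P b l + (if l = b then mono w c else 0)) u = 0"
            using key[OF that(2)] that(3) unfolding ord_ge_def by simp
          then have "nc (h * P b l) u = - (if l = b \<and> u = w then c else 0)"
            by (auto simp: nc_mono split: if_splits)
          then show ?thesis using P'v[OF that(1)] by auto
        qed
        have "T P' \<subseteq> T P - {(a, b, w)}"
        proof
          fix t assume "t \<in> T P'"
          then obtain i l u where *: "t = (i, l, u)" "i \<in> I" "l \<in> I" "length u = j" "nc (P' i l) u \<noteq> 0"
            by (auto simp: T_def)
          from nc'[OF *(2-4)] *(5) have "(i, l, u) \<noteq> (a, b, w)" "nc (P i l) u \<noteq> 0"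
            by (auto simp: c_def split: if_splits)
          with * show "t \<in> T P - {(a, b, w)}" by (simp add: T_def)
        qed
        with t finT have "card (T P') < card (T P)"
          by (metis DiffD2 insertI1 psubsetI psubset_card_mono subset_Diff_insert subset_empty
              Diff_subset order_trans)
        from less.hyps[OF this sup ord inv]
        have dP': "int p dvd cyc (wpow p v) (dlog I P' Q') - cyc v (dlog I P' Q')" by blast
        have "dlog I P Q = dlog I (mmult I ?E P') (mmult I Q' ?E')"
        proof (rule dlog_cong, rule conjI)
          fix i l assume il: "i \<in> I" "l \<in> I"
          show "P i l = mmult I ?E P' i l" unfolding P'_def using mmult_inverse_left(1)[OF I E il(1)] by simp
          have "mmult I Q' ?E' i l = mmult I Q (mmult I ?E ?E') i l" unfolding Q'_def by (rule mmult_assoc)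
          also have "\<dots> = mmult I Q mone i l" by (rule mmult_cong) (use E il in \<open>auto simp: minverse_def\<close>)
          finally show "Q i l = mmult I Q' ?E' i l" using mmult_mone(2)[OF I il(2), of Q i] by simp
        qed
        then have "cyc u (dlog I P Q) = cyc u (dlog I ?E ?E') + cyc u (dlog I P' Q')" for u
          using cyc_dlog_mult[OF I E inv] by simp
        then show ?thesis
          using dvd_add[OF dwork_elem[OF I ab w p, of v c, folded h_def] dP'] by (simp add: algebra_simps)
      qed
    qed
  qed
qed

section \<open>The integral group ring inside the power series\<close>

inductive_set gring :: "'a ncps set" where
  magnus: "magnus w \<in> gring"
| zero: "0 \<in> gring"
| add: "s \<in> gring \<Longrightarrow> t \<in> gring \<Longrightarrow> s + t \<in> gring"
| neg: "s \<in> gring \<Longrightarrow> - s \<in> gring"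

lemma gring_sum: "(\<And>a. a \<in> A \<Longrightarrow> f a \<in> gring) \<Longrightarrow> sum f A \<in> gring"
  by (induction A rule: infinite_finite_induct) (auto intro: gring.intros)

lemma gring_one: "1 \<in> gring"
  using gring.magnus[of "[]"] by simp

lemma gring_diff: "s \<in> gring \<Longrightarrow> t \<in> gring \<Longrightarrow> s - t \<in> gring"
  using gring.add[OF _ gring.neg, of s t] by simp

lemma magnus_append: "magnus (u @ v) = magnus u * magnus v"
  by (simp add: magnus_def)

lemma gring_mult: "s \<in> gring \<Longrightarrow> t \<in> gring \<Longrightarrow> s * t \<in> gring"
proof (induction rule: gring.induct)
  case (magnus w)
  from magnus.prems show ?case
    by (induction rule: gring.induct)
      (auto simp: magnus_append[symmetric] distrib_left intro: gring.intros)
qed (auto simp: distrib_right intro: gring.intros)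

lemma mlet_gring: "mlet l \<in> gring"
  using gring.magnus[of "[l]"] by (simp add: magnus_Cons)

text \<open>E(1 + x) = (1 + x) - 1 lies in the group ring, and for the inverse letter Leibniz gives
  E(M^-1) = -M^-1 E(M) M^-1. Hence the group ring is stable under E, although E is defined through
  lengths of monomials.\<close>

lemma euler_mlet_gring: "euler (mlet l) \<in> gring"
proof -
  obtain x b where l: "l = (x, b)" by (cases l)
  have "euler (mlet (x, True)) = mlet (x, True) - 1"
    by (rule ncps_eqI) (simp add: mlet_def nc_one nc_var)
  then have 1: "euler (mlet (x, True)) \<in> gring" by (simp add: gring_diff mlet_gring gring_one)
  have i: "mlet (x, True) * mlet (x, False) = 1" "mlet (x, False) * mlet (x, True) = 1"
    using mlet_inverse[of "(x, True)"] mlet_inverse[of "(x, False)"] by auto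
  have "euler (mlet (x, True)) * mlet (x, False) + mlet (x, True) * euler (mlet (x, False)) = 0"
    using euler_mult[of "mlet (x, True)" "mlet (x, False)"] unfolding i euler_simps by simp
  then have "mlet (x, False) * (euler (mlet (x, True)) * mlet (x, False) + mlet (x, True) * euler (mlet (x, False))) = 0"
    by simp
  then have "mlet (x, False) * euler (mlet (x, True)) * mlet (x, False) + euler (mlet (x, False)) = 0"
    by (simp add: distrib_left mult.assoc[symmetric] i)
  then have "euler (mlet (x, False)) = - (mlet (x, False) * euler (mlet (x, True)) * mlet (x, False))"
    by (simp add: eq_neg_iff_add_eq_0 add.commute)
  then have "euler (mlet (x, False)) \<in> gring" by (simp add: 1 mlet_gring gring_mult gring.neg)
  with 1 l show ?thesis by (cases b) auto
qed

lemma euler_gring: "s \<in> gring \<Longrightarrow> euler s \<in> gring"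
proof (induction rule: gring.induct)
  case (magnus w)
  show ?case
    by (induction w)
      (auto simp: magnus_Cons euler_mult euler_simps intro!: gring.zero gring.add gring_mult mlet_gring
        euler_mlet_gring intro: gring.magnus)
qed (auto simp: euler_simps intro: gring.intros)

text \<open>The number of places where adjacent letters differ. Expanding a group word of length n
  yields only monomials with at most n changes, because each letter contributes powers of one
  variable, whereas the p-th power of a word with a change has at least p of them. This is the
  finiteness of the group ring that is exploited.\<close>

fun changes :: "'a list \<Rightarrow> nat" where
  "changes (x # y # u) = (if x = y then 0 else 1) + changes (y # u)"
| "changes _ = 0"

lemma changes_append_ge: "changes a + changes b \<le> changes (a @ b)"
proof (induction a rule: changes.induct)
  case (1 x y u)
  then show ?case by simp
next
  case ("2_2" x)
  then show ?case by (cases b) auto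
qed simp

lemma changes_append_const: "set a \<subseteq> {x} \<Longrightarrow> changes (a @ b) \<le> Suc (changes b)"
proof (induction a rule: changes.induct)
  case (1 x y u)
  then show ?case by auto
next
  case ("2_2" x)
  then show ?case by (cases b) auto
qed simp

lemma changes_zero: "changes u = 0 \<Longrightarrow> set u \<subseteq> {hd u}"
  by (induction u rule: changes.induct) (auto split: if_splits)

lemma changes_wpow: "m * changes y \<le> changes (wpow m y)"
proof (induction m)
  case (Suc m)
  then show ?case using changes_append_ge[of y "wpow m y"] by simp
qed simp

lemma nc_mlet_nonzero: "nc (mlet l) u \<noteq> 0 \<Longrightarrow> set u \<subseteq> {fst l}"
  by (cases l; cases "snd l") (auto simp: mlet_def nc_one nc_var Abs_ncps_inverse split: if_splits)

lemma nc_magnus_changes: "nc (magnus w) u \<noteq> 0 \<Longrightarrow> changes u \<le> length w"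
proof (induction w arbitrary: u)
  case Nil
  then show ?case by (auto simp: nc_one split: if_splits)
next
  case (Cons l w)
  from Cons.prems have "nc (mlet l * magnus w) u \<noteq> 0" by (simp add: magnus_Cons)
  from nc_mult_nonzero[OF this] obtain a b where ab: "u = a @ b" "nc (mlet l) a \<noteq> 0" "nc (magnus w) b \<noteq> 0" by blast
  from Cons.IH[OF ab(3)] changes_append_const[OF nc_mlet_nonzero[OF ab(2)], of b] ab(1) show ?case by simp
qed

lemma gring_cyc_wpow:
  assumes "s \<in> gring" and v: "\<not> set v \<subseteq> {hd v}"
  shows "\<exists>N. \<forall>p>N. cyc (wpow p v) s = 0"
  using assms(1)
proof (induction rule: gring.induct)
  case (magnus w)
  have "cyc (wpow p v) (magnus w) = 0" if p: "p > length w" for p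
    unfolding cyc_def
  proof (rule sum.neutral, rule ballI)
    fix u assume "u \<in> rots (wpow p v)"
    then obtain y where y: "y \<in> rots v" "u = wpow p y" using rots_wpowD by blast
    have "changes y \<noteq> 0"
    proof
      assume "changes y = 0"
      then have "set v \<subseteq> {hd y}" using changes_zero rots_set[OF y(1)] by metis
      then show False using v by (cases v) auto
    qed
    then have "p \<le> changes u" using changes_wpow[of p y] y(2) by (cases "changes y") auto
    then show "nc (magnus w) u = 0" using p nc_magnus_changes[of w u] by linarith
  qed
  then show ?case by blast
next
  case (add s t)
  then obtain M N where "\<forall>p>M. cyc (wpow p v) s = 0" "\<forall>p>N. cyc (wpow p v) t = 0" by blast
  then show ?case by (intro exI[of _ "max M N"]) simp
qed auto

text \<open>All letters other than x are set to zero, a ring homomorphism to series in one variable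
  that sees exactly the words x^n.\<close>

definition restr_fps :: "'a \<Rightarrow> 'a ncps \<Rightarrow> int fps" where
  "restr_fps x s = Abs_fps (\<lambda>n. nc s (replicate n x))"

lemma restr_fps_simps:
  "restr_fps x (s * t) = restr_fps x s * restr_fps x t" "restr_fps x 1 = 1"
  "restr_fps x (mlet (x, True)) = 1 + fps_X" "x \<noteq> y \<Longrightarrow> restr_fps x (mlet (y, b)) = 1"
proof -
  show "restr_fps x (s * t) = restr_fps x s * restr_fps x t"
    by (rule fps_ext) (simp add: restr_fps_def fps_mult_nth nc_mult_sum atLeast0AtMost min_def)
  show "restr_fps x 1 = 1" by (rule fps_ext) (simp add: restr_fps_def nc_one)
  have "replicate n x = [x] \<longleftrightarrow> n = 1" for n by (cases n; cases "n - 1") auto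
  then show "restr_fps x (mlet (x, True)) = 1 + fps_X"
    by (intro fps_ext) (simp add: restr_fps_def mlet_def nc_one nc_var)
  assume "x \<noteq> y"
  moreover have "replicate n x = [z] \<longleftrightarrow> n = 1 \<and> x = z" for n z by (cases n; cases "n - 1") auto
  ultimately show "restr_fps x (mlet (y, b)) = 1"
    by (intro fps_ext, cases b) (auto simp: restr_fps_def mlet_def nc_one nc_var Abs_ncps_inverse)
qed

lemma restr_fps_mlet_False: "restr_fps x (mlet (x, False)) * (1 + fps_X) = 1"
proof -
  have "restr_fps x (mlet (x, False)) * restr_fps x (mlet (x, True)) = 1"
    unfolding restr_fps_simps(1)[symmetric] using mlet_inverse[of "(x, False)"] by (simp add: restr_fps_simps(2))
  then show ?thesis by (simp add: restr_fps_simps)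
qed

text \<open>The image of a group element is a power of 1 + X. The positive and negative parts of the
  exponent are kept apart, each bounded by the length of the word, which avoids negative
  powers.\<close>

lemma restr_fps_magnus:
  "\<exists>q r. q \<le> length w \<and> r \<le> length w \<and> restr_fps x (magnus w) * (1 + fps_X) ^ q = (1 + fps_X) ^ r"
proof (induction w)
  case Nil
  then show ?case by (simp add: restr_fps_simps)
next
  case (Cons l w)
  then obtain q r where qr: "q \<le> length w" "r \<le> length w"
    "restr_fps x (magnus w) * (1 + fps_X) ^ q = (1 + fps_X) ^ r" by blast
  obtain y b where l: "l = (y, b)" by (cases l)
  consider "y \<noteq> x" | "y = x" "b" | "y = x" "\<not> b" by blast
  then show ?case
  proof cases
    case 1
    then show ?thesis using qr l
      by (intro exI[of _ q] exI[of _ r]) (simp add: magnus_Cons restr_fps_simps)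
  next
    case 2
    then show ?thesis using qr l
      by (intro exI[of _ q] exI[of _ "Suc r"]) (simp add: magnus_Cons restr_fps_simps mult.assoc)
  next
    case 3
    have "restr_fps x (magnus (l # w)) * (1 + fps_X) ^ Suc q =
      (restr_fps x (mlet (x, False)) * (1 + fps_X)) * (restr_fps x (magnus w) * (1 + fps_X) ^ q)"
      using 3 l by (simp add: magnus_Cons restr_fps_simps ac_simps)
    also have "\<dots> = (1 + fps_X) ^ r" using qr by (simp add: restr_fps_mlet_False)
    finally show ?thesis using qr by (intro exI[of _ "Suc q"] exI[of _ r]) simp
  qed
qed

lemma fps_nth_one_plus_X_power: "fps_nth ((1 + fps_X :: int fps) ^ p) i = int (p choose i)"
proof (induction p arbitrary: i)
  case 0
  then show ?case by (cases i) auto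
next
  case (Suc p)
  have "(1 + fps_X :: int fps) ^ Suc p = (1 + fps_X) ^ p + fps_X * (1 + fps_X) ^ p" by (simp add: algebra_simps)
  then show ?case by (cases i) (simp_all add: Suc)
qed

text \<open>Modulo \<open>p\<close>, the series \<open>(1 + X)\<^sup>p\<close> is \<open>1 + X\<^sup>p\<close>, while \<open>(1 + X)\<^sup>p\<close> times the image of a
  group element is a polynomial of degree less than \<open>2 p\<close>.\<close>

lemma gring_power_coeff:
  assumes "s \<in> gring"
  shows "\<exists>N. \<forall>p>N. prime p \<longrightarrow> (\<forall>m\<ge>1. int p dvd nc s (replicate (Suc m * p) x) + nc s (replicate (m * p) x))"
  using assms
proof (induction rule: gring.induct)
  case (magnus w)
  from restr_fps_magnus[of w x] obtain q r where qr: "q \<le> length w" "r \<le> length w"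
    "restr_fps x (magnus w) * (1 + fps_X) ^ q = (1 + fps_X) ^ r" by blast
  have "int p dvd nc (magnus w) (replicate (Suc m * p) x) + nc (magnus w) (replicate (m * p) x)"
    if p: "p > length w" "prime p" and m: "m \<ge> 1" for p m
  proof -
    let ?A = "\<lambda>n. nc (magnus w) (replicate n x)"
    define n where "n = Suc m * p"
    have "p - q + q = p" using p qr by simp
    then have "(1 + fps_X) ^ p * restr_fps x (magnus w) = (1 + fps_X) ^ (p - q) * (restr_fps x (magnus w) * (1 + fps_X) ^ q)"
      by (metis mult.assoc mult.commute power_add)
    also have "\<dots> = (1 + fps_X) ^ (p - q + r)" unfolding qr(3) by (simp add: power_add)
    finally have "fps_nth ((1 + fps_X) ^ p * restr_fps x (magnus w)) n = int ((p - q + r) choose n)"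
      by (simp add: fps_nth_one_plus_X_power)
    \<comment> \<open>The product with (1 + X)^p is (1 + X)^(p - q + r), a polynomial of degree
      below 2p because r < p, so its coefficient at n = (m + 1) p vanishes. In the sum expressing it
      only i = 0 and i = p survive modulo p.\<close>
    moreover have "p - q + r < n"
    proof -
      have "2 * p \<le> n" using m by (simp add: n_def)
      then show ?thesis using p qr by linarith
    qed
    ultimately have "0 = (\<Sum>i=0..n. int (p choose i) * ?A (n - i))"
      by (simp add: fps_mult_nth fps_nth_one_plus_X_power restr_fps_def binomial_eq_0)
    also have "\<dots> = (\<Sum>i\<in>{0..n} - {0, p}. int (p choose i) * ?A (n - i)) + (\<Sum>i\<in>{0, p}. int (p choose i) * ?A (n - i))"
      by (rule sum.subset_diff) (auto simp: n_def)
    finally have "?A n + ?A (n - p) = - (\<Sum>i\<in>{0..n} - {0, p}. int (p choose i) * ?A (n - i))"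
      using prime_gt_0_nat[OF p(2)] by simp
    moreover have "int p dvd (\<Sum>i\<in>{0..n} - {0, p}. int (p choose i) * ?A (n - i))"
      by (intro dvd_sum dvd_mult2 binomial_prime_dvd[OF p(2)]) auto
    ultimately show ?thesis by (simp add: n_def)
  qed
  then show ?case by blast
next
  case (add s t)
  let ?P = "\<lambda>p s. \<forall>m\<ge>1. int p dvd nc s (replicate (Suc m * p) x) + nc s (replicate (m * p) x)"
  from add obtain M N where MN: "\<forall>p>M. prime p \<longrightarrow> ?P p s" "\<forall>p>N. prime p \<longrightarrow> ?P p t" by blast
  have "?P p (s + t)" if "p > max M N" "prime p" for p
  proof (intro allI impI)
    fix m :: nat assume "1 \<le> m"
    then have 1: "int p dvd nc s (replicate (Suc m * p) x) + nc s (replicate (m * p) x)"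
      "int p dvd nc t (replicate (Suc m * p) x) + nc t (replicate (m * p) x)"
      using MN that by simp_all
    from dvd_add[OF 1] show "int p dvd nc (s + t) (replicate (Suc m * p) x) + nc (s + t) (replicate (m * p) x)"
      by (simp add: algebra_simps)
  qed
  then show ?case by blast
next
  case (neg s)
  then obtain N where N: "\<forall>p>N. prime p \<longrightarrow> (\<forall>m\<ge>1. int p dvd nc s (replicate (Suc m * p) x) + nc s (replicate (m * p) x))" by blast
  have "int p dvd nc (- s) (replicate (Suc m * p) x) + nc (- s) (replicate (m * p) x)" if "p > N" "prime p" "m \<ge> 1" for p m
  proof -
    have "int p dvd - (nc s (replicate (Suc m * p) x) + nc s (replicate (m * p) x))"
      using N that dvd_minus_iff by blast
    then show ?thesis by simp
  qed
  then show ?case by blast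
qed simp

section \<open>Vanishing of cyclic coefficients by divisibility\<close>

lemma int_dvd_large_primes:
  assumes "\<And>p. p > N \<Longrightarrow> prime p \<Longrightarrow> int p dvd c"
  shows "c = 0"
proof (rule ccontr)
  assume c: "c \<noteq> 0"
  obtain p where p: "prime p" "p > N + nat \<bar>c\<bar>" using bigger_prime by blast
  then have "int p dvd c" using assms by simp
  from dvd_imp_le_int[OF c this] have "int p \<le> \<bar>c\<bar>" by simp
  with p show False by linarith
qed

lemma rots_replicate: "rots (replicate n x) = {replicate n x}"
proof -
  have "rotate i (replicate n x) = replicate n x" for i
    by (rule replicate_eqI) auto
  then show ?thesis by (auto simp: rots_def)
qed

lemma wpow_replicate: "wpow m (replicate n x) = replicate (m * n) x"
  by (induction m) (auto simp: replicate_add)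

theorem gring_cyc_zero:
  assumes s: "s \<in> gring"
    and dw: "\<And>p v. prime p \<Longrightarrow> v \<noteq> [] \<Longrightarrow> int p dvd cyc (wpow p v) s - cyc v s"
    and s1: "\<And>x. nc s [x] = 0" and v: "v \<noteq> []"
  shows "cyc v s = 0"
proof (cases "set v \<subseteq> {hd v}")
  case False
  from gring_cyc_wpow[OF s False] obtain N where "\<forall>p>N. cyc (wpow p v) s = 0" by blast
  note N = this
  show ?thesis
  proof (rule int_dvd_large_primes[of N])
    fix p :: nat assume p: "p > N" "prime p"
    have "cyc (wpow p v) s = 0" using N p(1) by blast
    then show "int p dvd cyc v s" using dw[OF p(2) v] by simp
  qed
next
  case True
  define x where "x = hd v"
  define m where "m = length v"
  have vx: "v = replicate m x" unfolding m_def by (rule replicate_eqI) (use True x_def in auto)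
  have m: "m \<ge> 1" using v unfolding m_def by (cases v) auto
  have cx: "cyc (replicate n x) s = nc s (replicate n x)" for n
    by (simp add: cyc_def rots_replicate)
  have dx: "int p dvd nc s (replicate (p * n) x) - nc s (replicate n x)" if "prime p" "n \<ge> 1" for p n
    using dw[OF that(1), of "replicate n x"] that(2) by (simp add: cx wpow_replicate)
  from gring_power_coeff[OF s, of x] obtain N where
    N: "\<forall>p>N. prime p \<longrightarrow> (\<forall>m\<ge>1. int p dvd nc s (replicate (Suc m * p) x) + nc s (replicate (m * p) x))" by blast
  have "int p dvd nc s v" if p: "p > N" "prime p" for p
  proof -
    \<comment> \<open>Dwork and the vanishing in degree 1 give m = 1, and the group ring relation
      passes from m to m + 1. Dwork then leads back from x^(m p) to x^m, whose coefficient is thus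
      divisible by all large primes.\<close>
    have "int p dvd nc s (replicate (m * p) x)"
      using m
    proof (induction m rule: nat_induct_at_least)
      case base
      then show ?case using dx[OF p(2), of 1] s1[of x] by simp
    next
      case (Suc m)
      then have "int p dvd nc s (replicate (Suc m * p) x) + nc s (replicate (m * p) x)" using N p by blast
      from dvd_diff[OF this Suc.IH] show ?case by simp
    qed
    from dvd_diff[OF this dx[OF p(2) m]] show ?thesis by (simp add: mult.commute vx)
  qed
  then have "nc s v = 0" by (rule int_dvd_large_primes)
  then show ?thesis using cx[of m] vx by simp
qed

section \<open>Jacobian matrices of automorphisms\<close>

text \<open>\<open>fox f e w\<close> is the image under \<open>f\<close> of the Fox derivative of \<open>w\<close> by \<open>e\<close>, for the convention
  \<open>w - 1 = (\<Sum>e. (e - 1) * \<partial>\<^sub>e w)\<close>.\<close>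

fun fox :: "('a fword \<Rightarrow> 'a fword) \<Rightarrow> 'a \<Rightarrow> 'a fword \<Rightarrow> 'a ncps" where
  "fox f e [] = 0"
| "fox f e (l # w) = fox f e w +
     (if fst l = e then if snd l then magnus (f w) else - magnus (f (l # w)) else 0)"

lemma fox_push:
  "fox f e (push l w) = fox f e w +
     (if fst l = e then if snd l then magnus (f w) else - magnus (f (push l w)) else 0)"
proof (cases w)
  case (Cons m w')
  show ?thesis
  proof (cases "m = (fst l, \<not> snd l)")
    case True
    then show ?thesis using Cons by (cases l) auto
  next
    case False
    then have "push l w = l # w" using Cons by simp
    then show ?thesis by (simp only: fox.simps(2))
  qed
qed simp

lemma fox_gring: "fox f e w \<in> gring"
  by (induction w) (auto intro!: gring.zero gring.add gring.neg gring.magnus gring_diff)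

lemma fox_mult_letter:
  assumes f: "f \<in> auto (surface_group g)" and x: "x \<in> gens g" and w: "w \<in> PI g"
  shows "fox f e ([(x, b)] \<otimes>\<^bsub>surface_group g\<^esub> w) = fox f e [(x, b)] * magnus (f w) + fox f e w"
proof -
  interpret f: group_hom "surface_group g" "surface_group g" f by (rule auto_homD(1)[OF f])
  have c: "[(x, b)] \<in> PI g" using x by (simp add: surface_group_def letter_in_free_group)
  have one: "f [] = []" using f.hom_one by (simp add: surface_group_def one_free_group)
  have push: "push (x, b) w = [(x, b)] \<otimes>\<^bsub>surface_group g\<^esub> w"
    by (simp add: surface_group_def mult_free_group)
  have m: "magnus (f (push (x, b) w)) = magnus (f [(x, b)]) * magnus (f w)"
    unfolding push using c w by (simp add: magnus_surface_mult)
  show ?thesis unfolding push[symmetric] fox_push using m by (auto simp: one)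
qed

lemma magnus_fox:
  assumes f: "f \<in> auto (surface_group g)" and w: "w \<in> PI g"
  shows "magnus (f w) - 1 = (\<Sum>e\<in>gens g. (magnus (f (pi_gen e)) - 1) * fox f e w)"
  using w[unfolded surface_group_def]
proof (induction rule: free_group_induct)
  case Nil
  interpret f: group_hom "surface_group g" "surface_group g" f by (rule auto_homD(1)[OF f])
  have "f [] = []" using f.hom_one by (simp add: surface_group_def one_free_group)
  then show ?case by simp
next
  case (Cons x b w)
  interpret f: group_hom "surface_group g" "surface_group g" f by (rule auto_homD(1)[OF f])
  have w: "w \<in> PI g" and c: "[(x, b)] \<in> PI g" and xc: "pi_gen x \<in> PI g"
    using Cons by (simp_all add: surface_group_def letter_in_free_group pi_gen_def)
  have one: "f [] = []" using f.hom_one by (simp add: surface_group_def one_free_group)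
  have "magnus (f [(x, b)]) - 1 = (magnus (f (pi_gen x)) - 1) * fox f x [(x, b)]"
  proof (cases b)
    case True
    then show ?thesis by (simp add: one pi_gen_def)
  next
    case False
    have "magnus (f (pi_gen x)) * magnus (f [(x, False)]) = 1"
      using pi_letter[OF Cons(1), of False] xc by (simp add: magnus_surface_inv)
    then show ?thesis using False by (simp add: left_diff_distrib)
  qed
  also have "\<dots> = (\<Sum>e\<in>gens g. (magnus (f (pi_gen e)) - 1) * fox f e [(x, b)])"
  proof -
    have "(\<Sum>e\<in>gens g. (magnus (f (pi_gen e)) - 1) * fox f e [(x, b)])
        = (\<Sum>e\<in>gens g. if e = x then (magnus (f (pi_gen x)) - 1) * fox f x [(x, b)] else 0)"
      by (rule sum.cong) auto
    then show ?thesis using Cons(1) by simp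
  qed
  finally have l: "magnus (f [(x, b)]) - 1 = (\<Sum>e\<in>gens g. (magnus (f (pi_gen e)) - 1) * fox f e [(x, b)])" .
  have "magnus (f ([(x, b)] \<otimes>\<^bsub>surface_group g\<^esub> w)) - 1
      = (magnus (f [(x, b)]) - 1) * magnus (f w) + (magnus (f w) - 1)"
    using c w by (simp add: magnus_surface_mult left_diff_distrib)
  also have "\<dots> = (\<Sum>e\<in>gens g. (magnus (f (pi_gen e)) - 1) * fox f e ([(x, b)] \<otimes>\<^bsub>surface_group g\<^esub> w))"
    unfolding l Cons(3) fox_mult_letter[OF f Cons(1) w]
    by (simp add: sum_distrib_right sum.distrib distrib_left mult.assoc)
  finally show ?case by (simp add: surface_group_def)
qed

definition jac :: "(gen fword \<Rightarrow> gen fword) \<Rightarrow> gen \<Rightarrow> gen \<Rightarrow> gen ncps" where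
  "jac f i j = lder i (magnus (f (pi_gen j)))"

text \<open>The Jacobian of the inverse automorphism with f applied to its entries, as the chain
  rule predicts. In this form the entries visibly lie in the group ring, which an inverse computed
  among power series would not show.\<close>

definition jac_inv :: "nat \<Rightarrow> (gen fword \<Rightarrow> gen fword) \<Rightarrow> gen \<Rightarrow> gen \<Rightarrow> gen ncps" where
  "jac_inv g f i j = fox f i (auto_inv g f (pi_gen j))"

text \<open>As functions of u, both sides satisfy R(v w) = R(v) M(w) + R(w), and they agree on
  generators. The twist is by M(w) itself because f undoes its inverse.\<close>

lemma jac_inv_chain:
  assumes f: "f \<in> auto (surface_group g)" and u: "u \<in> PI g"
  shows "fox f e (auto_inv g f u) = (\<Sum>i\<in>gens g. jac_inv g f e i * lder i (magnus u))"
proof -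
  note fi = auto_inv_auto[OF f]
  interpret f: group_hom "surface_group g" "surface_group g" f by (rule auto_homD(1)[OF f])
  interpret h: group_hom "surface_group g" "surface_group g" "auto_inv g f" by (rule auto_homD(1)[OF fi])
  have fox_mult: "fox f e (v \<otimes>\<^bsub>surface_group g\<^esub> w) = fox f e v * magnus (f w) + fox f e w"
    if v: "v \<in> PI g" and w: "w \<in> PI g" for v w
    using v[unfolded surface_group_def]
  proof (induction rule: free_group_induct)
    case Nil
    then show ?case by (simp add: surface_group_def mult_free_group)
  next
    case (Cons x b v)
    have c: "[(x, b)] \<in> PI g" "v \<in> PI g" using Cons by (simp_all add: surface_group_def letter_in_free_group)
    have "fox f e ([(x, b)] \<otimes>\<^bsub>surface_group g\<^esub> v \<otimes>\<^bsub>surface_group g\<^esub> w) =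
        fox f e ([(x, b)] \<otimes>\<^bsub>surface_group g\<^esub> (v \<otimes>\<^bsub>surface_group g\<^esub> w))"
      using c w by (simp add: S.m_assoc)
    also have "\<dots> = fox f e [(x, b)] * magnus (f (v \<otimes>\<^bsub>surface_group g\<^esub> w)) + fox f e (v \<otimes>\<^bsub>surface_group g\<^esub> w)"
      using c w by (intro fox_mult_letter[OF f Cons(1)]) simp
    also have "\<dots> = fox f e ([(x, b)] \<otimes>\<^bsub>surface_group g\<^esub> v) * magnus (f w) + fox f e w"
      unfolding Cons(3) fox_mult_letter[OF f Cons(1) c(2)]
      using c w by (simp add: magnus_surface_mult distrib_right mult.assoc)
    finally show ?case by (simp add: surface_group_def)
  qed
  define G where "G u = fox f e (auto_inv g f u)" for u
  define R where "R u = (\<Sum>i\<in>gens g. jac_inv g f e i * lder i (magnus u))" for u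
  have G: "G (v \<otimes>\<^bsub>surface_group g\<^esub> w) = G v * magnus w + G w" if "v \<in> PI g" "w \<in> PI g" for v w
    using that by (simp add: G_def fox_mult auto_inv_cancel[OF f])
  have R: "R (v \<otimes>\<^bsub>surface_group g\<^esub> w) = R v * magnus w + R w" for v w
    by (simp add: R_def magnus_surface_mult lder_mult distrib_left sum.distrib sum_distrib_right mult.assoc add.commute)
  have gen: "G (pi_gen x) = R (pi_gen x)" if x: "x \<in> gens g" for x
  proof -
    have "R (pi_gen x) = (\<Sum>i\<in>gens g. if i = x then jac_inv g f e i else 0)"
      unfolding R_def magnus_pi_gen by (rule sum.cong) (auto simp: lder_simps)
    then show ?thesis using x by (simp add: G_def jac_inv_def)
  qed
  have zero: "G \<one>\<^bsub>surface_group g\<^esub> = 0" "R \<one>\<^bsub>surface_group g\<^esub> = 0"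
    using G[of "\<one>\<^bsub>surface_group g\<^esub>" "\<one>\<^bsub>surface_group g\<^esub>"] R[of "\<one>\<^bsub>surface_group g\<^esub>" "\<one>\<^bsub>surface_group g\<^esub>"]
    by (simp_all add: magnus_surface_one)
  have letter: "G [(x, b)] = R [(x, b)]" if x: "x \<in> gens g" for x b
  proof (cases b)
    case True
    then show ?thesis using gen[OF x] by (simp add: pi_gen_def)
  next
    case False
    let ?y = "pi_gen x" and ?z = "inv\<^bsub>surface_group g\<^esub> pi_gen x"
    have y: "?y \<in> PI g" using x by (rule pi_gen_carrier)
    have "G ?y * magnus ?z + G ?z = 0" "R ?y * magnus ?z + R ?z = 0"
      using G[of ?y ?z] R[of ?y ?z] y zero by simp_all
    then have "G ?z = R ?z" using gen[OF x] by (metis add_left_cancel)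
    then show ?thesis using False pi_letter[OF x, of False] by simp
  qed
  have "G u = R u" using u[unfolded surface_group_def]
  proof (induction rule: free_group_induct)
    case Nil
    then show ?case using zero by (simp add: surface_group_def one_free_group)
  next
    case (Cons x b w)
    have c: "[(x, b)] \<in> PI g" "w \<in> PI g" using Cons by (simp_all add: surface_group_def letter_in_free_group)
    show ?case using G[OF c] R[of "[(x, b)]" w] letter[OF Cons(1), of b] Cons(3) by (simp add: surface_group_def)
  qed
  then show ?thesis unfolding G_def R_def .
qed

lemma jac_minverse:
  assumes f: "f \<in> auto (surface_group g)"
  shows "minverse (gens g) (jac f) (jac_inv g f)"
  unfolding minverse_def
proof (intro ballI conjI)
  fix i j assume i: "i \<in> gens g" and j: "j \<in> gens g"
  note fi = auto_inv_auto[OF f]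
  have cj: "pi_gen j \<in> PI g" "auto_inv g f (pi_gen j) \<in> PI g"
    using pi_gen_carrier[OF j] auto_homD(4)[OF fi] by auto
  \<comment> \<open>The fundamental formula of Fox calculus for the inverse image of the generator
    j; stripping a leading i gives the right inverse. The left inverse below is the chain rule at u
    = f(j).\<close>
  have "ncvar j = (\<Sum>e\<in>gens g. (magnus (f (pi_gen e)) - 1) * jac_inv g f e j)"
    using magnus_fox[OF f cj(2)] by (simp add: auto_inv_cancel[OF f cj(1)] magnus_pi_gen jac_inv_def)
  then have "lder i (ncvar j) = (\<Sum>e\<in>gens g. lder i ((magnus (f (pi_gen e)) - 1) * jac_inv g f e j))"
    by (simp add: lder_sum)
  also have "\<dots> = mmult (gens g) (jac f) (jac_inv g f) i j"
    unfolding mmult_def jac_def by (rule sum.cong) (simp_all add: lder_mult nc_one lder_simps)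
  finally show "mmult (gens g) (jac f) (jac_inv g f) i j = mone i j"
    by (simp add: lder_simps mone_def)
  interpret f: group_hom "surface_group g" "surface_group g" f by (rule auto_homD(1)[OF f])
  have one: "f [] = []" using f.hom_one by (simp add: surface_group_def one_free_group)
  have "mmult (gens g) (jac_inv g f) (jac f) i j = fox f i (auto_inv g f (f (pi_gen j)))"
    unfolding mmult_def jac_def using cj auto_homD(4)[OF f] by (simp add: jac_inv_chain[OF f])
  also have "\<dots> = fox f i (pi_gen j)" by (simp only: auto_inv_cancel(2)[OF f cj(1)])
  finally show "mmult (gens g) (jac_inv g f) (jac f) i j = mone i j"
    by (simp add: pi_gen_def one mone_def)
qed

section \<open>Vanishing of the trace on Johnson derivations\<close>

lemma lder_magnus_gring: "lder i (magnus w) \<in> gring"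
proof (induction w)
  case (Cons l w)
  obtain x b where l: "l = (x, b)" by (cases l)
  have "lder i (mlet l) \<in> gring"
    unfolding l by (cases b)
      (auto simp: lder_mlet_False mlet_def[of "(x, True)"] lder_simps intro: gring.intros gring_one mlet_gring)
  then show ?case using Cons by (simp add: magnus_Cons lder_mult gring.add gring_mult gring.magnus)
qed (simp add: lder_simps gring.zero)

lemma sup_on_magnus: "fst ` set w \<subseteq> X \<Longrightarrow> sup_on X (magnus w)"
proof (induction w)
  case (Cons l w)
  have "sup_on X (mlet l)" using Cons.prems nc_mlet_nonzero[of l] by (fastforce simp: sup_on_def)
  then show ?case using Cons by (simp add: magnus_Cons sup_on_mult)
qed (auto simp: sup_on_def nc_one split: if_splits)

text \<open>The trace of a Johnson derivation is, up to the factor \<open>k\<close>, the leading term of the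
  logarithmic derivative of the Jacobian matrix, whose cyclic coefficients all vanish.\<close>

theorem cyc_trace_tau':
  assumes f: "f \<in> Johnson_A g k" and k: "2 \<le> k"
  shows "cyc v (\<Sum>e\<in>gens g. lder e (lser (tau' g k f (lie_gen e)))) = 0"
proof (cases "length v = k")
  \<comment> \<open>The trace is homogeneous of degree k, so only words of length k can
    contribute.\<close>
  case False
  have "cyc v (lder e (lser (tau' g k f (lie_gen e)))) = 0" if e: "e \<in> gens g" for e
  proof -
    have "hom_deg (gens g) (k + 1) (lser (tau' g k f (lie_gen e)))"
      using Der_gen_part[OF tau'_Der[OF f] e] k by (intro hom_deg_lser_part) simp
    then show ?thesis
      unfolding cyc_def using False by (intro sum.neutral) (auto simp: hom_deg_def dest!: rots_length)
  qed
  then show ?thesis by (simp add: cyc_sum)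
next
  case lv: True
  note af = Johnson_A_D(1)[OF f]
  let ?I = "gens g" and ?P = "jac f" and ?Q = "jac_inv g f"
  define s where "s = dlog ?I ?P ?Q"
  have inv: "minverse ?I ?P ?Q" by (rule jac_minverse[OF af])
  have Pd: "?P i j - mone i j = lder i (dM f (pi_gen j))" for i j
    by (auto simp: jac_def dM_def lder_simps magnus_pi_gen mone_def)
  have N: "ord_ge k (?P i j - mone i j)" if "j \<in> ?I" for i j
    unfolding Pd using Johnson_A_D(2)[OF f pi_gen_carrier[OF that]] by (auto simp: ord_ge_def)
  have eN: "euler (?P i j) = euler (?P i j - mone i j)" for i j
    by (simp add: euler_simps mone_def)
  have "s \<in> gring"
    unfolding s_def dlog_def jac_inv_def jac_def
    by (intro gring_sum gring_mult fox_gring euler_gring lder_magnus_gring)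
  moreover have "int p dvd cyc (wpow p v) s - cyc v s" if "prime p" for p v
    unfolding s_def
  proof (rule dwork_congruence[OF _ _ that, where j = 1 and X = ?I])
    fix a b assume b: "b \<in> ?I"
    have "f (pi_gen b) \<in> PI g" using pi_gen_carrier[OF b] auto_homD(4)[OF af] by blast
    then have "sup_on ?I (magnus (f (pi_gen b)))"
      by (intro sup_on_magnus) (simp add: surface_group_def carrier_free_group)
    then have "set (a # w) \<subseteq> ?I" if "nc (magnus (f (pi_gen b))) (a # w) \<noteq> 0" for w
      using that unfolding sup_on_def by blast
    then show "sup_on ?I (?P a b)" by (simp add: sup_on_def jac_def)
    show "ord_ge 1 (?P a b - mone a b)" using ord_ge_mono[OF N[OF b, of a], of 1] k by simp
  qed (use inv in auto)
  moreover have sk: "ord_ge k s"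
    unfolding s_def dlog_def
    by (intro ord_ge_sum ord_ge_mult_left) (subst eN, intro ord_ge_euler N)
  then have "nc s [x] = 0" for x using k by (simp add: ord_ge_def)
  moreover have "v \<noteq> []" using lv k by auto
  ultimately have s0: "cyc v s = 0" using gring_cyc_zero by blast
  \<comment> \<open>The inverse matrix also differs from the identity by order k. Replacing it by
    the identity in s therefore changes only degrees 2k and above, and in degree k the series s is
    the trace of E(P).\<close>
  have Q: "ord_ge k (?Q i j - mone i j)" if i: "i \<in> ?I" and j: "j \<in> ?I" for i j
  proof -
    have "?Q i j + mmult ?I (\<lambda>i j. ?P i j - mone i j) ?Q i j = mmult ?I mone ?Q i j + mmult ?I (\<lambda>i j. ?P i j - mone i j) ?Q i j"
      using mmult_mone(1)[OF finite_gens i, of ?Q j] by simp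
    also have "\<dots> = mmult ?I ?P ?Q i j"
      unfolding mmult_def sum.distrib[symmetric] by (rule sum.cong) (simp_all add: left_diff_distrib)
    also have "\<dots> = mone i j" using inv i j by (simp add: minverse_def)
    finally have "?Q i j - mone i j = - mmult ?I (\<lambda>i j. ?P i j - mone i j) ?Q i j"
      by (simp add: algebra_simps eq_neg_iff_add_eq_0)
    moreover have "ord_ge k (mmult ?I (\<lambda>i j. ?P i j - mone i j) ?Q i j)"
      unfolding mmult_def by (intro ord_ge_sum ord_ge_mult_right N)
    ultimately show ?thesis by (simp add: ord_ge_minus)
  qed
  have "s - (\<Sum>i\<in>?I. euler (?P i i)) = (\<Sum>i\<in>?I. \<Sum>j\<in>?I. (?Q i j - mone i j) * euler (?P j i))"
  proof -
    have "(\<Sum>i\<in>?I. euler (?P i i)) = (\<Sum>i\<in>?I. \<Sum>j\<in>?I. mone i j * euler (?P j i))"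
    proof (rule sum.cong[OF HOL.refl])
      fix i assume "i \<in> ?I"
      have "(\<Sum>j\<in>?I. mone i j * euler (?P j i)) = (\<Sum>j\<in>?I. if i = j then euler (?P j i) else 0)"
        by (rule sum.cong) (auto simp: mone_def)
      then show "euler (?P i i) = (\<Sum>j\<in>?I. mone i j * euler (?P j i))" using \<open>i \<in> ?I\<close> by simp
    qed
    then show ?thesis by (simp add: s_def dlog_def left_diff_distrib sum_subtractf)
  qed
  moreover have "ord_ge (k + 1) ((?Q i j - mone i j) * euler (?P j i))" if "i \<in> ?I" "j \<in> ?I" for i j
    by (subst eN, rule ord_ge_mult[OF Q[OF that] ord_ge_euler[OF N[OF that(1)]]]) (use k in simp)
  ultimately have "ord_ge (k + 1) (s - (\<Sum>i\<in>?I. euler (?P i i)))"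
    by (simp only:) (intro ord_ge_sum)
  then have "cyc v (s - (\<Sum>i\<in>?I. euler (?P i i))) = 0" using lv by (intro cyc_ord_ge) auto
  then have e0: "cyc v (\<Sum>i\<in>?I. euler (?P i i)) = 0" using s0 by simp
  \<comment> \<open>In degree k the operator E multiplies by k, a nonzero integer that is cancelled
    at the end.\<close>
  have ce: "cyc v (euler t) = int k * cyc v t" for t
    unfolding cyc_def sum_distrib_left using lv by (intro sum.cong) (auto dest: rots_length)
  have "ord_ge (k + 1) ((?P i i - mone i i) - lder i (lser (tau' g k f (lie_gen i))))" if i: "i \<in> ?I" for i
  proof -
    have "ord_ge (1 + k + 1) (dM f (pi_gen i) - lser (tau' g k f (lie_gen i)))"
      using k by (intro dM_tau'[OF f _ lie_rep.gen[OF i]]) simp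
    then show ?thesis unfolding Pd lder_simps(4)[symmetric] by (auto simp: ord_ge_def)
  qed
  then have "cyc v ((?P i i - mone i i) - lder i (lser (tau' g k f (lie_gen i)))) = 0" if "i \<in> ?I" for i
    using that lv by (intro cyc_ord_ge) auto
  then have "cyc v (lder i (lser (tau' g k f (lie_gen i)))) = cyc v (?P i i - mone i i)" if "i \<in> ?I" for i
    using that by simp
  then have "int k * cyc v (\<Sum>e\<in>gens g. lder e (lser (tau' g k f (lie_gen e))))
      = (\<Sum>i\<in>?I. cyc v (euler (?P i i - mone i i)))"
    by (simp add: cyc_sum sum_distrib_left ce del: cyc_simps)
  also have "\<dots> = cyc v (\<Sum>i\<in>?I. euler (?P i i))" by (simp add: eN[symmetric] cyc_sum del: cyc_simps)
  finally show ?thesis using e0 k by simp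
qed

section \<open>Cyclic tensors\<close>

lemma Tens_iff: "p \<in> Tens g \<longleftrightarrow> sup_on (gens g) (ser p)"
  by (auto simp: tensor_on_def sup_on_def in_keys_iff)

lemma tensor_part_iff: "p \<in> tensor_part (gens g) k \<longleftrightarrow> hom_deg (gens g) k (ser p)"
  by (auto simp: tensor_part_def tensor_on_def hom_deg_def in_keys_iff)

lemma hom_deg_zero [simp]: "hom_deg X k 0"
  by (simp add: hom_deg_def)

lemma hom_deg_add: "hom_deg X n f \<Longrightarrow> hom_deg X n h \<Longrightarrow> hom_deg X n (f + h)"
  using hom_deg_diff[of X n f "- h"] hom_deg_diff[of X n 0 h] by simp

lemma hom_deg_sum: "(\<And>a. a \<in> A \<Longrightarrow> hom_deg X n (f a)) \<Longrightarrow> hom_deg X n (sum f A)"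
  by (induction A rule: infinite_finite_induct) (auto intro: hom_deg_add)

lemma sup_on_minus: "sup_on X f \<Longrightarrow> sup_on X (- f)"
  by (simp add: sup_on_def)

lemma Tens_closed [simp]:
  "0 \<in> Tens g" "p \<in> Tens g \<Longrightarrow> q \<in> Tens g \<Longrightarrow> p + q \<in> Tens g"
  "p \<in> Tens g \<Longrightarrow> - p \<in> Tens g" "p \<in> Tens g \<Longrightarrow> q \<in> Tens g \<Longrightarrow> p - q \<in> Tens g"
  "p \<in> Tens g \<Longrightarrow> q \<in> Tens g \<Longrightarrow> p * q \<in> Tens g"
  using sup_on_add[of "gens g" "ser p" "- ser q"]
  by (auto simp: Tens_iff ser_add ser_minus ser_diff ser_mult sup_on_add sup_on_mult sup_on_minus)
     (simp add: sup_on_def)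

lemma Tens_sum: "(\<And>a. a \<in> A \<Longrightarrow> f a \<in> Tens g) \<Longrightarrow> sum f A \<in> Tens g"
  by (induction A rule: infinite_finite_induct) auto

lemma Tens_single: "set w \<subseteq> gens g \<Longrightarrow> Poly_Mapping.single w c \<in> Tens g"
  by (auto simp: tensor_on_def)

lemma tensor_part_Tens: "p \<in> tensor_part (gens g) k \<Longrightarrow> p \<in> Tens g"
  by (simp add: tensor_part_def)

lemma lie_tensor_part: "l \<in> Lie_part g k \<Longrightarrow> lie_tensor l \<in> tensor_part (gens g) k"
  using hom_deg_lser_part by (simp add: tensor_part_iff lser_def)

lemma Tens_comm_group: "comm_group (Tens_group g)"
proof (rule comm_groupI)
  fix x assume "x \<in> carrier (Tens_group g)"
  then show "\<exists>y\<in>carrier (Tens_group g). y \<otimes>\<^bsub>Tens_group g\<^esub> x = \<one>\<^bsub>Tens_group g\<^esub>"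
    by (intro bexI[of _ "- x"]) (auto simp: Tens_group_def)
qed (auto simp: Tens_group_def algebra_simps)

interpretation T: comm_group "Tens_group g" for g by (rule Tens_comm_group)

lemma Tens_group_simps: "carrier (Tens_group g) = Tens g" "x \<otimes>\<^bsub>Tens_group g\<^esub> y = x + y" "\<one>\<^bsub>Tens_group g\<^esub> = 0"
  by (simp_all add: Tens_group_def)

lemma Tens_group_inv: "x \<in> Tens g \<Longrightarrow> inv\<^bsub>Tens_group g\<^esub> x = - x"
  by (rule T.inv_equality) (simp_all add: Tens_group_simps)

lemma Tens_comm_subgroup: "subgroup (Tens_comm g) (Tens_group g)"
  unfolding Tens_comm_def by (rule T.generate_is_subgroup) (auto simp: Tens_group_simps)

lemma Tens_comm_normal: "Tens_comm g \<lhd> Tens_group g"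
  by (rule T.subgroup_imp_normal[OF Tens_comm_subgroup])

lemma Tens_comm_closed:
  "0 \<in> Tens_comm g" "x \<in> Tens_comm g \<Longrightarrow> y \<in> Tens_comm g \<Longrightarrow> x + y \<in> Tens_comm g"
  "x \<in> Tens_comm g \<Longrightarrow> - x \<in> Tens_comm g" "x \<in> Tens_comm g \<Longrightarrow> x \<in> Tens g"
proof -
  interpret N: subgroup "Tens_comm g" "Tens_group g" by (rule Tens_comm_subgroup)
  show "0 \<in> Tens_comm g" using N.one_closed by (simp add: Tens_group_simps)
  show "x \<in> Tens_comm g \<Longrightarrow> y \<in> Tens_comm g \<Longrightarrow> x + y \<in> Tens_comm g"
    using N.m_closed by (simp add: Tens_group_simps)
  show in_Tens: "x \<in> Tens_comm g \<Longrightarrow> x \<in> Tens g" using N.mem_carrier by (simp add: Tens_group_simps)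
  show "x \<in> Tens_comm g \<Longrightarrow> - x \<in> Tens_comm g"
    using N.m_inv_closed[of x] in_Tens by (simp add: Tens_group_inv)
qed

lemma Tens_comm_diff: "x \<in> Tens_comm g \<Longrightarrow> y \<in> Tens_comm g \<Longrightarrow> x - y \<in> Tens_comm g"
  using Tens_comm_closed(2)[of x g "- y"] Tens_comm_closed(3)[of y g] by simp

lemma Tens_comm_sum: "(\<And>a. a \<in> A \<Longrightarrow> f a \<in> Tens_comm g) \<Longrightarrow> sum f A \<in> Tens_comm g"
  by (induction A rule: infinite_finite_induct) (auto intro: Tens_comm_closed)

lemma commutator_Tens_comm: "x \<in> Tens g \<Longrightarrow> y \<in> Tens g \<Longrightarrow> x * y - y * x \<in> Tens_comm g"
  unfolding Tens_comm_def by (rule generate.incl) blast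

lemma Tens_comm_induct [consumes 1, case_names zero comm neg add]:
  assumes "p \<in> Tens_comm g" and "P 0" and "\<And>x y. x \<in> Tens g \<Longrightarrow> y \<in> Tens g \<Longrightarrow> P (x * y - y * x)"
    and "\<And>x. x \<in> Tens_comm g \<Longrightarrow> P x \<Longrightarrow> P (- x)"
    and "\<And>x y. x \<in> Tens_comm g \<Longrightarrow> y \<in> Tens_comm g \<Longrightarrow> P x \<Longrightarrow> P y \<Longrightarrow> P (x + y)"
  shows "P p"
  using assms(1)[unfolded Tens_comm_def]
proof (induction rule: generate.induct)
  case one
  then show ?case using assms(2) by (simp add: Tens_group_simps)
next
  case (incl h)
  then show ?case using assms(3) by blast
next
  case (inv h)
  then obtain x y where h: "h = x * y - y * x" "x \<in> Tens g" "y \<in> Tens g" by blast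
  have "h \<in> Tens_comm g" unfolding h by (rule commutator_Tens_comm[OF h(2,3)])
  then have "P (- h)" using assms(3,4) h by blast
  then show ?case using h by (simp add: Tens_group_inv)
next
  case (eng h1 h2)
  then have "h1 \<in> Tens_comm g" "h2 \<in> Tens_comm g" unfolding Tens_comm_def by blast+
  then show ?case using assms(5) eng by (simp add: Tens_group_simps)
qed

section \<open>Necklaces and commutators\<close>

lemma single_append: "Poly_Mapping.single (u @ v) (a * b) = Poly_Mapping.single u a * Poly_Mapping.single v (b :: int)"
  unfolding mult_single plus_list_def ..

lemma single_rotate_Tens_comm:
  assumes "set w \<subseteq> gens g" "u \<in> rots w"
  shows "Poly_Mapping.single w c - Poly_Mapping.single u c \<in> Tens_comm g"
proof -
  from assms(2) obtain i where u: "u = rotate i w" by (auto simp: rots_def)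
  define j where "j = i mod length w"
  have u': "u = drop j w @ take j w" unfolding u j_def by (rule rotate_drop_take)
  have "Poly_Mapping.single (take j w @ drop j w) (c * 1) - Poly_Mapping.single (drop j w @ take j w) (1 * c) \<in> Tens_comm g"
    unfolding single_append
    using assms(1) set_take_subset[of j w] set_drop_subset[of j w]
    by (intro commutator_Tens_comm Tens_single) auto
  then show ?thesis using u' by simp
qed

lemma rots_eq: "u \<in> rots w \<Longrightarrow> rots u = rots w"
proof -
  have sub: "u \<in> rots w \<Longrightarrow> rots u \<subseteq> rots w" for u w :: "'a list"
    by (auto simp: rots_def rotate_rotate)
  assume u: "u \<in> rots w"
  have "w \<in> rots u"
  proof (cases "w = []")
    case False
    from u obtain i where "u = rotate i w" by (auto simp: rots_def)
    then have "rotate (length w - i mod length w) u = rotate (length w - i mod length w) (rotate (i mod length w) w)"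
      by (metis rotate_conv_mod)
    also have "\<dots> = w" using False by (simp add: rotate_rotate less_imp_le)
    finally show ?thesis unfolding rots_def by (metis rangeI)
  qed (use u in \<open>auto simp: rots_def\<close>)
  then show "rots u = rots w" using sub[OF u] sub[of w u] by auto
qed

text \<open>Modulo commutators each word may be replaced by a chosen rotation. The coefficients
  collected at a chosen word then form one cyclic coefficient, so p equals a sum of differences
  between words and their chosen rotations.\<close>

lemma Tens_comm_if_cyc_zero:
  assumes p: "p \<in> Tens g" and cyc: "\<And>v. cyc v (ser p) = 0"
  shows "p \<in> Tens_comm g"
proof -
  \<comment> \<open>The choice depends only on the set \<open>rots w\<close>, hence it is constant
    on each necklace.\<close>
  define nf where "nf w = (SOME u. u \<in> rots w)" for w :: "gen list"
  have nf: "nf w \<in> rots w" for w unfolding nf_def by (rule someI[of "\<lambda>u. u \<in> rots w", OF rots_self])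
  have nf_eq: "nf u = nf w" if "u \<in> rots w" for u w using rots_eq[OF that] by (simp add: nf_def)
  let ?K = "Poly_Mapping.keys p" and ?l = "Poly_Mapping.lookup p"
  have "(\<Sum>w\<in>?K. Poly_Mapping.single (nf w) (?l w)) = 0"
  proof (rule poly_mapping_eqI)
    fix u
    have "Poly_Mapping.lookup (\<Sum>w\<in>?K. Poly_Mapping.single (nf w) (?l w)) u = (\<Sum>w\<in>?K. if nf w = u then ?l w else 0)"
      by (simp add: lookup_sum lookup_single when_def)
    also have "\<dots> = (\<Sum>w\<in>{w \<in> ?K. nf w = u}. ?l w)" by (simp add: sum.inter_filter)
    also have "\<dots> = 0"
    proof (cases "\<exists>w. nf w = u")
      case True
      then obtain w0 where w0: "nf w0 = u" by blast
      have uu: "nf u = u" using nf_eq[OF nf[of w0]] w0 by simp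
      have "nf w = u \<longleftrightarrow> w \<in> rots u" for w
      proof
        assume "nf w = u"
        then show "w \<in> rots u" using nf[of w] rots_eq[of u w] rots_self[of w] by simp
      next
        assume "w \<in> rots u"
        then show "nf w = u" using nf_eq[of w u] uu by simp
      qed
      then have "(\<Sum>w\<in>{w \<in> ?K. nf w = u}. ?l w) = (\<Sum>w\<in>rots u. ?l w)"
        by (intro sum.mono_neutral_left) (auto simp: in_keys_iff)
      also have "\<dots> = cyc u (ser p)" by (simp add: cyc_def)
      finally show ?thesis using cyc by simp
    next
      case False
      then show ?thesis by simp
    qed
    finally show "Poly_Mapping.lookup (\<Sum>w\<in>?K. Poly_Mapping.single (nf w) (?l w)) u = Poly_Mapping.lookup 0 u" by simp
  qed
  then have "p = (\<Sum>w\<in>?K. Poly_Mapping.single w (?l w) - Poly_Mapping.single (nf w) (?l w))"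
    using tensor_expand[of p] by (simp add: sum_subtractf)
  also have "\<dots> \<in> Tens_comm g"
    using p nf by (intro Tens_comm_sum single_rotate_Tens_comm) (auto simp: tensor_on_def)
  finally show ?thesis .
qed

lemma cyc_class_eq_iff:
  "p \<in> Tens g \<Longrightarrow> q \<in> Tens g \<Longrightarrow> cyc_class g p = cyc_class g q \<longleftrightarrow> p - q \<in> Tens_comm g"
  using T.rcos_eq_iff[OF Tens_comm_normal, of p g q]
  by (simp add: cyc_class_def Tens_group_simps Tens_group_inv)

lemma cyc_class_add:
  "p \<in> Tens g \<Longrightarrow> q \<in> Tens g \<Longrightarrow> cyc_class g p <#>\<^bsub>Tens_group g\<^esub> cyc_class g q = cyc_class g (p + q)"
  using normal.rcos_sum[OF Tens_comm_normal, of p g q] by (simp add: cyc_class_def Tens_group_simps)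

lemma cyc_class_zero: "cyc_class g 0 = Tens_comm g"
  using T.coset_mult_one[of "Tens_comm g"] Tens_comm_closed(4) by (auto simp: cyc_class_def Tens_group_simps)

lemma cyc_class_mem: "p \<in> Tens g \<Longrightarrow> x \<in> cyc_class g p \<longleftrightarrow> x \<in> Tens g \<and> x - p \<in> Tens_comm g"
proof -
  assume p: "p \<in> Tens g"
  have "x \<in> cyc_class g p \<longleftrightarrow> (\<exists>h\<in>Tens_comm g. x = h + p)"
    by (auto simp: cyc_class_def r_coset_def Tens_group_simps)
  also have "\<dots> \<longleftrightarrow> x \<in> Tens g \<and> x - p \<in> Tens_comm g"
    using p Tens_comm_closed(4) by (auto intro!: bexI[of _ "x - p"])
  finally show ?thesis .
qed

section \<open>The groups of cyclic tensors\<close>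

lemma Cyc_simps: "carrier (Cyc g k) = cyc_class g ` tensor_part (gens g) k"
  "x \<otimes>\<^bsub>Cyc g k\<^esub> y = x <#>\<^bsub>Tens_group g\<^esub> y" "\<one>\<^bsub>Cyc g k\<^esub> = Tens_comm g"
  by (simp_all add: Cyc_def FactGroup_def)

lemma tensor_part_closed:
  "0 \<in> tensor_part (gens g) k" "p \<in> tensor_part (gens g) k \<Longrightarrow> q \<in> tensor_part (gens g) k \<Longrightarrow> p + q \<in> tensor_part (gens g) k"
  "p \<in> tensor_part (gens g) k \<Longrightarrow> - p \<in> tensor_part (gens g) k"
  using hom_deg_add[of "gens g" k "ser p" "ser q"] hom_deg_diff[of "gens g" k 0 "ser p"]
  by (simp_all add: tensor_part_iff ser_add ser_minus)

lemma Cyc_mult: "p \<in> tensor_part (gens g) k \<Longrightarrow> q \<in> tensor_part (gens g) k \<Longrightarrow>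
    cyc_class g p \<otimes>\<^bsub>Cyc g k\<^esub> cyc_class g q = cyc_class g (p + q)"
  by (simp add: Cyc_simps cyc_class_add tensor_part_Tens)

lemma Cyc_comm_group: "comm_group (Cyc g k)"
proof (rule comm_groupI)
  fix x y z assume x: "x \<in> carrier (Cyc g k)" and y: "y \<in> carrier (Cyc g k)" and z: "z \<in> carrier (Cyc g k)"
  from x obtain p where p: "x = cyc_class g p" "p \<in> tensor_part (gens g) k" by (auto simp: Cyc_simps)
  from y obtain q where q: "y = cyc_class g q" "q \<in> tensor_part (gens g) k" by (auto simp: Cyc_simps)
  from z obtain r where r: "z = cyc_class g r" "r \<in> tensor_part (gens g) k" by (auto simp: Cyc_simps)
  show "x \<otimes>\<^bsub>Cyc g k\<^esub> y \<in> carrier (Cyc g k)" using p q by (simp add: Cyc_mult Cyc_simps(1) tensor_part_closed)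
  show "x \<otimes>\<^bsub>Cyc g k\<^esub> y \<otimes>\<^bsub>Cyc g k\<^esub> z = x \<otimes>\<^bsub>Cyc g k\<^esub> (y \<otimes>\<^bsub>Cyc g k\<^esub> z)"
    using p q r by (simp add: Cyc_mult tensor_part_closed add.assoc)
  show "x \<otimes>\<^bsub>Cyc g k\<^esub> y = y \<otimes>\<^bsub>Cyc g k\<^esub> x" using p q by (simp add: Cyc_mult add.commute)
  show "\<one>\<^bsub>Cyc g k\<^esub> \<otimes>\<^bsub>Cyc g k\<^esub> x = x"
    using Cyc_mult[of 0 g k p] p tensor_part_closed(1) by (simp add: Cyc_simps(3) cyc_class_zero)
  show "\<exists>y\<in>carrier (Cyc g k). y \<otimes>\<^bsub>Cyc g k\<^esub> x = \<one>\<^bsub>Cyc g k\<^esub>"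
    using p Cyc_mult[of "- p" g k p] tensor_part_closed(3)
    by (intro bexI[of _ "cyc_class g (- p)"]) (simp_all add: Cyc_simps(1,3) cyc_class_zero)
next
  show "\<one>\<^bsub>Cyc g k\<^esub> \<in> carrier (Cyc g k)"
    using imageI[OF tensor_part_closed(1), of "cyc_class g" g k] by (simp add: Cyc_simps cyc_class_zero)
qed

interpretation C: comm_group "Cyc g k" for g k by (rule Cyc_comm_group)

lemma Cyc_inv: "p \<in> tensor_part (gens g) k \<Longrightarrow> inv\<^bsub>Cyc g k\<^esub> cyc_class g p = cyc_class g (- p)"
  by (rule C.inv_equality) (simp_all add: Cyc_mult tensor_part_closed Cyc_simps(1,3) cyc_class_zero)

section \<open>The Satoh trace\<close>

lemma exponent_sum_pi_gen: "exponent_sum e (pi_gen x) = (if x = e then 1 else 0)"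
  by (simp add: exponent_sum_def pi_gen_def)

text \<open>The bridge between the Satoh trace, given by contractions, and the diagonal entries of
  Jacobian matrices, given by \<open>lder\<close>.\<close>

lemma ser_contract:
  assumes p: "p \<in> Tens g" and e: "e \<in> gens g"
  shows "ser (contract g (dual_basis e) p) = lder e (ser p)"
proof (rule ncps_eqI)
  fix u
  have t: "Poly_Mapping.lookup (case w of [] \<Rightarrow> 0 | x # w' \<Rightarrow>
      Poly_Mapping.single w' (Poly_Mapping.lookup p w * dual_basis e (hclass g (pi_gen x)))) u
    = (if w = e # u then Poly_Mapping.lookup p w else 0)" if w: "w \<in> Poly_Mapping.keys p" for w
  proof (cases w)
    case (Cons x w')
    then have "x \<in> gens g" using w p by (auto simp: tensor_on_def)
    then have "dual_basis e (hclass g (pi_gen x)) = (if x = e then 1 else 0)"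
      using e by (simp add: dual_basis_hclass pi_gen_carrier exponent_sum_pi_gen)
    then show ?thesis using Cons by (auto simp: lookup_single when_def)
  qed simp
  have "nc (ser (contract g (dual_basis e) p)) u = (\<Sum>w\<in>Poly_Mapping.keys p. if w = e # u then Poly_Mapping.lookup p w else 0)"
    unfolding contract_def nc_ser lookup_sum by (rule sum.cong[OF HOL.refl t])
  also have "\<dots> = Poly_Mapping.lookup p (e # u)" by (simp add: in_keys_iff)
  finally show "nc (ser (contract g (dual_basis e) p)) u = nc (lder e (ser p)) u" by simp
qed

definition trace_tensor :: "nat \<Rightarrow> (gen free_lie \<Rightarrow> gen free_lie) \<Rightarrow> gen tensor" where
  "trace_tensor g d = (\<Sum>e \<in> gens g. contract g (dual_basis e) (lie_tensor (d (lie_gen e))))"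

lemma satoh_trace_eq: "satoh_trace g d = cyc_class g (trace_tensor g d)"
  by (simp add: satoh_trace_def trace_tensor_def)

lemma hom_deg_lder: "hom_deg X (Suc n) f \<Longrightarrow> hom_deg X n (lder e f)"
  unfolding hom_deg_def
proof (intro allI impI)
  fix w assume *: "\<forall>w. nc f w \<noteq> 0 \<longrightarrow> length w = Suc n \<and> set w \<subseteq> X" "nc (lder e f) w \<noteq> 0"
  then have "length (e # w) = Suc n \<and> set (e # w) \<subseteq> X" by (metis nc_lder)
  then show "length w = n \<and> set w \<subseteq> X" by simp
qed

lemma ser_trace_tensor:
  assumes d: "d \<in> Der g k"
  shows "ser (trace_tensor g d) = (\<Sum>e\<in>gens g. lder e (lser (d (lie_gen e))))"
  unfolding trace_tensor_def ser_sum lser_def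
  using tensor_part_Tens[OF lie_tensor_part[OF Der_gen_part[OF d]]]
  by (intro sum.cong HOL.refl ser_contract)

lemma trace_tensor_part: "d \<in> Der g k \<Longrightarrow> trace_tensor g d \<in> tensor_part (gens g) k"
  unfolding tensor_part_iff
  using hom_deg_lder[OF hom_deg_lser_part[OF Der_gen_part, unfolded Suc_eq_plus1[symmetric]]]
  by (auto simp: ser_trace_tensor intro!: hom_deg_sum)

definition der_add where "der_add g d d' = (\<lambda>l\<in>Lie g. d l + (d' l :: gen free_lie))"
definition der_neg where "der_neg g d = (\<lambda>l\<in>Lie g. - (d l :: gen free_lie))"
definition der_zero where "der_zero g = (\<lambda>l\<in>Lie g. (0 :: gen free_lie))"

lemma der_add_Der: "d \<in> Der g k \<Longrightarrow> d' \<in> Der g k \<Longrightarrow> der_add g d d' \<in> Der g k"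
  unfolding Der_def der_add_def
  by (auto simp: Lie_add lie_ring_on.br lie_br_add_left lie_br_add_right Lie_part_subset Lie_part_add)

lemma der_neg_Der: "d \<in> Der g k \<Longrightarrow> der_neg g d \<in> Der g k"
  unfolding Der_def der_neg_def
  by (auto simp: Lie_add lie_ring_on.br lie_br_minus Lie_part_subset Lie_part_minus)

lemma der_zero_Der: "der_zero g \<in> Der g k"
  unfolding Der_def der_zero_def by (auto simp: Lie_add lie_ring_on.br Lie_part_subset)

lemma trace_tensor_add:
  assumes "d \<in> Der g k" "d' \<in> Der g k"
  shows "trace_tensor g (der_add g d d') = trace_tensor g d + trace_tensor g d'"
  by (rule ser_inject, unfold ser_add ser_trace_tensor[OF der_add_Der[OF assms]]
      ser_trace_tensor[OF assms(1)] ser_trace_tensor[OF assms(2)])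
    (simp add: der_add_def lie_ring_on.gen lser_simps lder_simps sum.distrib)

lemma trace_tensor_neg:
  assumes "d \<in> Der g k"
  shows "trace_tensor g (der_neg g d) = - trace_tensor g d"
  by (rule ser_inject, unfold ser_minus ser_trace_tensor[OF der_neg_Der[OF assms]] ser_trace_tensor[OF assms(1)])
    (simp add: der_neg_def lie_ring_on.gen lser_simps lder_simps sum_negf)

lemma trace_tensor_zero: "trace_tensor g (der_zero g) = 0"
  by (rule ser_inject, unfold ser_trace_tensor[OF der_zero_Der[of g 0]])
    (simp add: der_zero_def lie_ring_on.gen lser_simps lder_simps)

lemma satoh_trace_tau':
  assumes "f \<in> Johnson_A g k" "2 \<le> k"
  shows "trace_tensor g (tau' g k f) \<in> Tens_comm g"
proof -
  have d: "tau' g k f \<in> Der g k" using assms by (intro tau'_Der) auto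
  show ?thesis
    using cyc_trace_tau'[OF assms] tensor_part_Tens[OF trace_tensor_part[OF d]]
    by (intro Tens_comm_if_cyc_zero) (simp_all add: ser_trace_tensor[OF d])
qed

lemma Der_symp_closed:
  "d \<in> Der_symp g k \<Longrightarrow> d' \<in> Der_symp g k \<Longrightarrow> der_add g d d' \<in> Der_symp g k"
  "d \<in> Der_symp g k \<Longrightarrow> der_neg g d \<in> Der_symp g k" "der_zero g \<in> Der_symp g k"
  using Lie_part_subset[OF omega_part]
  by (auto simp: Der_symp_def der_add_Der der_neg_Der der_zero_Der)
    (simp_all add: der_add_def der_neg_def der_zero_def)

lemma Cyc_bar_subgroup: "subgroup (Cyc_bar g k) (Cyc g k)"
proof (rule C.subgroupI)
  show "Cyc_bar g k \<subseteq> carrier (Cyc g k)"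
    by (auto simp: Cyc_bar_def Cyc_simps satoh_trace_eq Der_symp_def intro!: trace_tensor_part)
  show "Cyc_bar g k \<noteq> {}" using Der_symp_closed(3) by (auto simp: Cyc_bar_def)
next
  fix a assume "a \<in> Cyc_bar g k"
  then obtain d where d: "d \<in> Der_symp g k" "a = satoh_trace g d" by (auto simp: Cyc_bar_def)
  then have D: "d \<in> Der g k" by (simp add: Der_symp_def)
  have "inv\<^bsub>Cyc g k\<^esub> a = satoh_trace g (der_neg g d)"
    using D d by (simp add: satoh_trace_eq Cyc_inv trace_tensor_part trace_tensor_neg)
  then show "inv\<^bsub>Cyc g k\<^esub> a \<in> Cyc_bar g k" using Der_symp_closed(2)[OF d(1)] by (simp add: Cyc_bar_def)
next
  fix a b assume "a \<in> Cyc_bar g k" "b \<in> Cyc_bar g k"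
  then obtain d d' where d: "d \<in> Der_symp g k" "a = satoh_trace g d" "d' \<in> Der_symp g k" "b = satoh_trace g d'"
    by (auto simp: Cyc_bar_def)
  then have D: "d \<in> Der g k" "d' \<in> Der g k" by (simp_all add: Der_symp_def)
  have "a \<otimes>\<^bsub>Cyc g k\<^esub> b = satoh_trace g (der_add g d d')"
    using D d by (simp add: satoh_trace_eq Cyc_mult trace_tensor_part trace_tensor_add)
  then show "a \<otimes>\<^bsub>Cyc g k\<^esub> b \<in> Cyc_bar g k" using Der_symp_closed(1)[OF d(1,3)] by (simp add: Cyc_bar_def)
qed

lemma Cyc_bar_normal: "Cyc_bar g k \<lhd> Cyc g k"
  by (rule C.subgroup_imp_normal[OF Cyc_bar_subgroup])

definition ctr :: "nat \<Rightarrow> nat \<Rightarrow> (gen free_lie \<Rightarrow> gen free_lie) \<Rightarrow> gen tensor set set" where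
  "ctr g k d = Cyc_bar g k #>\<^bsub>Cyc g k\<^esub> satoh_trace g d"

lemma satoh_trace_carrier: "d \<in> Der g k \<Longrightarrow> satoh_trace g d \<in> carrier (Cyc g k)"
  by (simp add: Cyc_simps satoh_trace_eq trace_tensor_part)

lemma ctr_add:
  assumes "d \<in> Der g k" "d' \<in> Der g k"
  shows "ctr g k (der_add g d d') = ctr g k d \<otimes>\<^bsub>Cyc g k Mod Cyc_bar g k\<^esub> ctr g k d'"
proof -
  have "satoh_trace g (der_add g d d') = satoh_trace g d \<otimes>\<^bsub>Cyc g k\<^esub> satoh_trace g d'"
    using assms by (simp add: satoh_trace_eq Cyc_mult trace_tensor_part trace_tensor_add)
  then show ?thesis
    using normal.rcos_sum[OF Cyc_bar_normal satoh_trace_carrier[OF assms(1)] satoh_trace_carrier[OF assms(2)]]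
    by (simp add: ctr_def FactGroup_def)
qed

lemma ctr_carrier: "d \<in> Der g k \<Longrightarrow> ctr g k d \<in> carrier (Cyc g k Mod Cyc_bar g k)"
  using satoh_trace_carrier by (auto simp: ctr_def FactGroup_def RCOSETS_def)

lemma ctr_symp:
  assumes "d \<in> Der_symp g k"
  shows "ctr g k d = \<one>\<^bsub>Cyc g k Mod Cyc_bar g k\<^esub>"
proof -
  have "satoh_trace g d \<in> Cyc_bar g k" using assms by (simp add: Cyc_bar_def)
  then show ?thesis
    using C.coset_join2[OF _ Cyc_bar_subgroup] satoh_trace_carrier assms
    by (simp add: ctr_def FactGroup_def Der_symp_def)
qed

lemma ctr_eqI:
  assumes "d \<in> Der g k" "d' \<in> Der g k" "trace_tensor g d - trace_tensor g d' \<in> Tens_comm g"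
  shows "ctr g k d = ctr g k d'"
  using cyc_class_eq_iff[OF tensor_part_Tens[OF trace_tensor_part[OF assms(1)]]
      tensor_part_Tens[OF trace_tensor_part[OF assms(2)]]] assms(3)
  by (simp add: ctr_def satoh_trace_eq)

text \<open>Two derivations with the same value at \<omega> differ by an element of
  \<open>Der_symp\<close>, whose trace is trivial in the quotient.\<close>

lemma psi_eval:
  assumes d: "d \<in> Der g k"
  shows "psi g k (d (omega g)) = ctr g k d"
  unfolding psi_def
proof (rule the_equality)
  show "\<exists>d'\<in>Der g k. d' (omega g) = d (omega g) \<and> ctr g k d = Cyc_bar g k #>\<^bsub>Cyc g k\<^esub> satoh_trace g d'"
    using d by (auto simp: ctr_def)
  fix c assume "\<exists>d'\<in>Der g k. d' (omega g) = d (omega g) \<and> c = Cyc_bar g k #>\<^bsub>Cyc g k\<^esub> satoh_trace g d'"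
  then obtain d' where d': "d' \<in> Der g k" "d' (omega g) = d (omega g)" "c = ctr g k d'" by (auto simp: ctr_def)
  define e where "e = der_add g d' (der_neg g d)"
  have e: "e \<in> Der_symp g k"
    using d d' Lie_part_subset[OF omega_part] by (simp add: Der_symp_def e_def der_add_Der der_neg_Der)
      (simp add: der_add_def der_neg_def)
  then have eD: "e \<in> Der g k" by (simp add: Der_symp_def)
  have "d' = der_add g e d"
    using d'(1) by (auto simp: der_add_def e_def der_neg_def Der_def extensional_def)
  then have "c = ctr g k e \<otimes>\<^bsub>Cyc g k Mod Cyc_bar g k\<^esub> ctr g k d" using ctr_add[OF eD d] d'(3) by simp
  also have "\<dots> = ctr g k d"
    using ctr_symp[OF e] ctr_carrier[OF d] monoid.l_one[OF group.is_monoid[OF normal.factorgroup_is_group[OF Cyc_bar_normal]]] by simp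
  finally show "c = ctr g k d" .
qed

section \<open>Surjectivity of the evaluation at omega\<close>

definition gen_brackets :: "nat \<Rightarrow> nat \<Rightarrow> gen free_lie set" where
  "gen_brackets g n = {\<Sum>e\<in>gens g. lie_br (lie_gen e) (t e) | t. \<forall>e\<in>gens g. t e \<in> Lie_part g n}"

lemma lie_br_diff: "lie_br (u - v) w = lie_br u w - lie_br v w" "lie_br w (u - v) = lie_br w u - lie_br w v"
  using lie_br_add_left[of "u - v" v w] lie_br_add_right[of w "u - v" v] by (simp_all add: eq_diff_eq)

lemma gen_brackets_diff:
  assumes "u \<in> gen_brackets g n" "v \<in> gen_brackets g n"
  shows "u - v \<in> gen_brackets g n"
proof -
  from assms obtain s t where "\<forall>e\<in>gens g. s e \<in> Lie_part g n" "u = (\<Sum>e\<in>gens g. lie_br (lie_gen e) (s e))"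
    "\<forall>e\<in>gens g. t e \<in> Lie_part g n" "v = (\<Sum>e\<in>gens g. lie_br (lie_gen e) (t e))"
    by (auto simp: gen_brackets_def)
  then show ?thesis unfolding gen_brackets_def mem_Collect_eq
    by (intro exI[of _ "\<lambda>e. s e - t e"]) (simp add: lie_br_diff sum_subtractf Lie_part_diff)
qed

lemma gen_brackets_zero: "0 \<in> gen_brackets g n"
  unfolding gen_brackets_def mem_Collect_eq by (intro exI[of _ "\<lambda>e. 0"]) simp

text \<open>By the Jacobi identity [[u, u'], v] = [u, [u', v]] - [u', [u, v]], so the left entry can
  be broken down to generators. The right entries then have the total degree minus one.\<close>

lemma lie_br_gen_brackets:
  "lie_homogeneous (gens g) m u \<Longrightarrow> v \<in> Lie_part g n \<Longrightarrow> lie_br u v \<in> gen_brackets g (m + n - 1)"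
proof (induction arbitrary: v n rule: lie_homogeneous.induct)
  case (gen x)
  have "(\<Sum>e\<in>gens g. lie_br (lie_gen e) (if e = x then v else 0)) = (\<Sum>e\<in>gens g. if e = x then lie_br (lie_gen x) v else 0)"
    by (rule sum.cong) auto
  also have "\<dots> = lie_br (lie_gen x) v" using gen by simp
  finally show ?case unfolding gen_brackets_def mem_Collect_eq using gen
    by (intro exI[of _ "\<lambda>e. if e = x then v else 0"]) auto
next
  case (br m u m' u')
  have "lie_br u (lie_br u' v) \<in> gen_brackets g (m + (m' + n) - 1)"
    using br by (intro br.IH(1) Lie_part_br) (simp_all add: lie_part_def)
  moreover have "lie_br u' (lie_br u v) \<in> gen_brackets g (m' + (m + n) - 1)"
    using br by (intro br.IH(2) Lie_part_br) (simp_all add: lie_part_def)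
  moreover have "lie_br (lie_br u u') v = lie_br u (lie_br u' v) - lie_br u' (lie_br u v)"
    using lie_br_jacobi'[of u u' v] lie_br_anti[of "lie_br u v" u'] by simp
  ultimately show ?case using gen_brackets_diff by (simp add: add.assoc add.left_commute)
next
  case (zero k)
  then show ?case using gen_brackets_zero by simp
next
  case (diff k u u')
  then show ?case by (simp add: lie_br_diff gen_brackets_diff)
qed

lemma Lie_part_gen_brackets:
  assumes "l \<in> Lie_part g n" "2 \<le> n"
  shows "l \<in> gen_brackets g (n - 1)"
  using assms unfolding lie_part_def mem_Collect_eq
proof (induction rule: lie_homogeneous.induct)
  case (br m u n v)
  then show ?case using lie_br_gen_brackets[of g m u v n] by (simp add: lie_part_def)
qed (auto intro: gen_brackets_zero gen_brackets_diff)

lemma sum_gens: "(\<Sum>e\<in>gens g. h e) = (\<Sum>i=1..g. h (Alpha i)) + (\<Sum>i=1..g. (h (Beta i) :: 'a::comm_monoid_add))"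
proof -
  have "(\<Sum>e\<in>gens g. h e) = sum h (Alpha ` {1..g}) + sum h (Beta ` {1..g})"
    unfolding gens_def by (rule sum.union_disjoint) auto
  then show ?thesis by (simp add: sum.reindex inj_on_def)
qed

lemma Lie_sum: "(\<And>a. a \<in> A \<Longrightarrow> f a \<in> Lie g) \<Longrightarrow> sum f A \<in> Lie g"
  by (induction A rule: infinite_finite_induct) (auto intro: Lie_add lie_ring_on.zero)

lemma Der_sum:
  assumes "d \<in> Der g k" and "\<And>a. a \<in> A \<Longrightarrow> f a \<in> Lie g"
  shows "d (sum f A) = (\<Sum>a\<in>A. d (f a))"
  using assms(2)
proof (induction A rule: infinite_finite_induct)
  case (insert a A)
  then show ?case using Der_add[OF assms(1), of "f a" "sum f A"] Lie_sum[of A f g] by simp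
qed (auto simp: Der_zero[OF assms(1)])

lemma Der_omega:
  assumes d: "d \<in> Der g k"
  shows "d (omega g) = (\<Sum>i=1..g. lie_br (d (lie_gen (Alpha i))) (lie_gen (Beta i)) + lie_br (lie_gen (Alpha i)) (d (lie_gen (Beta i))))"
  unfolding omega_def
  using Alpha_Beta_gens by (subst Der_sum[OF d]) (auto intro!: sum.cong Der_br[OF d] lie_ring_on.br lie_ring_on.gen)

lemma Der_omega_surj:
  assumes "l \<in> Lie_part g (k + 2)"
  shows "\<exists>d\<in>Der g k. d (omega g) = l"
proof -
  have "l \<in> gen_brackets g (k + 1)" using Lie_part_gen_brackets[OF assms] by simp
  then obtain t where t: "\<And>e. e \<in> gens g \<Longrightarrow> t e \<in> Lie_part g (k + 1)" "l = (\<Sum>e\<in>gens g. lie_br (lie_gen e) (t e))"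
    by (auto simp: gen_brackets_def)
  \<comment> \<open>Since d(\<omega>) is the sum of all [d(a_i), b_i] + [a_i, d(b_i)], the element l
    is reached with d(a_i) = -t(b_i) and d(b_i) = t(a_i).\<close>
  define s where "s e = (case e of Alpha i \<Rightarrow> - t (Beta i) | Beta i \<Rightarrow> t (Alpha i))" for e
  have s: "s e \<in> Lie_part g (k + 1)" if "e \<in> gens g" for e
  proof (cases e)
    case (Alpha i)
    then have "Beta i \<in> gens g" using that by (auto simp: gens_def)
    then show ?thesis using t(1) Alpha by (simp add: s_def Lie_part_minus)
  next
    case (Beta i)
    then have "Alpha i \<in> gens g" using that by (auto simp: gens_def)
    then show ?thesis using t(1) Beta by (simp add: s_def)
  qed
  define d where "d = der_ext g s"
  have d: "d \<in> Der g k" unfolding d_def by (rule der_ext_Der[OF s])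
  have "d (omega g) = (\<Sum>i=1..g. lie_br (lie_gen (Beta i)) (t (Beta i)) + lie_br (lie_gen (Alpha i)) (t (Alpha i)))"
    unfolding Der_omega[OF d]
  proof (rule sum.cong[OF HOL.refl])
    fix i assume i: "i \<in> {1..g}"
    have "lie_br (- t (Beta i)) (lie_gen (Beta i)) = lie_br (lie_gen (Beta i)) (t (Beta i))"
      using lie_br_anti[of "lie_gen (Beta i)" "t (Beta i)"] by (simp add: lie_br_minus)
    then show "lie_br (d (lie_gen (Alpha i))) (lie_gen (Beta i)) + lie_br (lie_gen (Alpha i)) (d (lie_gen (Beta i)))
        = lie_br (lie_gen (Beta i)) (t (Beta i)) + lie_br (lie_gen (Alpha i)) (t (Alpha i))"
      using Alpha_Beta_gens[OF i] by (simp add: d_def der_ext_gen s_def)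
  qed
  also have "\<dots> = l" unfolding t(2) sum_gens sum.distrib by (rule add.commute)
  finally show ?thesis using d by blast
qed

section \<open>The induced trace\<close>

text \<open>Writing h(x) = c x with c in Gamma_n, the composite differs from the sum of the two
  differences by the motion of c under f, of order n + k, and by a product of orders n and k + 1.
  Additivity of \<open>tau'\<close> and \<open>mu\<close> and the comparison of two lifts rest on
  this.\<close>

lemma dM_compose:
  assumes f: "f \<in> Johnson_A g k" and k: "1 \<le> k" and h: "h \<in> auto (surface_group g)"
    and x: "x \<in> PI g" and n: "1 \<le> n" and o: "ord_ge n (dM h x)"
  shows "ord_ge (n + 1) (dM (compose (PI g) f h) x - dM f x - dM h x)"
proof -
  note af = Johnson_A_D(1)[OF f]
  interpret f: group_hom "surface_group g" "surface_group g" f by (rule auto_homD(1)[OF af])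
  define c where "c = h x \<otimes>\<^bsub>surface_group g\<^esub> inv\<^bsub>surface_group g\<^esub> x"
  have c: "c \<in> Gam g n" unfolding c_def using o by (simp add: quotient_Gam_iff[OF h x])
  have cc: "c \<in> PI g" using c by (rule S.lower_central_carrier)
  have hx: "h x = c \<otimes>\<^bsub>surface_group g\<^esub> x"
    using x auto_homD(4)[OF h x] by (simp add: c_def S.m_assoc)
  have "dM (compose (PI g) f h) x - dM f x - dM h x = dM f c * magnus (f x) + (magnus c - 1) * dM f x"
    using x cc by (simp add: dM_def compose_def hx magnus_surface_mult left_diff_distrib right_diff_distrib)
  moreover have "ord_ge (n + 1) (dM f c * magnus (f x))"
    using ord_ge_mono[OF dM_Gam[OF f n c], of "n + 1"] k by (intro ord_ge_mult_right) simp
  moreover have "ord_ge (n + 1) ((magnus c - 1) * dM f x)"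
    by (rule ord_ge_mult[OF magnus_Gam[OF c] Johnson_A_D(2)[OF f x]]) simp
  ultimately show ?thesis by (simp add: ord_ge_add)
qed

lemma dM_tau'_gen:
  "f \<in> Johnson_A g k \<Longrightarrow> 1 \<le> k \<Longrightarrow> e \<in> gens g \<Longrightarrow>
    ord_ge (k + 2) (dM f (pi_gen e) - lser (tau' g k f (lie_gen e)))"
  using dM_tau'[OF _ _ lie_rep.gen, of f g k e] by simp

lemma Johnson_A_compose:
  assumes f: "f \<in> Johnson_A g k" and h: "h \<in> Johnson_A g k" and k: "1 \<le> k"
  shows "compose (PI g) f h \<in> Johnson_A g k"
    "tau' g k (compose (PI g) f h) = der_add g (tau' g k f) (tau' g k h)"
proof -
  note af = Johnson_A_D(1)[OF f] and ah = Johnson_A_D(1)[OF h]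
  have o: "ord_ge (k + 2) (dM (compose (PI g) f h) x - dM f x - dM h x)" if x: "x \<in> PI g" for x
    using dM_compose[OF f k ah x _ Johnson_A_D(2)[OF h x]] by simp
  show A: "compose (PI g) f h \<in> Johnson_A g k"
    unfolding Johnson_A_iff
  proof (intro conjI ballI)
    show "compose (PI g) f h \<in> auto (surface_group g)" by (rule auto_compose[OF af ah])
    fix x assume x: "x \<in> PI g"
    from ord_ge_add[OF ord_ge_add[OF ord_ge_mono[OF o[OF x], of "k + 1"] Johnson_A_D(2)[OF f x]] Johnson_A_D(2)[OF h x]]
    show "ord_ge (k + 1) (dM (compose (PI g) f h) x)" by simp
  qed
  show "tau' g k (compose (PI g) f h) = der_add g (tau' g k f) (tau' g k h)"
  proof (rule tau'_eqI[OF A k der_add_Der[OF tau'_Der[OF f k] tau'_Der[OF h k]]])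
    fix e assume e: "e \<in> gens g"
    from ord_ge_add[OF ord_ge_add[OF o[OF pi_gen_carrier[OF e]] dM_tau'_gen[OF f k e]] dM_tau'_gen[OF h k e]]
    show "ord_ge (k + 2) (dM (compose (PI g) f h) (pi_gen e) - lser (der_add g (tau' g k f) (tau' g k h) (lie_gen e)))"
      using e by (simp add: der_add_def lie_ring_on.gen lser_simps algebra_simps)
  qed
qed

lemma auto_id: "(\<lambda>x\<in>PI g. x) \<in> auto (surface_group g)"
  by (rule autoI) (auto intro!: homI simp: bij_betw_def inj_on_def)

lemma Johnson_A_id:
  shows "(\<lambda>x\<in>PI g. x) \<in> Johnson_A g k"
    and "1 \<le> k \<Longrightarrow> tau' g k (\<lambda>x\<in>PI g. x) = der_zero g"
proof -
  show A: "(\<lambda>x\<in>PI g. x) \<in> Johnson_A g k" by (simp add: Johnson_A_iff auto_id dM_def)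
  assume k: "1 \<le> k"
  show "tau' g k (\<lambda>x\<in>PI g. x) = der_zero g"
    by (rule tau'_eqI[OF A k der_zero_Der])
      (simp add: dM_def pi_gen_carrier der_zero_def lie_ring_on.gen lser_simps)
qed

lemma Johnson_A_inv:
  assumes f: "f \<in> Johnson_A g k" and k: "1 \<le> k"
  shows "auto_inv g f \<in> Johnson_A g k" "tau' g k (auto_inv g f) = der_neg g (tau' g k f)"
proof -
  note af = Johnson_A_D(1)[OF f]
  note ai = auto_inv_auto[OF af]
  show A: "auto_inv g f \<in> Johnson_A g k"
    unfolding Johnson_A_iff
  proof (intro conjI ballI ai)
    fix x assume x: "x \<in> PI g"
    have "ord_ge (k + 1) (- dM f (auto_inv g f x))"
      by (rule ord_ge_minus[OF Johnson_A_D(2)[OF f auto_homD(4)[OF ai x]]])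
    then show "ord_ge (k + 1) (dM (auto_inv g f) x)" by (simp add: dM_def auto_inv_cancel[OF af x])
  qed
  show "tau' g k (auto_inv g f) = der_neg g (tau' g k f)"
  proof (rule tau'_eqI[OF A k der_neg_Der[OF tau'_Der[OF f k]]])
    fix e assume e: "e \<in> gens g"
    note x = pi_gen_carrier[OF e]
    have "dM (compose (PI g) f (auto_inv g f)) (pi_gen e) = 0"
      using x by (simp add: dM_def compose_def auto_inv_cancel[OF af x])
    then have "ord_ge (k + 2) (- dM f (pi_gen e) - dM (auto_inv g f) (pi_gen e))"
      using dM_compose[OF f k ai x _ Johnson_A_D(2)[OF A x]] by simp
    from ord_ge_minus[OF ord_ge_add[OF this dM_tau'_gen[OF f k e]]]
    show "ord_ge (k + 2) (dM (auto_inv g f) (pi_gen e) - lser (der_neg g (tau' g k f) (lie_gen e)))"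
      using e by (simp add: der_neg_def lie_ring_on.gen lser_simps algebra_simps)
  qed
qed

lemma mu_compose:
  assumes f: "f \<in> Johnson_G g k" and h: "h \<in> Johnson_G g k" and k: "1 \<le> k"
  shows "mu g k (compose (PI g) f h) = mu g k f + mu g k h"
proof -
  have fA: "f \<in> Johnson_A g k" and hA: "h \<in> Johnson_A g k" using f h by (simp_all add: Johnson_G_def)
  note ah = Johnson_A_D(1)[OF hA]
  have "ord_ge (k + 3) (dM h (zeta g))"
    using h quotient_Gam_iff[OF ah zeta_carrier] by (simp add: Johnson_G_def)
  then have "ord_ge (k + 4) (dM (compose (PI g) f h) (zeta g) - dM f (zeta g) - dM h (zeta g))"
    using dM_compose[OF fA k ah zeta_carrier, of "k + 3"] by (simp add: add.commute)
  from ord_ge_add[OF ord_ge_add[OF this mu_dM(2)[OF f]] mu_dM(2)[OF h]]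
  show ?thesis
    using mu_dM(1)[OF f] mu_dM(1)[OF h]
    by (intro mu_eqI Johnson_A_compose(1)[OF fA hA k] Lie_part_add) (simp_all add: lser_simps algebra_simps)
qed

interpretation Q: group "Cyc g k Mod Cyc_bar g k" for g k
  by (rule normal.factorgroup_is_group[OF Cyc_bar_normal])

lemma psi_carrier: "l \<in> Lie_part g (k + 2) \<Longrightarrow> psi g k l \<in> carrier (Cyc g k Mod Cyc_bar g k)"
  using Der_omega_surj[of l g k] ctr_carrier psi_eval by metis

lemma psi_add:
  assumes l: "l \<in> Lie_part g (k + 2)" and l': "l' \<in> Lie_part g (k + 2)"
  shows "psi g k (l + l') = psi g k l \<otimes>\<^bsub>Cyc g k Mod Cyc_bar g k\<^esub> psi g k l'"
proof -
  from Der_omega_surj[OF l] obtain d where d: "d \<in> Der g k" "d (omega g) = l" by blast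
  from Der_omega_surj[OF l'] obtain d' where d': "d' \<in> Der g k" "d' (omega g) = l'" by blast
  have "der_add g d d' (omega g) = l + l'"
    using d d' Lie_part_subset[OF omega_part] by (simp add: der_add_def)
  then show ?thesis
    using psi_eval[OF der_add_Der[OF d(1) d'(1)]] psi_eval[OF d(1)] psi_eval[OF d'(1)] ctr_add[OF d(1) d'(1)] d d' by simp
qed

lemma psi_zero: "psi g k 0 = \<one>\<^bsub>Cyc g k Mod Cyc_bar g k\<^esub>"
  using psi_eval[OF der_zero_Der[of g k]] ctr_symp[OF Der_symp_closed(3)] Lie_part_subset[OF omega_part]
  by (simp add: der_zero_def)

lemma ctr_tau': "f \<in> Johnson_A g k \<Longrightarrow> 2 \<le> k \<Longrightarrow> ctr g k (tau' g k f) = \<one>\<^bsub>Cyc g k Mod Cyc_bar g k\<^esub>"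
  using ctr_eqI[OF tau'_Der der_zero_Der, of f g k] satoh_trace_tau'[of f g k] ctr_symp[OF Der_symp_closed(3)]
  by (simp add: trace_tensor_zero)

text \<open>Equal values of \<open>tau'\<close> mean that f'(x) f(x)^-1 lies in Gamma_(k+2), and the
  inverse of f preserves this subgroup.\<close>

lemma Johnson_A_quotient:
  assumes f: "f \<in> Johnson_A g k" and f': "f' \<in> Johnson_A g k" and k: "1 \<le> k" and eq: "tau' g k f = tau' g k f'"
  shows "compose (PI g) (auto_inv g f) f' \<in> Johnson_A g (k + 1)"
  unfolding Johnson_A_iff
proof (intro conjI ballI)
  note af = Johnson_A_D(1)[OF f] and af' = Johnson_A_D(1)[OF f']
  note ai = auto_inv_auto[OF af]
  interpret h: group_hom "surface_group g" "surface_group g" "auto_inv g f" by (rule auto_homD(1)[OF ai])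
  show "compose (PI g) (auto_inv g f) f' \<in> auto (surface_group g)" by (rule auto_compose[OF ai af'])
  fix x assume x: "x \<in> PI g"
  have fx: "f x \<in> PI g" "f' x \<in> PI g" using auto_homD(4) af af' x by auto
  define c where "c = f' x \<otimes>\<^bsub>surface_group g\<^esub> inv\<^bsub>surface_group g\<^esub> f x"
  have "ord_ge (1 + k + 1) ((dM f' x - lser (tau' g k f' (word_lie x))) - (dM f x - lser (tau' g k f (word_lie x))))"
    by (rule ord_ge_diff[OF dM_tau'[OF f' k lie_rep_word_lie[OF x]] dM_tau'[OF f k lie_rep_word_lie[OF x]]])
  then have "ord_ge (k + 2) (magnus (f' x) - magnus (f x))" by (simp add: eq dM_def)
  then have "c \<in> Gam g (k + 2)"
    unfolding c_def Gam_iff using fx ord_ge_right_quotient_iff[OF fx(2,1)] by simp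
  then have hc: "auto_inv g f c \<in> Gam g (k + 2)" by (rule h.hom_lower_central)
  have cc: "c \<in> PI g" using fx by (simp add: c_def)
  have "f' x = c \<otimes>\<^bsub>surface_group g\<^esub> f x" using fx by (simp add: c_def S.m_assoc)
  then have "dM (compose (PI g) (auto_inv g f) f') x = (magnus (auto_inv g f c) - 1) * magnus x"
    using x fx cc by (simp add: dM_def compose_def magnus_surface_mult auto_inv_cancel[OF af x] left_diff_distrib)
  then show "ord_ge (k + 1 + 1) (dM (compose (PI g) (auto_inv g f) f') x)"
    using magnus_Gam[OF hc] by (simp add: ord_ge_mult_right)
qed

lemma psi_mu_well_defined:
  assumes f: "f \<in> Johnson_A g k" and f': "f' \<in> Johnson_A g k" and k: "1 \<le> k" and eq: "tau' g k f = tau' g k f'"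
    and symp: "tau' g k f \<in> Der_symp g k"
  shows "psi g (k + 1) (mu g k f) = psi g (k + 1) (mu g k f')"
proof -
  note af = Johnson_A_D(1)[OF f] and af' = Johnson_A_D(1)[OF f']
  define h where "h = compose (PI g) (auto_inv g f) f'"
  have h: "h \<in> Johnson_A g (k + 1)" unfolding h_def by (rule Johnson_A_quotient[OF f f' k eq])
  note ah = Johnson_A_D(1)[OF h]
  have fh: "compose (PI g) f h = f'"
  proof
    fix x
    show "compose (PI g) f h x = f' x"
    proof (cases "x \<in> PI g")
      case True
      then show ?thesis using auto_inv_cancel(1)[OF af auto_homD(4)[OF af' True]] by (simp add: compose_def h_def)
    next
      case False
      then show ?thesis using auto_homD(3)[OF af'] by (simp add: compose_def extensional_def)
    qed
  qed
  have fG: "f \<in> Johnson_G g k" using Johnson_G_iff[OF f k] symp by simp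
  have f'G: "f' \<in> Johnson_G g k" using Johnson_G_iff[OF f' k] symp eq by simp
  define d where "d = tau' g (k + 1) h"
  have d: "d \<in> Der g (k + 1)" unfolding d_def by (rule tau'_Der[OF h]) simp
  have dw: "d (omega g) \<in> Lie_part g (k + 3)" using Der_part[OF d omega_part] by (simp add: eval_nat_numeral)
  have z: "ord_ge (k + 4) (dM h (zeta g) + lser (d (omega g)))"
    using dM_zeta[OF h] by (simp add: d_def eval_nat_numeral)
  have dh: "ord_ge (k + 3) (dM h (zeta g))"
    using ord_ge_diff[OF ord_ge_mono[OF z, of "k + 3"] ord_ge_lser[OF dw]] by simp
  have c: "ord_ge (k + 4) (dM f' (zeta g) - dM f (zeta g) - dM h (zeta g))"
    using dM_compose[OF f k ah zeta_carrier _ dh] by (simp add: fh add.commute)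
  \<comment> \<open>From f' = f h: the leading term of \<open>dM h\<close> at zeta is -d(\<omega>),
    because zeta has class -\<omega>.\<close>
  have "mu g k f' = mu g k f - d (omega g)"
  proof (rule mu_eqI[OF f' Lie_part_diff[OF mu_dM(1)[OF fG] dw]])
    from ord_ge_add[OF ord_ge_add[OF c mu_dM(2)[OF fG]] z]
    show "ord_ge (k + 4) (dM f' (zeta g) - lser (mu g k f - d (omega g)))"
      by (simp add: lser_simps algebra_simps)
  qed
  then have "mu g k f = mu g k f' + d (omega g)" by simp
  \<comment> \<open>Here the vanishing of the trace is used in degree k + 1, which is at least
    2.\<close>
  moreover have "psi g (k + 1) (d (omega g)) = \<one>\<^bsub>Cyc g (k + 1) Mod Cyc_bar g (k + 1)\<^esub>"
    using psi_eval[OF d] ctr_tau'[OF h] k by (simp add: d_def)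
  moreover have "mu g k f' \<in> Lie_part g (k + 1 + 2)" "d (omega g) \<in> Lie_part g (k + 1 + 2)"
    using mu_dM(1)[OF f'G] dw by (simp_all add: eval_nat_numeral)
  ultimately show ?thesis
    using psi_add[of "mu g k f'" g "k + 1" "d (omega g)"] Q.r_one[OF psi_carrier[of "mu g k f'" g "k + 1"]]
    by (simp only:)
qed

section \<open>The induced map and its homomorphism property\<close>

lemma Tr_bar_eval:
  assumes f: "f \<in> Johnson_A g k" and k: "1 \<le> k" and symp: "tau' g k f \<in> Der_symp g k"
  shows "Tr_bar g k (tau' g k f) = psi g (k + 1) (mu g k f)"
proof -
  define f' where "f' = (SOME f'. f' \<in> Johnson_A g k \<and> tau' g k f' = tau' g k f)"
  have "f' \<in> Johnson_A g k \<and> tau' g k f' = tau' g k f"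
    unfolding f'_def by (rule someI[of _ f]) (use f in simp)
  then have "psi g (k + 1) (mu g k f) = psi g (k + 1) (mu g k f')"
    using f k symp by (intro psi_mu_well_defined) auto
  moreover have "tau' g k f \<in> Tr_bar_dom g k" using f symp by (simp add: Tr_bar_dom_def)
  ultimately show ?thesis by (simp add: Tr_bar_def f'_def)
qed

lemma Tr_bar_domE:
  assumes "d \<in> Tr_bar_dom g k"
  obtains f where "f \<in> Johnson_A g k" "tau' g k f = d" "d \<in> Der_symp g k"
  using assms by (auto simp: Tr_bar_dom_def)

lemma Tr_bar_dom_closed:
  assumes k: "1 \<le> k"
  shows "d \<in> Tr_bar_dom g k \<Longrightarrow> d' \<in> Tr_bar_dom g k \<Longrightarrow> der_add g d d' \<in> Tr_bar_dom g k"
    "d \<in> Tr_bar_dom g k \<Longrightarrow> der_neg g d \<in> Tr_bar_dom g k" "der_zero g \<in> Tr_bar_dom g k"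
proof -
  assume "d \<in> Tr_bar_dom g k" "d' \<in> Tr_bar_dom g k"
  then obtain f f' where f: "f \<in> Johnson_A g k" "tau' g k f = d" "d \<in> Der_symp g k"
    "f' \<in> Johnson_A g k" "tau' g k f' = d'" "d' \<in> Der_symp g k" by (meson Tr_bar_domE)
  then have "der_add g d d' = tau' g k (compose (PI g) f f')" "compose (PI g) f f' \<in> Johnson_A g k"
    using Johnson_A_compose[OF f(1,4) k] by simp_all
  then show "der_add g d d' \<in> Tr_bar_dom g k"
    using Der_symp_closed(1)[OF f(3,6)] unfolding Tr_bar_dom_def by blast
next
  assume "d \<in> Tr_bar_dom g k"
  then obtain f where f: "f \<in> Johnson_A g k" "tau' g k f = d" "d \<in> Der_symp g k" by (rule Tr_bar_domE)
  then have "der_neg g d = tau' g k (auto_inv g f)" "auto_inv g f \<in> Johnson_A g k"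
    using Johnson_A_inv[OF f(1) k] by simp_all
  then show "der_neg g d \<in> Tr_bar_dom g k"
    using Der_symp_closed(2)[OF f(3)] unfolding Tr_bar_dom_def by blast
next
  have "der_zero g = tau' g k (\<lambda>x\<in>PI g. x)" using Johnson_A_id(2)[OF k] by simp
  then show "der_zero g \<in> Tr_bar_dom g k"
    using Der_symp_closed(3)[of g k] Johnson_A_id(1)[of g k] unfolding Tr_bar_dom_def by blast
qed

lemma Der_group_simps:
  "carrier (Der_group g k) = Der g k" "d \<otimes>\<^bsub>Der_group g k\<^esub> d' = der_add g d d'" "\<one>\<^bsub>Der_group g k\<^esub> = der_zero g"
  by (simp_all add: Der_group_def der_add_def der_zero_def)

lemma Tr_bar_dom_group:
  assumes k: "1 \<le> k"
  shows "group (Der_group g k \<lparr>carrier := Tr_bar_dom g k\<rparr>)"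
proof (rule groupI)
  fix x y z
  assume x: "x \<in> carrier (Der_group g k \<lparr>carrier := Tr_bar_dom g k\<rparr>)"
    and y: "y \<in> carrier (Der_group g k \<lparr>carrier := Tr_bar_dom g k\<rparr>)"
    and z: "z \<in> carrier (Der_group g k \<lparr>carrier := Tr_bar_dom g k\<rparr>)"
  then have xe: "x \<in> extensional (Lie g)" by (auto simp: Tr_bar_dom_def Der_symp_def Der_def)
  show "x \<otimes>\<^bsub>Der_group g k \<lparr>carrier := Tr_bar_dom g k\<rparr>\<^esub> y \<in> carrier (Der_group g k \<lparr>carrier := Tr_bar_dom g k\<rparr>)"
    using x y Tr_bar_dom_closed(1)[OF k] by (simp add: Der_group_simps)
  show "x \<otimes>\<^bsub>Der_group g k \<lparr>carrier := Tr_bar_dom g k\<rparr>\<^esub> y \<otimes>\<^bsub>Der_group g k \<lparr>carrier := Tr_bar_dom g k\<rparr>\<^esub> z =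
    x \<otimes>\<^bsub>Der_group g k \<lparr>carrier := Tr_bar_dom g k\<rparr>\<^esub> (y \<otimes>\<^bsub>Der_group g k \<lparr>carrier := Tr_bar_dom g k\<rparr>\<^esub> z)"
    by (auto simp: Der_group_simps der_add_def add.assoc)
  show "\<one>\<^bsub>Der_group g k \<lparr>carrier := Tr_bar_dom g k\<rparr>\<^esub> \<otimes>\<^bsub>Der_group g k \<lparr>carrier := Tr_bar_dom g k\<rparr>\<^esub> x = x"
    using xe by (auto simp: Der_group_simps der_add_def der_zero_def extensional_def)
  show "\<exists>y\<in>carrier (Der_group g k \<lparr>carrier := Tr_bar_dom g k\<rparr>).
      y \<otimes>\<^bsub>Der_group g k \<lparr>carrier := Tr_bar_dom g k\<rparr>\<^esub> x = \<one>\<^bsub>Der_group g k \<lparr>carrier := Tr_bar_dom g k\<rparr>\<^esub>"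
    using x Tr_bar_dom_closed(2)[OF k]
    by (intro bexI[of _ "der_neg g x"]) (auto simp: Der_group_simps der_add_def der_zero_def der_neg_def)
qed (use Tr_bar_dom_closed(3)[OF k] in \<open>simp add: Der_group_simps\<close>)

lemma Tr_bar_group_hom:
  assumes k: "1 \<le> k"
  shows "group_hom (Der_group g k \<lparr>carrier := Tr_bar_dom g k\<rparr>) (Cyc g (k + 1) Mod Cyc_bar g (k + 1)) (Tr_bar g k)"
proof -
  have "Tr_bar g k \<in> hom (Der_group g k \<lparr>carrier := Tr_bar_dom g k\<rparr>) (Cyc g (k + 1) Mod Cyc_bar g (k + 1))"
  proof (rule homI)
    fix d assume "d \<in> carrier (Der_group g k \<lparr>carrier := Tr_bar_dom g k\<rparr>)"
    then have "d \<in> Tr_bar_dom g k" by simp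
    then obtain f where f: "f \<in> Johnson_A g k" "tau' g k f = d" "d \<in> Der_symp g k" by (rule Tr_bar_domE)
    then have "f \<in> Johnson_G g k" using Johnson_G_iff[OF f(1) k] by simp
    then show "Tr_bar g k d \<in> carrier (Cyc g (k + 1) Mod Cyc_bar g (k + 1))"
      using Tr_bar_eval[OF f(1) k] f psi_carrier[of "mu g k f" g "k + 1"] mu_dM(1)[of f g k]
      by (simp add: eval_nat_numeral)
  next
    fix d d' assume "d \<in> carrier (Der_group g k \<lparr>carrier := Tr_bar_dom g k\<rparr>)"
      "d' \<in> carrier (Der_group g k \<lparr>carrier := Tr_bar_dom g k\<rparr>)"
    then have "d \<in> Tr_bar_dom g k" "d' \<in> Tr_bar_dom g k" by simp_all
    then obtain f f' where f: "f \<in> Johnson_A g k" "tau' g k f = d" "d \<in> Der_symp g k"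
      "f' \<in> Johnson_A g k" "tau' g k f' = d'" "d' \<in> Der_symp g k" by (meson Tr_bar_domE)
    have G: "f \<in> Johnson_G g k" "f' \<in> Johnson_G g k"
      using Johnson_G_iff[OF f(1) k] Johnson_G_iff[OF f(4) k] f by simp_all
    note comp = Johnson_A_compose[OF f(1,4) k]
    have "Tr_bar g k (der_add g d d') = psi g (k + 1) (mu g k (compose (PI g) f f'))"
      using Tr_bar_eval[OF comp(1) k] comp(2) f Der_symp_closed(1)[OF f(3,6)] by simp
    also have "\<dots> = psi g (k + 1) (mu g k f) \<otimes>\<^bsub>Cyc g (k + 1) Mod Cyc_bar g (k + 1)\<^esub> psi g (k + 1) (mu g k f')"
      unfolding mu_compose[OF G k] using mu_dM(1)[OF G(1)] mu_dM(1)[OF G(2)] by (intro psi_add) (simp_all add: eval_nat_numeral)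
    also have "\<dots> = Tr_bar g k d \<otimes>\<^bsub>Cyc g (k + 1) Mod Cyc_bar g (k + 1)\<^esub> Tr_bar g k d'"
      using Tr_bar_eval[OF f(1) k] Tr_bar_eval[OF f(4) k] f by simp
    finally show "Tr_bar g k (d \<otimes>\<^bsub>Der_group g k \<lparr>carrier := Tr_bar_dom g k\<rparr>\<^esub> d') =
      Tr_bar g k d \<otimes>\<^bsub>Cyc g (k + 1) Mod Cyc_bar g (k + 1)\<^esub> Tr_bar g k d'"
      by (simp add: Der_group_simps)
  qed
  then show ?thesis
    using Tr_bar_dom_group[OF k] Q.group_axioms by (simp add: group_hom_def group_hom_axioms_def)
qed

lemma Tr_bar_Johnson_J:
  assumes f: "f \<in> Johnson_J g k" and k: "1 \<le> k"
  shows "Tr_bar g k (tau' g k f) = \<one>\<^bsub>Cyc g (k + 1) Mod Cyc_bar g (k + 1)\<^esub>"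
proof -
  have fA: "f \<in> Johnson_A g k" and z: "f (zeta g) = zeta g"
    using f by (auto simp: Johnson_J_def mapping_class_group_def)
  have "f \<in> Johnson_G g k" using fA z zeta_carrier[of g] by (simp add: Johnson_G_def)
  then have symp: "tau' g k f \<in> Der_symp g k" using Johnson_G_iff[OF fA k] by simp
  have "mu g k f = 0" by (rule mu_eqI[OF fA]) (simp_all add: dM_def z lser_simps)
  then show ?thesis using Tr_bar_eval[OF fA k symp] psi_zero by simp
qed

section \<open>Lifting automorphisms of the homology\<close>

definition zhom :: "nat \<Rightarrow> (gen fword \<Rightarrow> int) \<Rightarrow> bool" where
  "zhom g \<phi> \<longleftrightarrow> (\<forall>x\<in>PI g. \<forall>y\<in>PI g. \<phi> (x \<otimes>\<^bsub>surface_group g\<^esub> y) = \<phi> x + \<phi> y)"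

lemma zhom_mult: "zhom g \<phi> \<Longrightarrow> x \<in> PI g \<Longrightarrow> y \<in> PI g \<Longrightarrow> \<phi> (x \<otimes>\<^bsub>surface_group g\<^esub> y) = \<phi> x + \<phi> y"
  by (simp add: zhom_def)

lemma zhom_one: "zhom g \<phi> \<Longrightarrow> \<phi> \<one>\<^bsub>surface_group g\<^esub> = 0"
  using zhom_mult[of g \<phi> "\<one>\<^bsub>surface_group g\<^esub>" "\<one>\<^bsub>surface_group g\<^esub>"] by simp

lemma zhom_inv: "zhom g \<phi> \<Longrightarrow> x \<in> PI g \<Longrightarrow> \<phi> (inv\<^bsub>surface_group g\<^esub> x) = - \<phi> x"
  using zhom_mult[of g \<phi> x "inv\<^bsub>surface_group g\<^esub> x"] zhom_one[of g \<phi>] by simp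

lemma letter_carrier: "x \<in> gens g \<Longrightarrow> [(x, b)] \<in> PI g"
  by (simp add: surface_group_def letter_in_free_group)

lemma zhom_letter: "zhom g \<phi> \<Longrightarrow> x \<in> gens g \<Longrightarrow> \<phi> [(x, b)] = (if b then 1 else - 1) * \<phi> (pi_gen x)"
  using zhom_inv[OF _ pi_gen_carrier, of g \<phi> x] by (simp add: pi_letter)

lemma exponent_sum_push: "exponent_sum e (push l w) = (if fst l = e then if snd l then 1 else - 1 else 0) + exponent_sum e w"
  by (cases w) (auto simp: exponent_sum_def)

lemma exponent_sum_zhom: "zhom g (exponent_sum e)"
  unfolding zhom_def
proof (intro ballI)
  fix x y
  have "exponent_sum e (foldr push x y) = exponent_sum e x + exponent_sum e y"
    by (induction x) (simp_all add: exponent_sum_push exponent_sum_def[of e "_ # _"] exponent_sum_def[of e "[]"],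
        simp add: exponent_sum_def)
  then show "exponent_sum e (x \<otimes>\<^bsub>surface_group g\<^esub> y) = exponent_sum e x + exponent_sum e y"
    by (simp add: surface_group_def mult_free_group)
qed

lemma zhom_expand:
  assumes z: "zhom g \<phi>" and w: "w \<in> PI g"
  shows "\<phi> w = (\<Sum>x\<in>gens g. exponent_sum x w * \<phi> (pi_gen x))"
  using w[unfolded surface_group_def]
proof (induction rule: free_group_induct)
  case Nil
  then show ?case using zhom_one[OF z] by (simp add: surface_group_def one_free_group exponent_sum_def)
next
  case (Cons x b w)
  have w: "w \<in> PI g" using Cons by (simp add: surface_group_def)
  note l = letter_carrier[OF Cons(1), of b]
  have "(\<Sum>e\<in>gens g. exponent_sum e [(x, b)] * \<phi> (pi_gen e)) = (\<Sum>e\<in>gens g. if e = x then (if b then 1 else - 1) * \<phi> (pi_gen x) else 0)"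
    by (rule sum.cong) (auto simp: exponent_sum_def)
  also have "\<dots> = \<phi> [(x, b)]" using Cons(1) zhom_letter[OF z Cons(1), of b] by simp
  finally show ?case
    using zhom_mult[OF z l w] zhom_mult[OF exponent_sum_zhom l w] Cons(3)
    by (simp add: surface_group_def distrib_right sum.distrib)
qed

lemma zhom_compose:
  assumes "zhom g \<phi>" "E \<in> auto (surface_group g)"
  shows "zhom g (\<lambda>x. \<phi> (E x))"
proof -
  interpret E: group_hom "surface_group g" "surface_group g" E by (rule auto_homD(1)[OF assms(2)])
  show ?thesis using assms(1) by (simp add: zhom_def)
qed

text \<open>An integral matrix with entries \<open>\<Phi> s (pi_gen x)\<close>, in the guise of
  additive functions on the group, whose associated map to Z^(2g) is onto. In this guise column
  operations are precompositions with automorphisms.\<close>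

definition onto_fam :: "nat \<Rightarrow> (gen \<Rightarrow> gen fword \<Rightarrow> int) \<Rightarrow> bool" where
  "onto_fam g \<Phi> \<longleftrightarrow> (\<forall>s\<in>gens g. zhom g (\<Phi> s)) \<and>
     (\<forall>s\<in>gens g. \<exists>y\<in>PI g. \<forall>t\<in>gens g. \<Phi> t y = (if t = s then 1 else 0))"

definition liftable :: "nat \<Rightarrow> (gen \<Rightarrow> gen fword \<Rightarrow> int) \<Rightarrow> bool" where
  "liftable g \<Phi> \<longleftrightarrow> (\<exists>F\<in>auto (surface_group g). \<forall>x\<in>PI g. \<forall>s\<in>gens g. \<Phi> s x = exponent_sum s (F x))"

lemma onto_fam_compose:
  assumes \<Phi>: "onto_fam g \<Phi>" and E: "E \<in> auto (surface_group g)"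
  shows "onto_fam g (\<lambda>s x. \<Phi> s (E x))"
  unfolding onto_fam_def
proof (intro conjI ballI)
  fix s assume s: "s \<in> gens g"
  show "zhom g (\<lambda>x. \<Phi> s (E x))" using \<Phi> s by (intro zhom_compose[OF _ E]) (simp add: onto_fam_def)
  from \<Phi> s obtain y where y: "y \<in> PI g" "\<forall>t\<in>gens g. \<Phi> t y = (if t = s then 1 else 0)" unfolding onto_fam_def by blast
  show "\<exists>y\<in>PI g. \<forall>t\<in>gens g. \<Phi> t (E y) = (if t = s then 1 else 0)"
    by (rule bexI[of _ "auto_inv g E y"])
      (use y auto_inv_cancel(1)[OF E y(1)] auto_homD(4)[OF auto_inv_auto[OF E] y(1)] in simp_all)
qed

lemma liftable_compose:
  assumes l: "liftable g (\<lambda>s x. \<Phi> s (E x))" and E: "E \<in> auto (surface_group g)"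
  shows "liftable g \<Phi>"
proof -
  from l obtain F where F: "F \<in> auto (surface_group g)" "\<forall>x\<in>PI g. \<forall>s\<in>gens g. \<Phi> s (E x) = exponent_sum s (F x)"
    unfolding liftable_def by blast
  show ?thesis unfolding liftable_def
  proof (rule bexI[OF _ auto_compose[OF F(1) auto_inv_auto[OF E]]], intro ballI)
    fix x s assume x: "x \<in> PI g" and s: "s \<in> gens g"
    have "auto_inv g E x \<in> PI g" using auto_homD(4)[OF auto_inv_auto[OF E] x] .
    then have "\<Phi> s (E (auto_inv g E x)) = exponent_sum s (F (auto_inv g E x))" using F(2) s by blast
    then show "\<Phi> s x = exponent_sum s (compose (PI g) F (auto_inv g E) x)"
      using x by (simp add: auto_inv_cancel(1)[OF E x] compose_def)
  qed
qed

section \<open>Nielsen automorphisms\<close>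

lemma auto_of_images:
  assumes u: "\<And>e. e \<in> gens g \<Longrightarrow> u e \<in> PI g" and v: "\<And>e. e \<in> gens g \<Longrightarrow> v e \<in> PI g"
    and uv: "\<And>e. e \<in> gens g \<Longrightarrow> word_eval (surface_group g) u (v e) = pi_gen e"
    and vu: "\<And>e. e \<in> gens g \<Longrightarrow> word_eval (surface_group g) v (u e) = pi_gen e"
  shows "\<exists>E\<in>auto (surface_group g). \<forall>e\<in>gens g. E (pi_gen e) = u e"
proof -
  let ?f = "word_eval (surface_group g) u" and ?h = "word_eval (surface_group g) v"
  have f: "?f \<in> hom (surface_group g) (surface_group g)" and h: "?h \<in> hom (surface_group g) (surface_group g)"
    using S.word_eval_hom[of u "gens g" g] S.word_eval_hom[of v "gens g" g] u v
    by (auto simp: surface_group_def Pi_def)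
  have fg: "?f (pi_gen e) = u e" "?h (pi_gen e) = v e" if "e \<in> gens g" for e
    using u[OF that] v[OF that] S.word_eval_letter[of u e g] S.word_eval_letter[of v e g] by (simp_all add: pi_gen_def)
  have id: "id \<in> hom (free_group (gens g)) (surface_group g)"
    by (rule homI) (simp_all add: surface_group_def)
  have c: "?f (?h w) = w" "?h (?f w) = w" if w: "w \<in> PI g" for w
  proof -
    have fh: "?f \<circ> ?h \<in> hom (free_group (gens g)) (surface_group g)" "?h \<circ> ?f \<in> hom (free_group (gens g)) (surface_group g)"
      using hom_compose[OF h f] hom_compose[OF f h] by (simp_all add: surface_group_def)
    have w': "w \<in> carrier (free_group (gens g))" using w by (simp add: surface_group_def)
    have "(?f \<circ> ?h) w = id w"
      by (rule free_group_hom_eqI[OF group_surface_group fh(1) id _ w'])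
        (use fg(2) uv in \<open>simp add: pi_gen_def\<close>)
    then show "?f (?h w) = w" by simp
    have "(?h \<circ> ?f) w = id w"
      by (rule free_group_hom_eqI[OF group_surface_group fh(2) id _ w'])
        (use fg(1) vu in \<open>simp add: pi_gen_def\<close>)
    then show "?h (?f w) = w" by simp
  qed
  have cl: "?f w \<in> PI g" "?h w \<in> PI g" if "w \<in> PI g" for w
    using f h that by (auto simp: hom_def Pi_def)
  have "restrict ?f (PI g) \<in> auto (surface_group g)"
  proof (rule autoI)
    show "restrict ?f (PI g) \<in> hom (surface_group g) (surface_group g)"
      using f by (auto simp: hom_def)
    show "bij_betw (restrict ?f (PI g)) (PI g) (PI g)"
      by (rule bij_betwI[where g = ?h]) (use c cl in auto)
  qed simp
  then show ?thesis using fg(1) pi_gen_carrier by (intro bexI[of _ "restrict ?f (PI g)"]) auto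
qed

lemma word_eval_S:
  assumes u: "\<And>e. e \<in> gens g \<Longrightarrow> u e \<in> PI g" and e: "e \<in> gens g"
  shows "word_eval (surface_group g) u (pi_gen e) = u e"
    "word_eval (surface_group g) u (inv\<^bsub>surface_group g\<^esub> pi_gen e) = inv\<^bsub>surface_group g\<^esub> u e"
    "x \<in> PI g \<Longrightarrow> y \<in> PI g \<Longrightarrow> word_eval (surface_group g) u (x \<otimes>\<^bsub>surface_group g\<^esub> y)
      = word_eval (surface_group g) u x \<otimes>\<^bsub>surface_group g\<^esub> word_eval (surface_group g) u y"
proof -
  have h: "word_eval (surface_group g) u \<in> hom (surface_group g) (surface_group g)"
    using S.word_eval_hom[of u "gens g" g] u by (auto simp: surface_group_def Pi_def)
  then interpret h: group_hom "surface_group g" "surface_group g" "word_eval (surface_group g) u"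
    by (simp add: group_hom_def group_hom_axioms_def group_surface_group)
  show 1: "word_eval (surface_group g) u (pi_gen e) = u e"
    using u[OF e] S.word_eval_letter[of u e g] by (simp add: pi_gen_def)
  show "word_eval (surface_group g) u (inv\<^bsub>surface_group g\<^esub> pi_gen e) = inv\<^bsub>surface_group g\<^esub> u e"
    using pi_gen_carrier[OF e] 1 by simp
  show "x \<in> PI g \<Longrightarrow> y \<in> PI g \<Longrightarrow> word_eval (surface_group g) u (x \<otimes>\<^bsub>surface_group g\<^esub> y)
      = word_eval (surface_group g) u x \<otimes>\<^bsub>surface_group g\<^esub> word_eval (surface_group g) u y" by simp
qed

lemma transvection:
  assumes i: "i \<in> gens g" and j: "j \<in> gens g" and ij: "i \<noteq> j"
  shows "\<exists>E\<in>auto (surface_group g). \<forall>e\<in>gens g.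
    E (pi_gen e) = (if e = i then pi_gen i \<otimes>\<^bsub>surface_group g\<^esub> [(j, b)] else pi_gen e)"
proof (rule auto_of_images)
  define u where "u b e = (if e = i then pi_gen i \<otimes>\<^bsub>surface_group g\<^esub> [(j, b)] else pi_gen e)" for b e
  have u: "u b e \<in> PI g" if "e \<in> gens g" for b e
    using that i j by (auto simp: u_def pi_gen_carrier letter_carrier)
  have ul: "word_eval (surface_group g) (u b) [(j, c)] = [(j, c)]" for b c
    using word_eval_S(1,2)[of g "u b", OF u j] ij pi_letter[OF j, of c] by (simp add: u_def)
  have uu: "word_eval (surface_group g) (u b) (u (\<not> b) e) = pi_gen e" if e: "e \<in> gens g" for b e
  proof (cases "e = i")
    case True
    have "[(j, b)] \<otimes>\<^bsub>surface_group g\<^esub> [(j, \<not> b)] = \<one>\<^bsub>surface_group g\<^esub>"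
      by (simp add: surface_group_def mult_free_group one_free_group)
    moreover have "word_eval (surface_group g) (u b) (u (\<not> b) e) =
        pi_gen i \<otimes>\<^bsub>surface_group g\<^esub> ([(j, b)] \<otimes>\<^bsub>surface_group g\<^esub> [(j, \<not> b)])"
      using word_eval_S(3)[of g "u b" i "pi_gen i" "[(j, \<not> b)]", OF u i] word_eval_S(1)[of g "u b" i, OF u i] ul i j True
      by (simp add: u_def pi_gen_carrier letter_carrier S.m_assoc)
    ultimately show ?thesis using True i by (simp add: pi_gen_carrier)
  next
    case False
    then show ?thesis using word_eval_S(1)[of g "u b" e, OF u e] by (simp add: u_def)
  qed
  show "e \<in> gens g \<Longrightarrow> (if e = i then pi_gen i \<otimes>\<^bsub>surface_group g\<^esub> [(j, b)] else pi_gen e) \<in> PI g" for e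
    using u[of e b] by (simp add: u_def)
  show "e \<in> gens g \<Longrightarrow> (if e = i then pi_gen i \<otimes>\<^bsub>surface_group g\<^esub> [(j, \<not> b)] else pi_gen e) \<in> PI g" for e
    using u[of e "\<not> b"] by (simp add: u_def)
  have U: "(\<lambda>e. if e = i then pi_gen i \<otimes>\<^bsub>surface_group g\<^esub> [(j, c)] else pi_gen e) = u c" for c
    by (simp add: u_def fun_eq_iff)
  show "e \<in> gens g \<Longrightarrow> word_eval (surface_group g) (\<lambda>e. if e = i then pi_gen i \<otimes>\<^bsub>surface_group g\<^esub> [(j, b)] else pi_gen e)
      (if e = i then pi_gen i \<otimes>\<^bsub>surface_group g\<^esub> [(j, \<not> b)] else pi_gen e) = pi_gen e" for e
    using uu[of e b] fun_cong[OF U[of "\<not> b"], of e] unfolding U by simp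
  show "e \<in> gens g \<Longrightarrow> word_eval (surface_group g) (\<lambda>e. if e = i then pi_gen i \<otimes>\<^bsub>surface_group g\<^esub> [(j, \<not> b)] else pi_gen e)
      (if e = i then pi_gen i \<otimes>\<^bsub>surface_group g\<^esub> [(j, b)] else pi_gen e) = pi_gen e" for e
    using uu[of e "\<not> b"] fun_cong[OF U[of b], of e] unfolding U by simp
qed

lemma letter_inversion:
  assumes i: "i \<in> gens g"
  shows "\<exists>E\<in>auto (surface_group g). \<forall>e\<in>gens g.
    E (pi_gen e) = (if e = i then inv\<^bsub>surface_group g\<^esub> pi_gen i else pi_gen e)"
proof (rule auto_of_images[where v = "\<lambda>e. if e = i then inv\<^bsub>surface_group g\<^esub> pi_gen i else pi_gen e"])
  define u where "u e = (if e = i then inv\<^bsub>surface_group g\<^esub> pi_gen i else pi_gen e)" for e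
  have u: "u e \<in> PI g" if "e \<in> gens g" for e using that i by (auto simp: u_def pi_gen_carrier)
  show "e \<in> gens g \<Longrightarrow> (if e = i then inv\<^bsub>surface_group g\<^esub> pi_gen i else pi_gen e) \<in> PI g"
    "e \<in> gens g \<Longrightarrow> (if e = i then inv\<^bsub>surface_group g\<^esub> pi_gen i else pi_gen e) \<in> PI g" for e
    using u[of e] by (simp_all add: u_def)
  have U: "(\<lambda>e. if e = i then inv\<^bsub>surface_group g\<^esub> pi_gen i else pi_gen e) = u" by (simp add: u_def fun_eq_iff)
  have uu: "word_eval (surface_group g) u (u e) = pi_gen e" if "e \<in> gens g" for e
    using word_eval_S(1,2)[of g u e, OF u that] that i by (auto simp: u_def pi_gen_carrier)
  show "e \<in> gens g \<Longrightarrow> word_eval (surface_group g) (\<lambda>e. if e = i then inv\<^bsub>surface_group g\<^esub> pi_gen i else pi_gen e)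
      (if e = i then inv\<^bsub>surface_group g\<^esub> pi_gen i else pi_gen e) = pi_gen e"
    "e \<in> gens g \<Longrightarrow> word_eval (surface_group g) (\<lambda>e. if e = i then inv\<^bsub>surface_group g\<^esub> pi_gen i else pi_gen e)
      (if e = i then inv\<^bsub>surface_group g\<^esub> pi_gen i else pi_gen e) = pi_gen e" for e
    using uu[of e] fun_cong[OF U, of e] unfolding U by simp_all
qed

section \<open>Integral column reduction\<close>

definition rows_done :: "nat \<Rightarrow> (gen \<Rightarrow> gen fword \<Rightarrow> int) \<Rightarrow> gen set \<Rightarrow> bool" where
  "rows_done g \<Phi> T \<longleftrightarrow> T \<subseteq> gens g \<and> (\<forall>t\<in>T. \<forall>x\<in>gens g. \<Phi> t (pi_gen x) = (if x = t then 1 else 0))"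

text \<open>Precomposition with a Nielsen transvection adds plus or minus column j to column i.
  Finished rows have entry zero in column j, because j is outside T, and so they stay
  finished.\<close>

lemma liftable_transvection:
  assumes \<Phi>: "onto_fam g \<Phi>" and T: "rows_done g \<Phi> T" and i: "i \<in> gens g" and j: "j \<in> gens g" "j \<notin> T"
    and ij: "i \<noteq> j"
    and rec: "\<And>\<Phi>'. onto_fam g \<Phi>' \<Longrightarrow> rows_done g \<Phi>' T \<Longrightarrow>
      (\<And>s x. s \<in> gens g \<Longrightarrow> x \<in> gens g \<Longrightarrow> \<Phi>' s (pi_gen x) =
        \<Phi> s (pi_gen x) + (if x = i then (if b then 1 else - 1) * \<Phi> s (pi_gen j) else 0)) \<Longrightarrow> liftable g \<Phi>'"
  shows "liftable g \<Phi>"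
proof -
  from transvection[OF i j(1) ij, of b] obtain E where E: "E \<in> auto (surface_group g)"
    "\<forall>e\<in>gens g. E (pi_gen e) = (if e = i then pi_gen i \<otimes>\<^bsub>surface_group g\<^esub> [(j, b)] else pi_gen e)" by blast
  have val: "\<Phi> s (E (pi_gen x)) = \<Phi> s (pi_gen x) + (if x = i then (if b then 1 else - 1) * \<Phi> s (pi_gen j) else 0)"
    if s: "s \<in> gens g" and x: "x \<in> gens g" for s x
  proof -
    have z: "zhom g (\<Phi> s)" using \<Phi> s by (simp add: onto_fam_def)
    show ?thesis
      using E(2) x zhom_mult[OF z pi_gen_carrier[OF i] letter_carrier[OF j(1), of b]] zhom_letter[OF z j(1), of b] by auto
  qed
  have "rows_done g (\<lambda>s x. \<Phi> s (E x)) T"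
    using T j val by (auto simp: rows_done_def subset_iff)
  from rec[OF onto_fam_compose[OF \<Phi> E(1)] this val] show ?thesis by (rule liftable_compose[OF _ E(1)])
qed

text \<open>With a pivot 1 in column s, that column clears the rest of row s, including its entries
  in the columns of T. The sign of the transvection is chosen so that each round lowers one absolute
  value by 1.\<close>

lemma liftable_pivot:
  assumes outer: "\<And>\<Phi>'. onto_fam g \<Phi>' \<Longrightarrow> rows_done g \<Phi>' (insert s T) \<Longrightarrow> liftable g \<Phi>'"
    and s: "s \<in> gens g" "s \<notin> T"
  shows "onto_fam g \<Phi> \<Longrightarrow> rows_done g \<Phi> T \<Longrightarrow> \<Phi> s (pi_gen s) = 1 \<Longrightarrow> liftable g \<Phi>"
proof (induction "nat (\<Sum>x\<in>gens g - {s}. \<bar>\<Phi> s (pi_gen x)\<bar>)" arbitrary: \<Phi> rule: less_induct)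
  case less
  show ?case
  proof (cases "\<forall>x\<in>gens g - {s}. \<Phi> s (pi_gen x) = 0")
    case True
    then have "rows_done g \<Phi> (insert s T)" using less.prems s by (auto simp: rows_done_def)
    then show ?thesis by (rule outer[OF less.prems(1)])
  next
    case False
    then obtain x where x: "x \<in> gens g" "x \<noteq> s" "\<Phi> s (pi_gen x) \<noteq> 0" by blast
    show ?thesis
    proof (rule liftable_transvection[OF less.prems(1,2) x(1) s(1,2) x(2), where b = "\<Phi> s (pi_gen x) < 0"])
      fix \<Phi>' assume \<Phi>': "onto_fam g \<Phi>'" "rows_done g \<Phi>' T"
        "\<And>t y. t \<in> gens g \<Longrightarrow> y \<in> gens g \<Longrightarrow> \<Phi>' t (pi_gen y) =
          \<Phi> t (pi_gen y) + (if y = x then (if \<Phi> s (pi_gen x) < 0 then 1 else - 1) * \<Phi> t (pi_gen s) else 0)"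
      have "(\<Sum>y\<in>gens g - {s}. \<bar>\<Phi>' s (pi_gen y)\<bar>) < (\<Sum>y\<in>gens g - {s}. \<bar>\<Phi> s (pi_gen y)\<bar>)"
      proof (rule sum_strict_mono_ex1)
        show "\<forall>y\<in>gens g - {s}. \<bar>\<Phi>' s (pi_gen y)\<bar> \<le> \<bar>\<Phi> s (pi_gen y)\<bar>"
          using \<Phi>'(3)[OF s(1)] less.prems(3) x(3) by auto
        show "\<exists>y\<in>gens g - {s}. \<bar>\<Phi>' s (pi_gen y)\<bar> < \<bar>\<Phi> s (pi_gen y)\<bar>"
          using \<Phi>'(3)[OF s(1) x(1)] less.prems(3) x by (intro bexI[of _ x]) auto
      qed simp
      then have "nat (\<Sum>y\<in>gens g - {s}. \<bar>\<Phi>' s (pi_gen y)\<bar>) < nat (\<Sum>y\<in>gens g - {s}. \<bar>\<Phi> s (pi_gen y)\<bar>)"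
        by (subst nat_less_eq_zless) (auto intro: sum_nonneg)
      from less.hyps[OF this \<Phi>'(1,2)] \<Phi>'(3)[OF s(1) s(1)] less.prems(3) x(2)
      show "liftable g \<Phi>'" by simp
    qed
  qed
qed

text \<open>Euclid's algorithm on the entries of row s outside T: while two are nonzero, the smaller
  is added to or subtracted from the larger. A single remaining entry must be a unit because the
  family is onto, and it is turned into the pivot.\<close>

lemma liftable_row:
  assumes outer: "\<And>\<Phi>'. onto_fam g \<Phi>' \<Longrightarrow> rows_done g \<Phi>' (insert s T) \<Longrightarrow> liftable g \<Phi>'"
    and s: "s \<in> gens g" "s \<notin> T"
  shows "onto_fam g \<Phi> \<Longrightarrow> rows_done g \<Phi> T \<Longrightarrow> liftable g \<Phi>"
proof (induction "nat (\<Sum>x\<in>gens g - T. \<bar>\<Phi> s (pi_gen x)\<bar>)" arbitrary: \<Phi> rule: less_induct)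
  case less
  let ?r = "\<lambda>x. \<Phi> s (pi_gen x)"
  show ?case
  proof (cases "\<exists>i\<in>gens g - T. \<exists>j\<in>gens g - T. i \<noteq> j \<and> ?r i \<noteq> 0 \<and> ?r j \<noteq> 0")
    case True
    then obtain i j where ij: "i \<in> gens g - T" "j \<in> gens g - T" "i \<noteq> j" "?r j \<noteq> 0" "\<bar>?r j\<bar> \<le> \<bar>?r i\<bar>"
      by (metis linear)
    define b where "b \<longleftrightarrow> (?r i < 0) = (0 < ?r j)"
    have dec: "\<bar>?r i + (if b then 1 else - 1) * ?r j\<bar> < \<bar>?r i\<bar>"
      using ij(4,5) by (auto simp: b_def split: if_splits)
    show ?thesis
    proof (rule liftable_transvection[OF less.prems, of i j b])
      fix \<Phi>' assume \<Phi>': "onto_fam g \<Phi>'" "rows_done g \<Phi>' T"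
        "\<And>t y. t \<in> gens g \<Longrightarrow> y \<in> gens g \<Longrightarrow> \<Phi>' t (pi_gen y) =
          \<Phi> t (pi_gen y) + (if y = i then (if b then 1 else - 1) * \<Phi> t (pi_gen j) else 0)"
      have "(\<Sum>y\<in>gens g - T. \<bar>\<Phi>' s (pi_gen y)\<bar>) < (\<Sum>y\<in>gens g - T. \<bar>\<Phi> s (pi_gen y)\<bar>)"
      proof (rule sum_strict_mono_ex1)
        show "\<forall>y\<in>gens g - T. \<bar>\<Phi>' s (pi_gen y)\<bar> \<le> \<bar>\<Phi> s (pi_gen y)\<bar>"
          using \<Phi>'(3)[OF s(1)] dec by auto
        show "\<exists>y\<in>gens g - T. \<bar>\<Phi>' s (pi_gen y)\<bar> < \<bar>\<Phi> s (pi_gen y)\<bar>"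
          using \<Phi>'(3)[OF s(1), of i] dec ij(1) by (intro bexI[of _ i]) auto
      qed simp
      then have "nat (\<Sum>y\<in>gens g - T. \<bar>\<Phi>' s (pi_gen y)\<bar>) < nat (\<Sum>y\<in>gens g - T. \<bar>\<Phi> s (pi_gen y)\<bar>)"
        by (subst nat_less_eq_zless) (auto intro: sum_nonneg)
      from less.hyps[OF this \<Phi>'(1,2)] show "liftable g \<Phi>'" .
    qed (use ij in auto)
  next
    case False
    have z: "\<And>t. t \<in> gens g \<Longrightarrow> zhom g (\<Phi> t)" using less.prems by (simp add: onto_fam_def)
    from less.prems(1) s obtain y where y: "y \<in> PI g" "\<forall>t\<in>gens g. \<Phi> t y = (if t = s then 1 else 0)"
      unfolding onto_fam_def by blast
    \<comment> \<open>A vector y that is mapped to the basis vector of s has no component along T,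
      since the finished rows read off these components. Hence row s represents 1 on the columns
      outside T alone.\<close>
    have yT: "exponent_sum t y = 0" if t: "t \<in> T" for t
    proof -
      have tg: "t \<in> gens g" and row: "\<And>x. x \<in> gens g \<Longrightarrow> \<Phi> t (pi_gen x) = (if x = t then 1 else 0)"
        using less.prems(2) t by (auto simp: rows_done_def)
      have "\<Phi> t y = (\<Sum>x\<in>gens g. if x = t then exponent_sum x y else 0)"
        unfolding zhom_expand[OF z[OF tg] y(1)] by (rule sum.cong) (auto simp: row)
      also have "\<dots> = exponent_sum t y" using tg by simp
      finally have "exponent_sum t y = \<Phi> t y" by simp
      moreover have "t \<noteq> s" using t s(2) by blast
      ultimately show ?thesis using y(2) tg by simp
    qed
    have "1 = (\<Sum>x\<in>gens g. exponent_sum x y * ?r x)" using zhom_expand[OF z[OF s(1)] y(1)] y(2) s(1) by simp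
    also have "\<dots> = (\<Sum>x\<in>gens g - T. exponent_sum x y * ?r x)"
      by (rule sum.mono_neutral_right) (auto simp: yT)
    finally have one: "1 = (\<Sum>x\<in>gens g - T. exponent_sum x y * ?r x)" .
    then obtain i where i: "i \<in> gens g - T" "?r i \<noteq> 0"
      by (metis (no_types, lifting) mult_zero_right sum.neutral zero_neq_one)
    have others: "?r x = 0" if "x \<in> gens g - T" "x \<noteq> i" for x using False i that by blast
    have "(\<Sum>x\<in>gens g - T. exponent_sum x y * ?r x) = (\<Sum>x\<in>gens g - T. if x = i then exponent_sum i y * ?r i else 0)"
      by (rule sum.cong) (auto simp: others)
    then have "exponent_sum i y * ?r i = 1" using one i(1) by simp
    then have ri: "?r i = 1 \<or> ?r i = - 1" using zmult_eq_1_iff[of "exponent_sum i y" "?r i"] by auto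
    note pivot = liftable_pivot[OF outer s]
    show ?thesis
    proof (cases "i = s")
      case True
      show ?thesis
      proof (cases "?r s = 1")
        case True
        then show ?thesis using pivot[OF _ _ less.prems] by blast
      next
        case neg: False
        from letter_inversion[OF s(1)] obtain E where E: "E \<in> auto (surface_group g)"
          "\<forall>e\<in>gens g. E (pi_gen e) = (if e = s then inv\<^bsub>surface_group g\<^esub> pi_gen s else pi_gen e)" by blast
        have val: "\<Phi> t (E (pi_gen x)) = (if x = s then - \<Phi> t (pi_gen s) else \<Phi> t (pi_gen x))"
          if "t \<in> gens g" "x \<in> gens g" for t x
          using E(2) that zhom_inv[OF z[OF that(1)] pi_gen_carrier[OF s(1)]] by simp
        have "rows_done g (\<lambda>t x. \<Phi> t (E x)) T"
          using less.prems(2) s val by (auto simp: rows_done_def subset_iff)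
        moreover have "\<Phi> s (E (pi_gen s)) = 1" using val[OF s(1) s(1)] ri True neg by simp
        ultimately have "liftable g (\<lambda>t x. \<Phi> t (E x))"
          using pivot[OF _ _ onto_fam_compose[OF less.prems(1) E(1)]] by blast
        then show ?thesis by (rule liftable_compose[OF _ E(1)])
      qed
    next
      case False
      have rs: "?r s = 0" using others[of s] s False by auto
      show ?thesis
      \<comment> \<open>The unit stands in another column i and column s has entry 0 in this row;
        adding plus or minus column i to column s creates the pivot 1.\<close>
      proof (rule liftable_transvection[OF less.prems s(1), of i "?r i = 1"])
        fix \<Phi>' assume \<Phi>': "onto_fam g \<Phi>'" "rows_done g \<Phi>' T"
          "\<And>t y. t \<in> gens g \<Longrightarrow> y \<in> gens g \<Longrightarrow> \<Phi>' t (pi_gen y) =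
            \<Phi> t (pi_gen y) + (if y = s then (if ?r i = 1 then 1 else - 1) * \<Phi> t (pi_gen i) else 0)"
        have "\<Phi>' s (pi_gen s) = 1" using \<Phi>'(3)[OF s(1) s(1)] rs ri by auto
        then show "liftable g \<Phi>'" using pivot[OF _ _ \<Phi>'(1,2)] by blast
      qed (use i False in auto)
    qed
  qed
qed

theorem onto_fam_liftable:
  assumes "onto_fam g \<Phi>"
  shows "liftable g \<Phi>"
proof -
  have "onto_fam g \<Phi> \<Longrightarrow> rows_done g \<Phi> T \<Longrightarrow> liftable g \<Phi>" for T \<Phi>
  proof (induction "card (gens g - T)" arbitrary: T \<Phi> rule: less_induct)
    case less
    show ?case
    proof (cases "gens g \<subseteq> T")
      case True
      have "\<Phi> s x = exponent_sum s ((\<lambda>x\<in>PI g. x) x)" if x: "x \<in> PI g" and s: "s \<in> gens g" for x s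
      proof -
        have "\<Phi> s x = (\<Sum>e\<in>gens g. exponent_sum e x * \<Phi> s (pi_gen e))"
          using less.prems(1) s by (intro zhom_expand[OF _ x]) (simp add: onto_fam_def)
        also have "\<dots> = (\<Sum>e\<in>gens g. if e = s then exponent_sum e x else 0)"
          using less.prems(2) True s by (intro sum.cong HOL.refl) (auto simp: rows_done_def)
        finally show ?thesis using s x by simp
      qed
      then show ?thesis unfolding liftable_def using auto_id by blast
    next
      case False
      then obtain s where s: "s \<in> gens g" "s \<notin> T" by blast
      have "card (gens g - insert s T) < card (gens g - T)" using s by (intro psubset_card_mono) auto
      from less.hyps[OF this] show ?thesis
        using liftable_row[OF _ s less.prems] by blast
    qed
  qed
  from this[OF assms, of "{}"] show ?thesis by (simp add: rows_done_def)
qed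

lemma homology_carrier: "carrier (homology g) = hclass g ` PI g"
  by (auto simp: homology_def FactGroup_def RCOSETS_def hclass_def)

lemma hclass_mult: "x \<in> PI g \<Longrightarrow> y \<in> PI g \<Longrightarrow> hclass g x \<otimes>\<^bsub>homology g\<^esub> hclass g y = hclass g (x \<otimes>\<^bsub>surface_group g\<^esub> y)"
  using normal.rcos_sum[OF S.lower_central_normal] by (simp add: homology_def FactGroup_def hclass_def)

text \<open>Surjectivity of Aut(pi) onto Aut(H). The family to be reduced consists of the
  coordinates of \<phi> on homology classes; it is onto because \<phi> is.\<close>

theorem homology_auto_lift:
  assumes \<phi>: "\<phi> \<in> auto (homology g)"
  shows "\<exists>F\<in>auto (surface_group g). \<forall>x\<in>PI g. \<phi> (hclass g x) = hclass g (F x)"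
proof -
  have h: "\<phi> \<in> hom (homology g) (homology g)" and b: "bij_betw \<phi> (carrier (homology g)) (carrier (homology g))"
    using \<phi> by (auto simp: auto_def Bij_def)
  define \<Phi> where "\<Phi> s x = dual_basis s (\<phi> (hclass g x))" for s x
  have ex: "\<exists>u\<in>PI g. \<phi> (hclass g x) = hclass g u" if "x \<in> PI g" for x
    using hom_in_carrier[OF h, of "hclass g x"] that by (auto simp: homology_carrier)
  have "zhom g (\<Phi> s)" if s: "s \<in> gens g" for s
    unfolding zhom_def
  proof (intro ballI)
    fix x y assume x: "x \<in> PI g" and y: "y \<in> PI g"
    from ex[OF x] ex[OF y] obtain u v where uv: "u \<in> PI g" "\<phi> (hclass g x) = hclass g u" "v \<in> PI g" "\<phi> (hclass g y) = hclass g v" by blast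
    have "\<phi> (hclass g (x \<otimes>\<^bsub>surface_group g\<^esub> y)) = \<phi> (hclass g x) \<otimes>\<^bsub>homology g\<^esub> \<phi> (hclass g y)"
      unfolding hclass_mult[OF x y, symmetric] using x y by (intro hom_mult[OF h]) (auto simp: homology_carrier)
    then have "\<phi> (hclass g (x \<otimes>\<^bsub>surface_group g\<^esub> y)) = hclass g (u \<otimes>\<^bsub>surface_group g\<^esub> v)"
      using uv by (simp add: hclass_mult)
    then show "\<Phi> s (x \<otimes>\<^bsub>surface_group g\<^esub> y) = \<Phi> s x + \<Phi> s y"
      using uv s zhom_mult[OF exponent_sum_zhom uv(1,3)] by (simp add: \<Phi>_def dual_basis_hclass)
  qed
  moreover have "\<exists>y\<in>PI g. \<forall>t\<in>gens g. \<Phi> t y = (if t = s then 1 else 0)" if s: "s \<in> gens g" for s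
  proof -
    have "hclass g (pi_gen s) \<in> carrier (homology g)" using pi_gen_carrier[OF s] by (simp add: homology_carrier)
    then have "hclass g (pi_gen s) \<in> \<phi> ` carrier (homology g)" using b by (simp add: bij_betw_def)
    then obtain y where y: "y \<in> PI g" "\<phi> (hclass g y) = hclass g (pi_gen s)" unfolding homology_carrier by auto
    then show ?thesis using pi_gen_carrier[OF s]
      by (intro bexI[of _ y]) (auto simp: \<Phi>_def dual_basis_hclass exponent_sum_pi_gen)
  qed
  ultimately have "onto_fam g \<Phi>" by (simp add: onto_fam_def)
  from onto_fam_liftable[OF this] obtain F where F: "F \<in> auto (surface_group g)"
    "\<forall>x\<in>PI g. \<forall>s\<in>gens g. \<Phi> s x = exponent_sum s (F x)" unfolding liftable_def by blast
  have "\<phi> (hclass g x) = hclass g (F x)" if x: "x \<in> PI g" for x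
  proof -
    from ex[OF x] obtain u where u: "u \<in> PI g" "\<phi> (hclass g x) = hclass g u" by blast
    have "exponent_sum s u = exponent_sum s (F x)" if "s \<in> gens g" for s
    proof -
      have "dual_basis s (\<phi> (hclass g x)) = exponent_sum s (F x)" using F(2) x that unfolding \<Phi>_def by blast
      then show ?thesis unfolding u(2) dual_basis_hclass[OF u(1) that] .
    qed
    then show ?thesis using u hclass_eq_iff[OF u(1) auto_homD(4)[OF F(1) x]] by simp
  qed
  with F(1) show ?thesis by blast
qed

section \<open>Linear extensions and derivations of the tensor algebra\<close>

lemma mult_of_int_left: "y * (of_int c * x) = of_int c * (y * (x :: 'a::ring_1))"
proof -
  have "y * of_int c * x = of_int c * y * x" using mult_of_int_commute[of c y] by simp
  then show ?thesis by (simp only: mult.assoc)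
qed

definition lin_ext :: "(gen list \<Rightarrow> gen tensor) \<Rightarrow> gen tensor \<Rightarrow> gen tensor" where
  "lin_ext h p = (\<Sum>w \<in> Poly_Mapping.keys p. of_int (Poly_Mapping.lookup p w) * h w)"

lemma lin_ext_superset:
  "finite S \<Longrightarrow> Poly_Mapping.keys p \<subseteq> S \<Longrightarrow> lin_ext h p = (\<Sum>w\<in>S. of_int (Poly_Mapping.lookup p w) * h w)"
  unfolding lin_ext_def by (rule sum.mono_neutral_left) (auto simp: in_keys_iff)

lemma lin_ext_zero [simp]: "lin_ext h 0 = 0"
  by (simp add: lin_ext_def)

lemma lin_ext_add: "lin_ext h (p + q) = lin_ext h p + lin_ext h q"
proof -
  let ?S = "Poly_Mapping.keys p \<union> Poly_Mapping.keys q"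
  have "Poly_Mapping.keys (p + q) \<subseteq> ?S" by (rule keys_add)
  then show ?thesis
    by (simp add: lin_ext_superset[of ?S] lookup_add distrib_right sum.distrib)
qed

lemma lin_ext_minus: "lin_ext h (- p) = - lin_ext h p"
  using lin_ext_add[of h p "- p"] by (simp add: eq_neg_iff_add_eq_0 add.commute)

lemma lin_ext_diff: "lin_ext h (p - q) = lin_ext h p - lin_ext h q"
  using lin_ext_add[of h p "- q"] lin_ext_minus[of h q] by simp

lemma lin_ext_sum: "lin_ext h (sum f A) = (\<Sum>a\<in>A. lin_ext h (f a))"
  by (induction A rule: infinite_finite_induct) (auto simp: lin_ext_add)

lemma lin_ext_single: "lin_ext h (Poly_Mapping.single w c) = of_int c * h w"
  by (cases "c = 0") (simp_all add: lin_ext_def)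

lemma of_int_tensor: "(of_int c :: gen tensor) = Poly_Mapping.single [] c"
  by (rule poly_mapping_eqI) (auto simp: lookup_of_int lookup_single zero_list_def when_def)

lemma tensor_one: "Poly_Mapping.single [] 1 = (1 :: gen tensor)"
  using of_int_tensor[of 1] by simp

lemma single_scale: "Poly_Mapping.single w c = of_int c * (Poly_Mapping.single w 1 :: gen tensor)"
  unfolding of_int_tensor single_append[symmetric] by simp

lemma tensor_subst_lin_ext: "tensor_subst \<sigma> = lin_ext (\<lambda>w. prod_list (map \<sigma> w))"
  by (simp add: fun_eq_iff tensor_subst_def lin_ext_def)

lemma Tens_induct [consumes 1, case_names const mult add]:
  assumes p: "p \<in> Tens g" and const: "\<And>c. P (Poly_Mapping.single [] c)"
    and mult: "\<And>x q. x \<in> gens g \<Longrightarrow> q \<in> Tens g \<Longrightarrow> P q \<Longrightarrow> P (Poly_Mapping.single [x] 1 * q)"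
    and add: "\<And>p q. p \<in> Tens g \<Longrightarrow> q \<in> Tens g \<Longrightarrow> P p \<Longrightarrow> P q \<Longrightarrow> P (p + q)"
  shows "P p"
proof -
  have single: "P (Poly_Mapping.single w c)" if "set w \<subseteq> gens g" for w c
    using that
  proof (induction w)
    case (Cons x w)
    then have "P (Poly_Mapping.single [x] 1 * Poly_Mapping.single w c)"
      by (intro mult Tens_single) auto
    then show ?case using single_append[of "[x]" w 1 c] by simp
  qed (rule const)
  have "P (\<Sum>w\<in>A. Poly_Mapping.single w (Poly_Mapping.lookup p w))" if "finite A" "A \<subseteq> Poly_Mapping.keys p" for A
    using that
  proof (induction A rule: finite_induct)
    case empty
    then show ?case using const[of 0] by simp
  next
    case (insert w A)
    then have "set v \<subseteq> gens g" if "v \<in> insert w A" for v using p that by (auto simp: tensor_on_def)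
    then show ?case using insert by (auto intro!: add single Tens_sum Tens_single)
  qed
  from this[of "Poly_Mapping.keys p"] show ?thesis using tensor_expand[of p] by simp
qed

lemma tensor_subst_mult:
  fixes \<sigma> :: "gen \<Rightarrow> gen tensor"
  shows "tensor_subst \<sigma> (p * q) = tensor_subst \<sigma> p * tensor_subst \<sigma> q"
proof -
  have s: "tensor_subst \<sigma> (Poly_Mapping.single u a * Poly_Mapping.single v b) =
      tensor_subst \<sigma> (Poly_Mapping.single u a) * tensor_subst \<sigma> (Poly_Mapping.single v b)" for u v a b
  proof -
    have "of_int a * (of_int b * (P * R)) = of_int a * P * (of_int b * (R :: gen tensor))" for P R
      by (simp only: mult.assoc mult_of_int_left[of P])
    then show ?thesis
      unfolding single_append[symmetric] tensor_subst_lin_ext lin_ext_single by (simp add: mult.assoc)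
  qed
  let ?S = "\<lambda>p. (\<Sum>w\<in>Poly_Mapping.keys p. Poly_Mapping.single w (Poly_Mapping.lookup p w))"
  have "tensor_subst \<sigma> (?S p * ?S q) = tensor_subst \<sigma> (?S p) * tensor_subst \<sigma> (?S q)"
    by (simp only: sum_distrib_left sum_distrib_right tensor_subst_lin_ext lin_ext_sum s[unfolded tensor_subst_lin_ext])
  then show ?thesis using tensor_expand[of p] tensor_expand[of q] by simp
qed

primrec word_der :: "(gen \<Rightarrow> gen tensor) \<Rightarrow> gen list \<Rightarrow> gen tensor" where
  "word_der t [] = 0"
| "word_der t (x # w) = t x * Poly_Mapping.single w 1 + Poly_Mapping.single [x] 1 * word_der t w"

definition tder :: "(gen \<Rightarrow> gen tensor) \<Rightarrow> gen tensor \<Rightarrow> gen tensor" where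
  "tder t = lin_ext (word_der t)"

lemma word_der_append:
  "word_der t (u @ v) = word_der t u * Poly_Mapping.single v 1 + Poly_Mapping.single u 1 * word_der t v"
proof (induction u)
  case Nil
  then show ?case by (simp add: tensor_one)
next
  case (Cons x u)
  have "Poly_Mapping.single (u @ v) (1 :: int) = Poly_Mapping.single u 1 * Poly_Mapping.single v 1"
    "Poly_Mapping.single (x # u) (1 :: int) = Poly_Mapping.single [x] 1 * Poly_Mapping.single u 1"
    using single_append[of u v 1 1] single_append[of "[x]" u 1 1] by simp_all
  with Cons show ?case by (simp add: distrib_left distrib_right mult.assoc add.assoc)
qed

lemma tder_mult: "tder t (p * q) = tder t p * q + p * tder t q"
proof -
  have s: "tder t (Poly_Mapping.single u a * Poly_Mapping.single v b) =
      tder t (Poly_Mapping.single u a) * Poly_Mapping.single v b + Poly_Mapping.single u a * tder t (Poly_Mapping.single v b)" for u v a b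
  proof -
    have "tder t (Poly_Mapping.single u a * Poly_Mapping.single v b) = of_int a * (of_int b * word_der t (u @ v))"
      unfolding single_append[symmetric] tder_def lin_ext_single by (simp add: mult.assoc)
    also have "\<dots> = of_int a * (of_int b * (word_der t u * Poly_Mapping.single v 1)) + of_int a * (of_int b * (Poly_Mapping.single u 1 * word_der t v))"
      by (simp add: word_der_append distrib_left)
    also have "of_int b * (word_der t u * Poly_Mapping.single v 1) = word_der t u * Poly_Mapping.single v b"
      by (simp only: single_scale[of v b] mult_of_int_left[of "word_der t u"])
    also have "of_int b * (Poly_Mapping.single u 1 * word_der t v) = Poly_Mapping.single u 1 * (of_int b * word_der t v)"
      by (simp only: mult_of_int_left[of "Poly_Mapping.single u 1"])
    also have "of_int a * (Poly_Mapping.single u 1 * (of_int b * word_der t v)) = Poly_Mapping.single u a * (of_int b * word_der t v)"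
      by (simp only: single_scale[of u a] mult.assoc)
    finally have e: "tder t (Poly_Mapping.single u a * Poly_Mapping.single v b) =
      of_int a * (word_der t u * Poly_Mapping.single v b) + Poly_Mapping.single u a * (of_int b * word_der t v)" .
    have "tder t (Poly_Mapping.single w c) = of_int c * word_der t w" for w c by (simp only: tder_def lin_ext_single)
    then show ?thesis unfolding e by (simp only: mult.assoc)
  qed
  let ?S = "\<lambda>p. (\<Sum>w\<in>Poly_Mapping.keys p. Poly_Mapping.single w (Poly_Mapping.lookup p w))"
  have add: "tder t (sum f A) = (\<Sum>a\<in>A. tder t (f a))" for f and A :: "gen list set"
    by (simp add: tder_def lin_ext_sum)
  have "tder t (?S p * ?S q) = tder t (?S p) * ?S q + ?S p * tder t (?S q)"
    by (simp only: sum_distrib_left sum_distrib_right add s sum.distrib)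
  then show ?thesis using tensor_expand[of p] tensor_expand[of q] by simp
qed

lemma tder_gen: "tder t (Poly_Mapping.single [x] 1) = t x"
  by (simp add: tder_def lin_ext_single tensor_one)

lemma tder_const: "tder t (Poly_Mapping.single [] c) = 0"
  by (simp add: tder_def lin_ext_single)

lemma tder_add: "tder t (p + q) = tder t p + tder t q" and tder_diff: "tder t (p - q) = tder t p - tder t q"
  and tder_minus: "tder t (- p) = - tder t p" and tder_zero: "tder t 0 = 0"
  and tder_sum: "tder t (sum f A) = (\<Sum>a\<in>A. tder t (f a))"
  by (simp_all add: tder_def lin_ext_add lin_ext_diff lin_ext_minus lin_ext_sum)

lemma tder_Tens: "p \<in> Tens g \<Longrightarrow> (\<And>x. x \<in> gens g \<Longrightarrow> t x \<in> Tens g) \<Longrightarrow> tder t p \<in> Tens g"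
proof (induction rule: Tens_induct)
  case (const c)
  then show ?case by (simp add: tder_const)
next
  case (mult x q)
  then show ?case by (simp add: tder_mult tder_gen Tens_single)
next
  case (add p q)
  then show ?case by (simp add: tder_add)
qed

lemma tder_Tens_comm:
  assumes t: "\<And>x. x \<in> gens g \<Longrightarrow> t x \<in> Tens g"
  shows "p \<in> Tens_comm g \<Longrightarrow> tder t p \<in> Tens_comm g"
proof (induction rule: Tens_comm_induct)
  case zero
  then show ?case by (simp add: tder_zero Tens_comm_closed)
next
  case (comm x y)
  have "tder t (x * y - y * x) = (tder t x * y - y * tder t x) + (x * tder t y - tder t y * x)"
    by (simp add: tder_diff tder_mult)
  also have "\<dots> \<in> Tens_comm g"
    using comm tder_Tens[OF _ t] by (intro Tens_comm_closed(2) commutator_Tens_comm) auto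
  finally show ?case .
next
  case (neg x)
  then show ?case by (simp add: tder_minus Tens_comm_closed)
next
  case (add x y)
  then show ?case by (simp add: tder_add Tens_comm_closed)
qed

lemma Tens_comm_scale: "p \<in> Tens_comm g \<Longrightarrow> of_int c * p \<in> Tens_comm g"
proof (induction rule: Tens_comm_induct)
  case (comm x y)
  have "(of_int c :: gen tensor) \<in> Tens g" by (simp add: of_int_tensor Tens_single)
  then have "(of_int c * x) * y - y * (of_int c * x) \<in> Tens_comm g"
    using comm by (intro commutator_Tens_comm) simp_all
  moreover have "(of_int c * x) * y - y * (of_int c * x) = of_int c * (x * y - y * x)"
    by (simp only: right_diff_distrib mult.assoc mult_of_int_left[of y])
  ultimately show ?case by simp
qed (simp_all add: Tens_comm_closed distrib_left)

lemma tder_lie_tensor: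
  assumes d: "d \<in> Der g k" and l: "l \<in> Lie g"
  shows "tder (\<lambda>x. lie_tensor (d (lie_gen x))) (lie_tensor l) = lie_tensor (d l)"
  using l
proof (induction rule: lie_ring_on.induct)
  case (gen x)
  then show ?case by (simp add: tder_gen)
next
  case (br u v)
  then show ?case by (simp add: Der_br[OF d] tder_diff tder_mult)
next
  case zero
  then show ?case by (simp add: Der_zero[OF d] tder_zero)
next
  case (diff u v)
  then show ?case by (simp add: Der_diff[OF d] tder_diff)
qed

section \<open>Contractions with dual basis vectors\<close>

abbreviation contr :: "nat \<Rightarrow> gen \<Rightarrow> gen tensor \<Rightarrow> gen tensor" where
  "contr g x p \<equiv> contract g (dual_basis x) p"

lemma contr_Tens: "p \<in> Tens g \<Longrightarrow> x \<in> gens g \<Longrightarrow> contr g x p \<in> Tens g"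
proof -
  assume p: "p \<in> Tens g" and x: "x \<in> gens g"
  have "set w \<subseteq> gens g" if "nc (lder x (ser p)) w \<noteq> 0" for w
  proof -
    have "set (x # w) \<subseteq> gens g" using p that unfolding Tens_iff sup_on_def nc_lder by blast
    then show ?thesis by simp
  qed
  then show ?thesis unfolding Tens_iff ser_contract[OF p x] sup_on_def by blast
qed

lemma contr_simps:
  assumes y: "y \<in> gens g"
  shows "contr g y (Poly_Mapping.single [] c) = 0"
    "x \<in> gens g \<Longrightarrow> q \<in> Tens g \<Longrightarrow> contr g y (Poly_Mapping.single [x] 1 * q) = (if x = y then q else 0)"
    "p \<in> Tens g \<Longrightarrow> q \<in> Tens g \<Longrightarrow> contr g y (p + q) = contr g y p + contr g y q"
proof -
  show "contr g y (Poly_Mapping.single [] c) = 0"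
    by (rule ser_inject) (simp add: ser_contract Tens_single y ser_single_Nil lder_simps)
  show "x \<in> gens g \<Longrightarrow> q \<in> Tens g \<Longrightarrow> contr g y (Poly_Mapping.single [x] 1 * q) = (if x = y then q else 0)"
    by (rule ser_inject) (simp add: ser_contract Tens_single y ser_mult ser_single_gen lder_mult nc_var lder_simps)
  show "p \<in> Tens g \<Longrightarrow> q \<in> Tens g \<Longrightarrow> contr g y (p + q) = contr g y p + contr g y q"
    by (rule ser_inject) (simp add: ser_contract y ser_add lder_simps)
qed

text \<open>The derivation acts either on the first letter x, replacing it by \<open>t x\<close>,
  which supplies the new first letter because it has no constant term; this gives the matrix
  product. Or it acts on the remaining letters and commutes with the contraction.\<close>

lemma contr_tder:
  assumes t: "\<And>x. x \<in> gens g \<Longrightarrow> t x \<in> Tens g" "\<And>x. x \<in> gens g \<Longrightarrow> nc (ser (t x)) [] = 0" and y: "y \<in> gens g"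
    and p: "p \<in> Tens g"
  shows "contr g y (tder t p) = (\<Sum>x\<in>gens g. contr g y (t x) * contr g x p) + tder t (contr g y p)"
  using p
proof (induction rule: Tens_induct)
  case (const c)
  have "contr g y 0 = 0" using contr_simps(1)[OF y, of 0] by simp
  then show ?case by (simp add: tder_const tder_zero contr_simps y)
next
  case (mult x q)
  have Tq: "tder t q \<in> Tens g" "t x \<in> Tens g" using mult t(1) tder_Tens by auto
  have "contr g y (t x * q) = contr g y (t x) * q"
    using mult Tq t(2)[OF mult(1)]
    by (intro ser_inject) (simp add: ser_contract y ser_mult lder_mult)
  then have "contr g y (tder t (Poly_Mapping.single [x] 1 * q)) = contr g y (t x) * q + (if x = y then tder t q else 0)"
    using mult Tq by (simp add: tder_mult tder_gen contr_simps[OF y] Tens_single)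
  moreover have "(\<Sum>z\<in>gens g. contr g y (t z) * contr g z (Poly_Mapping.single [x] 1 * q)) = contr g y (t x) * q"
  proof -
    have "(\<Sum>z\<in>gens g. contr g y (t z) * contr g z (Poly_Mapping.single [x] 1 * q)) = (\<Sum>z\<in>gens g. if z = x then contr g y (t x) * q else 0)"
      using mult by (intro sum.cong HOL.refl) (simp add: contr_simps(2))
    then show ?thesis using mult by simp
  qed
  moreover have "tder t (contr g y (Poly_Mapping.single [x] 1 * q)) = (if x = y then tder t q else 0)"
    using mult by (simp add: contr_simps(2)[OF y] tder_zero)
  ultimately show ?case by simp
next
  case (add p q)
  have "tder t p \<in> Tens g" "tder t q \<in> Tens g" using add t(1) tder_Tens by auto
  then show ?case
    using add y by (simp add: tder_add contr_simps(3) distrib_left sum.distrib algebra_simps)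
qed

section \<open>Traces of brackets of derivations\<close>

lemma Der_Lie: "d \<in> Der g k \<Longrightarrow> l \<in> Lie g \<Longrightarrow> d l \<in> Lie g"
proof -
  assume d: "d \<in> Der g k" and l: "l \<in> Lie g"
  from l show "d l \<in> Lie g"
  proof (induction rule: lie_ring_on.induct)
    case (gen x)
    then show ?case using Lie_part_subset[OF Der_gen_part[OF d]] by simp
  next
    case (br u v)
    then show ?case by (simp add: Der_br[OF d] Lie_add lie_ring_on.br)
  next
    case zero
    then show ?case by (simp add: Der_zero[OF d] lie_ring_on.zero)
  next
    case (diff u v)
    then show ?case by (simp add: Der_diff[OF d] lie_ring_on.diff)
  qed
qed

definition der_br where "der_br g d e = (\<lambda>l\<in>Lie g. d (e l) - (e (d l) :: gen free_lie))"

lemma der_br_Der: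
  assumes d: "d \<in> Der g k" and e: "e \<in> Der g j"
  shows "der_br g d e \<in> Der g (k + j)"
proof -
  have L: "d u \<in> Lie g" "e u \<in> Lie g" if "u \<in> Lie g" for u using Der_Lie[OF d that] Der_Lie[OF e that] by simp_all
  have "d (e u) - e (d u) \<in> Lie_part g (m + (k + j))" if u: "u \<in> Lie_part g m" for u m
    using Der_part[OF d Der_part[OF e u]] Der_part[OF e Der_part[OF d u]]
    by (intro Lie_part_diff) (simp_all add: ac_simps)
  then show ?thesis
    unfolding Der_def der_br_def
    by (auto simp: Lie_add lie_ring_on.br Lie_part_subset L Der_add[OF d] Der_add[OF e] Der_br[OF d] Der_br[OF e]
      lie_br_diff)
qed

lemma lie_tensor_Tens_comm: "l \<in> Lie_part g n \<Longrightarrow> 2 \<le> n \<Longrightarrow> lie_tensor l \<in> Tens_comm g"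
proof -
  assume "l \<in> Lie_part g n" "2 \<le> n"
  then have "l \<in> gen_brackets g (n - 1)" by (rule Lie_part_gen_brackets)
  then obtain t where t: "\<forall>e\<in>gens g. t e \<in> Lie_part g (n - 1)" "l = (\<Sum>e\<in>gens g. lie_br (lie_gen e) (t e))"
    by (auto simp: gen_brackets_def)
  have "lie_tensor (lie_br (lie_gen e) (t e)) \<in> Tens_comm g" if e: "e \<in> gens g" for e
    using tensor_part_Tens[OF lie_tensor_part] t(1) e
    unfolding lie_tensor_simps by (intro commutator_Tens_comm Tens_single) auto
  then show "lie_tensor l \<in> Tens_comm g" unfolding t(2) lie_tensor_sum by (rule Tens_comm_sum)
qed

lemma nc_lser_Nil: "l \<in> Lie_part g n \<Longrightarrow> 1 \<le> n \<Longrightarrow> nc (lser l) [] = 0"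
  using hom_deg_lser_part[of l g n] unfolding hom_deg_def by (metis list.size(3) not_one_le_zero)

text \<open>After an exchange of summation indices the matrix products of d and e combine into
  commutators of entries. What remains are two derivations of the tensor algebra: d sends each
  letter to a Lie element of degree at least 2, hence to a sum of commutators, and e preserves the
  sums of commutators.\<close>

lemma trace_der_br:
  assumes d: "d \<in> Der g k" and k: "1 \<le> k" and e: "e \<in> Der g 1" and trd: "trace_tensor g d \<in> Tens_comm g"
  shows "trace_tensor g (der_br g d e) \<in> Tens_comm g"
proof -
  let ?d = "\<lambda>x. lie_tensor (d (lie_gen x))" and ?e = "\<lambda>x. lie_tensor (e (lie_gen x))"
  have T: "?d x \<in> Tens g" "?e x \<in> Tens g" "nc (ser (?d x)) [] = 0" "nc (ser (?e x)) [] = 0" if x: "x \<in> gens g" for x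
  proof -
    show "?d x \<in> Tens g" "?e x \<in> Tens g"
      using tensor_part_Tens[OF lie_tensor_part[OF Der_gen_part[OF d x]]]
        tensor_part_Tens[OF lie_tensor_part[OF Der_gen_part[OF e x]]] .
    show "nc (ser (?d x)) [] = 0" "nc (ser (?e x)) [] = 0"
      using nc_lser_Nil[OF Der_gen_part[OF d x]] nc_lser_Nil[OF Der_gen_part[OF e x]]
      unfolding lser_def by simp_all
  qed
  have gl: "lie_gen x \<in> Lie g" if "x \<in> gens g" for x using that by (rule lie_ring_on.gen)
  have "trace_tensor g (der_br g d e) =
      (\<Sum>y\<in>gens g. contr g y (tder ?d (?e y)) - contr g y (tder ?e (?d y)))"
  proof (unfold trace_tensor_def, rule sum.cong[OF HOL.refl])
    fix y assume y: "y \<in> gens g"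
    have "lie_tensor (der_br g d e (lie_gen y)) = tder ?d (?e y) - tder ?e (?d y)"
      using gl[OF y] Der_Lie[OF d gl[OF y]] Der_Lie[OF e gl[OF y]]
      by (simp add: der_br_def tder_lie_tensor[OF d] tder_lie_tensor[OF e])
    moreover have "contr g y (p - q) = contr g y p - contr g y q" if "p \<in> Tens g" "q \<in> Tens g" for p q
      using contr_simps(3)[OF y, of "p - q" q] that by (simp add: eq_diff_eq)
    ultimately show "contr g y (lie_tensor (der_br g d e (lie_gen y))) = contr g y (tder ?d (?e y)) - contr g y (tder ?e (?d y))"
      using tder_Tens[of "?e y" g ?d] tder_Tens[of "?d y" g ?e] T y by simp
  qed
  also have "\<dots> = (\<Sum>y\<in>gens g. \<Sum>x\<in>gens g. contr g y (?d x) * contr g x (?e y)) + tder ?d (trace_tensor g e)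
      - ((\<Sum>y\<in>gens g. \<Sum>x\<in>gens g. contr g y (?e x) * contr g x (?d y)) + tder ?e (trace_tensor g d))"
    unfolding trace_tensor_def tder_sum sum.distrib[symmetric] sum_subtractf[symmetric]
    by (rule sum.cong[OF HOL.refl])
      (simp add: contr_tder[of g ?d, OF T(1,3)] contr_tder[of g ?e, OF T(2,4)] T)
  also have "(\<Sum>y\<in>gens g. \<Sum>x\<in>gens g. contr g y (?e x) * contr g x (?d y)) =
      (\<Sum>y\<in>gens g. \<Sum>x\<in>gens g. contr g x (?e y) * contr g y (?d x))"
    by (rule sum.swap)
  finally have eq: "trace_tensor g (der_br g d e) =
      (\<Sum>y\<in>gens g. \<Sum>x\<in>gens g. contr g y (?d x) * contr g x (?e y) - contr g x (?e y) * contr g y (?d x))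
      + tder ?d (trace_tensor g e) - tder ?e (trace_tensor g d)"
    by (simp add: sum_subtractf algebra_simps)
  have 1: "(\<Sum>y\<in>gens g. \<Sum>x\<in>gens g. contr g y (?d x) * contr g x (?e y) - contr g x (?e y) * contr g y (?d x)) \<in> Tens_comm g"
    by (intro Tens_comm_sum commutator_Tens_comm contr_Tens T)
  have "tder ?d p \<in> Tens_comm g" if p: "p \<in> tensor_part (gens g) 1" for p
    unfolding tder_def lin_ext_def
  proof (intro Tens_comm_sum Tens_comm_scale)
    fix w assume "w \<in> Poly_Mapping.keys p"
    then have "length w = 1" "set w \<subseteq> gens g" using p by (auto simp: tensor_part_def tensor_on_def)
    then obtain x where x: "w = [x]" "x \<in> gens g" by (cases w) auto
    have "?d x \<in> Tens_comm g" using k by (intro lie_tensor_Tens_comm[OF Der_gen_part[OF d x(2)]]) simp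
    then show "word_der ?d w \<in> Tens_comm g" using x by (simp add: tensor_one)
  qed
  then have 2: "tder ?d (trace_tensor g e) \<in> Tens_comm g" using trace_tensor_part[OF e] by blast
  have 3: "tder ?e (trace_tensor g d) \<in> Tens_comm g" by (rule tder_Tens_comm[OF T(2) trd])
  show ?thesis unfolding eq by (intro Tens_comm_diff Tens_comm_closed(2) 1 2 3)
qed

section \<open>The action of automorphisms\<close>

text \<open>The action on the Lie ring expressed through a lift F to the free group, so that it can
  be compared with the motion of group elements.\<close>

definition lie_lift :: "(gen fword \<Rightarrow> gen fword) \<Rightarrow> gen free_lie \<Rightarrow> gen free_lie" where
  "lie_lift F = lie_subst (\<lambda>e. word_lie (F (pi_gen e)))"

lemma lie_subst_diff: "lie_subst \<sigma> (u - v) = lie_subst \<sigma> u - lie_subst \<sigma> v"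
  using lie_subst_simps(4)[of \<sigma> u "- v"] lie_subst_simps(3)[of \<sigma> v] by (simp del: lie_subst_simps)

lemma lie_lift_simps: "lie_lift F (lie_gen x) = word_lie (F (pi_gen x))" "lie_lift F 0 = 0"
  "lie_lift F (- u) = - lie_lift F u" "lie_lift F (u + v) = lie_lift F u + lie_lift F v"
  "lie_lift F (u - v) = lie_lift F u - lie_lift F v" "lie_lift F (lie_br u v) = lie_br (lie_lift F u) (lie_lift F v)"
  by (simp_all add: lie_lift_def lie_subst_diff)

lemma lie_lift_sum: "lie_lift F (sum f A) = (\<Sum>a\<in>A. lie_lift F (f a))"
  by (induction A rule: infinite_finite_induct) (auto simp: lie_lift_simps)

lemma lie_rep_lift:
  assumes F: "F \<in> auto (surface_group g)"
  shows "lie_rep g n l x \<Longrightarrow> lie_rep g n (lie_lift F l) (F x)"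
proof (induction rule: lie_rep.induct)
  interpret F: group_hom "surface_group g" "surface_group g" F by (rule auto_homD(1)[OF F])
  {
    case (gen e)
    then show ?case
      unfolding lie_lift_simps by (intro lie_rep_word_lie auto_homD(4)[OF F] pi_gen_carrier)
  next
    case (br m u x n v y)
    have "x \<in> PI g" "y \<in> PI g"
      using S.lower_central_carrier[OF lie_rep_Gam[OF br.hyps(1)]] S.lower_central_carrier[OF lie_rep_Gam[OF br.hyps(2)]] .
    then show ?case using lie_rep.br[OF br.IH] by (simp add: lie_lift_simps F.hom_commutator)
  next
    case (add k u x v y)
    have "x \<in> PI g" "y \<in> PI g"
      using S.lower_central_carrier[OF lie_rep_Gam[OF add.hyps(1)]] S.lower_central_carrier[OF lie_rep_Gam[OF add.hyps(2)]] .
    then show ?case using lie_rep.add[OF add.IH] by (simp add: lie_lift_simps)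
  next
    case (neg k u x)
    have "x \<in> PI g" using S.lower_central_carrier[OF lie_rep_Gam[OF neg.hyps]] .
    then show ?case using lie_rep.neg[OF neg.IH] by (simp add: lie_lift_simps)
  next
    case (zero k x)
    then show ?case using F.hom_lower_central[OF zero(2)] by (simp add: lie_lift_simps lie_rep.zero)
  }
qed

lemma lie_lift_part: "F \<in> auto (surface_group g) \<Longrightarrow> l \<in> Lie_part g n \<Longrightarrow> lie_lift F l \<in> Lie_part g n"
  using Lie_part_lie_rep[of l g n] lie_rep_lift[of F g n l] lie_rep_homogeneous[of g n "lie_lift F l"]
  by (cases "n = 0") (auto simp: lie_lift_simps)

lemma lie_lift_word_lie:
  assumes F: "F \<in> auto (surface_group g)" and x: "x \<in> PI g"
  shows "lie_lift F (word_lie x) = word_lie (F x)"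
  using lie_class_eq[OF lie_rep_lift[OF F lie_rep_word_lie[OF x]]]
    lie_class_eq[OF lie_rep_word_lie[OF auto_homD(4)[OF F x]]] by simp

lemma lie_lift_Lie:
  assumes F: "F \<in> auto (surface_group g)"
  shows "l \<in> Lie g \<Longrightarrow> lie_lift F l \<in> Lie g"
proof (induction rule: lie_ring_on.induct)
  case (gen x)
  then show ?case unfolding lie_lift_simps
    by (intro Lie_part_subset[OF word_lie_part] auto_homD(4)[OF F] pi_gen_carrier)
qed (simp_all add: lie_lift_simps lie_ring_on.intros)

lemma lie_lift_id:
  "(\<And>e. e \<in> gens g \<Longrightarrow> F (pi_gen e) = pi_gen e) \<Longrightarrow> l \<in> Lie g \<Longrightarrow> lie_lift F l = l"
proof -
  assume F: "\<And>e. e \<in> gens g \<Longrightarrow> F (pi_gen e) = pi_gen e" and l: "l \<in> Lie g"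
  from l show "lie_lift F l = l"
    by (induction rule: lie_ring_on.induct) (simp_all add: lie_lift_simps F)
qed

section \<open>The action on tensors\<close>

definition ten_lift :: "(gen fword \<Rightarrow> gen fword) \<Rightarrow> gen tensor \<Rightarrow> gen tensor" where
  "ten_lift F = tensor_subst (\<lambda>e. lie_tensor (word_lie (F (pi_gen e))))"

lemma ten_lift_simps:
  "ten_lift F 0 = 0" "ten_lift F (p + q) = ten_lift F p + ten_lift F q" "ten_lift F (- p) = - ten_lift F p"
  "ten_lift F (p - q) = ten_lift F p - ten_lift F q" "ten_lift F (p * q) = ten_lift F p * ten_lift F q"
  "ten_lift F (Poly_Mapping.single [] c) = Poly_Mapping.single [] c"
  "ten_lift F (Poly_Mapping.single [x] 1) = lie_tensor (word_lie (F (pi_gen x)))"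
  unfolding ten_lift_def tensor_subst_mult
  by (simp_all add: tensor_subst_lin_ext lin_ext_add lin_ext_minus lin_ext_diff lin_ext_single of_int_tensor tensor_one)

lemma ten_lift_sum: "ten_lift F (sum f A) = (\<Sum>a\<in>A. ten_lift F (f a))"
  by (induction A rule: infinite_finite_induct) (auto simp: ten_lift_simps)

lemma ten_lift_of_int: "ten_lift F (of_int c * p) = of_int c * ten_lift F p"
  by (simp add: ten_lift_simps of_int_tensor)

lemma ten_lift_lie_tensor: "l \<in> Lie g \<Longrightarrow> ten_lift F (lie_tensor l) = lie_tensor (lie_lift F l)"
  by (induction rule: lie_ring_on.induct) (simp_all add: ten_lift_simps lie_lift_simps)

lemma word_tensor_Tens: "x \<in> PI g \<Longrightarrow> lie_tensor (word_lie x) \<in> Tens g"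
  by (rule tensor_part_Tens[OF lie_tensor_part[OF word_lie_part]])

lemma ten_lift_Tens:
  assumes F: "F \<in> auto (surface_group g)"
  shows "p \<in> Tens g \<Longrightarrow> ten_lift F p \<in> Tens g"
proof (induction rule: Tens_induct)
  case (const c)
  then show ?case by (simp add: ten_lift_simps Tens_single)
next
  case (mult x q)
  then show ?case using word_tensor_Tens[OF auto_homD(4)[OF F pi_gen_carrier[OF mult(1)]]]
    by (simp add: ten_lift_simps)
next
  case (add p q)
  then show ?case by (simp add: ten_lift_simps)
qed

lemma ten_lift_Tens_comm:
  assumes F: "F \<in> auto (surface_group g)"
  shows "p \<in> Tens_comm g \<Longrightarrow> ten_lift F p \<in> Tens_comm g"
proof (induction rule: Tens_comm_induct)
  case (comm x y)
  then show ?case unfolding ten_lift_simps by (intro commutator_Tens_comm ten_lift_Tens[OF F])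
qed (simp_all add: ten_lift_simps Tens_comm_closed)

text \<open>The new first letter comes from F applied to the old one; its coordinate at e is an
  exponent sum, an entry of the matrix of F on H.\<close>

lemma contr_ten_lift:
  assumes F: "F \<in> auto (surface_group g)" and e: "e \<in> gens g" and p: "p \<in> Tens g"
  shows "contr g e (ten_lift F p) = (\<Sum>x\<in>gens g. of_int (exponent_sum e (F (pi_gen x))) * ten_lift F (contr g x p))"
  using p
proof (induction rule: Tens_induct)
  case (const c)
  then show ?case by (simp add: ten_lift_simps contr_simps e)
next
  case (mult x q)
  let ?w = "word_lie (F (pi_gen x))"
  have xc: "F (pi_gen x) \<in> PI g" by (rule auto_homD(4)[OF F pi_gen_carrier[OF mult(1)]])
  note T = word_tensor_Tens[OF xc] ten_lift_Tens[OF F mult(2)]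
  have "lder e (lser ?w) = of_int (exponent_sum e (F (pi_gen x)))"
  proof (rule ncps_eqI)
    fix w show "nc (lder e (lser ?w)) w = nc (of_int (exponent_sum e (F (pi_gen x)))) w"
      using hom_deg_lser_part[OF word_lie_part[OF xc]] nc_lser_word_lie[OF xc, of e]
      by (cases w) (auto simp: nc_of_int hom_deg_def)
  qed
  then have "ser (contr g e (lie_tensor ?w * ten_lift F q)) = ser (of_int (exponent_sum e (F (pi_gen x))) * ten_lift F q)"
    using T nc_lser_Nil[OF word_lie_part[OF xc]] e
    by (simp add: ser_contract ser_mult lder_mult lser_def[symmetric] del: nc_ser)
      (simp add: of_int_tensor ser_single_Nil)
  then have "contr g e (ten_lift F (Poly_Mapping.single [x] 1 * q)) = of_int (exponent_sum e (F (pi_gen x))) * ten_lift F q"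
    unfolding ten_lift_simps by (rule ser_inject)
  moreover have "(\<Sum>z\<in>gens g. of_int (exponent_sum e (F (pi_gen z))) * ten_lift F (contr g z (Poly_Mapping.single [x] 1 * q)))
      = (\<Sum>z\<in>gens g. if z = x then of_int (exponent_sum e (F (pi_gen x))) * ten_lift F q else 0)"
    using mult by (intro sum.cong HOL.refl) (simp add: contr_simps(2) ten_lift_simps)
  ultimately show ?case using mult(1) by simp
next
  case (add p q)
  then show ?case
    using ten_lift_Tens[OF F] e by (simp add: ten_lift_simps contr_simps(3) distrib_left sum.distrib)
qed

lemma lie_tensor_Der_word_lie:
  assumes d: "d \<in> Der g k" and w: "w \<in> PI g"
  shows "lie_tensor (d (word_lie w)) = (\<Sum>z\<in>gens g. of_int (exponent_sum z w) * lie_tensor (d (lie_gen z)))"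
  using w[unfolded surface_group_def]
proof (induction rule: free_group_induct)
  case Nil
  then show ?case by (simp add: Der_zero[OF d] exponent_sum_def)
next
  case (Cons x b w)
  have w: "w \<in> PI g" using Cons by (simp add: surface_group_def)
  have L: "lie_gen x \<in> Lie g" "word_lie w \<in> Lie g" "- lie_gen x \<in> Lie g"
    using Cons(1) Lie_part_subset[OF word_lie_part[OF w]] by (auto intro: lie_ring_on.gen Lie_minus)
  have "lie_tensor (d (word_lie ([(x, b)] \<otimes>\<^bsub>free_group (gens g)\<^esub> w))) =
      of_int (if b then 1 else - 1) * lie_tensor (d (lie_gen x)) + lie_tensor (d (word_lie w))"
    using L Der_add[OF d L(1,2)] Der_add[OF d L(3,2)] Der_minus[OF d L(1)]
    by (cases b) (simp_all add: mult_free_group word_lie_push del: lie_tensor_simps,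
      simp_all del: add_uminus_conv_diff)
  moreover have "(\<Sum>z\<in>gens g. of_int (exponent_sum z ([(x, b)] \<otimes>\<^bsub>free_group (gens g)\<^esub> w)) * lie_tensor (d (lie_gen z)))
    = (\<Sum>z\<in>gens g. (if z = x then of_int (if b then 1 else - 1) * lie_tensor (d (lie_gen x)) else 0) + of_int (exponent_sum z w) * lie_tensor (d (lie_gen z)))"
    by (rule sum.cong) (auto simp: mult_free_group exponent_sum_push distrib_right)
  ultimately show ?case using Cons by (simp add: sum.distrib)
qed

text \<open>The inverse F' is a parameter instead of being computed from F, so that interpreting the
  locale with the two exchanged gives each result for the inverse.\<close>

locale auto_pair =
  fixes g :: nat and F F' :: "gen fword \<Rightarrow> gen fword"
  assumes F: "F \<in> auto (surface_group g)" and F': "F' \<in> auto (surface_group g)"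
    and FF': "\<And>x. x \<in> PI g \<Longrightarrow> F (F' x) = x" and F'F: "\<And>x. x \<in> PI g \<Longrightarrow> F' (F x) = x"
begin

lemma swap: "auto_pair g F' F"
  using F F' FF' F'F by unfold_locales

lemma lift_lift: "l \<in> Lie g \<Longrightarrow> lie_lift F (lie_lift F' l) = l"
proof (induction rule: lie_ring_on.induct)
  case (gen x)
  then show ?case
    using lie_lift_word_lie[OF F auto_homD(4)[OF F' pi_gen_carrier[OF gen]]]
    by (simp add: lie_lift_simps FF' pi_gen_carrier)
qed (simp_all add: lie_lift_simps)

lemma ten_lift_lift: "p \<in> Tens g \<Longrightarrow> ten_lift F (ten_lift F' p) = p"
proof (induction rule: Tens_induct)
  case (const c)
  then show ?case by (simp add: ten_lift_simps)
next
  case (mult x q)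
  have c: "F' (pi_gen x) \<in> PI g" by (rule auto_homD(4)[OF F' pi_gen_carrier[OF mult(1)]])
  have "ten_lift F (lie_tensor (word_lie (F' (pi_gen x)))) = Poly_Mapping.single [x] 1"
    using mult(1) by (simp add: ten_lift_lie_tensor[OF Lie_part_subset[OF word_lie_part[OF c]]]
        lie_lift_word_lie[OF F c] FF' pi_gen_carrier)
  then show ?case using mult by (simp add: ten_lift_simps)
next
  case (add p q)
  then show ?case by (simp add: ten_lift_simps)
qed

definition der_act :: "(gen free_lie \<Rightarrow> gen free_lie) \<Rightarrow> gen free_lie \<Rightarrow> gen free_lie" where
  "der_act d = (\<lambda>l \<in> Lie g. lie_lift F (d (lie_lift F' l)))"

lemma der_act_Der:
  assumes d: "d \<in> Der g k"
  shows "der_act d \<in> Der g k"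
  unfolding Der_def der_act_def
  using lie_lift_Lie[OF F'] lift_lift lie_lift_part[OF F Der_part[OF d lie_lift_part[OF F']]]
  by (auto simp: Lie_add lie_ring_on.br lie_lift_simps Der_add[OF d] Der_br[OF d] Lie_part_subset)

text \<open>F' transforms the argument of d and F its values, and contraction pairs the two. Their
  matrices on H multiply to the identity, which leaves only the diagonal contractions.\<close>

lemma trace_der_act:
  assumes d: "d \<in> Der g k"
  shows "trace_tensor g (der_act d) = ten_lift F (trace_tensor g d)"
proof -
  let ?T = "\<lambda>z. lie_tensor (d (lie_gen z))"
  let ?c = "\<lambda>e x. exponent_sum e (F (pi_gen x))" and ?b = "\<lambda>z e. exponent_sum z (F' (pi_gen e))"
  have T: "?T z \<in> Tens g" if "z \<in> gens g" for z
    using tensor_part_Tens[OF lie_tensor_part[OF Der_gen_part[OF d that]]] .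
  have ct: "contr g x (of_int n * p) = of_int n * contr g x p" if "x \<in> gens g" "p \<in> Tens g" for x p n
    using that by (intro ser_inject)
      (simp add: of_int_tensor ser_contract Tens_single ser_mult ser_single_Nil lder_mult nc_of_int lder_simps)
  have csum: "contr g x (sum f (gens g)) = (\<Sum>z\<in>gens g. contr g x (f z))" if "x \<in> gens g" "\<And>z. z \<in> gens g \<Longrightarrow> f z \<in> Tens g" for x f
    using that by (intro ser_inject) (simp add: ser_contract Tens_sum ser_sum lder_sum)
  have "trace_tensor g (der_act d) = (\<Sum>e\<in>gens g. contr g e (ten_lift F (lie_tensor (d (word_lie (F' (pi_gen e)))))))"
    unfolding trace_tensor_def
  proof (rule sum.cong[OF HOL.refl])
    fix e assume e: "e \<in> gens g"
    have "d (word_lie (F' (pi_gen e))) \<in> Lie g"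
      by (intro Der_Lie[OF d] Lie_part_subset[OF word_lie_part] auto_homD(4)[OF F'] pi_gen_carrier e)
    then show "contr g e (lie_tensor (der_act d (lie_gen e))) = contr g e (ten_lift F (lie_tensor (d (word_lie (F' (pi_gen e))))))"
      using e by (simp add: der_act_def lie_ring_on.gen lie_lift_simps(1) ten_lift_lie_tensor)
  qed
  also have "\<dots> = (\<Sum>e\<in>gens g. \<Sum>x\<in>gens g. \<Sum>z\<in>gens g. of_int (?b z e * ?c e x) * ten_lift F (contr g x (?T z)))"
  proof (rule sum.cong[OF HOL.refl])
    fix e assume e: "e \<in> gens g"
    have w: "F' (pi_gen e) \<in> PI g" by (intro auto_homD(4)[OF F'] pi_gen_carrier e)
    let ?p = "\<Sum>z\<in>gens g. of_int (?b z e) * ?T z"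
    have bT: "of_int (?b z e) * ?T z \<in> Tens g" if "z \<in> gens g" for z
      using T[OF that] by (simp add: of_int_tensor Tens_single)
    have "contr g e (ten_lift F ?p) = (\<Sum>x\<in>gens g. of_int (?c e x) * ten_lift F (contr g x ?p))"
      by (rule contr_ten_lift[OF F e Tens_sum[OF bT]])
    also have "\<dots> = (\<Sum>x\<in>gens g. \<Sum>z\<in>gens g. of_int (?b z e * ?c e x) * ten_lift F (contr g x (?T z)))"
    proof (rule sum.cong[OF HOL.refl])
      fix x assume x: "x \<in> gens g"
      have "contr g x ?p = (\<Sum>z\<in>gens g. of_int (?b z e) * contr g x (?T z))"
        using csum[OF x bT] ct[OF x T] by simp
      then show "of_int (?c e x) * ten_lift F (contr g x ?p) = (\<Sum>z\<in>gens g. of_int (?b z e * ?c e x) * ten_lift F (contr g x (?T z)))"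
        by (simp add: ten_lift_sum ten_lift_of_int sum_distrib_left mult.assoc[symmetric] mult.commute[of "?b _ e"] del: of_int_mult)
          (simp add: mult.assoc)
    qed
    finally show "contr g e (ten_lift F (lie_tensor (d (word_lie (F' (pi_gen e)))))) =
       (\<Sum>x\<in>gens g. \<Sum>z\<in>gens g. of_int (?b z e * ?c e x) * ten_lift F (contr g x (?T z)))"
      by (simp add: lie_tensor_Der_word_lie[OF d w])
  qed
  also have "\<dots> = (\<Sum>x\<in>gens g. \<Sum>z\<in>gens g. \<Sum>e\<in>gens g. of_int (?b z e * ?c e x) * ten_lift F (contr g x (?T z)))"
    by (subst sum.swap, rule sum.cong[OF HOL.refl], subst sum.swap) simp
  also have "\<dots> = (\<Sum>x\<in>gens g. \<Sum>z\<in>gens g. of_int (\<Sum>e\<in>gens g. ?b z e * ?c e x) * ten_lift F (contr g x (?T z)))"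
    by (simp add: sum_distrib_right)
  also have "\<dots> = (\<Sum>x\<in>gens g. \<Sum>z\<in>gens g. if z = x then ten_lift F (contr g x (?T x)) else 0)"
  proof (intro sum.cong HOL.refl)
    fix x z assume x: "x \<in> gens g" and z: "z \<in> gens g"
    have "exponent_sum z (F' (F (pi_gen x))) = (\<Sum>e\<in>gens g. exponent_sum e (F (pi_gen x)) * exponent_sum z (F' (pi_gen e)))"
      by (rule zhom_expand[OF zhom_compose[OF exponent_sum_zhom F'] auto_homD(4)[OF F pi_gen_carrier[OF x]]])
    then have "(\<Sum>e\<in>gens g. ?b z e * ?c e x) = (if x = z then 1 else 0)"
      using x by (simp add: F'F pi_gen_carrier exponent_sum_pi_gen mult.commute)
    then show "of_int (\<Sum>e\<in>gens g. ?b z e * ?c e x) * ten_lift F (contr g x (?T z)) =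
      (if z = x then ten_lift F (contr g x (?T x)) else 0)" by auto
  qed
  also have "\<dots> = ten_lift F (trace_tensor g d)" by (simp add: trace_tensor_def ten_lift_sum)
  finally show ?thesis .
qed

definition conj_auto :: "(gen fword \<Rightarrow> gen fword) \<Rightarrow> gen fword \<Rightarrow> gen fword" where
  "conj_auto f = compose (PI g) F (compose (PI g) f F')"

lemma lie_rep_conj:
  assumes f: "f \<in> auto (surface_group g)" and x: "x \<in> PI g"
    and l: "lie_rep g n l (f (F' x) \<otimes>\<^bsub>surface_group g\<^esub> inv\<^bsub>surface_group g\<^esub> F' x)"
  shows "lie_rep g n (lie_lift F l) (conj_auto f x \<otimes>\<^bsub>surface_group g\<^esub> inv\<^bsub>surface_group g\<^esub> x)"
proof -
  interpret F: group_hom "surface_group g" "surface_group g" F by (rule auto_homD(1)[OF F])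
  have y: "F' x \<in> PI g" "f (F' x) \<in> PI g" using auto_homD(4)[OF F' x] auto_homD(4)[OF f] by auto
  have "F (f (F' x) \<otimes>\<^bsub>surface_group g\<^esub> inv\<^bsub>surface_group g\<^esub> F' x) = conj_auto f x \<otimes>\<^bsub>surface_group g\<^esub> inv\<^bsub>surface_group g\<^esub> x"
    using x y by (simp add: conj_auto_def compose_def FF')
  then show ?thesis using lie_rep_lift[OF F l] by simp
qed

lemma conj_auto_auto: "f \<in> auto (surface_group g) \<Longrightarrow> conj_auto f \<in> auto (surface_group g)"
  unfolding conj_auto_def by (intro auto_compose F F')

lemma Johnson_A_conj:
  assumes f: "f \<in> Johnson_A g k" and k: "1 \<le> k"
  shows "conj_auto f \<in> Johnson_A g k" "tau' g k (conj_auto f) = der_act (tau' g k f)"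
proof -
  note af = Johnson_A_D(1)[OF f] and ac = conj_auto_auto[OF Johnson_A_D(1)[OF f]]
  have rep: "lie_rep g (k + 1) (lie_lift F (tau' g k f (word_lie (F' x)))) (conj_auto f x \<otimes>\<^bsub>surface_group g\<^esub> inv\<^bsub>surface_group g\<^esub> x)"
    if x: "x \<in> PI g" for x
  proof (rule lie_rep_conj[OF af x])
    have y: "F' x \<in> PI g" by (rule auto_homD(4)[OF F' x])
    show "lie_rep g (k + 1) (tau' g k f (word_lie (F' x))) (f (F' x) \<otimes>\<^bsub>surface_group g\<^esub> inv\<^bsub>surface_group g\<^esub> F' x)"
      unfolding lie_rep_dM_iff[OF af y]
      using dM_tau'[OF f k lie_rep_word_lie[OF y]] Der_part[OF tau'_Der[OF f k] word_lie_part[OF y]]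
      by (simp add: add.commute)
  qed
  show A: "conj_auto f \<in> Johnson_A g k"
    unfolding Johnson_A_iff
    using ac lie_rep_Gam[OF rep] quotient_Gam_iff[OF ac] by blast
  show "tau' g k (conj_auto f) = der_act (tau' g k f)"
  proof (rule tau'_eqI[OF A k der_act_Der[OF tau'_Der[OF f k]]])
    fix e assume e: "e \<in> gens g"
    show "ord_ge (k + 2) (dM (conj_auto f) (pi_gen e) - lser (der_act (tau' g k f) (lie_gen e)))"
      using rep[OF pi_gen_carrier[OF e]] e
      unfolding lie_rep_dM_iff[OF ac pi_gen_carrier[OF e]]
      by (simp add: der_act_def lie_ring_on.gen lie_lift_simps(1))
  qed
qed

end

section \<open>Symplectic automorphisms\<close>

definition es_form :: "nat \<Rightarrow> gen fword \<Rightarrow> gen fword \<Rightarrow> int" where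
  "es_form g x y = (\<Sum>i=1..g. exponent_sum (Alpha i) x * exponent_sum (Beta i) y
    - exponent_sum (Beta i) x * exponent_sum (Alpha i) y)"

fun dual_gen :: "gen \<Rightarrow> gen" where
  "dual_gen (Alpha i) = Beta i"
| "dual_gen (Beta i) = Alpha i"

fun gen_sign :: "gen \<Rightarrow> int" where
  "gen_sign (Alpha i) = 1"
| "gen_sign (Beta i) = - 1"

lemma dual_gen_simps [simp]: "dual_gen (dual_gen e) = e" "gen_sign (dual_gen e) = - gen_sign e"
  "gen_sign e * gen_sign e = 1" "dual_gen e \<in> gens g \<longleftrightarrow> e \<in> gens g"
  by (cases e; auto simp: gens_def)+

lemma es_form_gens:
  "es_form g x y = (\<Sum>e\<in>gens g. gen_sign e * exponent_sum e x * exponent_sum (dual_gen e) y)"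
  by (simp add: es_form_def sum_gens sum_subtractf sum_negf)

lemma es_form_pi_gen_right:
  assumes w: "w \<in> gens g"
  shows "es_form g x (pi_gen w) = - gen_sign w * exponent_sum (dual_gen w) x"
proof -
  have "es_form g x (pi_gen w) = (\<Sum>e\<in>gens g. if e = dual_gen w then - gen_sign w * exponent_sum (dual_gen w) x else 0)"
    unfolding es_form_gens by (intro sum.cong HOL.refl) (auto simp: exponent_sum_pi_gen)
  then show ?thesis using w by simp
qed

lemma es_form_pi_gen_left:
  assumes w: "w \<in> gens g"
  shows "es_form g (pi_gen w) y = gen_sign w * exponent_sum (dual_gen w) y"
proof -
  have "es_form g (pi_gen w) y = (\<Sum>e\<in>gens g. if e = w then gen_sign w * exponent_sum (dual_gen w) y else 0)"
    unfolding es_form_gens by (intro sum.cong HOL.refl) (auto simp: exponent_sum_pi_gen)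
  then show ?thesis using w by simp
qed

lemma nc_lser_br_word_lie:
  assumes "x \<in> PI g" "y \<in> PI g"
  shows "nc (lser (lie_br (word_lie x) (word_lie y))) [u, v] =
    exponent_sum u x * exponent_sum v y - exponent_sum u y * exponent_sum v x"
  using nc_mult_hom_deg[OF hom_deg_lser_part[OF word_lie_part[OF assms(1)]], of "[u]" "lser (word_lie y)" "[v]"]
    nc_mult_hom_deg[OF hom_deg_lser_part[OF word_lie_part[OF assms(2)]], of "[u]" "lser (word_lie x)" "[v]"] assms
  by (simp add: lser_simps nc_lser_word_lie)

lemma lser_sum: "lser (sum f A) = (\<Sum>a\<in>A. lser (f a))"
  by (induction A rule: infinite_finite_induct) (auto simp: lser_simps)

lemma nc_lser_lie_lift_omega:
  assumes F: "\<And>e. e \<in> gens g \<Longrightarrow> F (pi_gen e) \<in> PI g"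
  shows "nc (lser (lie_lift F (omega g))) [u, v] =
    (\<Sum>e\<in>gens g. gen_sign e * exponent_sum u (F (pi_gen e)) * exponent_sum v (F (pi_gen (dual_gen e))))"
proof -
  have "nc (lser (lie_lift F (omega g))) [u, v] =
    (\<Sum>i=1..g. nc (lser (lie_br (word_lie (F (pi_gen (Alpha i)))) (word_lie (F (pi_gen (Beta i)))))) [u, v])"
    by (simp add: omega_def lie_lift_sum lie_lift_simps lser_sum nc_sum)
  also have "\<dots> = (\<Sum>i=1..g. exponent_sum u (F (pi_gen (Alpha i))) * exponent_sum v (F (pi_gen (Beta i)))
      - exponent_sum u (F (pi_gen (Beta i))) * exponent_sum v (F (pi_gen (Alpha i))))"
    by (intro sum.cong HOL.refl nc_lser_br_word_lie[of _ g] F) (auto simp: gens_def)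
  finally show ?thesis by (simp add: sum_gens sum_subtractf sum_negf)
qed

locale symplectic_pair = auto_pair +
  assumes form: "\<And>x y. x \<in> PI g \<Longrightarrow> y \<in> PI g \<Longrightarrow> es_form g (F x) (F y) = es_form g x y"
begin

lemma symplectic_swap: "symplectic_pair g F' F"
proof -
  interpret A: auto_pair g F' F by (rule swap)
  show ?thesis
  proof
    fix x y assume "x \<in> PI g" "y \<in> PI g"
    then show "es_form g (F' x) (F' y) = es_form g x y"
      using form[of "F' x" "F' y"] auto_homD(4)[OF F'] by (simp add: FF')
  qed
qed

text \<open>The inverse of a symplectic map is its adjoint for the form: evaluating <v, F u> = <F'
  v, u> on dual generators reads off matrix entries up to sign.\<close>

lemma exponent_sum_adjoint:
  assumes u: "u \<in> gens g" and v: "v \<in> gens g"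
  shows "exponent_sum v (F (pi_gen (dual_gen u))) =
    - gen_sign v * gen_sign u * exponent_sum u (F' (pi_gen (dual_gen v)))"
proof -
  let ?v = "pi_gen (dual_gen v)" and ?u = "pi_gen (dual_gen u)"
  have c: "?v \<in> PI g" "?u \<in> PI g" "F' ?v \<in> PI g" using u v by (simp_all add: pi_gen_carrier auto_homD(4)[OF F'])
  have "es_form g ?v (F ?u) = es_form g (F' ?v) ?u"
    using form[OF c(3,2)] c by (simp add: FF')
  then have e: "- gen_sign v * exponent_sum v (F ?u) = gen_sign u * exponent_sum u (F' ?v)"
    using es_form_pi_gen_left[of "dual_gen v" g "F ?u"] es_form_pi_gen_right[of "dual_gen u" g "F' ?v"] u v by simp
  have "exponent_sum v (F ?u) = (gen_sign v * gen_sign v) * exponent_sum v (F ?u)" by simp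
  also have "\<dots> = - gen_sign v * (- gen_sign v * exponent_sum v (F ?u))" by (simp only: mult.assoc mult_minus_left mult_minus_right minus_minus)
  finally show ?thesis unfolding e by simp
qed

text \<open>The bivector \<omega> is dual to the intersection form. On two-letter words the left
  side has the coefficients of F J F^T, with J the matrix of signs; the adjoint relation replaces
  one factor by F', and the product with F collapses to the identity.\<close>

lemma lie_lift_omega: "lie_lift F (omega g) = omega g"
proof (rule lser_inj[OF lie_lift_part[OF F omega_part] omega_part], rule ncps_eqI)
  fix w
  have hd: "hom_deg (gens g) 2 (lser (lie_lift F (omega g)))" "hom_deg (gens g) 2 (lser (omega g))"
    using hom_deg_lser_part[OF lie_lift_part[OF F omega_part]] hom_deg_lser_part[OF omega_part] .
  show "nc (lser (lie_lift F (omega g))) w = nc (lser (omega g)) w"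
  proof (cases "length w = 2 \<and> set w \<subseteq> gens g")
    case False
    then show ?thesis using hd unfolding hom_deg_def by metis
  next
    case True
    then obtain u v where w: "w = [u, v]" and uv: "u \<in> gens g" "v \<in> gens g"
      by (auto simp: length_Suc_conv eval_nat_numeral)
    have "nc (lser (lie_lift F (omega g))) w =
      (\<Sum>e\<in>gens g. - gen_sign v * (exponent_sum e (F' (pi_gen (dual_gen v))) * exponent_sum u (F (pi_gen e))))"
      unfolding w nc_lser_lie_lift_omega[of g F, OF auto_homD(4)[OF F pi_gen_carrier], simplified]
    proof (rule sum.cong[OF HOL.refl])
      fix e assume e: "e \<in> gens g"
      show "gen_sign e * exponent_sum u (F (pi_gen e)) * exponent_sum v (F (pi_gen (dual_gen e)))
        = - gen_sign v * (exponent_sum e (F' (pi_gen (dual_gen v))) * exponent_sum u (F (pi_gen e)))"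
        unfolding exponent_sum_adjoint[OF e uv(2)] by (cases e) simp_all
    qed
    also have "\<dots> = - gen_sign v * exponent_sum u (F (F' (pi_gen (dual_gen v))))"
      using zhom_expand[OF zhom_compose[OF exponent_sum_zhom F], of "F' (pi_gen (dual_gen v))" u] uv
      by (simp add: sum_distrib_left sum_negf auto_homD(4)[OF F'] pi_gen_carrier)
    also have "\<dots> = - gen_sign v * (if dual_gen v = u then 1 else 0)"
      using uv by (simp add: FF' pi_gen_carrier exponent_sum_pi_gen)
    also have "\<dots> = (\<Sum>e\<in>gens g. if e = u then if v = dual_gen u then gen_sign u else 0 else 0)"
      using uv by auto
    also have "\<dots> = (\<Sum>e\<in>gens g. gen_sign e * exponent_sum u (pi_gen e) * exponent_sum v (pi_gen (dual_gen e)))"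
      by (intro sum.cong HOL.refl) (auto simp: exponent_sum_pi_gen)
    also have "\<dots> = nc (lser (lie_lift (\<lambda>x. x) (omega g))) w"
      unfolding w using nc_lser_lie_lift_omega[of g "\<lambda>x. x" u v] by (simp add: pi_gen_carrier)
    also have "lie_lift (\<lambda>x. x) (omega g) = omega g"
      by (rule lie_lift_id[OF _ Lie_part_subset[OF omega_part]]) simp
    finally show ?thesis .
  qed
qed

lemma der_act_omega:
  "der_act d (omega g) = lie_lift F (d (omega g))"
  using symplectic_pair.lie_lift_omega[OF symplectic_swap] Lie_part_subset[OF omega_part]
  by (simp add: der_act_def)

lemma der_act_Der_symp: "d \<in> Der_symp g k \<Longrightarrow> der_act d \<in> Der_symp g k"
  by (simp add: Der_symp_def der_act_Der der_act_omega lie_lift_simps)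

lemma der_act_surj_Der_symp:
  assumes d: "d \<in> Der_symp g k"
  obtains d' where "d' \<in> Der_symp g k" "der_act d' = d"
proof -
  interpret S: symplectic_pair g F' F by (rule symplectic_swap)
  have "der_act (S.der_act d) = d"
  proof
    fix l
    have dD: "d \<in> Der g k" using d by (simp add: Der_symp_def)
    show "der_act (S.der_act d) l = d l"
    proof (cases "l \<in> Lie g")
      case True
      then show ?thesis using lie_lift_Lie[OF F'] Der_Lie[OF dD] lift_lift
        by (simp add: der_act_def S.der_act_def)
    next
      case False
      then show ?thesis using dD by (auto simp: der_act_def Der_def extensional_def)
    qed
  qed
  then show ?thesis using that S.der_act_Der_symp[OF d] by blast
qed

definition zeta_defect :: "gen fword" where
  "zeta_defect = F' (zeta g) \<otimes>\<^bsub>surface_group g\<^esub> inv\<^bsub>surface_group g\<^esub> zeta g"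

text \<open>F' fixes \<omega>, so F'(zeta) and zeta have the same class in degree 2.\<close>

lemma zeta_defect_Gam: "zeta_defect \<in> Gam g 3"
proof -
  interpret S: symplectic_pair g F' F by (rule symplectic_swap)
  have z: "F' (zeta g) \<in> PI g" by (rule auto_homD(4)[OF F' zeta_carrier])
  have "lie_rep g 2 (- omega g) (F' (zeta g))"
    using lie_rep_lift[OF F' lie_rep_zeta] by (simp add: lie_lift_simps S.lie_lift_omega)
  then have "ord_ge 3 (magnus (F' (zeta g)) - magnus (zeta g))"
    using ord_ge_diff[of "Suc 2" "magnus (F' (zeta g)) - 1 - lser (- omega g)" "magnus (zeta g) - 1 - lser (- omega g)"] lie_rep_zeta[of g]
    unfolding lie_rep_iff by simp
  then show ?thesis
    unfolding Gam_iff zeta_defect_def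
    using ord_ge_right_quotient_iff[OF z zeta_carrier] z zeta_carrier by simp
qed

lemma mu_conj:
  assumes f: "f \<in> Johnson_A g k" and k: "1 \<le> k" and symp: "tau' g k f \<in> Der_symp g k"
  shows "mu g k (conj_auto f) = lie_lift F (mu g k f + tau' g k f (lie_class g 3 zeta_defect))"
proof -
  let ?c = "zeta_defect" and ?z = "F' (zeta g)" and ?l = "lie_class g 3 zeta_defect" and ?d = "tau' g k f"
  have fa: "f \<in> auto (surface_group g)" by (rule Johnson_A_D(1)[OF f])
  have fG: "f \<in> Johnson_G g k" using Johnson_G_iff[OF f k] symp by simp
  note mu = mu_dM[OF fG]
  have z: "?z \<in> PI g" by (rule auto_homD(4)[OF F' zeta_carrier])
  have c: "?c \<in> PI g" by (rule S.lower_central_carrier[OF zeta_defect_Gam])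
  have zc: "?z = ?c \<otimes>\<^bsub>surface_group g\<^esub> zeta g"
    using z zeta_carrier by (simp add: zeta_defect_def S.m_assoc)
  have rep: "lie_rep g 3 ?l ?c" using lie_rep_lie_class[of 3 ?c g] zeta_defect_Gam by simp
  then have lp: "?l \<in> Lie_part g 3" by (simp add: lie_rep_iff)
  have dl: "?d ?l \<in> Lie_part g (k + 3)" using Der_part[OF tau'_Der[OF f k] lp] by (simp add: add.commute)
  \<comment> \<open>With F'(zeta) = c zeta, f moves c with leading term d(c) and zeta with leading
    term \<open>mu g k f\<close>; the remaining products have order at least k + 4.\<close>
  have "dM f ?z - lser (mu g k f + ?d ?l) =
      (dM f ?c - lser (?d ?l)) * magnus (f (zeta g)) + lser (?d ?l) * (magnus (f (zeta g)) - 1)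
      + (dM f (zeta g) - lser (mu g k f)) + (magnus ?c - 1) * dM f (zeta g)"
    unfolding zc dM_mult[OF fa c zeta_carrier] by (simp add: lser_simps algebra_simps)
  moreover have "ord_ge (k + 4) ((dM f ?c - lser (?d ?l)) * magnus (f (zeta g)))"
    using ord_ge_mult_right[OF dM_tau'[OF f k rep]] by (simp add: eval_nat_numeral)
  moreover have "ord_ge (k + 4) (lser (?d ?l) * (magnus (f (zeta g)) - 1))"
    by (rule ord_ge_mult[OF ord_ge_lser[OF dl] ord_ge_1_magnus]) simp
  moreover have "ord_ge (k + 4) ((magnus ?c - 1) * dM f (zeta g))"
    by (rule ord_ge_mult[OF magnus_Gam[OF zeta_defect_Gam] dM_Gam[OF f _ lie_rep_Gam[OF lie_rep_zeta]]]) (use k in simp_all)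
  ultimately have o: "ord_ge (k + 4) (dM f ?z - lser (mu g k f + ?d ?l))"
    using mu(2) by (auto intro: ord_ge_add)
  have "lie_rep g (k + 3) (mu g k f + ?d ?l) (f ?z \<otimes>\<^bsub>surface_group g\<^esub> inv\<^bsub>surface_group g\<^esub> ?z)"
    unfolding lie_rep_dM_iff[OF fa z] using o Lie_part_add[OF mu(1) dl] by (simp add: eval_nat_numeral)
  from lie_class_eq[OF lie_rep_conj[OF fa zeta_carrier this]] show ?thesis by (simp add: mu_def)
qed

text \<open>The correction term \<open>d(c)\<close> in \<open>mu_conj\<close> is \<open>[d, e](\<omega>)\<close> for any degree 1 derivation \<open>e\<close>
  with \<open>e(\<omega>) = c\<close>, and \<open>[d, e]\<close> has trace zero because \<open>d\<close> has.\<close>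

lemma psi_mu_conj:
  assumes f: "f \<in> Johnson_A g k" and k: "2 \<le> k" and symp: "tau' g k f \<in> Der_symp g k"
    and D: "D \<in> Der g (k + 1)" "D (omega g) = mu g k f"
  shows "psi g (k + 1) (mu g k (conj_auto f)) = ctr g (k + 1) (der_act D)"
proof -
  let ?d = "tau' g k f" and ?c = "lie_class g 3 zeta_defect"
  have k1: "1 \<le> k" using k by simp
  have d: "?d \<in> Der g k" by (rule tau'_Der[OF f k1])
  have "?c \<in> Lie_part g (1 + 2)"
    using lie_rep_lie_class[of 3 zeta_defect g] zeta_defect_Gam by (simp add: lie_rep_iff numeral_3_eq_3)
  from Der_omega_surj[OF this] obtain e where e: "e \<in> Der g 1" "e (omega g) = ?c" by blast
  let ?E = "der_add g D (der_br g ?d e)"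
  have br: "der_br g ?d e \<in> Der g (k + 1)" by (rule der_br_Der[OF d e(1)])
  have E: "?E \<in> Der g (k + 1)" by (rule der_add_Der[OF D(1) br])
  have "?E (omega g) = mu g k f + ?d ?c"
    using symp Lie_part_subset[OF omega_part] D(2) e Der_zero[OF e(1)]
    by (simp add: der_add_def der_br_def Der_symp_def)
  then have "mu g k (conj_auto f) = der_act ?E (omega g)"
    by (simp add: der_act_omega mu_conj[OF f k1 symp])
  then have "psi g (k + 1) (mu g k (conj_auto f)) = ctr g (k + 1) (der_act ?E)"
    using psi_eval[OF der_act_Der[OF E]] by simp
  also have "\<dots> = ctr g (k + 1) (der_act D)"
  proof (rule ctr_eqI[OF der_act_Der[OF E] der_act_Der[OF D(1)]])
    have "trace_tensor g (der_act ?E) - trace_tensor g (der_act D) = ten_lift F (trace_tensor g (der_br g ?d e))"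
      by (simp add: trace_der_act[OF E] trace_der_act[OF D(1)] trace_tensor_add[OF D(1) br] ten_lift_simps)
    then show "trace_tensor g (der_act ?E) - trace_tensor g (der_act D) \<in> Tens_comm g"
      using ten_lift_Tens_comm[OF F trace_der_br[OF d k1 e(1) satoh_trace_tau'[OF f k]]] by simp
  qed
  finally show ?thesis .
qed

end

section \<open>Equivariance of the induced trace\<close>

lemma group_homology: "group (homology g)"
  unfolding homology_def by (rule normal.factorgroup_is_group[OF S.lower_central_normal])

lemma inv_AutoGroup:
  assumes "group G" "\<phi> \<in> auto G" "h \<in> carrier G"
  shows "(inv\<^bsub>AutoGroup G\<^esub> \<phi>) (\<phi> h) = h"
proof -
  have b: "\<phi> \<in> Bij (carrier G)" using assms by (simp add: auto_def)
  have "inv\<^bsub>AutoGroup G\<^esub> \<phi> = inv\<^bsub>BijGroup (carrier G)\<^esub> \<phi>"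
    unfolding AutoGroup_def
    using group.m_inv_consistent[OF group_BijGroup group.subgroup_auto[OF assms(1)] assms(2)] by simp
  also have "\<dots> = (\<lambda>x\<in>carrier G. inv_into (carrier G) \<phi> x)" by (rule inv_BijGroup[OF b])
  finally show ?thesis
    using b assms(3) by (auto simp: Bij_def bij_betw_def)
qed

lemma Lie_act_lie_lift:
  assumes F: "F \<in> auto (surface_group g)" and \<phi>: "\<And>x. x \<in> PI g \<Longrightarrow> \<phi> (hclass g x) = hclass g (F x)"
  shows "l \<in> Lie g \<Longrightarrow> Lie_act g \<phi> l = lie_lift F l"
proof (induction rule: lie_ring_on.induct)
  case (gen x)
  then show ?case
    by (simp add: Lie_act_def lie_lift_simps \<phi> pi_gen_carrier homology_lie_hclass auto_homD(4)[OF F])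
qed (simp_all add: Lie_act_def lie_lift_simps lie_subst_diff)

lemma Tens_act_ten_lift:
  assumes F: "F \<in> auto (surface_group g)" and \<phi>: "\<And>x. x \<in> PI g \<Longrightarrow> \<phi> (hclass g x) = hclass g (F x)"
    and p: "p \<in> Tens g"
  shows "Tens_act g \<phi> p = ten_lift F p"
  unfolding Tens_act_def ten_lift_def tensor_subst_def
proof (rule sum.cong[OF HOL.refl])
  fix w assume "w \<in> Poly_Mapping.keys p"
  then have "set w \<subseteq> gens g" using p by (auto simp: tensor_on_def)
  then have "map (\<lambda>e. lie_tensor (homology_lie (\<phi> (hclass g (pi_gen e))))) w = map (\<lambda>e. lie_tensor (word_lie (F (pi_gen e)))) w"
    by (intro map_cong) (auto simp: \<phi> pi_gen_carrier homology_lie_hclass auto_homD(4)[OF F])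
  then show "of_int (Poly_Mapping.lookup p w) * prod_list (map (\<lambda>e. lie_tensor (homology_lie (\<phi> (hclass g (pi_gen e))))) w) =
      of_int (Poly_Mapping.lookup p w) * prod_list (map (\<lambda>e. lie_tensor (word_lie (F (pi_gen e)))) w)" by (simp only:)
qed

text \<open>The image of a coset is a whole coset because the inverse lift preserves sums of
  commutators as well.\<close>

lemma (in auto_pair) Cyc_act_cyc_class:
  assumes \<phi>: "\<And>x. x \<in> PI g \<Longrightarrow> \<phi> (hclass g x) = hclass g (F x)" and p: "p \<in> Tens g"
  shows "Cyc_act g \<phi> (cyc_class g p) = cyc_class g (ten_lift F p)"
proof -
  interpret A: auto_pair g F' F by (rule swap)
  have "Cyc_act g \<phi> (cyc_class g p) = ten_lift F ` cyc_class g p"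
    unfolding Cyc_act_def using Tens_act_ten_lift[OF F \<phi>] by (intro image_cong HOL.refl) (simp add: cyc_class_mem[OF p])
  also have "\<dots> = cyc_class g (ten_lift F p)"
  proof (intro equalityI subsetI)
    fix y assume "y \<in> ten_lift F ` cyc_class g p"
    then obtain x where x: "y = ten_lift F x" "x \<in> Tens g" "x - p \<in> Tens_comm g" by (auto simp: cyc_class_mem[OF p])
    then show "y \<in> cyc_class g (ten_lift F p)"
      using ten_lift_Tens[OF F x(2)] ten_lift_Tens_comm[OF F x(3)]
      by (simp add: cyc_class_mem[OF ten_lift_Tens[OF F p]] ten_lift_simps)
  next
    fix y assume "y \<in> cyc_class g (ten_lift F p)"
    then have y: "y \<in> Tens g" "y - ten_lift F p \<in> Tens_comm g" by (simp_all add: cyc_class_mem[OF ten_lift_Tens[OF F p]])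
    have "ten_lift F' y \<in> cyc_class g p"
      using ten_lift_Tens[OF F' y(1)] ten_lift_Tens_comm[OF F' y(2)] A.ten_lift_lift[OF p]
      by (simp add: cyc_class_mem[OF p] ten_lift_simps)
    then show "y \<in> ten_lift F ` cyc_class g p" using ten_lift_lift[OF y(1)] by force
  qed
  finally show ?thesis .
qed

text \<open>A coset in the iterated quotient made explicit as a family indexed by symplectic
  derivations, so that the action by images can be evaluated member by member.\<close>

lemma ctr_eq_image:
  assumes d: "d \<in> Der g m"
  shows "ctr g m d = (\<lambda>d'. cyc_class g (trace_tensor g d' + trace_tensor g d)) ` Der_symp g m"
proof -
  have "ctr g m d = (\<lambda>d'. satoh_trace g d' \<otimes>\<^bsub>Cyc g m\<^esub> satoh_trace g d) ` Der_symp g m"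
    by (auto simp: ctr_def Cyc_bar_def r_coset_def)
  also have "\<dots> = (\<lambda>d'. cyc_class g (trace_tensor g d' + trace_tensor g d)) ` Der_symp g m"
    using d by (intro image_cong HOL.refl) (simp add: Der_symp_def satoh_trace_eq Cyc_mult trace_tensor_part)
  finally show ?thesis .
qed

lemma (in symplectic_pair) Cyc_quot_act_ctr:
  assumes \<phi>: "\<And>x. x \<in> PI g \<Longrightarrow> \<phi> (hclass g x) = hclass g (F x)" and d: "d \<in> Der g m"
  shows "Cyc_quot_act g \<phi> (ctr g m d) = ctr g m (der_act d)"
proof -
  have "Cyc_quot_act g \<phi> (ctr g m d) =
    (\<lambda>d'. Cyc_act g \<phi> (cyc_class g (trace_tensor g d' + trace_tensor g d))) ` Der_symp g m"
    by (simp add: Cyc_quot_act_def ctr_eq_image[OF d] image_image)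
  also have "\<dots> = (\<lambda>d'. cyc_class g (trace_tensor g (der_act d') + trace_tensor g (der_act d))) ` Der_symp g m"
  proof (rule image_cong[OF HOL.refl])
    fix d' assume "d' \<in> Der_symp g m"
    then have d': "d' \<in> Der g m" by (simp add: Der_symp_def)
    show "Cyc_act g \<phi> (cyc_class g (trace_tensor g d' + trace_tensor g d)) =
      cyc_class g (trace_tensor g (der_act d') + trace_tensor g (der_act d))"
      using Cyc_act_cyc_class[OF \<phi>, of "trace_tensor g d' + trace_tensor g d"]
        tensor_part_Tens[OF trace_tensor_part[OF d]] tensor_part_Tens[OF trace_tensor_part[OF d']]
      by (simp add: trace_der_act[OF d] trace_der_act[OF d'] ten_lift_simps)
  qed
  also have "\<dots> = (\<lambda>d'. cyc_class g (trace_tensor g d' + trace_tensor g (der_act d))) ` der_act ` Der_symp g m"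
    by (simp add: image_image)
  \<comment> \<open>The action maps the symplectic derivations onto themselves, so the family can be
    reindexed.\<close>
  also have "der_act ` Der_symp g m = Der_symp g m"
    using der_act_Der_symp der_act_surj_Der_symp by (metis image_eqI image_subsetI subsetI subset_antisym)
  finally show ?thesis by (simp add: ctr_eq_image[OF der_act_Der[OF d]])
qed

lemma Tr_bar_equivariant:
  assumes k: "2 \<le> k" and \<phi>: "\<phi> \<in> Sp g" and d: "d \<in> Tr_bar_dom g k"
  shows "Der_act g \<phi> d \<in> Tr_bar_dom g k \<and> Tr_bar g k (Der_act g \<phi> d) = Cyc_quot_act g \<phi> (Tr_bar g k d)"
proof -
  have k1: "1 \<le> k" using k by simp
  have \<phi>a: "\<phi> \<in> auto (homology g)" using \<phi> by (simp add: Sp_def)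
  from homology_auto_lift[OF this] obtain F where F: "F \<in> auto (surface_group g)"
    and \<phi>F: "\<And>x. x \<in> PI g \<Longrightarrow> \<phi> (hclass g x) = hclass g (F x)" by blast
  define F' where "F' = auto_inv g F"
  note F' = auto_inv_auto[OF F, folded F'_def] and canc = auto_inv_cancel[OF F, folded F'_def]
  interpret symplectic_pair g F F'
  proof
    fix x y assume x: "x \<in> PI g" and y: "y \<in> PI g"
    have form: "intersection_form g (hclass g u) (hclass g v) = es_form g u v" if "u \<in> PI g" "v \<in> PI g" for u v
      unfolding intersection_form_def es_form_def
      by (intro sum.cong HOL.refl) (use that in \<open>simp add: dual_basis_hclass gens_def\<close>)
    have "intersection_form g (\<phi> (hclass g x)) (\<phi> (hclass g y)) = intersection_form g (hclass g x) (hclass g y)"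
      using \<phi> x y by (simp add: Sp_def homology_carrier)
    then show "es_form g (F x) (F y) = es_form g x y"
      using x y auto_homD(4)[OF F] by (simp add: \<phi>F form)
  qed (use F F' canc in simp_all)
  let ?\<psi> = "inv\<^bsub>AutoGroup (homology g)\<^esub> \<phi>"
  have \<psi>: "?\<psi> (hclass g x) = hclass g (F' x)" if x: "x \<in> PI g" for x
    using inv_AutoGroup[OF group_homology \<phi>a, of "hclass g (F' x)"] x auto_homD(4)[OF F' x]
    by (simp add: homology_carrier \<phi>F FF')
  from d obtain f where f: "f \<in> Johnson_A g k" "tau' g k f = d" "d \<in> Der_symp g k" by (rule Tr_bar_domE)
  have dD: "d \<in> Der g k" using f(3) by (simp add: Der_symp_def)
  have act: "Der_act g \<phi> d = der_act d"
    unfolding Der_act_def der_act_def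
    using Lie_act_lie_lift[OF F \<phi>F] Lie_act_lie_lift[OF F' \<psi>] Der_Lie[OF dD] lie_lift_Lie[OF F']
    by (intro restrict_ext) simp
  have conj: "conj_auto f \<in> Johnson_A g k" "tau' g k (conj_auto f) = der_act d"
    using Johnson_A_conj[OF f(1) k1] f(2) by simp_all
  have symp: "der_act d \<in> Der_symp g k" by (rule der_act_Der_symp[OF f(3)])
  have fG: "f \<in> Johnson_G g k" using Johnson_G_iff[OF f(1) k1] f by simp
  have "mu g k f \<in> Lie_part g ((k + 1) + 2)" using mu_dM(1)[OF fG] by (simp add: eval_nat_numeral)
  from Der_omega_surj[OF this] obtain D where D: "D \<in> Der g (k + 1)" "D (omega g) = mu g k f" by blast
  have "Tr_bar g k (der_act d) = psi g (k + 1) (mu g k (conj_auto f))"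
    using Tr_bar_eval[OF conj(1) k1] conj(2) symp by simp
  also have "\<dots> = ctr g (k + 1) (der_act D)"
    using psi_mu_conj[OF f(1) k _ D] f by simp
  also have "\<dots> = Cyc_quot_act g \<phi> (psi g (k + 1) (mu g k f))"
    using Cyc_quot_act_ctr[OF \<phi>F D(1)] psi_eval[OF D(1)] D(2) by simp
  also have "psi g (k + 1) (mu g k f) = Tr_bar g k d"
    using Tr_bar_eval[OF f(1) k1] f by simp
  finally show ?thesis using act conj(1) conj(2)[symmetric] symp by (simp add: Tr_bar_dom_def)
qed

text \<open>\<open>Tr_bar\<close> selects a preimage by \<open>SOME\<close>. The first conjunct
  asserts the formula for every preimage, which is well-definedness, together with membership in
  \<open>Johnson_G\<close>, where \<open>mu\<close> has its intended meaning.\<close>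

theorem theorem3p6:
  fixes g k :: nat
  assumes "g \<ge> 1" and "k \<ge> 2"
  shows "(\<forall>f \<in> Johnson_A g k. tau' g k f \<in> Der_symp g k \<longrightarrow>
            f \<in> Johnson_G g k \<and> Tr_bar g k (tau' g k f) = psi g (k + 1) (mu g k f)) \<and>
         group_hom (Der_group g k \<lparr>carrier := Tr_bar_dom g k\<rparr>)
           (Cyc g (k + 1) Mod Cyc_bar g (k + 1)) (Tr_bar g k) \<and>
         (\<forall>\<phi> \<in> Sp g. \<forall>d \<in> Tr_bar_dom g k.
            Der_act g \<phi> d \<in> Tr_bar_dom g k \<and>
            Tr_bar g k (Der_act g \<phi> d) = Cyc_quot_act g \<phi> (Tr_bar g k d)) \<and>
         (\<forall>d \<in> tau' g k ` Johnson_J g k.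
            Tr_bar g k d = \<one>\<^bsub>Cyc g (k + 1) Mod Cyc_bar g (k + 1)\<^esub>)"
proof (intro conjI ballI impI)
  have k1: "1 \<le> k" using assms(2) by simp
  show "group_hom (Der_group g k \<lparr>carrier := Tr_bar_dom g k\<rparr>) (Cyc g (k + 1) Mod Cyc_bar g (k + 1)) (Tr_bar g k)"
    by (rule Tr_bar_group_hom[OF k1])
  {
    fix f assume f: "f \<in> Johnson_A g k" "tau' g k f \<in> Der_symp g k"
    then show "f \<in> Johnson_G g k" using Johnson_G_iff[OF f(1) k1] by simp
    from f show "Tr_bar g k (tau' g k f) = psi g (k + 1) (mu g k f)" by (intro Tr_bar_eval k1)
  next
    fix \<phi> d assume "\<phi> \<in> Sp g" "d \<in> Tr_bar_dom g k"
    then show "Der_act g \<phi> d \<in> Tr_bar_dom g k" "Tr_bar g k (Der_act g \<phi> d) = Cyc_quot_act g \<phi> (Tr_bar g k d)"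
      using Tr_bar_equivariant[OF assms(2)] by simp_all
  next
    fix d assume "d \<in> tau' g k ` Johnson_J g k"
    then show "Tr_bar g k d = \<one>\<^bsub>Cyc g (k + 1) Mod Cyc_bar g (k + 1)\<^esub>"
      using Tr_bar_Johnson_J[OF _ k1] by auto
  }
qed

end
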